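(* Let $u$ be a nonconstant inner function. Then: (i) $\mathscr{C}(C^*(A_z^u)) = \mathscr{K}$, the algebra of compact operators on $\mathcal{K}_u$. (ii) $C^*(A_z^u)/\mathscr{K}$ is isometrically $*$-isomorphic to $C(\sigma(u)\cap\mathbb{T})$. (iii) For $\varphi\in C(\mathbb{T})$, the operator $A_\varphi^u$ is compact if and only if $\varphi(\sigma(u)\cap\mathbb{T})=\{0\}$, i.e. $\varphi$ vanishes identically on $\sigma(u)\cap\mathbb{T}$. (iv) $C^*(A_z^u)=\{A_\varphi^u+K : \varphi\in C(\mathbb{T}),\ K\in\mathscr{K}\}$. (v) For $\varphi\in C(\mathbb{T})$, $\sigma_e(A_\varphi^u)=\varphi(\sigma_e(A_z^u))$. (vi) For $\varphi\in C(\mathbb{T})$, $\|A_\varphi^u\|_e=\sup\{|\varphi(\zeta)| : \zeta\in\sigma(u)\cap\mathbb{T}\}$. (vii) Every operator in $C^*(A_z^u)$ is of the form normal plus compact, i.e. equals $N+K$ with $N$ a normal operator on $\mathcal{K}_u$ and $K\in\mathscr{K}$. Moreover, $$0\longrightarrow \mathscr{K}\overset{\iota}{\longrightarrow} C^*(A_z^u)\overset{\pi}{\longrightarrow} C(\sigma(u)\cap\mathbb{T})\longrightarrow 0$$ is a short exact sequence, where $\iota$ is the inclusion map and the map $\pi:C^*(A_z^u)\to C(\sigma(u)\cap\mathbb{T})$ is given by $\pi(A_\varphi^u+K)=\varphi|_{\sigma(u)\cap\mathbb{T}}$ for $\varphi\in C(\mathbb{T})$, $K\in\mathscr{K}$.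 Thus $C^*(A_z^u)$ is an extension of the compact operators by $C(\sigma(u)\cap\mathbb{T})$.
   Context: $\mathbb{D}$ is the open unit disk, $\mathbb{D}^-$ its closure, $\mathbb{T}$ the unit circle, $H^2$ the classical Hardy space on $\mathbb{D}$, viewed as a subspace of $L^2=L^2(\mathbb{T})$ via boundary values (normalized Lebesgue measure). For a nonconstant inner function $u$, the model space is $\mathcal{K}_u:=H^2\ominus uH^2$, and $P_u$ is the orthogonal projection of $L^2$ onto $\mathcal{K}_u$. For $\varphi\in L^\infty(\mathbb{T})$ the truncated Toeplitz operator with symbol $\varphi$ is $A_\varphi^u:\mathcal{K}_u\to\mathcal{K}_u$, $A_\varphi^u f=P_u(\varphi f)$. The compressed shift is $A_z^u$ (symbol $\varphi(z)=z$). The spectrum of the inner function $u$ is $$\sigma(u):=\{\lambda\in\mathbb{D}^-:\liminf_{z\to\lambda}|u(z)|=0\},$$ where $z\to\lambda$ with $z\in\mathbb{D}$. For an operator $A$, or a set $\mathscr{X}$ of bounded operators, on a Hilbert space $\mathcal{H}$, $C^*(A)$, respectively $C^*(\mathscr{X})$, denotes the unital $C^*$-algebra generated by it (containing the identity of $\mathcal{B}(\mathcal{H})$). The commutator ideal $\mathscr{C}(C^*(\mathscr{X}))$ is the smallest norm-closed two-sided ideal of $C^*(\mathscr{X})$ containing all commutators $[A,B]=AB-BA$ with $A,B\in C^*(\mathscr{X})$. $\mathscr{K}$ is the ideal of compact operators on $\mathcal{K}_u$. $\sigma_e(T)$ and $\|T\|_e$ are the essential spectrum and essential norm of $T$, i.e.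 the spectrum and the norm of the coset $T+\mathscr{K}$ in $\mathcal{B}(\mathcal{K}_u)/\mathscr{K}$. $C(Y)$ is the $C^*$-algebra of continuous complex functions on the compact space $Y$; when $\sigma(u)\cap\mathbb{T}=\emptyset$, one reads $C(\emptyset)=\{0\}$, suprema over $\emptyset$ as $0$, and the condition in (iii) as vacuously true.
   Formalization: Item (i) is stated only when K_u is not one-dimensional: if dim K_u = 1 (e.g. u(z)=z), C*(A_z^u) is commutative, so its commutator ideal is {0}, while the compact operators are all of B(K_u) ≠ {0}. All other items are stated for every nonconstant inner u. *)

theory Defs
  imports
    "HOL-Complex_Analysis.Complex_Analysis"
    "HOL-Algebra.QuotRing"
    "HOL-Algebra.Subrings"
    "HOL-Algebra.Module"
begin

section \<open>The space L2 of the unit circle\<close>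

text \<open>Normalized Lebesgue measure; the underlying space is the unit circle \<open>sphere 0 1\<close>.\<close>

definition circle_measure :: "complex measure" where
  "circle_measure =
     distr (uniform_measure lborel {0..2 * pi}) (restrict_space borel (sphere 0 1)) cis"

definition square_integrable :: "(complex \<Rightarrow> complex) \<Rightarrow> bool" where
  "square_integrable f \<longleftrightarrow>
     f \<in> borel_measurable circle_measure \<and> integrable circle_measure (\<lambda>z. (norm (f z))\<^sup>2)"

definition L2_eq :: "(complex \<Rightarrow> complex) \<Rightarrow> (complex \<Rightarrow> complex) \<Rightarrow> bool" where
  "L2_eq f g \<longleftrightarrow> square_integrable f \<and> square_integrable g \<and> (AE z in circle_measure. f z = g z)"

lemma square_integrable_zero: "square_integrable (\<lambda>z. 0)"
  by (simp add: square_integrable_def)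

lemma square_integrable_add:
  assumes "square_integrable f" "square_integrable g"
  shows "square_integrable (\<lambda>z. f z + g z)"
proof -
  have m [measurable]: "f \<in> borel_measurable circle_measure" "g \<in> borel_measurable circle_measure"
    using assms by (auto simp: square_integrable_def)
  have bound: "(norm (f z + g z))\<^sup>2 \<le> 2 * (norm (f z))\<^sup>2 + 2 * (norm (g z))\<^sup>2" for z
  proof -
    have "(norm (f z + g z))\<^sup>2 \<le> (norm (f z) + norm (g z))\<^sup>2"
      by (simp add: norm_triangle_ineq power_mono)
    also have "\<dots> \<le> 2 * (norm (f z))\<^sup>2 + 2 * (norm (g z))\<^sup>2"
      using sum_squares_bound[of "norm (f z)" "norm (g z)"] by (simp add: power2_sum)
    finally show ?thesis .
  qed
  have "integrable circle_measure (\<lambda>z. 2 * (norm (f z))\<^sup>2 + 2 * (norm (g z))\<^sup>2)"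
    using assms by (auto simp: square_integrable_def)
  then have "integrable circle_measure (\<lambda>z. (norm (f z + g z))\<^sup>2)"
    by (rule Bochner_Integration.integrable_bound) (auto intro!: AE_I2 bound)
  then show ?thesis
    by (simp add: square_integrable_def)
qed

lemma square_integrable_cmult:
  "square_integrable f \<Longrightarrow> square_integrable (\<lambda>z. c * f z)"
  by (auto simp: square_integrable_def norm_mult power_mult_distrib)

lemma square_integrable_uminus:
  "square_integrable f \<Longrightarrow> square_integrable (\<lambda>z. - f z)"
  using square_integrable_cmult[of f "-1"] by simp

lemma square_integrable_diff:
  "square_integrable f \<Longrightarrow> square_integrable g \<Longrightarrow> square_integrable (\<lambda>z. f z - g z)"
  using square_integrable_add[of f "\<lambda>z. - g z"] square_integrable_uminus[of g] by simp

lemma integrable_mult_cnj: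
  assumes "square_integrable f" "square_integrable g"
  shows "integrable circle_measure (\<lambda>z. f z * cnj (g z))"
proof -
  have m [measurable]: "f \<in> borel_measurable circle_measure" "g \<in> borel_measurable circle_measure"
    using assms by (auto simp: square_integrable_def)
  have m' [measurable]: "(\<lambda>z. cnj (g z)) \<in> borel_measurable circle_measure"
    by (rule borel_measurable_continuous_on[OF _ m(2)]) (intro continuous_intros)
  have "integrable circle_measure (\<lambda>z. (norm (f z))\<^sup>2 + (norm (g z))\<^sup>2)"
    using assms by (auto simp: square_integrable_def)
  then show ?thesis
  proof (rule Bochner_Integration.integrable_bound)
    show "AE z in circle_measure.
        norm (f z * cnj (g z)) \<le> norm ((norm (f z))\<^sup>2 + (norm (g z))\<^sup>2)"
    proof (rule AE_I2)
      fix z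
      have "2 * (norm (f z) * norm (g z)) \<le> (norm (f z))\<^sup>2 + (norm (g z))\<^sup>2"
        using sum_squares_bound[of "norm (f z)" "norm (g z)"] by (simp add: mult.assoc)
      moreover have "0 \<le> norm (f z) * norm (g z)"
        by simp
      ultimately show "norm (f z * cnj (g z)) \<le> norm ((norm (f z))\<^sup>2 + (norm (g z))\<^sup>2)"
        unfolding norm_mult complex_mod_cnj real_norm_def by linarith
    qed
  qed measurable
qed

quotient_type circle_L2 = "complex \<Rightarrow> complex" / partial: L2_eq
proof (rule part_equivpI)
  show "\<exists>f. L2_eq f f"
    using square_integrable_zero by (auto simp: L2_eq_def)
  show "symp L2_eq"
    by (auto simp: symp_def L2_eq_def eq_commute)
  show "transp L2_eq"
    unfolding transp_def L2_eq_def by (auto elim: AE_mp)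
qed

instantiation circle_L2 :: real_vector
begin

lift_definition zero_circle_L2 :: circle_L2 is "\<lambda>z. 0"
  by (simp add: L2_eq_def square_integrable_zero)

lift_definition plus_circle_L2 :: "circle_L2 \<Rightarrow> circle_L2 \<Rightarrow> circle_L2" is
  "\<lambda>f g z. f z + g z"
  by (auto simp: L2_eq_def square_integrable_add)

lift_definition uminus_circle_L2 :: "circle_L2 \<Rightarrow> circle_L2" is "\<lambda>f z. - f z"
  by (auto simp: L2_eq_def square_integrable_uminus)

lift_definition minus_circle_L2 :: "circle_L2 \<Rightarrow> circle_L2 \<Rightarrow> circle_L2" is
  "\<lambda>f g z. f z - g z"
  by (auto simp: L2_eq_def square_integrable_diff)

lift_definition scaleR_circle_L2 :: "real \<Rightarrow> circle_L2 \<Rightarrow> circle_L2" is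
  "\<lambda>r f z. of_real r * f z"
  by (auto simp: L2_eq_def square_integrable_cmult)

instance
proof
  fix a b c :: circle_L2 and r s :: real
  show "a + b + c = a + (b + c)"
    by transfer (auto simp: L2_eq_def add.assoc intro!: square_integrable_add)
  show "a + b = b + a"
    by transfer (auto simp: L2_eq_def add.commute intro!: square_integrable_add)
  show "0 + a = a"
    by transfer (auto simp: L2_eq_def)
  show "- a + a = 0"
    by transfer (auto simp: L2_eq_def square_integrable_zero)
  show "a - b = a + - b"
    by transfer (auto simp: L2_eq_def intro: square_integrable_diff)
  show "r *\<^sub>R (a + b) = r *\<^sub>R a + r *\<^sub>R b"
    by transfer (auto simp: L2_eq_def distrib_left
        intro!: square_integrable_add square_integrable_cmult)
  show "(r + s) *\<^sub>R a = r *\<^sub>R a + s *\<^sub>R a"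
    by transfer (auto simp: L2_eq_def distrib_right
        intro!: square_integrable_add square_integrable_cmult)
  show "r *\<^sub>R s *\<^sub>R a = (r * s) *\<^sub>R a"
    by transfer (auto simp: L2_eq_def mult.assoc intro!: square_integrable_cmult)
  show "1 *\<^sub>R a = a"
    by transfer (auto simp: L2_eq_def)
qed

end

lift_definition L2_scaleC :: "complex \<Rightarrow> circle_L2 \<Rightarrow> circle_L2" is "\<lambda>c f z. c * f z"
  by (auto simp: L2_eq_def square_integrable_cmult)

lift_definition L2_cinner :: "circle_L2 \<Rightarrow> circle_L2 \<Rightarrow> complex" is
  "\<lambda>f g. \<integral>z. f z * cnj (g z) \<partial>circle_measure"
proof -
  fix f f' g g' assume "L2_eq f f'" "L2_eq g g'"
  then show "(\<integral>z. f z * cnj (g z) \<partial>circle_measure) = (\<integral>z. f' z * cnj (g' z) \<partial>circle_measure)"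
    by (intro integral_cong_AE borel_measurable_integrable integrable_mult_cnj)
       (auto simp: L2_eq_def)
qed

lemma L2_cinner_cnj: "L2_cinner y x = cnj (L2_cinner x y)"
  by transfer (subst Bochner_Integration.integral_cnj[symmetric], simp add: mult.commute)

lemma L2_cinner_add_left: "L2_cinner (x + y) z = L2_cinner x z + L2_cinner y z"
  by transfer (auto simp: L2_eq_def integrable_mult_cnj distrib_right)

lemma L2_cinner_scaleC_left: "L2_cinner (L2_scaleC c x) y = c * L2_cinner x y"
  by transfer (simp add: mult.assoc)

lemma L2_scaleR_scaleC: "r *\<^sub>R x = L2_scaleC (complex_of_real r) x"
  by transfer (auto simp: L2_eq_def square_integrable_cmult)

lemma L2_cinner_self:
  "L2_cinner x x = complex_of_real (\<integral>z. (norm (rep_circle_L2 x z))\<^sup>2 \<partial>circle_measure)"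
  by (simp add: L2_cinner.rep_eq complex_norm_square[symmetric] flip: of_real_power)

lemma L2_cinner_self_eq_zero_iff: "L2_cinner x x = 0 \<longleftrightarrow> x = 0"
proof
  assume "L2_cinner x x = 0"
  then show "x = 0"
  proof (transfer)
    fix f :: "complex \<Rightarrow> complex"
    assume f: "L2_eq f f" and 0: "(\<integral>z. f z * cnj (f z) \<partial>circle_measure) = 0"
    have int: "integrable circle_measure (\<lambda>z. (norm (f z))\<^sup>2)"
      using f by (simp add: L2_eq_def square_integrable_def)
    have "(\<integral>z. f z * cnj (f z) \<partial>circle_measure)
        = complex_of_real (\<integral>z. (norm (f z))\<^sup>2 \<partial>circle_measure)"
      by (simp add: complex_norm_square[symmetric] flip: of_real_power)
    with 0 have "(\<integral>z. (norm (f z))\<^sup>2 \<partial>circle_measure) = 0"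
      by simp
    then have "AE z in circle_measure. (norm (f z))\<^sup>2 = 0"
      using integral_nonneg_eq_0_iff_AE[OF int] by auto
    then show "L2_eq f (\<lambda>z. 0)"
      using f by (auto simp: L2_eq_def square_integrable_zero)
  qed
next
  assume "x = 0"
  then show "L2_cinner x x = 0"
    using L2_cinner_scaleC_left[of 0 0 0] L2_scaleR_scaleC[of 0 0] by simp
qed

instantiation circle_L2 :: real_inner
begin

definition inner_circle_L2 :: "circle_L2 \<Rightarrow> circle_L2 \<Rightarrow> real" where
  "inner_circle_L2 x y = Re (L2_cinner x y)"

definition norm_circle_L2 :: "circle_L2 \<Rightarrow> real" where
  "norm_circle_L2 x = sqrt (Re (L2_cinner x x))"

definition sgn_circle_L2 :: "circle_L2 \<Rightarrow> circle_L2" where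
  "sgn_circle_L2 x = x /\<^sub>R norm x"

definition dist_circle_L2 :: "circle_L2 \<Rightarrow> circle_L2 \<Rightarrow> real" where
  "dist_circle_L2 x y = norm (x - y)"

definition uniformity_circle_L2 :: "(circle_L2 \<times> circle_L2) filter" where
  "uniformity_circle_L2 = (INF e\<in>{0 <..}. principal {(x, y). dist x y < e})"

definition open_circle_L2 :: "circle_L2 set \<Rightarrow> bool" where
  "open_circle_L2 U = (\<forall>x\<in>U. \<forall>\<^sub>F (x', y) in uniformity. x' = x \<longrightarrow> y \<in> U)"

instance
proof
  fix x y z :: circle_L2 and r :: real
  show "inner x y = inner y x"
    unfolding inner_circle_L2_def by (subst L2_cinner_cnj) simp
  show "inner (x + y) z = inner x z + inner y z"
    by (simp add: inner_circle_L2_def L2_cinner_add_left)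
  show "inner (r *\<^sub>R x) y = r * inner x y"
    by (simp add: inner_circle_L2_def L2_scaleR_scaleC L2_cinner_scaleC_left)
  show "0 \<le> inner x x"
    by (simp add: inner_circle_L2_def L2_cinner_self)
  show "inner x x = 0 \<longleftrightarrow> x = 0"
    by (simp add: inner_circle_L2_def L2_cinner_self flip: L2_cinner_self_eq_zero_iff)
qed (simp_all add: norm_circle_L2_def inner_circle_L2_def sgn_circle_L2_def dist_circle_L2_def
    uniformity_circle_L2_def open_circle_L2_def)

end


section \<open>Hardy space, inner functions, model spaces, truncated Toeplitz operators\<close>

text \<open>
  The Hardy space as a space of functions on the disk (only the values of \<open>f\<close> on the open disk
  matter), and radial boundary values.  A function on the disk and an element of L2 are related
  by \<open>boundary_value\<close> when the radial limits exist and agree with that element almost everywhere.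
\<close>

definition hardy_disk :: "(complex \<Rightarrow> complex) \<Rightarrow> bool" where
  "hardy_disk f \<longleftrightarrow> f holomorphic_on ball 0 1 \<and>
     bdd_above ((\<lambda>r. \<integral>\<zeta>. (norm (f (of_real r * \<zeta>)))\<^sup>2 \<partial>circle_measure) ` {0..<1})"

definition boundary_value :: "(complex \<Rightarrow> complex) \<Rightarrow> circle_L2 \<Rightarrow> bool" where
  "boundary_value f F \<longleftrightarrow>
     (AE \<zeta> in circle_measure. ((\<lambda>r. f (of_real r * \<zeta>)) \<longlongrightarrow> rep_circle_L2 F \<zeta>) (at_left 1))"

definition hardy_H2 :: "circle_L2 set" where
  "hardy_H2 = {F. \<exists>f. hardy_disk f \<and> boundary_value f F}"

definition inner_function :: "(complex \<Rightarrow> complex) \<Rightarrow> bool" where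
  "inner_function u \<longleftrightarrow> u holomorphic_on ball 0 1 \<and> (\<forall>z\<in>ball 0 1. norm (u z) \<le> 1) \<and>
     (AE \<zeta> in circle_measure.
        \<exists>w. ((\<lambda>r. u (of_real r * \<zeta>)) \<longlongrightarrow> w) (at_left 1) \<and> norm w = 1)"

definition inner_times_H2 :: "(complex \<Rightarrow> complex) \<Rightarrow> circle_L2 set" where
  "inner_times_H2 u = {F. \<exists>f. hardy_disk f \<and> boundary_value (\<lambda>z. u z * f z) F}"

definition model_space :: "(complex \<Rightarrow> complex) \<Rightarrow> circle_L2 set" where
  "model_space u = {F \<in> hardy_H2. \<forall>G\<in>inner_times_H2 u. L2_cinner F G = 0}"

definition inner_spectrum :: "(complex \<Rightarrow> complex) \<Rightarrow> complex set" where
  "inner_spectrum u =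
     {w \<in> cball 0 1. Liminf (at w within ball 0 1) (\<lambda>z. ereal (norm (u z))) = 0}"

definition orth_proj :: "circle_L2 set \<Rightarrow> circle_L2 \<Rightarrow> circle_L2" where
  "orth_proj H F = (THE G. G \<in> H \<and> (\<forall>h\<in>H. L2_cinner (F - G) h = 0))"

text \<open>Multiplication by a symbol; meaningful for essentially bounded measurable \<open>\<phi>\<close>.\<close>

definition L2_mult :: "(complex \<Rightarrow> complex) \<Rightarrow> circle_L2 \<Rightarrow> circle_L2" where
  "L2_mult \<phi> F = abs_circle_L2 (\<lambda>z. \<phi> z * rep_circle_L2 F z)"

definition truncated_toeplitz ::
    "(complex \<Rightarrow> complex) \<Rightarrow> (complex \<Rightarrow> complex) \<Rightarrow> circle_L2 \<Rightarrow> circle_L2" where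
  "truncated_toeplitz u \<phi> = (\<lambda>F\<in>model_space u. orth_proj (model_space u) (L2_mult \<phi> F))"

definition compressed_shift :: "(complex \<Rightarrow> complex) \<Rightarrow> circle_L2 \<Rightarrow> circle_L2" where
  "compressed_shift u = truncated_toeplitz u (\<lambda>z. z)"


section \<open>Normed star algebras as structures with carrier\<close>

record 'a star_algebra = "(complex, 'a) module" +
  adj :: "'a \<Rightarrow> 'a"
  nrm :: "'a \<Rightarrow> real"

definition norm_closed :: "('a, 'm) star_algebra_scheme \<Rightarrow> 'a set \<Rightarrow> bool" where
  "norm_closed A S \<longleftrightarrow>
     (\<forall>f. \<forall>a\<in>carrier A. (\<forall>n. f n \<in> S) \<and> (\<lambda>n::nat. nrm A (f n \<ominus>\<^bsub>A\<^esub> a)) \<longlonglongrightarrow> 0 \<longrightarrow> a \<in> S)"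

text \<open>Norm-closed star subalgebras containing the unit.\<close>

definition cstar_subalgebra :: "'a set \<Rightarrow> ('a, 'm) star_algebra_scheme \<Rightarrow> bool" where
  "cstar_subalgebra S A \<longleftrightarrow> subring S A \<and> (\<forall>c. \<forall>a\<in>S. c \<odot>\<^bsub>A\<^esub> a \<in> S) \<and>
     (\<forall>a\<in>S. adj A a \<in> S) \<and> norm_closed A S"

definition cstar_generated :: "'a star_algebra \<Rightarrow> 'a set \<Rightarrow> 'a star_algebra" where
  "cstar_generated A X = A\<lparr>carrier := \<Inter>{S. cstar_subalgebra S A \<and> X \<subseteq> S}\<rparr>"

definition commutator_ideal :: "('a, 'm) star_algebra_scheme \<Rightarrow> 'a set" where
  "commutator_ideal A = \<Inter>{I. ideal I A \<and> norm_closed A I \<and>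
     (\<forall>a\<in>carrier A. \<forall>b\<in>carrier A. (a \<otimes>\<^bsub>A\<^esub> b) \<ominus>\<^bsub>A\<^esub> (b \<otimes>\<^bsub>A\<^esub> a) \<in> I)}"

text \<open>
  The quotient by a closed star ideal: the ring \<open>A Quot I\<close> of cosets, with the quotient norm.
  In \<open>smult\<close>, adding \<open>I\<close> makes the result a full coset also for the scalar 0.
\<close>

definition star_quotient :: "'a star_algebra \<Rightarrow> 'a set \<Rightarrow> 'a set star_algebra" where
  "star_quotient A I =
     \<lparr>carrier = carrier (A Quot I), mult = mult (A Quot I), one = one (A Quot I),
      zero = zero (A Quot I), add = add (A Quot I),
      smult = (\<lambda>c X. I <+>\<^bsub>A\<^esub> ((\<lambda>a. c \<odot>\<^bsub>A\<^esub> a) ` X)),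
      adj = (\<lambda>X. adj A ` X),
      nrm = (\<lambda>X. Inf (nrm A ` X))\<rparr>"

text \<open>Units are not required to be preserved, because ideals are also used as domains.\<close>

definition star_hom ::
    "('a, 'm) star_algebra_scheme \<Rightarrow> ('b, 'n) star_algebra_scheme \<Rightarrow> ('a \<Rightarrow> 'b) set" where
  "star_hom A B = {h \<in> carrier A \<rightarrow> carrier B.
     (\<forall>a\<in>carrier A. \<forall>b\<in>carrier A.
        h (a \<oplus>\<^bsub>A\<^esub> b) = h a \<oplus>\<^bsub>B\<^esub> h b \<and> h (a \<otimes>\<^bsub>A\<^esub> b) = h a \<otimes>\<^bsub>B\<^esub> h b) \<and>
     (\<forall>c. \<forall>a\<in>carrier A. h (c \<odot>\<^bsub>A\<^esub> a) = c \<odot>\<^bsub>B\<^esub> h a) \<and>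
     (\<forall>a\<in>carrier A. h (adj A a) = adj B (h a))}"

definition isometrically_star_isomorphic ::
    "('a, 'm) star_algebra_scheme \<Rightarrow> ('b, 'n) star_algebra_scheme \<Rightarrow> bool" where
  "isometrically_star_isomorphic A B \<longleftrightarrow>
     (\<exists>h\<in>star_hom A B. bij_betw h (carrier A) (carrier B) \<and>
        (\<forall>a\<in>carrier A. nrm B (h a) = nrm A a))"

definition short_exact_sequence ::
    "('a, 'k) star_algebra_scheme \<Rightarrow> ('a \<Rightarrow> 'b) \<Rightarrow> ('b, 'm) star_algebra_scheme \<Rightarrow>
     ('b \<Rightarrow> 'c) \<Rightarrow> ('c, 'n) star_algebra_scheme \<Rightarrow> bool" where
  "short_exact_sequence J i A p B \<longleftrightarrow> i \<in> star_hom J A \<and> p \<in> star_hom A B \<and>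
     inj_on i (carrier J) \<and> i ` carrier J = a_kernel A B p \<and> p ` carrier A = carrier B"

definition algebra_spectrum :: "('a, 'm) star_algebra_scheme \<Rightarrow> 'a \<Rightarrow> complex set" where
  "algebra_spectrum A a = {c. (c \<odot>\<^bsub>A\<^esub> \<one>\<^bsub>A\<^esub>) \<ominus>\<^bsub>A\<^esub> a \<notin> Units A}"

text \<open>
  Continuous functions on \<open>Y\<close> with the supremum norm; inserting 0 only matters for empty \<open>Y\<close>,
  where the carrier is a singleton, i.e. the zero algebra.
\<close>

definition continuous_functions :: "complex set \<Rightarrow> (complex \<Rightarrow> complex) star_algebra" where
  "continuous_functions Y =
     \<lparr>carrier = {f \<in> extensional Y. continuous_on Y f},
      mult = (\<lambda>f g. \<lambda>z\<in>Y. f z * g z), one = (\<lambda>z\<in>Y. 1),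
      zero = (\<lambda>z\<in>Y. 0), add = (\<lambda>f g. \<lambda>z\<in>Y. f z + g z),
      smult = (\<lambda>c f. \<lambda>z\<in>Y. c * f z),
      adj = (\<lambda>f. \<lambda>z\<in>Y. cnj (f z)),
      nrm = (\<lambda>f. Sup (insert 0 ((\<lambda>z. norm (f z)) ` Y)))\<rparr>"


section \<open>Operators on a closed complex subspace of L2\<close>

definition bounded_operators :: "circle_L2 set \<Rightarrow> (circle_L2 \<Rightarrow> circle_L2) set" where
  "bounded_operators H = {T \<in> H \<rightarrow>\<^sub>E H.
     (\<forall>x\<in>H. \<forall>y\<in>H. T (x + y) = T x + T y) \<and>
     (\<forall>c. \<forall>x\<in>H. T (L2_scaleC c x) = L2_scaleC c (T x)) \<and>
     (\<exists>B. \<forall>x\<in>H. norm (T x) \<le> B * norm x)}"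

definition compact_operators :: "circle_L2 set \<Rightarrow> (circle_L2 \<Rightarrow> circle_L2) set" where
  "compact_operators H =
     {T \<in> bounded_operators H. compact (closure (T ` (H \<inter> cball 0 1)))}"

definition operator_algebra :: "circle_L2 set \<Rightarrow> (circle_L2 \<Rightarrow> circle_L2) star_algebra" where
  "operator_algebra H =
     \<lparr>carrier = bounded_operators H,
      mult = (\<lambda>S T. compose H S T), one = (\<lambda>x\<in>H. x),
      zero = (\<lambda>x\<in>H. 0), add = (\<lambda>S T. \<lambda>x\<in>H. S x + T x),
      smult = (\<lambda>c T. \<lambda>x\<in>H. L2_scaleC c (T x)),
      adj = (\<lambda>T. THE S. S \<in> bounded_operators H \<and>
                   (\<forall>x\<in>H. \<forall>y\<in>H. L2_cinner (T x) y = L2_cinner x (S y))),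
      nrm = (\<lambda>T. Sup {norm (T x) |x. x \<in> H \<and> norm x \<le> 1})\<rparr>"

text \<open>The compact operators with the inherited operations (the field \<open>one\<close> is then irrelevant).\<close>

definition compact_algebra :: "circle_L2 set \<Rightarrow> (circle_L2 \<Rightarrow> circle_L2) star_algebra" where
  "compact_algebra H = (operator_algebra H)\<lparr>carrier := compact_operators H\<rparr>"

definition calkin_algebra :: "circle_L2 set \<Rightarrow> (circle_L2 \<Rightarrow> circle_L2) set star_algebra" where
  "calkin_algebra H = star_quotient (operator_algebra H) (compact_operators H)"

definition calkin_coset ::
    "circle_L2 set \<Rightarrow> (circle_L2 \<Rightarrow> circle_L2) \<Rightarrow> (circle_L2 \<Rightarrow> circle_L2) set" where
  "calkin_coset H T = compact_operators H +>\<^bsub>operator_algebra H\<^esub> T"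

definition essential_spectrum :: "circle_L2 set \<Rightarrow> (circle_L2 \<Rightarrow> circle_L2) \<Rightarrow> complex set" where
  "essential_spectrum H T = algebra_spectrum (calkin_algebra H) (calkin_coset H T)"

definition essential_norm :: "circle_L2 set \<Rightarrow> (circle_L2 \<Rightarrow> circle_L2) \<Rightarrow> real" where
  "essential_norm H T = nrm (calkin_algebra H) (calkin_coset H T)"

text \<open>
  If \<open>H\<close> is one-dimensional, all its operators commute, so the commutator ideal of any algebra of
  operators on \<open>H\<close> is \<open>{0}\<close>, while every operator on \<open>H\<close> is compact.  For model spaces this
  happens exactly when the inner function is a single Blaschke factor (e.g. \<open>u z = z\<close>).
\<close>

definition one_dimensional :: "circle_L2 set \<Rightarrow> bool" where
  "one_dimensional H \<longleftrightarrow> (\<exists>G. G \<noteq> 0 \<and> H = {L2_scaleC c G |c. True})"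

definition normal_operator :: "circle_L2 set \<Rightarrow> (circle_L2 \<Rightarrow> circle_L2) \<Rightarrow> bool" where
  "normal_operator H N \<longleftrightarrow> N \<in> bounded_operators H \<and>
     N \<otimes>\<^bsub>operator_algebra H\<^esub> adj (operator_algebra H) N =
     adj (operator_algebra H) N \<otimes>\<^bsub>operator_algebra H\<^esub> N"

definition cstar_of_operator ::
    "circle_L2 set \<Rightarrow> (circle_L2 \<Rightarrow> circle_L2) \<Rightarrow> (circle_L2 \<Rightarrow> circle_L2) star_algebra" where
  "cstar_of_operator H T = cstar_generated (operator_algebra H) {T}"

end

theory Submission
  imports Defs
begin

text \<open>
  Multiplication by a continuous symbol commutes with the projection onto the model space up to a
  compact operator (Stone--Weierstrass reduces this to \<open>z\<close> and its conjugate, where the commutator has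
  finite rank), so \<open>\<phi> \<mapsto> A \<phi>\<close> is multiplicative modulo compact operators.  At a point of
  \<open>\<sigma>(u) \<inter> \<TT>\<close>, normalized reproducing kernels are asymptotic eigenvectors with
  eigenvalue \<open>\<phi> \<zeta>\<close> and tend weakly to 0, which gives every lower bound.  Near a point of the circle
  outside \<open>\<sigma>(u)\<close>, \<open>log \<bar>u\<bar>\<close> is harmonic up to the circle and vanishes there, so that the norms of the
  kernels stay integrable; hence multiplication by a bump function is Hilbert--Schmidt on the model
  space, and a symbol vanishing on \<open>\<sigma>(u) \<inter> \<TT>\<close> gives a compact operator.  The
  compact operators lie in the algebra because the defect of the adjoint of the compressed shift has
  rank one and its range is cyclic.  Finally, the compressed shift is a rank-one perturbation of a
  unitary operator, whose continuous functions supply the normal parts.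
\<close>

text \<open>Membership in the Hardy space asks for a holomorphic function whose radial limits give
  the L2 element almost everywhere, so closedness of the model space, and with it every projection,
  rests on the existence of radial limits for L2 limits; the maximal function estimates serve this.
  Off \<open>inner_spectrum u\<close> the available facts are that |u| is bounded below near an arc
  and has radial limits of modulus 1 almost everywhere. Testing log |u| against a squared bump turns
  them into a function of one real variable whose linear decay at the circle cancels the growth of 1
  / (1 - r^2) in the squared norm of the kernels. For the unitary, the sup-norm bound on polynomials
  in z and its conjugate comes from averaging over finite orbits, on which the unitary acts like a
  scalar up to a bounded error. The algebra is handled through the relation that S differs from
  \<open>A \<phi>\<close> by a compact operator: S determines \<phi> exactly on the part of the
  spectrum in the circle, and Tietze extensions carry functions from there to the whole circle
  without increasing their bound.\<close>

abbreviation circle_mu (\<open>\<mu>\<close>) where "\<mu> \<equiv> circle_measure"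

section \<open>Integration over the unit circle\<close>

lemma measurable_cis_sphere:
  "cis \<in> uniform_measure lborel {0..2*pi} \<rightarrow>\<^sub>M restrict_space borel (sphere 0 1)"
proof (rule measurable_restrict_space2)
  have "cis \<in> borel_measurable borel"
    by (intro borel_measurable_continuous_onI continuous_intros)
  thus "cis \<in> borel_measurable (uniform_measure lborel {0..2*pi})"
    by (subst measurable_cong_sets[OF _ refl, of _ borel]) simp_all
qed simp

lemma space_circle_measure [simp]: "space \<mu> = sphere 0 1"
  by (simp add: circle_measure_def space_restrict_space)

lemma sets_circle_measure [measurable_cong]:
  "sets \<mu> = sets (restrict_space borel (sphere 0 1))"
  by (simp add: circle_measure_def)

lemma emeasure_circle_measure_space: "emeasure \<mu> (sphere 0 1) = 1"
proof -
  have "sphere 0 1 \<in> sets (restrict_space borel (sphere (0::complex) 1))"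
    using sets.top[of "restrict_space borel (sphere (0::complex) 1)"] by (simp add: space_restrict_space)
  thus ?thesis
    unfolding circle_measure_def
    by (subst emeasure_distr[OF measurable_cis_sphere])
       (auto simp: vimage_def ennreal_divide_self)
qed

interpretation circle_measure: finite_measure \<mu>
  by standard (simp add: emeasure_circle_measure_space)

lemma measure_circle_measure_space [simp]: "measure \<mu> (sphere 0 1) = 1"
  by (simp add: measure_def emeasure_circle_measure_space)

lemma continuous_imp_measurable_circle:
  "continuous_on (sphere 0 1) f \<Longrightarrow> f \<in> borel_measurable \<mu>"
  using borel_measurable_continuous_on_restrict measurable_cong_sets[OF sets_circle_measure] by blast

lemma measurable_ident_circle [measurable]: "(\<lambda>z. z) \<in> borel_measurable \<mu>"
  by (rule continuous_imp_measurable_circle) (intro continuous_intros)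

lemma circle_integrable_bounded:
  fixes f :: "complex \<Rightarrow> 'a :: {banach, second_countable_topology}"
  assumes "f \<in> borel_measurable \<mu>" "\<And>z. z \<in> sphere 0 1 \<Longrightarrow> norm (f z) \<le> B"
  shows "integrable \<mu> f"
  by (rule circle_measure.integrable_const_bound[where B = B]) (use assms in auto)

lemma circle_integrable_continuous:
  fixes f :: "complex \<Rightarrow> 'a :: {banach, second_countable_topology}"
  assumes "continuous_on (sphere 0 1) f"
  shows "integrable \<mu> f"
proof -
  have "compact (f ` sphere 0 1)"
    using assms by (intro compact_continuous_image) auto
  then obtain B where "\<And>z. z \<in> sphere 0 1 \<Longrightarrow> norm (f z) \<le> B"
    using compact_imp_bounded bounded_iff by (metis imageI)
  thus ?thesis
    using assms by (intro circle_integrable_bounded continuous_imp_measurable_circle)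
qed

lemma circle_integral:
  fixes f :: "complex \<Rightarrow> 'a :: {banach, second_countable_topology}"
  assumes "f \<in> borel_measurable \<mu>"
  shows "(\<integral>z. f z \<partial>\<mu>) = (\<integral>t\<in>{0..2*pi}. f (cis t) \<partial>lborel) /\<^sub>R (2*pi)"
proof -
  have m: "f \<in> borel_measurable (restrict_space borel (sphere 0 1))"
    using assms measurable_cong_sets[OF sets_circle_measure refl] by auto
  have "(\<lambda>t. f (cis t)) \<in> borel_measurable (uniform_measure lborel {0..2*pi})"
    using measurable_comp[OF measurable_cis_sphere m] by (simp add: comp_def)
  hence m': "(\<lambda>t. f (cis t)) \<in> borel_measurable lborel"
    by simp
  have eq: "uniform_measure lborel {0..2*pi} = density lborel (\<lambda>x. ennreal (indicator {0..2*pi} x / (2*pi)))"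
    unfolding uniform_measure_def
    by (intro arg_cong2[of _ _ _ _ density] refl ext) (auto simp: indicator_def divide_ennreal[symmetric])
  have "(\<integral>z. f z \<partial>\<mu>) = (\<integral>t. f (cis t) \<partial>uniform_measure lborel {0..2*pi})"
    unfolding circle_measure_def by (subst integral_distr[OF measurable_cis_sphere m]) simp
  also have "\<dots> = (\<integral>t. (indicator {0..2*pi} t / (2*pi)) *\<^sub>R f (cis t) \<partial>lborel)"
    unfolding eq using m' by (subst integral_density) auto
  also have "\<dots> = (\<integral>t\<in>{0..2*pi}. f (cis t) /\<^sub>R (2*pi) \<partial>lborel)"
    unfolding set_lebesgue_integral_def scaleR_scaleR divide_inverse ..
  also have "\<dots> = (\<integral>t\<in>{0..2*pi}. f (cis t) \<partial>lborel) /\<^sub>R (2*pi)"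
    by (rule set_integral_scaleR_right)
  finally show ?thesis .
qed

lemma circle_integral_continuous:
  fixes f :: "complex \<Rightarrow> 'a :: euclidean_space"
  assumes "continuous_on (sphere 0 1) f"
  shows "(\<integral>z. f z \<partial>\<mu>) = integral {0..2*pi} (\<lambda>t. f (cis t)) /\<^sub>R (2*pi)"
proof -
  have "continuous_on {0..2*pi} (\<lambda>t. f (cis t))"
    by (rule continuous_on_compose2[OF assms]) (auto intro!: continuous_intros)
  hence "set_integrable lborel {0..2*pi} (\<lambda>t. f (cis t))"
    unfolding set_integrable_def using borel_integrable_compact[of "{0..2*pi}" "\<lambda>t. f (cis t)"] by simp
  thus ?thesis
    using set_borel_integral_eq_integral(2)[of "{0..2*pi}" "\<lambda>t. f (cis t)"]
    by (subst circle_integral[OF continuous_imp_measurable_circle[OF assms]]) simp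
qed

text \<open>On the unit circle dz / z = i dt. This is the bridge from Cauchy's theory to inner
  products in L2.\<close>

lemma circle_integral_contour:
  assumes "continuous_on (sphere 0 1) f"
  shows "contour_integral (circlepath 0 1) (\<lambda>z. f z / z) = 2 * pi * \<i> * (\<integral>z. f z \<partial>\<mu>)"
proof -
  have "contour_integral (circlepath 0 1) (\<lambda>z. f z / z) = integral {0..2*pi} (\<lambda>t. \<i> * f (cis t))"
    unfolding circlepath_def
    by (subst contour_integral_part_circlepath_eq) (auto intro!: integral_cong simp: mult.commute)
  also have "\<dots> = \<i> * integral {0..2*pi} (\<lambda>t. f (cis t))"
    by (rule integral_mult_right)
  finally show ?thesis
    by (simp add: circle_integral_continuous[OF assms] scaleR_conv_of_real)
qed

lemma circle_z_cnj: "z \<in> sphere 0 1 \<Longrightarrow> z * cnj z = 1"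
  using complex_norm_square[of z] by simp

lemma circle_cnj: "z \<in> sphere 0 1 \<Longrightarrow> cnj z = inverse z"
  using inverse_unique[OF circle_z_cnj] by simp

text \<open>On the circle z - l = z (1 - l cnj z), so Cauchy's kernel becomes the conjugate of the
  Szego kernel. Holomorphy on a larger disk is the situation of the dilates f (r z) with r < 1, to
  which the formula is applied.\<close>

lemma circle_Cauchy:
  assumes f: "f holomorphic_on ball 0 R" and R: "R > 1" and l: "norm l < 1"
  shows "(\<integral>z. f z / (1 - l * cnj z) \<partial>\<mu>) = f l"
proof -
  have sub: "cball 0 1 \<subseteq> ball (0::complex) R"
    using R by auto
  have nz: "1 - l * cnj z \<noteq> 0" if "norm z = 1" for z
  proof
    assume "1 - l * cnj z = 0"
    hence "norm (l * cnj z) = 1" by simp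
    thus False using that l by (simp add: norm_mult)
  qed
  have cont: "continuous_on (sphere 0 1) (\<lambda>z. f z / (1 - l * cnj z))"
    by (intro continuous_intros continuous_on_subset[OF holomorphic_on_imp_continuous_on[OF f]])
       (use R nz in auto)
  have "((\<lambda>z. f z / (z - l)) has_contour_integral 2 * pi * \<i> * f l) (circlepath 0 1)"
    using Cauchy_integral_circlepath_simple[OF holomorphic_on_subset[OF f sub], of l] l by simp
  hence "2 * pi * \<i> * f l = contour_integral (circlepath 0 1) (\<lambda>z. f z / (z - l))"
    by (metis contour_integral_unique)
  also have "\<dots> = contour_integral (circlepath 0 1) (\<lambda>z. (f z / (1 - l * cnj z)) / z)"
  proof (rule contour_integral_eq)
    fix z :: complex assume "z \<in> path_image (circlepath 0 1)"
    hence z: "norm z = 1" by simp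
    hence "z * cnj z = 1" using circle_z_cnj[of z] by simp
    hence "z - l = (1 - l * cnj z) * z"
      by (simp add: algebra_simps)
    thus "f z / (z - l) = (f z / (1 - l * cnj z)) / z"
      by simp
  qed
  also have "\<dots> = 2 * pi * \<i> * (\<integral>z. f z / (1 - l * cnj z) \<partial>\<mu>)"
    by (rule circle_integral_contour[OF cont])
  finally show ?thesis by simp
qed

lemma circle_mean_value:
  assumes "f holomorphic_on ball 0 R" "R > 1"
  shows "(\<integral>z. f z \<partial>\<mu>) = f 0"
  using circle_Cauchy[OF assms, of 0] by simp

section \<open>Chords, arcs and the measure of small arcs\<close>

lemma sin_ge_third: 
  assumes "0 \<le> x" "x \<le> pi/2" shows "x / 3 \<le> sin x"
proof (cases "x \<le> pi / 3")
  case True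
  have "(\<lambda>t. sin t - t/3) 0 \<le> (\<lambda>t. sin t - t/3) x"
  proof (rule DERIV_nonneg_imp_nondecreasing[OF assms(1)])
    fix t assume t: "0 \<le> t" "t \<le> x"
    have "cos (pi/3) \<le> cos t"
      using t True pi_gt_zero by (intro cos_monotone_0_pi_le) auto
    hence "0 \<le> cos t - 1/3" by (simp add: cos_60)
    moreover have "((\<lambda>t. sin t - t/3) has_real_derivative (cos t - 1/3)) (at t)"
      by (auto intro!: derivative_eq_intros)
    ultimately show "\<exists>y. ((\<lambda>t. sin t - t/3) has_real_derivative y) (at t) \<and> 0 \<le> y"
      by blast
  qed
  thus ?thesis by simp
next
  case False
  \<comment> \<open>Beyond pi/3 crude values suffice: sin x is at least sqrt 3 / 2 \<ge> 0.8, while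
    x / 3 stays below 0.8 because x \<le> 2.\<close>
  have "sin (pi/3) \<le> sin x"
    using False assms by (subst sin_mono_le_eq) auto
  moreover have "sqrt 3 \<ge> sqrt (1.6 ^ 2)"
    by (intro real_sqrt_le_mono) (simp add: power2_eq_square)
  ultimately have "0.8 \<le> sin x" by (simp add: sin_60)
  moreover have "x \<le> 2" using assms pi_less_4 by linarith
  ultimately show ?thesis by linarith
qed

text \<open>The chord has length 2 sin (|x|/2). The bound makes distance in the plane comparable
  with arc length.\<close>

lemma norm_cis_diff_ge:
  assumes "\<bar>x\<bar> \<le> pi" shows "norm (cis x - 1) \<ge> \<bar>x\<bar> / 3"
proof -
  have c: "cos x = 1 - 2 * (sin (\<bar>x\<bar>/2))^2"
    using cos_double_sin[of "\<bar>x\<bar>/2"] by simp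
  have "(norm (cis x - 1))^2 = (cos x - 1)^2 + (sin x)^2"
    by (simp add: cmod_def)
  also have "\<dots> = 2 - 2 * cos x"
    using sin_cos_squared_add[of x] by (simp add: power2_eq_square algebra_simps)
  also have "\<dots> = (2 * sin (\<bar>x\<bar>/2))^2"
    unfolding c by (simp add: power_mult_distrib)
  finally have "norm (cis x - 1) = \<bar>2 * sin (\<bar>x\<bar>/2)\<bar>"
    by (metis abs_norm_cancel real_sqrt_abs)
  moreover have "\<bar>x\<bar>/2/3 \<le> sin (\<bar>x\<bar>/2)"
    using assms by (intro sin_ge_third) auto
  ultimately show ?thesis by linarith
qed

text \<open>A point of the ball has an angle within 3 s of that of w, up to a multiple of 2 pi.
  Since {0..2*pi} cuts the circle open, three translates of an interval of length 6 s are united in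
  T; their total length 18 s divided by 2 pi gives the constant.\<close>

lemma measure_circle_ball:
  assumes w: "norm w = 1" and s: "0 < s"
  shows "measure \<mu> (ball w s \<inter> sphere 0 1) \<le> 9 * s / pi"
    and "ball w s \<inter> sphere 0 1 \<in> sets \<mu>"
proof -
  obtain a where a: "0 \<le> a" "a < 2 * pi" "w = cis a"
  proof -
    have "(Re w)\<^sup>2 + (Im w)\<^sup>2 = 1"
      using w by (simp add: cmod_def)
    then obtain t where "0 \<le> t" "t < 2 * pi" "Re w = cos t" "Im w = sin t"
      using sincos_total_2pi by blast
    thus ?thesis
      by (intro that[of t]) (auto simp: complex_eq_iff)
  qed
  show "ball w s \<inter> sphere 0 1 \<in> sets \<mu>"
    by (subst sets_circle_measure, subst sets_restrict_space) auto
  note set = this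
  define T where "T = {a - 3 * s .. a + 3 * s} \<union> {a - 2*pi - 3 * s .. a - 2*pi + 3 * s} \<union> {a + 2*pi - 3 * s .. a + 2*pi + 3 * s}"
  have "t \<in> T" if t: "t \<in> {0..2*pi}" "cis t \<in> ball w s" for t
  proof -
    have d: "norm (cis (t - a + 2 * pi * of_int k) - 1) < s" for k :: int
    proof -
      have "norm (cis (t - a + 2 * pi * of_int k) - 1) = norm (cis t / cis a - 1)"
        by (simp add: cis_mult[symmetric] cis_divide[symmetric] cis_multiple_2pi del: cis_mult cis_divide)
      also have "cis t / cis a - 1 = (cis t - cis a) / cis a"
        by (simp add: diff_divide_distrib)
      also have "norm \<dots> = dist w (cis t)"
        by (simp add: norm_divide a dist_norm norm_minus_commute)
      finally show ?thesis using t by simp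
    qed
    have x: "\<bar>t - a + 2 * pi * of_int k\<bar> < 3 * s" if "\<bar>t - a + 2 * pi * of_int k\<bar> \<le> pi" for k :: int
    proof -
      have "\<bar>t - a + 2 * pi * of_int k\<bar> \<le> 3 * norm (cis (t - a + 2 * pi * of_int k) - 1)"
        using norm_cis_diff_ge[OF that] by simp
      also have "\<dots> < 3 * s" using d[of k] by simp
      finally show ?thesis .
    qed
    consider "\<bar>t - a\<bar> \<le> pi" | "t - a > pi" | "t - a < -pi" by linarith
    thus ?thesis
    proof cases
      case 1 thus ?thesis using x[of 0] by (auto simp: T_def)
    next
      case 2 
      hence "\<bar>t - a - 2 * pi\<bar> \<le> pi" using t a by auto
      thus ?thesis using x[of "-1"] by (auto simp: T_def)
    next
      case 3
      hence "\<bar>t - a + 2 * pi\<bar> \<le> pi" using t a by auto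
      thus ?thesis using x[of "1"] by (auto simp: T_def)
    qed
  qed
  hence sub: "cis -` (ball w s \<inter> sphere 0 1) \<inter> {0..2*pi} \<subseteq> T" by auto
  have mT: "emeasure lborel T \<le> ennreal (18 * s)"
  proof -
    have "emeasure lborel T \<le> emeasure lborel {a - 3 * s .. a + 3 * s} + emeasure lborel {a - 2*pi - 3 * s .. a - 2*pi + 3 * s} + emeasure lborel {a + 2*pi - 3 * s .. a + 2*pi + 3 * s}"
      unfolding T_def
      by (intro order_trans[OF emeasure_subadditive] add_mono) auto
    also have "\<dots> = ennreal (6 * s) + ennreal (6 * s) + ennreal (6 * s)"
      using s by simp
    also have "\<dots> = ennreal (18 * s)"
      using s by (simp flip: ennreal_plus)
    finally show ?thesis .
  qed
  have "emeasure \<mu> (ball w s \<inter> sphere 0 1) = emeasure (uniform_measure lborel {0..2*pi}) (cis -` (ball w s \<inter> sphere 0 1))"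
    using set unfolding circle_measure_def
    by (subst emeasure_distr[OF measurable_cis_sphere]) auto
  also have "\<dots> = emeasure lborel ({0..2*pi} \<inter> cis -` (ball w s \<inter> sphere 0 1)) / emeasure lborel {0..2*pi}"
  proof (rule emeasure_uniform_measure)
    have "cis -` (ball w s \<inter> sphere 0 1) = cis -` ball w s" by auto
    also have "\<dots> \<in> sets borel"
      by (intro borel_open open_vimage open_ball continuous_intros)
    finally show "cis -` (ball w s \<inter> sphere 0 1) \<in> sets lborel" by simp
  qed simp
  also have "\<dots> \<le> ennreal (18 * s) / ennreal (2*pi)"
    by (intro order_trans[OF divide_right_mono_ennreal[OF order_trans[OF emeasure_mono mT]]])
       (use sub in \<open>auto simp: T_def\<close>)
  also have "\<dots> = ennreal (9 * s / pi)"
    using s by (subst divide_ennreal) auto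
  finally show "measure \<mu> (ball w s \<inter> sphere 0 1) \<le> 9 * s / pi"
    using s by (simp add: measure_def enn2real_leI)
qed

section \<open>Square integrable functions on the circle\<close>

notation L2_cinner (infixl "\<cdot>" 70)
notation L2_scaleC (infixr "*\<^sub>C" 75)

lemma L2_eq_rep: "L2_eq (rep_circle_L2 F) (rep_circle_L2 F)"
  by (rule Quotient_rep_reflp[OF Quotient_circle_L2])

lemma square_integrable_rep [simp]: "square_integrable (rep_circle_L2 F)"
  using L2_eq_rep by (simp add: L2_eq_def)

lemma rep_measurable [measurable]: "rep_circle_L2 F \<in> borel_measurable \<mu>"
  using square_integrable_rep by (simp add: square_integrable_def)

lemma rep_integrable_square: "integrable \<mu> (\<lambda>z. (norm (rep_circle_L2 F z))\<^sup>2)"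
  using square_integrable_rep by (simp add: square_integrable_def)

lemma rep_abs_AE:
  "square_integrable f \<Longrightarrow> AE z in circle_measure. rep_circle_L2 (abs_circle_L2 f) z = f z"
  using Quotient_rep_abs[OF Quotient_circle_L2, of f] by (simp add: L2_eq_def)

lemma abs_rep [simp]: "abs_circle_L2 (rep_circle_L2 F) = F"
  by (rule Quotient_abs_rep[OF Quotient_circle_L2])

lemma circle_L2_eqI:
  assumes "AE z in circle_measure. rep_circle_L2 F z = rep_circle_L2 G z"
  shows "F = G"
  using Quotient_rel_abs[OF Quotient_circle_L2, of "rep_circle_L2 F" "rep_circle_L2 G"] assms
  by (simp add: L2_eq_def)

lemma abs_eq_iff:
  assumes "square_integrable f" "square_integrable g"
  shows "abs_circle_L2 f = abs_circle_L2 g \<longleftrightarrow> (AE z in circle_measure. f z = g z)"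
  using Quotient_rel[OF Quotient_circle_L2, of f g] assms by (simp add: L2_eq_def)

lemma rep_zero: "AE z in circle_measure. rep_circle_L2 0 z = 0"
  unfolding zero_circle_L2_def map_fun_apply id_apply by (rule rep_abs_AE) (simp add: square_integrable_zero)

lemma rep_add: "AE z in circle_measure. rep_circle_L2 (F + G) z = rep_circle_L2 F z + rep_circle_L2 G z"
  unfolding plus_circle_L2_def map_fun_apply id_apply by (rule rep_abs_AE) (simp add: square_integrable_add)

lemma rep_diff: "AE z in circle_measure. rep_circle_L2 (F - G) z = rep_circle_L2 F z - rep_circle_L2 G z"
  unfolding minus_circle_L2_def map_fun_apply id_apply by (rule rep_abs_AE) (simp add: square_integrable_diff)

lemma rep_scaleC: "AE z in circle_measure. rep_circle_L2 (c *\<^sub>C F) z = c * rep_circle_L2 F z"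
  unfolding L2_scaleC_def map_fun_apply id_apply by (rule rep_abs_AE) (simp add: square_integrable_cmult)

lemma L2_norm_square: "(norm F)\<^sup>2 = (\<integral>z. (norm (rep_circle_L2 F z))\<^sup>2 \<partial>\<mu>)"
  unfolding norm_circle_L2_def by (simp add: L2_cinner_self)

lemma L2_norm_square_nn:
  "ennreal ((norm F)\<^sup>2) = (\<integral>\<^sup>+z. ennreal ((norm (rep_circle_L2 F z))\<^sup>2) \<partial>\<mu>)"
  unfolding L2_norm_square by (rule nn_integral_eq_integral[symmetric, OF rep_integrable_square]) auto

lemma L2_norm_abs_square:
  assumes "square_integrable f"
  shows "(norm (abs_circle_L2 f))\<^sup>2 = (\<integral>z. (norm (f z))\<^sup>2 \<partial>\<mu>)"
proof -
  have [measurable]: "f \<in> borel_measurable \<mu>"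
    using assms by (simp add: square_integrable_def)
  show ?thesis unfolding L2_norm_square
    by (rule integral_cong_AE) (use rep_abs_AE[OF assms] in auto)
qed

lemma L2_cinner_rep: "F \<cdot> G = (\<integral>z. rep_circle_L2 F z * cnj (rep_circle_L2 G z) \<partial>\<mu>)"
  by (simp add: L2_cinner.rep_eq)

lemma L2_cinner_abs:
  assumes "square_integrable f" "square_integrable g"
  shows "abs_circle_L2 f \<cdot> abs_circle_L2 g = (\<integral>z. f z * cnj (g z) \<partial>\<mu>)"
  using assms by (simp add: L2_cinner.abs_eq L2_eq_def)

section \<open>L2 as a complex inner product space\<close>

lemma scaleC_add_right: "c *\<^sub>C (x + y) = c *\<^sub>C x + c *\<^sub>C y"
  by transfer (auto simp: L2_eq_def distrib_left intro!: square_integrable_add square_integrable_cmult)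

lemma scaleC_add_left: "(c + d) *\<^sub>C x = c *\<^sub>C x + d *\<^sub>C x"
  by transfer (auto simp: L2_eq_def distrib_right intro!: square_integrable_add square_integrable_cmult)

lemma scaleC_scaleC [simp]: "c *\<^sub>C d *\<^sub>C x = (c * d) *\<^sub>C x"
  by transfer (auto simp: L2_eq_def mult.assoc intro!: square_integrable_cmult)

lemma scaleC_one [simp]: "1 *\<^sub>C x = x"
  by transfer (auto simp: L2_eq_def)

lemma scaleC_zero_left [simp]: "0 *\<^sub>C x = 0"
  using L2_scaleR_scaleC[of 0 x] by simp

lemma scaleC_zero_right [simp]: "c *\<^sub>C 0 = 0"
  using scaleC_add_right[of c 0 0] by simp

lemma scaleC_minus_one: "(-1) *\<^sub>C x = - x"
  using L2_scaleR_scaleC[of "-1" x] by simp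

lemma scaleC_minus_left [simp]: "(-c) *\<^sub>C x = - (c *\<^sub>C x)"
  using scaleC_scaleC[of "-1" c x] by (simp only: scaleC_minus_one) simp

lemma scaleC_minus_right [simp]: "c *\<^sub>C (- x) = - (c *\<^sub>C x)"
  using scaleC_scaleC[of c "-1" x] by (simp only: scaleC_minus_one) simp

lemma scaleC_diff_right: "c *\<^sub>C (x - y) = c *\<^sub>C x - c *\<^sub>C y"
  using scaleC_add_right[of c x "- y"] by simp

lemma scaleC_diff_left: "(c - d) *\<^sub>C x = c *\<^sub>C x - d *\<^sub>C x"
  using scaleC_add_left[of c "- d" x] by simp

lemma scaleC_sum_right: "c *\<^sub>C (\<Sum>i\<in>I. f i) = (\<Sum>i\<in>I. c *\<^sub>C f i)"
  by (induction I rule: infinite_finite_induct) (simp_all add: scaleC_add_right)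

lemma cinner_zero_left [simp]: "0 \<cdot> x = 0"
  using L2_cinner_scaleC_left[of 0 0 x] by simp

lemma cinner_zero_right [simp]: "x \<cdot> 0 = 0"
  using L2_cinner_cnj[of x 0] by simp

lemma cinner_add_right: "x \<cdot> (y + z) = x \<cdot> y + x \<cdot> z"
  using L2_cinner_cnj[of x "y+z"] L2_cinner_cnj[of x y] L2_cinner_cnj[of x z] L2_cinner_add_left[of y z x] by simp

lemma cinner_scaleC_right: "x \<cdot> (c *\<^sub>C y) = cnj c * (x \<cdot> y)"
  using L2_cinner_cnj[of x "c *\<^sub>C y"] L2_cinner_cnj[of x y] L2_cinner_scaleC_left[of c y x] by simp

lemma cinner_minus_left [simp]: "(- x) \<cdot> y = - (x \<cdot> y)"
  using L2_cinner_scaleC_left[of "-1" x y] by (simp add: scaleC_minus_one)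

lemma cinner_minus_right [simp]: "x \<cdot> (- y) = - (x \<cdot> y)"
  using cinner_scaleC_right[of x "-1" y] by (simp add: scaleC_minus_one)

lemma cinner_diff_left: "(x - y) \<cdot> z = x \<cdot> z - y \<cdot> z"
  using L2_cinner_add_left[of x "-y" z] by simp

lemma cinner_diff_right: "x \<cdot> (y - z) = x \<cdot> y - x \<cdot> z"
  using cinner_add_right[of x y "-z"] by simp

lemma cinner_sum_left: "(\<Sum>i\<in>I. f i) \<cdot> y = (\<Sum>i\<in>I. f i \<cdot> y)"
  by (induction I rule: infinite_finite_induct) (simp_all add: L2_cinner_add_left)

lemma cinner_sum_right: "y \<cdot> (\<Sum>i\<in>I. f i) = (\<Sum>i\<in>I. y \<cdot> f i)"
  by (induction I rule: infinite_finite_induct) (simp_all add: cinner_add_right)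

lemmas cinner_simps = L2_cinner_add_left cinner_add_right L2_cinner_scaleC_left cinner_scaleC_right
  cinner_diff_left cinner_diff_right

lemma cinner_self: "x \<cdot> x = complex_of_real ((norm x)\<^sup>2)"
  by (simp add: L2_cinner_self L2_norm_square)

lemma cinner_self_Re: "Re (x \<cdot> x) = (norm x)\<^sup>2"
  by (simp add: cinner_self)

lemma cinner_swap_eq_zero: "x \<cdot> y = 0 \<longleftrightarrow> y \<cdot> x = 0"
  using L2_cinner_cnj[of x y] by simp

lemma norm_scaleC [simp]: "norm (c *\<^sub>C x) = norm c * norm x"
proof -
  have "complex_of_real ((norm (c *\<^sub>C x))\<^sup>2) = c * cnj c * complex_of_real ((norm x)\<^sup>2)"
    unfolding cinner_self[symmetric] by (simp add: cinner_simps)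
  hence "complex_of_real ((norm (c *\<^sub>C x))\<^sup>2) = complex_of_real ((norm c * norm x)\<^sup>2)"
    by (simp only: complex_norm_square[symmetric] of_real_mult power_mult_distrib)
  hence "(norm (c *\<^sub>C x))\<^sup>2 = (norm c * norm x)\<^sup>2"
    using of_real_eq_iff by blast
  thus ?thesis
    by (metis abs_norm_cancel abs_of_nonneg mult_nonneg_nonneg norm_ge_zero power2_eq_imp_eq)
qed

lemma norm_add_square: "(norm (x + y))\<^sup>2 = (norm x)\<^sup>2 + (norm y)\<^sup>2 + 2 * Re (x \<cdot> y)"
proof -
  have "Re ((x + y) \<cdot> (x + y)) = Re (x \<cdot> x) + Re (y \<cdot> y) + Re (x \<cdot> y) + Re (y \<cdot> x)"
    by (simp add: cinner_simps)
  moreover have "Re (y \<cdot> x) = Re (x \<cdot> y)"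
    by (subst L2_cinner_cnj) simp
  ultimately show ?thesis
    by (simp add: cinner_self_Re)
qed

lemma pythagoras: "x \<cdot> y = 0 \<Longrightarrow> (norm (x + y))\<^sup>2 = (norm x)\<^sup>2 + (norm y)\<^sup>2"
  by (simp add: norm_add_square)

lemma cinner_Cauchy_Schwarz: "norm (x \<cdot> y) \<le> norm x * norm y"
proof (cases "x \<cdot> y = 0")
  case False
  \<comment> \<open>A unimodular factor rotates x until the inner product is real, so that the real
    Cauchy--Schwarz inequality of the type class applies.\<close>
  define c where "c = cnj (x \<cdot> y) / of_real (norm (x \<cdot> y))"
  have nc: "norm c = 1" using False by (simp add: c_def norm_divide)
  have "(c *\<^sub>C x) \<cdot> y = of_real (norm (x \<cdot> y))"
    using False complex_norm_square[of "x \<cdot> y"]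
    by (simp add: c_def cinner_simps power2_eq_square field_simps)
  hence "norm (x \<cdot> y) = inner (c *\<^sub>C x) y"
    by (simp add: inner_circle_L2_def)
  also have "\<dots> \<le> norm (c *\<^sub>C x) * norm y"
    by (rule norm_cauchy_schwarz)
  finally show ?thesis by (simp add: nc)
qed simp

lemma bounded_linear_cinner_left: "bounded_linear (\<lambda>x. x \<cdot> y)"
  by (rule bounded_linear_intro[where K = "norm y"])
     (simp_all add: cinner_simps L2_scaleR_scaleC scaleR_conv_of_real cinner_Cauchy_Schwarz)

lemma bounded_linear_cinner_right: "bounded_linear (\<lambda>x. y \<cdot> x)"
  by (rule bounded_linear_intro[where K = "norm y"])
     (use cinner_Cauchy_Schwarz[of y] in \<open>simp_all add: cinner_simps L2_scaleR_scaleC scaleR_conv_of_real mult.commute\<close>)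

lemmas tendsto_cinner_left = bounded_linear.tendsto[OF bounded_linear_cinner_left]
lemmas tendsto_cinner_right = bounded_linear.tendsto[OF bounded_linear_cinner_right]

lemma bounded_linear_scaleC: "bounded_linear (\<lambda>x. c *\<^sub>C x)"
  by (rule bounded_linear_intro[where K = "norm c"])
     (simp_all add: scaleC_add_right L2_scaleR_scaleC mult.commute)

lemmas tendsto_scaleC = bounded_linear.tendsto[OF bounded_linear_scaleC]

section \<open>Multiplication by bounded symbols\<close>

lemma measurable_cnj [measurable]:
  "f \<in> borel_measurable M \<Longrightarrow> (\<lambda>x. cnj (f x)) \<in> borel_measurable M"
  by (rule borel_measurable_continuous_on[where f = cnj]) (intro continuous_intros)

lemma square_integrable_continuous: "continuous_on (sphere 0 1) f \<Longrightarrow> square_integrable f"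
  unfolding square_integrable_def
  by (auto intro!: continuous_imp_measurable_circle circle_integrable_continuous continuous_intros)

text \<open>The bound is demanded at every point of the circle. Continuous symbols satisfy this, and
  so does the boundary function \<open>ub\<close> below, whose values are adjusted to have modulus 1
  everywhere.\<close>

definition bounded_symbol :: "(complex \<Rightarrow> complex) \<Rightarrow> bool" where
  "bounded_symbol \<phi> \<longleftrightarrow> \<phi> \<in> borel_measurable \<mu> \<and> (\<exists>M. \<forall>z\<in>sphere 0 1. norm (\<phi> z) \<le> M)"

lemma continuous_bounded_symbol:
  assumes "continuous_on (sphere 0 1) \<phi>"
  shows "bounded_symbol \<phi>"
proof -
  have "bounded (\<phi> ` sphere 0 1)"
    using assms by (intro compact_imp_bounded compact_continuous_image) auto
  thus ?thesis
    using assms by (auto simp: bounded_symbol_def bounded_iff continuous_imp_measurable_circle)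
qed

lemma bounded_symbol_cnj: "bounded_symbol \<phi> \<Longrightarrow> bounded_symbol (\<lambda>z. cnj (\<phi> z))"
  by (simp add: bounded_symbol_def measurable_cnj)

lemma bounded_symbol_mult:
  assumes "bounded_symbol \<phi>" "bounded_symbol \<psi>" 
  shows "bounded_symbol (\<lambda>z. \<phi> z * \<psi> z)"
proof -
  obtain M N where "\<forall>z\<in>sphere 0 1. norm (\<phi> z) \<le> M" "\<forall>z\<in>sphere 0 1. norm (\<psi> z) \<le> N"
    using assms by (auto simp: bounded_symbol_def)
  hence "\<forall>z\<in>sphere 0 1. norm (\<phi> z * \<psi> z) \<le> M * N"
    unfolding norm_mult by (meson mult_mono norm_ge_zero order_trans)
  thus ?thesis
    using assms by (auto simp: bounded_symbol_def)
qed

lemma square_integrable_mult: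
  assumes "bounded_symbol \<phi>" "square_integrable f"
  shows "square_integrable (\<lambda>z. \<phi> z * f z)"
proof -
  obtain M where M: "\<And>z. z\<in>sphere 0 1 \<Longrightarrow> norm (\<phi> z) \<le> M"
    using assms(1) unfolding bounded_symbol_def by blast
  have m [measurable]: "\<phi> \<in> borel_measurable \<mu>" "f \<in> borel_measurable \<mu>"
    using assms by (auto simp: bounded_symbol_def square_integrable_def)
  have "integrable \<mu> (\<lambda>z. M\<^sup>2 * (norm (f z))\<^sup>2)"
    using assms by (auto simp: square_integrable_def)
  hence "integrable \<mu> (\<lambda>z. (norm (\<phi> z * f z))\<^sup>2)"
  proof (rule Bochner_Integration.integrable_bound)
    show "AE z in circle_measure. norm ((norm (\<phi> z * f z))\<^sup>2) \<le> norm (M\<^sup>2 * (norm (f z))\<^sup>2)"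
      using M by (intro AE_I2) (auto simp: norm_mult power_mult_distrib intro!: mult_right_mono power_mono)
  qed auto
  thus ?thesis by (simp add: square_integrable_def)
qed

lemma rep_L2_mult:
  "bounded_symbol \<phi> \<Longrightarrow> AE z in circle_measure. rep_circle_L2 (L2_mult \<phi> F) z = \<phi> z * rep_circle_L2 F z"
  unfolding L2_mult_def by (intro rep_abs_AE square_integrable_mult) auto

lemma L2_mult_add: 
  assumes "bounded_symbol \<phi>" shows "L2_mult \<phi> (F + G) = L2_mult \<phi> F + L2_mult \<phi> G"
proof (rule circle_L2_eqI)
  show "AE z in circle_measure. rep_circle_L2 (L2_mult \<phi> (F + G)) z = rep_circle_L2 (L2_mult \<phi> F + L2_mult \<phi> G) z"
    using rep_L2_mult[OF assms, of "F+G"] rep_L2_mult[OF assms, of F] rep_L2_mult[OF assms, of G]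
      rep_add[of F G] rep_add[of "L2_mult \<phi> F" "L2_mult \<phi> G"]
    by eventually_elim (simp add: distrib_left)
qed

lemma L2_mult_scaleC: 
  assumes "bounded_symbol \<phi>" shows "L2_mult \<phi> (c *\<^sub>C F) = c *\<^sub>C L2_mult \<phi> F"
proof (rule circle_L2_eqI)
  show "AE z in circle_measure. rep_circle_L2 (L2_mult \<phi> (c *\<^sub>C F)) z = rep_circle_L2 (c *\<^sub>C L2_mult \<phi> F) z"
    using rep_L2_mult[OF assms, of "c *\<^sub>C F"] rep_L2_mult[OF assms, of F] rep_scaleC[of c F] rep_scaleC[of c "L2_mult \<phi> F"]
    by eventually_elim simp
qed

lemma L2_mult_add_symbol: 
  assumes "bounded_symbol \<phi>" "bounded_symbol \<psi>" "bounded_symbol (\<lambda>z. \<phi> z + \<psi> z)"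
  shows "L2_mult (\<lambda>z. \<phi> z + \<psi> z) F = L2_mult \<phi> F + L2_mult \<psi> F"
proof (rule circle_L2_eqI)
  show "AE z in circle_measure. rep_circle_L2 (L2_mult (\<lambda>z. \<phi> z + \<psi> z) F) z = rep_circle_L2 (L2_mult \<phi> F + L2_mult \<psi> F) z"
    using rep_L2_mult[OF assms(1), of F] rep_L2_mult[OF assms(2), of F] rep_L2_mult[OF assms(3), of F]
      rep_add[of "L2_mult \<phi> F" "L2_mult \<psi> F"]
    by eventually_elim (simp add: distrib_right)
qed

lemma L2_mult_mult: 
  assumes "bounded_symbol \<phi>" "bounded_symbol \<psi>"
  shows "L2_mult (\<lambda>z. \<phi> z * \<psi> z) F = L2_mult \<phi> (L2_mult \<psi> F)"
proof (rule circle_L2_eqI)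
  show "AE z in circle_measure. rep_circle_L2 (L2_mult (\<lambda>z. \<phi> z * \<psi> z) F) z = rep_circle_L2 (L2_mult \<phi> (L2_mult \<psi> F)) z"
    using rep_L2_mult[OF assms(2), of F] rep_L2_mult[OF assms(1), of "L2_mult \<psi> F"] rep_L2_mult[OF bounded_symbol_mult[OF assms], of F]
    by eventually_elim simp
qed

lemma bounded_symbol_const: "bounded_symbol (\<lambda>z. c)"
  by (intro continuous_bounded_symbol continuous_intros)

lemma L2_mult_const: "L2_mult (\<lambda>z. c) F = c *\<^sub>C F"
proof (rule circle_L2_eqI)
  show "AE z in circle_measure. rep_circle_L2 (L2_mult (\<lambda>z. c) F) z = rep_circle_L2 (c *\<^sub>C F) z"
    using rep_L2_mult[OF bounded_symbol_const, of c F] rep_scaleC[of c F]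
    by eventually_elim simp
qed

lemma L2_mult_cong:
  assumes "\<And>z. z \<in> sphere 0 1 \<Longrightarrow> \<phi> z = \<psi> z" "bounded_symbol \<phi>"
  shows "L2_mult \<phi> F = L2_mult \<psi> F"
proof -
  have "\<psi> \<in> borel_measurable \<mu> \<longleftrightarrow> \<phi> \<in> borel_measurable \<mu>"
    by (rule measurable_cong) (simp add: assms)
  hence b: "bounded_symbol \<psi>"
    using assms by (auto simp: bounded_symbol_def)
  show ?thesis
    unfolding L2_mult_def
    by (subst abs_eq_iff) (auto intro!: square_integrable_mult assms b AE_I2)
qed

lemma norm_L2_mult_le:
  assumes "bounded_symbol \<phi>" "\<And>z. z \<in> sphere 0 1 \<Longrightarrow> norm (\<phi> z) \<le> M"
  shows "norm (L2_mult \<phi> F) \<le> M * norm F"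
proof (rule power2_le_imp_le)
  have M: "0 \<le> M" using order_trans[OF norm_ge_zero assms(2)[of 1]] by simp
  have m [measurable]: "\<phi> \<in> borel_measurable \<mu>"
    using assms by (simp add: bounded_symbol_def)
  have "(norm (L2_mult \<phi> F))\<^sup>2 = (\<integral>z. (norm (\<phi> z * rep_circle_L2 F z))\<^sup>2 \<partial>\<mu>)"
    unfolding L2_mult_def by (rule L2_norm_abs_square) (intro square_integrable_mult assms, simp)
  also have "\<dots> \<le> (\<integral>z. M\<^sup>2 * (norm (rep_circle_L2 F z))\<^sup>2 \<partial>\<mu>)"
  proof (rule integral_mono_AE)
    show "integrable \<mu> (\<lambda>z. (norm (\<phi> z * rep_circle_L2 F z))\<^sup>2)"
      using square_integrable_mult[OF assms(1) square_integrable_rep[of F]] by (simp add: square_integrable_def)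
    show "integrable \<mu> (\<lambda>z. M\<^sup>2 * (norm (rep_circle_L2 F z))\<^sup>2)"
      using rep_integrable_square by simp
    show "AE z in circle_measure. (norm (\<phi> z * rep_circle_L2 F z))\<^sup>2 \<le> M\<^sup>2 * (norm (rep_circle_L2 F z))\<^sup>2"
      using assms(2) by (intro AE_I2) (auto simp: norm_mult power_mult_distrib intro!: mult_right_mono power_mono)
  qed
  also have "\<dots> = (M * norm F)\<^sup>2"
    by (simp add: L2_norm_square power_mult_distrib)
  finally show "(norm (L2_mult \<phi> F))\<^sup>2 \<le> (M * norm F)\<^sup>2" .
  show "0 \<le> M * norm F" using M by simp
qed

lemma cinner_L2_mult:
  assumes "bounded_symbol \<phi>"
  shows "L2_mult \<phi> F \<cdot> G = F \<cdot> L2_mult (\<lambda>z. cnj (\<phi> z)) G"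
proof -
  have m [measurable]: "\<phi> \<in> borel_measurable \<mu>" "(\<lambda>z. cnj (\<phi> z)) \<in> borel_measurable \<mu>"
    using assms bounded_symbol_cnj[OF assms] by (simp_all add: bounded_symbol_def)
  have m': "(\<lambda>z. cnj (rep_circle_L2 H z)) \<in> borel_measurable \<mu>" for H
    by measurable
  note [measurable] = m'
  show ?thesis
    unfolding L2_cinner_rep
  proof (rule integral_cong_AE)
    show "AE z in circle_measure. rep_circle_L2 (L2_mult \<phi> F) z * cnj (rep_circle_L2 G z)
       = rep_circle_L2 F z * cnj (rep_circle_L2 (L2_mult (\<lambda>z. cnj (\<phi> z)) G) z)"
      using rep_L2_mult[OF assms, of F] rep_L2_mult[OF bounded_symbol_cnj[OF assms], of G]
      by eventually_elim simp
  qed simp_all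
qed

section \<open>Convergence in the mean and completeness\<close>

lemma circle_integral_norm_le:
  assumes "square_integrable f"
  shows "integrable \<mu> (\<lambda>z. norm (f z))" "integrable \<mu> f"
    "(\<integral>z. norm (f z) \<partial>\<mu>) \<le> norm (abs_circle_L2 f)"
proof -
  have m [measurable]: "f \<in> borel_measurable \<mu>"
    using assms by (simp add: square_integrable_def)
  define g where "g = (\<lambda>z. complex_of_real (norm (f z)))"
  have g: "square_integrable g"
    using assms by (auto simp: g_def square_integrable_def)
  have o: "square_integrable (\<lambda>z. 1)"
    by (rule square_integrable_continuous) (rule continuous_intros)
  have i: "integrable \<mu> g"
    using integrable_mult_cnj[OF g o] by simp
  thus i': "integrable \<mu> (\<lambda>z. norm (f z))"
    using integrable_norm[OF i] by (simp add: g_def)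
  thus "integrable \<mu> f"
    by (simp add: integrable_norm_iff)
  \<comment> \<open>The integral of |f| is its inner product with the constant 1, which has norm 1
    for the normalized measure; Cauchy--Schwarz then compares the L1 and L2 norms.\<close>
  have "complex_of_real (\<integral>z. norm (f z) \<partial>\<mu>) = abs_circle_L2 g \<cdot> abs_circle_L2 (\<lambda>z. 1)"
    unfolding L2_cinner_abs[OF g o] by (simp add: g_def)
  hence "\<bar>\<integral>z. norm (f z) \<partial>\<mu>\<bar> \<le> norm (abs_circle_L2 g) * norm (abs_circle_L2 (\<lambda>z. 1))"
    using cinner_Cauchy_Schwarz[of "abs_circle_L2 g" "abs_circle_L2 (\<lambda>z. 1)"]
      norm_of_real[of "\<integral>z. norm (f z) \<partial>\<mu>", where 'a = complex] by simp
  moreover have "norm (abs_circle_L2 (\<lambda>z. 1)) = 1"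
    using L2_norm_abs_square[OF o] norm_ge_zero[of "abs_circle_L2 (\<lambda>z. 1)"]
    by (simp add: power2_eq_1_iff del: norm_ge_zero)
  moreover have "(norm (abs_circle_L2 g))\<^sup>2 = (norm (abs_circle_L2 f))\<^sup>2"
    unfolding L2_norm_abs_square[OF g] L2_norm_abs_square[OF assms] by (simp add: g_def)
  ultimately show "(\<integral>z. norm (f z) \<partial>\<mu>) \<le> norm (abs_circle_L2 f)"
    by (simp add: power2_eq_1_iff)
qed

text \<open>Fatou's lemma, applied to the squared distances to F. In the completeness proof F is
  itself a member of the Cauchy sequence, so the distance of the pointwise limit to late members is
  controlled directly.\<close>

lemma L2_limit_in_norm:
  assumes g [measurable]: "g \<in> borel_measurable \<mu>"
    and lim: "AE z in circle_measure. (\<lambda>n. rep_circle_L2 (X n) z) \<longlonglongrightarrow> g z"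
    and bd: "\<And>n. n \<ge> k \<Longrightarrow> norm (X n - F) \<le> e"
  shows "square_integrable g" "norm (abs_circle_L2 g - F) \<le> e"
proof -
  have e: "0 \<le> e" using bd[of k] norm_ge_zero order_trans by blast
  define h where "h = (\<lambda>z. g z - rep_circle_L2 F z)"
  have h [measurable]: "h \<in> borel_measurable \<mu>"
    unfolding h_def by measurable
  have "AE z in circle_measure. \<forall>n. rep_circle_L2 (X n - F) z = rep_circle_L2 (X n) z - rep_circle_L2 F z"
    by (intro AE_all_countable[THEN iffD2] allI rep_diff)
  hence "AE z in circle_measure. ennreal ((norm (h z))\<^sup>2) = liminf (\<lambda>n. ennreal ((norm (rep_circle_L2 (X n - F) z))\<^sup>2))"
    using lim
  proof eventually_elim
    case (elim z)
    have "(\<lambda>n. ennreal ((norm (rep_circle_L2 (X n - F) z))\<^sup>2)) \<longlonglongrightarrow> ennreal ((norm (h z))\<^sup>2)"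
      unfolding h_def using elim by (auto intro!: tendsto_intros tendsto_ennrealI)
    thus ?case
      by (rule lim_imp_Liminf[OF sequentially_bot, symmetric])
  qed
  hence "(\<integral>\<^sup>+z. ennreal ((norm (h z))\<^sup>2) \<partial>\<mu>) = (\<integral>\<^sup>+z. liminf (\<lambda>n. ennreal ((norm (rep_circle_L2 (X n - F) z))\<^sup>2)) \<partial>\<mu>)"
    by (rule nn_integral_cong_AE)
  also have "\<dots> \<le> liminf (\<lambda>n. (\<integral>\<^sup>+z. ennreal ((norm (rep_circle_L2 (X n - F) z))\<^sup>2) \<partial>\<mu>))"
    by (rule nn_integral_liminf) measurable
  also have "\<dots> = liminf (\<lambda>n. ennreal ((norm (X n - F))\<^sup>2))"
    by (simp add: L2_norm_square_nn)
  also have "\<dots> \<le> liminf (\<lambda>n. ennreal (e\<^sup>2))"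
    by (rule Liminf_mono) (use bd in \<open>auto simp: eventually_sequentially intro!: exI[of _ k] ennreal_leI power_mono\<close>)
  finally have le: "(\<integral>\<^sup>+z. ennreal ((norm (h z))\<^sup>2) \<partial>\<mu>) \<le> ennreal (e\<^sup>2)"
    by (simp add: Liminf_const)
  hence "integrable \<mu> (\<lambda>z. (norm (h z))\<^sup>2)"
    by (intro integrableI_nonneg) (auto intro: le_less_trans)
  hence hs: "square_integrable h"
    by (simp add: square_integrable_def)
  have "g = (\<lambda>z. h z + rep_circle_L2 F z)" by (simp add: h_def)
  thus gs: "square_integrable g"
    using square_integrable_add[OF hs square_integrable_rep] by simp
  have "abs_circle_L2 g - F = abs_circle_L2 h"
  proof (rule circle_L2_eqI)
    show "AE z in circle_measure. rep_circle_L2 (abs_circle_L2 g - F) z = rep_circle_L2 (abs_circle_L2 h) z"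
      using rep_diff[of "abs_circle_L2 g" F] rep_abs_AE[OF hs] rep_abs_AE[OF gs]
      by eventually_elim (simp add: h_def)
  qed
  moreover have "ennreal ((norm (abs_circle_L2 h))\<^sup>2) \<le> ennreal (e\<^sup>2)"
    using le nn_integral_eq_integral[of \<mu> "\<lambda>z. (norm (h z))\<^sup>2"] hs
    by (simp add: L2_norm_abs_square[OF hs] square_integrable_def)
  ultimately show "norm (abs_circle_L2 g - F) \<le> e"
    using e power2_le_imp_le[of "norm (abs_circle_L2 h)" e] by simp
qed

text \<open>Riesz--Fischer: a rapidly converging subsequence converges absolutely almost everywhere.\<close>

instance circle_L2 :: complete_space
proof
  fix X :: "nat \<Rightarrow> circle_L2" assume X: "Cauchy X"
  have "\<exists>r. strict_mono r \<and> (\<forall>k. \<forall>m\<ge>r k. \<forall>n\<ge>r k. norm (X m - X n) < (1/2)^k)"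
  proof -
    have "\<exists>r. \<forall>k. (\<forall>m\<ge>r k. \<forall>n\<ge>r k. norm (X m - X n) < (1/2)^k) \<and> r k < r (Suc k)"
    proof (rule dependent_nat_choice)
      show "\<exists>x. \<forall>m\<ge>x. \<forall>n\<ge>x. norm (X m - X n) < (1 / 2) ^ 0"
        using CauchyD[OF X, of 1] by auto
      fix x :: nat and k :: nat
      obtain M where "\<forall>m\<ge>M. \<forall>n\<ge>M. norm (X m - X n) < (1/2)^Suc k"
        using CauchyD[OF X, of "(1/2)^Suc k"] by auto
      thus "\<exists>y. (\<forall>m\<ge>y. \<forall>n\<ge>y. norm (X m - X n) < (1/2)^Suc k) \<and> x < y"
        by (intro exI[of _ "max M (Suc x)"]) auto
    qed
    thus ?thesis by (auto simp: strict_mono_Suc_iff)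
  qed
  then obtain r where r: "strict_mono r" "\<And>k m n. m \<ge> r k \<Longrightarrow> n \<ge> r k \<Longrightarrow> norm (X m - X n) < (1/2)^k"
    by blast
  define D where "D k = X (r (Suc k)) - X (r k)" for k
  have D: "norm (D k) \<le> (1/2)^k" for k
    using r(2)[of k "r (Suc k)" "r k"] strict_monoD[OF r(1), of k "Suc k"] by (simp add: D_def)
  have "(\<integral>\<^sup>+z. (\<Sum>k. ennreal (norm (rep_circle_L2 (D k) z))) \<partial>\<mu>)
      = (\<Sum>k. (\<integral>\<^sup>+z. ennreal (norm (rep_circle_L2 (D k) z)) \<partial>\<mu>))"
    by (rule nn_integral_suminf) measurable
  also have "\<dots> \<le> (\<Sum>k. ennreal ((1/2)^k))"
  proof (rule suminf_le)
    fix k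
    have "(\<integral>\<^sup>+z. ennreal (norm (rep_circle_L2 (D k) z)) \<partial>\<mu>) = ennreal (\<integral>z. norm (rep_circle_L2 (D k) z) \<partial>\<mu>)"
      by (rule nn_integral_eq_integral) (auto intro!: circle_integral_norm_le)
    also have "\<dots> \<le> ennreal ((1/2)^k)"
      using circle_integral_norm_le(3)[OF square_integrable_rep, of "D k"] D[of k] by (intro ennreal_leI) simp
    finally show "(\<integral>\<^sup>+z. ennreal (norm (rep_circle_L2 (D k) z)) \<partial>\<mu>) \<le> ennreal ((1/2)^k)" .
  qed auto
  also have "\<dots> = ennreal (\<Sum>k. (1/2)^k)"
    by (rule suminf_ennreal2) (auto intro!: summable_geometric)
  also have "\<dots> < \<infinity>" by simp
  finally have "AE z in circle_measure. (\<Sum>k. ennreal (norm (rep_circle_L2 (D k) z))) \<noteq> \<infinity>"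
    by (intro nn_integral_PInf_AE) auto
  moreover have "AE z in circle_measure. \<forall>k. rep_circle_L2 (D k) z = rep_circle_L2 (X (r (Suc k))) z - rep_circle_L2 (X (r k)) z"
    unfolding D_def by (intro AE_all_countable[THEN iffD2] allI rep_diff)
  ultimately have conv: "AE z in circle_measure. convergent (\<lambda>k. rep_circle_L2 (X (r k)) z)"
  proof eventually_elim
    case (elim z)
    hence "summable (\<lambda>k. norm (rep_circle_L2 (D k) z))"
      by (intro summable_suminf_not_top) auto
    hence "summable (\<lambda>k. rep_circle_L2 (D k) z)"
      by (rule summable_norm_cancel)
    hence "convergent (\<lambda>n. \<Sum>k<n. rep_circle_L2 (X (r (Suc k))) z - rep_circle_L2 (X (r k)) z)"
      using elim by (simp add: summable_iff_convergent)
    hence "convergent (\<lambda>n. rep_circle_L2 (X (r n)) z - rep_circle_L2 (X (r 0)) z)"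
      by (simp only: sum_lessThan_telescope[of "\<lambda>k. rep_circle_L2 (X (r k)) z"])
    thus ?case by (simp add: convergent_diff_const_right_iff)
  qed
  define g where "g z = lim (\<lambda>k. rep_circle_L2 (X (r k)) z)" for z
  have g: "g \<in> borel_measurable \<mu>"
    unfolding g_def by (rule borel_measurable_lim_metric) measurable
  have lim: "AE z in circle_measure. (\<lambda>k. rep_circle_L2 (X (r k)) z) \<longlonglongrightarrow> g z"
    using conv by eventually_elim (simp add: g_def convergent_LIMSEQ_iff)
  have bd: "norm (abs_circle_L2 g - X n) \<le> (1/2)^k" if "n \<ge> r k" for n k
  proof (rule L2_limit_in_norm(2)[OF g lim])
    fix j assume "k \<le> j"
    hence "r k \<le> r j" using r(1) by (simp add: strict_mono_less_eq)
    thus "norm (X (r j) - X n) \<le> (1/2)^k" using r(2) that by (simp add: less_imp_le)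
  qed
  have "X \<longlonglongrightarrow> abs_circle_L2 g"
  proof (rule LIMSEQ_I)
    fix e :: real assume "e > 0"
    then obtain k where "(1/2)^k < e" using real_arch_pow_inv[of e "1/2"] by auto
    thus "\<exists>no. \<forall>n\<ge>no. norm (X n - abs_circle_L2 g) < e"
      using bd[of k] by (intro exI[of _ "r k"]) (auto simp: norm_minus_commute intro: le_less_trans)
  qed
  thus "convergent X" by (auto simp: convergent_def)
qed

text \<open>Boundedness in the mean square upgrades almost everywhere convergence to convergence in the mean:
  \<open>t \<le> min t K + t\<^sup>2 / K\<close>.\<close>

lemma AE_tendsto_imp_L1:
  assumes h: "\<And>n. square_integrable (h n)"
    and lim: "AE z in circle_measure. (\<lambda>n. h n z) \<longlonglongrightarrow> 0"
    and bd: "\<And>n. (\<integral>z. (norm (h n z))\<^sup>2 \<partial>\<mu>) \<le> M"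
  shows "(\<lambda>n. \<integral>z. norm (h n z) \<partial>\<mu>) \<longlonglongrightarrow> 0"
proof (rule LIMSEQ_I)
  fix e :: real assume e: "e > 0"
  have m [measurable]: "h n \<in> borel_measurable \<mu>" for n
    using h by (simp add: square_integrable_def)
  have M: "0 \<le> M" using order_trans[OF Bochner_Integration.integral_nonneg bd[of 0]] by simp
  \<comment> \<open>The truncation level is chosen to make M / K at most e / 2; adding 1 to M keeps
    K positive when M = 0.\<close>
  define K where "K = 2 * (M + 1) / e"
  have K: "K > 0" using e M by (simp add: K_def)
  have "(\<lambda>n. \<integral>z. min (norm (h n z)) K \<partial>\<mu>) \<longlonglongrightarrow> (\<integral>z. 0 \<partial>\<mu>)"
  proof (rule integral_dominated_convergence[where w = "\<lambda>_. K"])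
    show "AE z in circle_measure. (\<lambda>n. min (norm (h n z)) K) \<longlonglongrightarrow> 0"
      using lim
    proof eventually_elim
      case (elim z)
      have "(\<lambda>n. min (norm (h n z)) K) \<longlonglongrightarrow> min (norm (0::complex)) K"
        by (intro tendsto_intros elim)
      thus ?case using K by simp
    qed
  qed (use K in auto)
  then obtain N where N: "\<And>n. n \<ge> N \<Longrightarrow> \<bar>\<integral>z. min (norm (h n z)) K \<partial>\<mu>\<bar> < e/2"
    using LIMSEQ_D[of "\<lambda>n. \<integral>z. min (norm (h n z)) K \<partial>\<mu>" 0 "e/2"] e by auto
  show "\<exists>no. \<forall>n\<ge>no. norm ((\<integral>z. norm (h n z) \<partial>\<mu>) - 0) < e"
  proof (intro exI[of _ N] allI impI)
    fix n assume n: "n \<ge> N"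
    have i1: "integrable \<mu> (\<lambda>z. min (norm (h n z)) K)"
      using K by (intro circle_integrable_bounded[where B = K]) auto
    have i2: "integrable \<mu> (\<lambda>z. (norm (h n z))\<^sup>2 / K)"
      using h[of n] by (simp add: square_integrable_def)
    have "(\<integral>z. norm (h n z) \<partial>\<mu>) \<le> (\<integral>z. min (norm (h n z)) K + (norm (h n z))\<^sup>2 / K \<partial>\<mu>)"
    proof (rule integral_mono)
      show "integrable \<mu> (\<lambda>z. norm (h n z))"
        by (rule circle_integral_norm_le[OF h])
      show "integrable \<mu> (\<lambda>z. min (norm (h n z)) K + (norm (h n z))\<^sup>2 / K)"
        using i1 i2 by simp
      fix z
      show "norm (h n z) \<le> min (norm (h n z)) K + (norm (h n z))\<^sup>2 / K"
      proof (cases "norm (h n z) \<le> K")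
        case False
        hence "K * norm (h n z) \<le> (norm (h n z))\<^sup>2"
          by (simp add: power2_eq_square mult_right_mono)
        hence "norm (h n z) \<le> (norm (h n z))\<^sup>2 / K"
          using K by (simp add: field_simps)
        thus ?thesis using K False by simp
      qed (use K in simp)
    qed
    also have "\<dots> = (\<integral>z. min (norm (h n z)) K \<partial>\<mu>) + (\<integral>z. (norm (h n z))\<^sup>2 \<partial>\<mu>) / K"
      using i1 i2 h[of n] by (subst Bochner_Integration.integral_add) (auto simp: square_integrable_def)
    also have "\<dots> \<le> (\<integral>z. min (norm (h n z)) K \<partial>\<mu>) + M / K"
      using K bd[of n] by (simp add: divide_right_mono)
    also have "M / K \<le> e / 2"
      using M e by (simp add: K_def field_simps)
    finally have "(\<integral>z. norm (h n z) \<partial>\<mu>) < e"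
      using N[OF n] by linarith
    thus "norm ((\<integral>z. norm (h n z) \<partial>\<mu>) - 0) < e"
      by (simp add: Bochner_Integration.integral_nonneg)
  qed
qed

section \<open>Closed subspaces and their bounded operators\<close>

locale hilbert_subspace =
  fixes H :: "circle_L2 set"
  assumes closed_H: "closed H"
    and zero_H [simp, intro]: "0 \<in> H"
    and add_H [simp, intro]: "x \<in> H \<Longrightarrow> y \<in> H \<Longrightarrow> x + y \<in> H"
    and scaleC_H [simp, intro]: "x \<in> H \<Longrightarrow> c *\<^sub>C x \<in> H"
begin

lemma minus_H [simp, intro]: "x \<in> H \<Longrightarrow> - x \<in> H"
  using scaleC_H[of x "-1"] by (simp add: scaleC_minus_one)

lemma diff_H [simp, intro]: "x \<in> H \<Longrightarrow> y \<in> H \<Longrightarrow> x - y \<in> H"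
  using add_H[of x "- y"] by simp

lemma scaleR_H [simp, intro]: "x \<in> H \<Longrightarrow> r *\<^sub>R x \<in> H"
  by (simp add: L2_scaleR_scaleC)

lemma sum_H [simp, intro]: "(\<And>i. i \<in> I \<Longrightarrow> f i \<in> H) \<Longrightarrow> (\<Sum>i\<in>I. f i) \<in> H"
  by (induction I rule: infinite_finite_induct) auto

lemma cinner_H_eqI:
  assumes "x \<in> H" "y \<in> H" "\<And>h. h \<in> H \<Longrightarrow> h \<cdot> x = h \<cdot> y"
  shows "x = y"
proof -
  have "(x - y) \<cdot> (x - y) = 0"
    using assms by (simp add: cinner_diff_right)
  thus ?thesis
    by (simp add: L2_cinner_self_eq_zero_iff)
qed

section \<open>Orthogonal projection onto a closed subspace\<close>

lemma nearest_point_exists: "\<exists>g\<in>H. \<forall>h\<in>H. norm (x - g) \<le> norm (x - h)"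
proof -
  define D where "D = (\<lambda>h. (norm (x - h))\<^sup>2) ` H"
  have bdd: "bdd_below D" and ne: "D \<noteq> {}"
    by (auto simp: D_def intro!: bdd_belowI[where m = 0])
  have d: "Inf D \<le> (norm (x - h))\<^sup>2" if "h \<in> H" for h
    using that bdd by (intro cInf_lower) (auto simp: D_def)
  have "\<exists>h\<in>H. (norm (x - h))\<^sup>2 < Inf D + 1 / real (Suc n)" for n
  proof -
    have "\<exists>v\<in>D. v < Inf D + 1 / real (Suc n)"
      using ne bdd by (subst cInf_less_iff[symmetric]) auto
    thus ?thesis by (auto simp: D_def)
  qed
  then obtain y where y: "\<And>n. y n \<in> H" "\<And>n. (norm (x - y n))\<^sup>2 < Inf D + 1 / real (Suc n)"
    by metis
  \<comment> \<open>Parallelogram law: the midpoint of two members lies in \<open>H\<close> and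
    cannot come closer to x than the infimum, so two nearly optimal members are close to each other.
    Hence the minimizing sequence is Cauchy.\<close>
  have par: "(norm (y m - y n))\<^sup>2 \<le> 2 / real (Suc m) + 2 / real (Suc n)" for m n
  proof -
    have "(1/2) *\<^sub>R (y m + y n) \<in> H" using y by auto
    from d[OF this] have "4 * Inf D \<le> (2 * norm (x - (1/2) *\<^sub>R (y m + y n)))\<^sup>2"
      by (simp add: power_mult_distrib)
    also have "2 * norm (x - (1/2) *\<^sub>R (y m + y n)) = norm (2 *\<^sub>R (x - (1/2) *\<^sub>R (y m + y n)))"
      by simp
    also have "2 *\<^sub>R (x - (1/2) *\<^sub>R (y m + y n)) = (x - y m) + (x - y n)"
      by (simp add: scaleR_diff_right scaleR_2)
    finally have 1: "4 * Inf D \<le> (norm ((x - y m) + (x - y n)))\<^sup>2" .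
    have "(norm ((x - y m) + (x - y n)))\<^sup>2 + (norm ((x - y n) - (x - y m)))\<^sup>2 = 2 * (norm (x - y m))\<^sup>2 + 2 * (norm (x - y n))\<^sup>2"
      by (simp add: power2_norm_eq_inner inner_simps inner_commute)
    hence "(norm (y m - y n))\<^sup>2 = 2 * (norm (x - y m))\<^sup>2 + 2 * (norm (x - y n))\<^sup>2 - (norm ((x - y m) + (x - y n)))\<^sup>2"
      by simp
    thus ?thesis using 1 y(2)[of m] y(2)[of n] by (simp add: algebra_simps)
  qed
  have "Cauchy y"
  proof (rule CauchyI)
    fix e :: real assume e: "e > 0"
    obtain N where N: "1 / real (Suc N) < e\<^sup>2 / 4"
      using nat_approx_posE[of "e\<^sup>2 / 4"] e by auto
    show "\<exists>M. \<forall>m\<ge>M. \<forall>n\<ge>M. norm (y m - y n) < e"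
    proof (intro exI[of _ N] allI impI)
      fix m n assume mn: "N \<le> m" "N \<le> n"
      have "1 / real (Suc m) \<le> 1 / real (Suc N)" "1 / real (Suc n) \<le> 1 / real (Suc N)"
        using mn by (auto intro!: divide_left_mono)
      hence "(norm (y m - y n))\<^sup>2 < e\<^sup>2" using par[of m n] N by simp
      thus "norm (y m - y n) < e" using e by (simp add: power2_less_imp_less)
    qed
  qed
  then obtain g where g: "y \<longlonglongrightarrow> g"
    using Cauchy_convergent_iff convergent_def by blast
  have gH: "g \<in> H" using closed_sequentially[OF closed_H _ g] y by auto
  have "(\<lambda>n. (norm (x - y n))\<^sup>2) \<longlonglongrightarrow> (norm (x - g))\<^sup>2"
    by (intro tendsto_intros g)
  moreover have "(\<lambda>n. Inf D + 1 / real (Suc n)) \<longlonglongrightarrow> Inf D + 0"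
    by (intro tendsto_add tendsto_const LIMSEQ_Suc lim_1_over_n)
  ultimately have "(norm (x - g))\<^sup>2 \<le> Inf D"
    using y(2) by (intro LIMSEQ_le[of _ _ _ "Inf D"]) (auto intro: less_imp_le)
  hence "norm (x - g) \<le> norm (x - h)" if "h \<in> H" for h
    using d[OF that] by (meson norm_ge_zero order_trans power2_le_imp_le)
  with gH show ?thesis by blast
qed

lemma orthogonal_decomposition: "\<exists>g\<in>H. \<forall>h\<in>H. (x - g) \<cdot> h = 0"
proof -
  obtain g where g: "g \<in> H" "\<And>h. h \<in> H \<Longrightarrow> norm (x - g) \<le> norm (x - h)"
    using nearest_point_exists by blast
  have "(x - g) \<cdot> h = 0" if h: "h \<in> H" for h
  proof (cases "h = 0")
    case False
    define a where "a = (x - g) \<cdot> h"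
    \<comment> \<open>This multiple of h is the best correction of g in the direction of h; it would
      lower the squared distance by (|a| / |h|)^2, so minimality of g forces a = 0.\<close>
    define c where "c = a / of_real ((norm h)\<^sup>2)"
    have "norm (x - g) \<le> norm (x - (g + c *\<^sub>C h))"
      using g h by auto
    hence "(norm (x - g))\<^sup>2 \<le> (norm ((x - g) + (- c) *\<^sub>C h))\<^sup>2"
      by (simp add: algebra_simps power_mono)
    also have "\<dots> = (norm (x - g))\<^sup>2 + (norm c * norm h)\<^sup>2 - 2 * Re (cnj c * a)"
      by (subst norm_add_square) (simp add: a_def cinner_scaleC_right)
    also have "cnj c * a = of_real ((norm a / norm h)\<^sup>2)"
      using complex_norm_square[of a] False by (simp add: c_def power_divide mult.commute)
    also have "(norm c * norm h)\<^sup>2 = (norm a / norm h)\<^sup>2"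
      using False by (simp add: c_def norm_divide norm_mult power2_eq_square)
    finally have "(norm a / norm h)\<^sup>2 \<le> 0" by simp
    thus ?thesis using False by (simp add: a_def)
  qed simp
  with g show ?thesis by blast
qed

abbreviation P where "P \<equiv> orth_proj H"

lemma orth_proj_unique:
  assumes "g \<in> H" "\<And>h. h \<in> H \<Longrightarrow> (x - g) \<cdot> h = 0"
  shows "P x = g"
  unfolding orth_proj_def
proof (rule the_equality)
  fix g' assume g': "g' \<in> H \<and> (\<forall>h\<in>H. (x - g') \<cdot> h = 0)"
  show "g' = g"
  proof (rule cinner_H_eqI)
    fix h assume "h \<in> H"
    hence "(x - g') \<cdot> h = (x - g) \<cdot> h" using assms g' by simp
    hence "g' \<cdot> h = g \<cdot> h" by (simp add: cinner_simps)
    thus "h \<cdot> g' = h \<cdot> g" using L2_cinner_cnj[of h g'] L2_cinner_cnj[of h g] by simp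
  qed (use assms g' in auto)
qed (use assms in auto)

lemma orth_proj_props: "P x \<in> H" "h \<in> H \<Longrightarrow> (x - P x) \<cdot> h = 0"
proof -
  obtain g where g: "g \<in> H" "\<And>h. h \<in> H \<Longrightarrow> (x - g) \<cdot> h = 0"
    using orthogonal_decomposition by blast
  hence "P x = g" by (rule orth_proj_unique)
  with g show "P x \<in> H" "h \<in> H \<Longrightarrow> (x - P x) \<cdot> h = 0" by auto
qed

lemma orth_proj_in [simp, intro]: "P x \<in> H"
  by (rule orth_proj_props)

lemma cinner_orth_proj: "h \<in> H \<Longrightarrow> P x \<cdot> h = x \<cdot> h"
  using orth_proj_props(2)[of h x] by (simp add: cinner_simps)

lemma cinner_orth_proj_right: "h \<in> H \<Longrightarrow> h \<cdot> P x = h \<cdot> x"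
  using cinner_orth_proj[of h x] L2_cinner_cnj[of h x] L2_cinner_cnj[of h "P x"] by simp

lemma orth_proj_self [simp]: "x \<in> H \<Longrightarrow> P x = x"
  by (rule orth_proj_unique) auto

lemma orth_proj_add: "P (x + y) = P x + P y"
  by (rule orth_proj_unique) (auto simp: cinner_simps cinner_orth_proj)

lemma orth_proj_scaleC: "P (c *\<^sub>C x) = c *\<^sub>C P x"
  by (rule orth_proj_unique) (auto simp: cinner_simps cinner_orth_proj)

lemma orth_proj_diff: "P (x - y) = P x - P y"
  by (rule orth_proj_unique) (auto simp: cinner_simps cinner_orth_proj)

lemma norm_orth_proj_square: "(norm x)\<^sup>2 = (norm (P x))\<^sup>2 + (norm (x - P x))\<^sup>2"
proof -
  have "P x \<cdot> (x - P x) = 0"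
    using orth_proj_props(2)[of "P x" x] cinner_swap_eq_zero by auto
  from pythagoras[OF this] show ?thesis by simp
qed

lemma norm_orth_proj_le: "norm (P x) \<le> norm x"
  by (rule power2_le_imp_le) (use norm_orth_proj_square[of x] in auto)

lemma norm_orth_compl_le: "norm (x - P x) \<le> norm x"
  by (rule power2_le_imp_le) (use norm_orth_proj_square[of x] in auto)

section \<open>Bounded operators, Riesz representation and adjoints\<close>

abbreviation B where "B \<equiv> bounded_operators H"
abbreviation R where "R \<equiv> operator_algebra H"

lemma bounded_operatorsI:
  assumes "\<And>x. x \<in> H \<Longrightarrow> T x \<in> H" "\<And>x. x \<notin> H \<Longrightarrow> T x = undefined"
    "\<And>x y. x \<in> H \<Longrightarrow> y \<in> H \<Longrightarrow> T (x + y) = T x + T y"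
    "\<And>c x. x \<in> H \<Longrightarrow> T (c *\<^sub>C x) = c *\<^sub>C T x"
    "\<And>x. x \<in> H \<Longrightarrow> norm (T x) \<le> M * norm x"
  shows "T \<in> B"
  unfolding bounded_operators_def mem_Collect_eq
  by (intro conjI PiE_I ballI allI exI[of _ M]) (use assms in auto)

lemma opD:
  assumes "T \<in> B"
  shows "x \<in> H \<Longrightarrow> T x \<in> H" "x \<notin> H \<Longrightarrow> T x = undefined"
    "x \<in> H \<Longrightarrow> y \<in> H \<Longrightarrow> T (x + y) = T x + T y"
    "x \<in> H \<Longrightarrow> T (c *\<^sub>C x) = c *\<^sub>C T x"
  using assms unfolding bounded_operators_def by auto

lemma op_bound:
  assumes "T \<in> B"
  obtains M where "M > 0" "\<And>x. x \<in> H \<Longrightarrow> norm (T x) \<le> M * norm x"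
proof -
  obtain M where "\<And>x. x \<in> H \<Longrightarrow> norm (T x) \<le> M * norm x"
    using assms unfolding bounded_operators_def by blast
  hence "norm (T x) \<le> max M 1 * norm x" if "x \<in> H" for x
    using that by (meson max.cobounded1 mult_right_mono norm_ge_zero order_trans)
  thus ?thesis by (intro that[of "max M 1"]) auto
qed

lemma op_ext:
  assumes "S \<in> B" "T \<in> B" "\<And>x. x \<in> H \<Longrightarrow> S x = T x"
  shows "S = T"
proof
  fix x show "S x = T x"
    using assms opD(2)[OF assms(1), of x] opD(2)[OF assms(2), of x] by (cases "x \<in> H") auto
qed

lemma op_zero: assumes "T \<in> B" shows "T 0 = 0"
  using opD(4)[OF assms zero_H, of 0] by simp

lemma op_minus: assumes "T \<in> B" "x \<in> H" shows "T (- x) = - T x"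
  using opD(4)[OF assms, of "-1"] by (simp add: scaleC_minus_one)

lemma op_diff: assumes "T \<in> B" "x \<in> H" "y \<in> H" shows "T (x - y) = T x - T y"
  using opD(3)[OF assms(1,2), of "- y"] op_minus[OF assms(1,3)] assms(3) by simp

lemma op_continuous: assumes "T \<in> B" shows "continuous_on H T"
proof -
  obtain M where M: "M > 0" "\<And>x. x \<in> H \<Longrightarrow> norm (T x) \<le> M * norm x"
    using op_bound[OF assms] by blast
  have "M-lipschitz_on H T"
    by (rule lipschitz_onI) (use M in \<open>auto simp: dist_norm op_diff[OF assms, symmetric]\<close>)
  thus ?thesis by (rule lipschitz_on_continuous_on)
qed

text \<open>The zero set N of f in \<open>H\<close> is a closed subspace. For e in \<open>H\<close>
  orthogonal to N, the vector f(e) x - f(x) e lies in N, and pairing it with e expresses f(x) as a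
  multiple of the inner product of x with e.\<close>

lemma Riesz_representation:
  assumes add: "\<And>x y. x \<in> H \<Longrightarrow> y \<in> H \<Longrightarrow> f (x + y) = f x + f y"
    and scale: "\<And>c x. x \<in> H \<Longrightarrow> f (c *\<^sub>C x) = c * f x"
    and bd: "\<And>x. x \<in> H \<Longrightarrow> norm (f x) \<le> M * norm x"
  shows "\<exists>y\<in>H. \<forall>x\<in>H. f x = x \<cdot> y"
proof -
  define N where "N = {x \<in> H. f x = 0}"
  have f0: "f 0 = 0" using scale[OF zero_H, of 0] by simp
  have fdiff: "f (x - y) = f x - f y" if "x \<in> H" "y \<in> H" for x y
    using add[of "x - y" y] that by simp
  have "closed N"
    unfolding closed_sequential_limits
  proof (intro allI impI)
    fix x l assume x: "(\<forall>n. x n \<in> N) \<and> x \<longlonglongrightarrow> l"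
    hence l: "l \<in> H" using closed_sequentially[OF closed_H, of x l] by (auto simp: N_def)
    have "(\<lambda>n. M * norm (l - x n)) \<longlonglongrightarrow> M * norm (l - l)"
      using x by (intro tendsto_intros) auto
    moreover have "norm (f l) \<le> M * norm (l - x n)" for n
      using bd[of "l - x n"] fdiff[of l "x n"] x l by (auto simp: N_def)
    ultimately have "norm (f l) \<le> M * norm (l - l)"
      by (intro LIMSEQ_le_const) auto
    thus "l \<in> N" using l by (simp add: N_def)
  qed
  then interpret N: hilbert_subspace N
    by unfold_locales (auto simp: N_def f0 add scale)
  show ?thesis
  proof (cases "N = H")
    case True
    thus ?thesis by (intro bexI[of _ 0]) (auto simp: N_def)
  next
    case False
    then obtain x0 where x0: "x0 \<in> H" "x0 \<notin> N" by (auto simp: N_def)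
    define e where "e = x0 - N.P x0"
    have e: "e \<in> H" "\<And>n. n \<in> N \<Longrightarrow> e \<cdot> n = 0"
      using x0 N.orth_proj_in[of x0] N.orth_proj_props(2) by (auto simp: e_def N_def)
    have "e \<noteq> 0" using x0 N.orth_proj_in[of x0] unfolding e_def by (metis eq_iff_diff_eq_0)
    have "f x = x \<cdot> ((cnj (f e) / of_real ((norm e)\<^sup>2)) *\<^sub>C e)" if x: "x \<in> H" for x
    proof -
      have "f e *\<^sub>C x - f x *\<^sub>C e \<in> N"
        using x e by (auto simp: N_def fdiff scale)
      hence "(f e *\<^sub>C x - f x *\<^sub>C e) \<cdot> e = 0"
        using e(2) cinner_swap_eq_zero by blast
      hence "f e * (x \<cdot> e) = f x * of_real ((norm e)\<^sup>2)"
        by (simp add: cinner_simps cinner_self)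
      thus ?thesis
        using \<open>e \<noteq> 0\<close> by (simp add: cinner_simps field_simps)
    qed
    thus ?thesis using e by blast
  qed
qed

text \<open>A relational form of the adjoint: the definite description in
  \<open>operator_algebra\<close> is resolved by exhibiting one S with this property, as all later
  computations of adjoints do.\<close>

definition is_adjoint where
  "is_adjoint T S \<longleftrightarrow> S \<in> B \<and> (\<forall>x\<in>H. \<forall>y\<in>H. T x \<cdot> y = x \<cdot> S y)"

lemma adjoint_unique: "is_adjoint T S \<Longrightarrow> is_adjoint T S' \<Longrightarrow> S = S'"
  unfolding is_adjoint_def by (elim conjE, rule op_ext, assumption+, rule cinner_H_eqI) (auto simp: opD(1))

lemma adj_eqI: assumes "is_adjoint T S" shows "adj R T = S"
proof -
  have "adj R T = (THE S. is_adjoint T S)"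
    by (simp add: operator_algebra_def is_adjoint_def)
  also have "\<dots> = S"
    using assms adjoint_unique by blast
  finally show ?thesis .
qed

lemma adjoint_exists:
  assumes "T \<in> B"
  shows "\<exists>S. is_adjoint T S"
proof -
  obtain M where M: "M > 0" "\<And>x. x \<in> H \<Longrightarrow> norm (T x) \<le> M * norm x"
    using op_bound[OF assms] by blast
  have "\<exists>s\<in>H. \<forall>x\<in>H. T x \<cdot> y = x \<cdot> s" if "y \<in> H" for y
  proof (rule Riesz_representation[where M = "M * norm y"])
    fix x assume "x \<in> H"
    hence "norm (T x \<cdot> y) \<le> M * norm x * norm y"
      using cinner_Cauchy_Schwarz M(2) by (meson mult_right_mono norm_ge_zero order_trans)
    thus "norm (T x \<cdot> y) \<le> M * norm y * norm x" by (simp add: mult_ac)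
  qed (auto simp: opD(3,4)[OF assms] cinner_simps)
  then obtain s where s: "\<And>y. y \<in> H \<Longrightarrow> s y \<in> H" "\<And>x y. x \<in> H \<Longrightarrow> y \<in> H \<Longrightarrow> T x \<cdot> y = x \<cdot> s y"
    by metis
  have "(\<lambda>y\<in>H. s y) \<in> B"
  proof (rule bounded_operatorsI[where M = M])
    fix x y assume xy: "x \<in> H" "y \<in> H"
    hence "s (x + y) = s x + s y"
      by (intro cinner_H_eqI) (auto simp: s cinner_simps simp flip: s(2))
    thus "(\<lambda>y\<in>H. s y) (x + y) = (\<lambda>y\<in>H. s y) x + (\<lambda>y\<in>H. s y) y" using xy by simp
  next
    fix c x assume x: "x \<in> H"
    hence "s (c *\<^sub>C x) = c *\<^sub>C s x"
      by (intro cinner_H_eqI) (auto simp: s cinner_simps simp flip: s(2))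
    thus "(\<lambda>y\<in>H. s y) (c *\<^sub>C x) = c *\<^sub>C (\<lambda>y\<in>H. s y) x" using x by simp
  next
    fix x assume x: "x \<in> H"
    \<comment> \<open>The adjoint relation tested at the vector s x bounds the adjoint by the same
      constant M as T.\<close>
    have "(norm (s x))\<^sup>2 = Re (T (s x) \<cdot> x)"
      using x s by (simp add: cinner_self_Re)
    also have "\<dots> \<le> norm (T (s x)) * norm x"
      using complex_Re_le_cmod cinner_Cauchy_Schwarz order_trans by blast
    also have "\<dots> \<le> M * norm (s x) * norm x"
      using M(2)[OF s(1)[OF x]] by (intro mult_right_mono) auto
    finally have "norm (s x) * norm (s x) \<le> norm (s x) * (M * norm x)"
      by (simp add: power2_eq_square mult_ac)
    hence "norm (s x) \<le> M * norm x"
      using M(1) by (cases "norm (s x) = 0") auto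
    thus "norm ((\<lambda>y\<in>H. s y) x) \<le> M * norm x" using x by simp
  qed (use s in auto)
  thus ?thesis
    by (intro exI[of _ "\<lambda>y\<in>H. s y"]) (auto simp: is_adjoint_def s)
qed

lemma adj_props:
  assumes "T \<in> B"
  shows "adj R T \<in> B" "x \<in> H \<Longrightarrow> y \<in> H \<Longrightarrow> T x \<cdot> y = x \<cdot> adj R T y"
proof -
  obtain S where S: "is_adjoint T S" using adjoint_exists[OF assms] by blast
  show "adj R T \<in> B" "x \<in> H \<Longrightarrow> y \<in> H \<Longrightarrow> T x \<cdot> y = x \<cdot> adj R T y"
    using S unfolding adj_eqI[OF S] by (auto simp: is_adjoint_def)
qed

lemma adj_cinner_left:
  assumes "T \<in> B" "x \<in> H" "y \<in> H"
  shows "adj R T x \<cdot> y = x \<cdot> T y"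
proof -
  have "adj R T x \<cdot> y = cnj (y \<cdot> adj R T x)"
    by (rule L2_cinner_cnj)
  also have "\<dots> = cnj (T y \<cdot> x)"
    using adj_props(2)[OF assms(1,3,2)] by simp
  also have "\<dots> = x \<cdot> T y"
    by (rule L2_cinner_cnj[symmetric])
  finally show ?thesis .
qed

section \<open>The operator algebra as a normed star ring\<close>

lemma carrier_R [simp]: "carrier R = B"
  by (simp add: operator_algebra_def)

lemma one_R [simp]: "x \<in> H \<Longrightarrow> \<one>\<^bsub>R\<^esub> x = x"
  and zero_R [simp]: "x \<in> H \<Longrightarrow> \<zero>\<^bsub>R\<^esub> x = 0"
  and mult_R [simp]: "x \<in> H \<Longrightarrow> (S \<otimes>\<^bsub>R\<^esub> T) x = S (T x)"
  and add_R [simp]: "x \<in> H \<Longrightarrow> (S \<oplus>\<^bsub>R\<^esub> T) x = S x + T x"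
  and smult_R [simp]: "x \<in> H \<Longrightarrow> (c \<odot>\<^bsub>R\<^esub> T) x = c *\<^sub>C T x"
  by (simp_all add: operator_algebra_def compose_def)

lemma one_B [simp, intro]: "\<one>\<^bsub>R\<^esub> \<in> B"
  by (rule bounded_operatorsI[where M = 1]) (auto simp: operator_algebra_def)

lemma zero_B [simp, intro]: "\<zero>\<^bsub>R\<^esub> \<in> B"
  by (rule bounded_operatorsI[where M = 0]) (auto simp: operator_algebra_def)

lemma smult_B [simp, intro]: assumes "T \<in> B" shows "c \<odot>\<^bsub>R\<^esub> T \<in> B"
proof -
  obtain M where M: "M > 0" "\<And>x. x \<in> H \<Longrightarrow> norm (T x) \<le> M * norm x"
    using op_bound[OF assms] by blast
  show ?thesis
  proof (rule bounded_operatorsI[where M = "norm c * M"])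
    fix x assume "x \<in> H"
    thus "norm ((c \<odot>\<^bsub>R\<^esub> T) x) \<le> norm c * M * norm x"
      using M(2)[of x] by (simp add: mult.assoc mult_left_mono)
  qed (auto simp: opD[OF assms] scaleC_add_right mult.commute, simp add: operator_algebra_def)
qed

lemma add_B [simp, intro]: assumes "S \<in> B" "T \<in> B" shows "S \<oplus>\<^bsub>R\<^esub> T \<in> B"
proof -
  obtain M where M: "M > 0" "\<And>x. x \<in> H \<Longrightarrow> norm (T x) \<le> M * norm x"
    using op_bound[OF assms(2)] by blast
  obtain N where N: "N > 0" "\<And>x. x \<in> H \<Longrightarrow> norm (S x) \<le> N * norm x"
    using op_bound[OF assms(1)] by blast
  show ?thesis
  proof (rule bounded_operatorsI[where M = "N + M"])
    fix x assume "x \<in> H"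
    thus "norm ((S \<oplus>\<^bsub>R\<^esub> T) x) \<le> (N + M) * norm x"
      using M(2)[of x] N(2)[of x] norm_triangle_ineq[of "S x" "T x"] by (simp add: distrib_right)
  qed (auto simp: opD[OF assms(1)] opD[OF assms(2)] scaleC_add_right, simp add: operator_algebra_def)
qed

lemma mult_B [simp, intro]: assumes "S \<in> B" "T \<in> B" shows "S \<otimes>\<^bsub>R\<^esub> T \<in> B"
proof -
  obtain M where M: "M > 0" "\<And>x. x \<in> H \<Longrightarrow> norm (T x) \<le> M * norm x"
    using op_bound[OF assms(2)] by blast
  obtain N where N: "N > 0" "\<And>x. x \<in> H \<Longrightarrow> norm (S x) \<le> N * norm x"
    using op_bound[OF assms(1)] by blast
  show ?thesis
  proof (rule bounded_operatorsI[where M = "N * M"])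
    fix x assume "x \<in> H"
    thus "norm ((S \<otimes>\<^bsub>R\<^esub> T) x) \<le> N * M * norm x"
      using M(2)[of x] N(2)[of "T x"] N(1) opD(1)[OF assms(2), of x]
      by (simp add: mult.assoc) (meson mult_left_mono less_imp_le order_trans)
  qed (auto simp: opD[OF assms(1)] opD[OF assms(2)], simp add: operator_algebra_def compose_def)
qed

lemma ring_R: "ring R"
proof (rule ringI)
  show "abelian_group R"
  proof (rule abelian_groupI)
    fix T assume "T \<in> carrier R"
    thus "\<exists>S\<in>carrier R. S \<oplus>\<^bsub>R\<^esub> T = \<zero>\<^bsub>R\<^esub>"
      by (intro bexI[of _ "(-1) \<odot>\<^bsub>R\<^esub> T"] op_ext) (auto simp: scaleC_minus_one)
  qed (auto intro!: op_ext simp: add_ac)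
  show "Group.monoid R"
    by (rule monoidI) (auto intro!: op_ext simp: opD)
qed (auto intro!: op_ext simp: opD)

sublocale R: ring R by (rule ring_R)

lemma uminus_R: assumes "T \<in> B" shows "\<ominus>\<^bsub>R\<^esub> T = (-1) \<odot>\<^bsub>R\<^esub> T"
  by (rule R.minus_equality) (use assms in \<open>auto intro!: op_ext simp: scaleC_minus_one\<close>)

lemma minus_R [simp]: "T \<in> B \<Longrightarrow> x \<in> H \<Longrightarrow> (S \<ominus>\<^bsub>R\<^esub> T) x = S x - T x"
  by (simp add: a_minus_def uminus_R scaleC_minus_one)

lemma minus_B [simp, intro]: "S \<in> B \<Longrightarrow> T \<in> B \<Longrightarrow> S \<ominus>\<^bsub>R\<^esub> T \<in> B"
  using R.minus_closed by simp

lemma adj_B [simp, intro]: "T \<in> B \<Longrightarrow> adj R T \<in> B"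
  by (rule adj_props)

lemma adj_adj: "T \<in> B \<Longrightarrow> adj R (adj R T) = T"
  by (rule adj_eqI) (auto simp: is_adjoint_def adj_cinner_left)

lemma adj_add: "S \<in> B \<Longrightarrow> T \<in> B \<Longrightarrow> adj R (S \<oplus>\<^bsub>R\<^esub> T) = adj R S \<oplus>\<^bsub>R\<^esub> adj R T"
  by (rule adj_eqI) (auto simp: is_adjoint_def adj_props(2) cinner_simps)

lemma adj_smult: "T \<in> B \<Longrightarrow> adj R (c \<odot>\<^bsub>R\<^esub> T) = cnj c \<odot>\<^bsub>R\<^esub> adj R T"
  by (rule adj_eqI) (auto simp: is_adjoint_def adj_props(2) cinner_simps)

lemma adj_mult: "S \<in> B \<Longrightarrow> T \<in> B \<Longrightarrow> adj R (S \<otimes>\<^bsub>R\<^esub> T) = adj R T \<otimes>\<^bsub>R\<^esub> adj R S"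
  by (rule adj_eqI) (auto simp: is_adjoint_def adj_props(2) opD)

lemma nrm_set:
  assumes "T \<in> B"
  shows "bdd_above {norm (T x) |x. x \<in> H \<and> norm x \<le> 1}" "{norm (T x) |x. x \<in> H \<and> norm x \<le> 1} \<noteq> {}"
proof -
  obtain M where M: "M > 0" "\<And>x. x \<in> H \<Longrightarrow> norm (T x) \<le> M * norm x"
    using op_bound[OF assms] by blast
  have "norm (T x) \<le> M" if "x \<in> H" "norm x \<le> 1" for x
    using M(2)[OF that(1)] mult_left_le[OF that(2), of M] M(1) by linarith
  thus "bdd_above {norm (T x) |x. x \<in> H \<and> norm x \<le> 1}"
    by (intro bdd_aboveI[where M = M]) auto
  show "{norm (T x) |x. x \<in> H \<and> norm x \<le> 1} \<noteq> {}"
    using zero_H by (force intro: exI[of _ 0])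
qed

lemma nrm_R: "nrm R T = Sup {norm (T x) |x. x \<in> H \<and> norm x \<le> 1}"
  by (simp add: operator_algebra_def)

lemma nrm_nonneg: assumes "T \<in> B" shows "0 \<le> nrm R T"
proof -
  have "norm (T 0) \<le> nrm R T"
    unfolding nrm_R by (rule cSup_upper[OF _ nrm_set(1)[OF assms]]) (auto intro!: exI[of _ 0])
  thus ?thesis by (meson norm_ge_zero order_trans)
qed

lemma norm_op_le: assumes "T \<in> B" "x \<in> H" shows "norm (T x) \<le> nrm R T * norm x"
proof (cases "x = 0")
  case False
  define y where "y = of_real (inverse (norm x)) *\<^sub>C x"
  have y: "y \<in> H" "norm y \<le> 1" using assms False by (auto simp: y_def norm_inverse)
  have "norm (T y) \<le> nrm R T"
    unfolding nrm_R by (rule cSup_upper[OF _ nrm_set(1)[OF assms(1)]]) (use y in auto)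
  moreover have "norm (T y) = inverse (norm x) * norm (T x)"
    unfolding y_def by (simp add: opD(4)[OF assms] del: of_real_inverse)
  ultimately show ?thesis using False by (simp add: field_simps)
qed (simp add: op_zero[OF assms(1)])

lemma nrm_le:
  assumes "\<And>x. x \<in> H \<Longrightarrow> norm (T x) \<le> M * norm x" "0 \<le> M"
  shows "nrm R T \<le> M"
  unfolding nrm_R
proof (rule cSup_least)
  show "{norm (T x) |x. x \<in> H \<and> norm x \<le> 1} \<noteq> {}"
    using zero_H by (force intro: exI[of _ 0])
  fix v assume "v \<in> {norm (T x) |x. x \<in> H \<and> norm x \<le> 1}"
  then obtain x where x: "v = norm (T x)" "x \<in> H" "norm x \<le> 1" by auto
  show "v \<le> M"
    using assms(1)[OF x(2)] mult_left_le[OF x(3) assms(2)] x(1) by linarith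
qed

text \<open>Replaces the norm of \<open>operator_algebra\<close>, a supremum over the unit ball, by
  pointwise estimates with \<open>norm x\<close> on the right; all norm approximations below are
  made in this form.\<close>

lemma nrm_minus_tendsto_0_iff:
  assumes "\<And>n. F n \<in> B" "T \<in> B"
  shows "(\<lambda>n. nrm R (F n \<ominus>\<^bsub>R\<^esub> T)) \<longlonglongrightarrow> 0 \<longleftrightarrow>
     (\<forall>e>0. \<exists>N. \<forall>n\<ge>N. \<forall>x\<in>H. norm (F n x - T x) \<le> e * norm x)"
proof
  assume L: "(\<lambda>n. nrm R (F n \<ominus>\<^bsub>R\<^esub> T)) \<longlonglongrightarrow> 0"
  show "\<forall>e>0. \<exists>N. \<forall>n\<ge>N. \<forall>x\<in>H. norm (F n x - T x) \<le> e * norm x"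
  proof (intro allI impI)
    fix e :: real assume "e > 0"
    then obtain N where "\<forall>n\<ge>N. norm (nrm R (F n \<ominus>\<^bsub>R\<^esub> T) - 0) < e"
      using LIMSEQ_D[OF L, of e] by blast
    hence N: "nrm R (F n \<ominus>\<^bsub>R\<^esub> T) < e" if "n \<ge> N" for n
      using that by (force simp: abs_less_iff)
    have "norm (F n x - T x) \<le> e * norm x" if "n \<ge> N" "x \<in> H" for n x
    proof -
      have "norm (F n x - T x) \<le> nrm R (F n \<ominus>\<^bsub>R\<^esub> T) * norm x"
        using norm_op_le[of "F n \<ominus>\<^bsub>R\<^esub> T" x] assms that by simp
      also have "\<dots> \<le> e * norm x"
        using N[OF that(1)] by (intro mult_right_mono) auto
      finally show ?thesis .
    qed
    thus "\<exists>N. \<forall>n\<ge>N. \<forall>x\<in>H. norm (F n x - T x) \<le> e * norm x" by blast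
  qed
next
  assume *: "\<forall>e>0. \<exists>N. \<forall>n\<ge>N. \<forall>x\<in>H. norm (F n x - T x) \<le> e * norm x"
  show "(\<lambda>n. nrm R (F n \<ominus>\<^bsub>R\<^esub> T)) \<longlonglongrightarrow> 0"
  proof (rule LIMSEQ_I)
    fix e :: real assume e: "e > 0"
    then obtain N where N: "\<And>n x. n \<ge> N \<Longrightarrow> x \<in> H \<Longrightarrow> norm (F n x - T x) \<le> e/2 * norm x"
      using *[rule_format, of "e/2"] by auto
    have "nrm R (F n \<ominus>\<^bsub>R\<^esub> T) \<le> e/2" if "n \<ge> N" for n
      by (rule nrm_le) (use N[OF that] assms e in auto)
    thus "\<exists>no. \<forall>n\<ge>no. norm (nrm R (F n \<ominus>\<^bsub>R\<^esub> T) - 0) < e"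
      using nrm_nonneg assms e by (intro exI[of _ N]) (force simp: abs_of_nonneg)
  qed
qed

lemma norm_closedI:
  assumes "S \<subseteq> B"
    and "\<And>T. T \<in> B \<Longrightarrow> (\<And>e. e > 0 \<Longrightarrow> \<exists>F\<in>S. \<forall>x\<in>H. norm (T x - F x) \<le> e * norm x) \<Longrightarrow> T \<in> S"
  shows "norm_closed R S"
  unfolding norm_closed_def
proof (intro allI ballI impI)
  fix F T assume T: "T \<in> carrier R" and F: "(\<forall>n. F n \<in> S) \<and> (\<lambda>n. nrm R (F n \<ominus>\<^bsub>R\<^esub> T)) \<longlonglongrightarrow> 0"
  hence "\<forall>e>0. \<exists>N. \<forall>n\<ge>N. \<forall>x\<in>H. norm (F n x - T x) \<le> e * norm x"
    using assms(1) by (subst nrm_minus_tendsto_0_iff[symmetric]) auto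
  hence "\<exists>F\<in>S. \<forall>x\<in>H. norm (T x - F x) \<le> e * norm x" if "e > 0" for e
    using that F by (metis norm_minus_commute order_refl)
  thus "T \<in> S" using assms(2)[of T] T by auto
qed

lemma norm_closedD:
  assumes "norm_closed R S" "S \<subseteq> B" "T \<in> B"
    and "\<And>e. e > 0 \<Longrightarrow> \<exists>F\<in>S. \<forall>x\<in>H. norm (T x - F x) \<le> e * norm x"
  shows "T \<in> S"
proof -
  have "\<exists>F. F \<in> S \<and> (\<forall>x\<in>H. norm (T x - F x) \<le> (1 / real (Suc n)) * norm x)" for n
    using assms(4)[of "1 / real (Suc n)"] by auto
  then obtain F where F: "\<And>n. F n \<in> S" "\<And>n x. x \<in> H \<Longrightarrow> norm (T x - F n x) \<le> (1 / real (Suc n)) * norm x"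
    by metis
  have "(\<lambda>n. nrm R (F n \<ominus>\<^bsub>R\<^esub> T)) \<longlonglongrightarrow> 0"
  proof (subst nrm_minus_tendsto_0_iff)
    show "\<forall>e>0. \<exists>N. \<forall>n\<ge>N. \<forall>x\<in>H. norm (F n x - T x) \<le> e * norm x"
    proof (intro allI impI)
      fix e :: real assume "e > 0"
      then obtain N where N: "1 / real (Suc N) < e" using nat_approx_posE by blast
      have "norm (F n x - T x) \<le> e * norm x" if "n \<ge> N" "x \<in> H" for n x
      proof -
        have "1 / real (Suc n) \<le> 1 / real (Suc N)" using that by (auto intro!: divide_left_mono)
        hence "1 / real (Suc n) \<le> e" using N by simp
        hence "(1 / real (Suc n)) * norm x \<le> e * norm x" by (rule mult_right_mono) simp
        thus ?thesis using F(2)[OF that(2), of n] by (simp only: norm_minus_commute[of "F n x"])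
      qed
      thus "\<exists>N. \<forall>n\<ge>N. \<forall>x\<in>H. norm (F n x - T x) \<le> e * norm x" by blast
    qed
  qed (use F assms in auto)
  thus ?thesis using assms(1,3) F(1) unfolding norm_closed_def by auto
qed

end

section \<open>Compact operators\<close>

definition orthonormal :: "circle_L2 set \<Rightarrow> bool" where
  "orthonormal E \<longleftrightarrow> (\<forall>e\<in>E. norm e = 1) \<and> (\<forall>e\<in>E. \<forall>f\<in>E. e \<noteq> f \<longrightarrow> e \<cdot> f = 0)"

lemma orthonormal_cinner_sum:
  assumes "orthonormal E" "finite E" "f \<in> E"
  shows "(\<Sum>e\<in>E. c e *\<^sub>C e) \<cdot> f = c f"
proof -
  have "(\<Sum>e\<in>E. c e *\<^sub>C e) \<cdot> f = (\<Sum>e\<in>E. if e = f then c f else 0)"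
    unfolding cinner_sum_left
    using assms by (intro sum.cong) (auto simp: orthonormal_def cinner_simps cinner_self)
  thus ?thesis using assms by simp
qed

lemma orthonormal_residual:
  assumes "orthonormal E" "finite E" "f \<in> E"
  shows "(x - (\<Sum>e\<in>E. (x \<cdot> e) *\<^sub>C e)) \<cdot> f = 0"
  by (simp add: cinner_diff_left orthonormal_cinner_sum[OF assms])

lemma orthonormal_norm_sum:
  assumes "orthonormal E" "finite E"
  shows "(norm (\<Sum>e\<in>E. c e *\<^sub>C e))\<^sup>2 = (\<Sum>e\<in>E. (norm (c e))\<^sup>2)"
proof -
  have "complex_of_real ((norm (\<Sum>e\<in>E. c e *\<^sub>C e))\<^sup>2) = (\<Sum>e\<in>E. c e *\<^sub>C e) \<cdot> (\<Sum>f\<in>E. c f *\<^sub>C f)"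
    by (rule cinner_self[symmetric])
  also have "\<dots> = (\<Sum>f\<in>E. cnj (c f) * c f)"
    unfolding cinner_sum_right cinner_scaleC_right
    by (intro sum.cong refl) (simp add: orthonormal_cinner_sum[OF assms])
  also have "\<dots> = complex_of_real (\<Sum>e\<in>E. (norm (c e))\<^sup>2)"
    unfolding of_real_sum complex_norm_square by (simp add: mult.commute)
  finally show ?thesis using of_real_eq_iff by blast
qed

lemma orthonormal_split:
  assumes "orthonormal E" "finite E"
  shows "(norm x)\<^sup>2 = (\<Sum>e\<in>E. (norm (x \<cdot> e))\<^sup>2) + (norm (x - (\<Sum>e\<in>E. (x \<cdot> e) *\<^sub>C e)))\<^sup>2"
proof -
  have "(\<Sum>e\<in>E. (x \<cdot> e) *\<^sub>C e) \<cdot> (x - (\<Sum>e\<in>E. (x \<cdot> e) *\<^sub>C e)) = 0"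
    unfolding cinner_sum_left L2_cinner_scaleC_left
    using orthonormal_residual[OF assms] cinner_swap_eq_zero by (intro sum.neutral) auto
  from pythagoras[OF this] show ?thesis
    by (simp add: orthonormal_norm_sum[OF assms])
qed

lemma Bessel_inequality:
  assumes "orthonormal E" "finite E"
  shows "(\<Sum>e\<in>E. (norm (x \<cdot> e))\<^sup>2) \<le> (norm x)\<^sup>2"
  using orthonormal_split[OF assms, of x] by simp

lemma norm_residual_le:
  assumes "orthonormal E" "finite E"
  shows "norm (x - (\<Sum>e\<in>E. (x \<cdot> e) *\<^sub>C e)) \<le> norm x"
  by (rule power2_le_imp_le) (use orthonormal_split[OF assms, of x] in \<open>simp_all add: sum_nonneg\<close>)

section \<open>Compact maps through total boundedness and finite rank\<close>

context hilbert_subspace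
begin

text \<open>Orthogonality to E implies orthogonality to A; this consequence takes the place of a
  statement on linear spans. When the new vector a equals its own projection s, the old E already
  serves.\<close>

lemma Gram_Schmidt:
  assumes "finite A" "A \<subseteq> H"
  shows "\<exists>E. finite E \<and> E \<subseteq> H \<and> orthonormal E \<and> (\<forall>x. (\<forall>e\<in>E. x \<cdot> e = 0) \<longrightarrow> (\<forall>a\<in>A. x \<cdot> a = 0))"
  using assms
proof (induction A rule: finite_induct)
  case empty
  thus ?case by (intro exI[of _ "{}"]) (auto simp: orthonormal_def)
next
  case (insert a A)
  then obtain E where E: "finite E" "E \<subseteq> H" "orthonormal E"
    "\<And>x. (\<forall>e\<in>E. x \<cdot> e = 0) \<Longrightarrow> (\<forall>a\<in>A. x \<cdot> a = 0)" by auto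
  define s where "s = (\<Sum>e\<in>E. (a \<cdot> e) *\<^sub>C e)"
  have xs: "x \<cdot> s = 0" if "\<forall>e\<in>E. x \<cdot> e = 0" for x
    using that by (auto simp: s_def cinner_sum_right cinner_scaleC_right)
  show ?case
  proof (cases "a - s = 0")
    case True
    hence "a = s" by simp
    thus ?thesis using E xs by (intro exI[of _ E]) auto
  next
    case False
    define b where "b = of_real (inverse (norm (a - s))) *\<^sub>C (a - s)"
    have res: "(a - s) \<cdot> e = 0" if "e \<in> E" for e
      unfolding s_def using orthonormal_residual[OF E(3,1) that] .
    have be: "b \<cdot> e = 0" if "e \<in> E" for e
      using res[OF that] by (simp add: b_def L2_cinner_scaleC_left)
    hence eb: "e \<cdot> b = 0" if "e \<in> E" for e
      using cinner_swap_eq_zero that by blast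
    have nb: "norm b = 1" using False by (simp add: b_def norm_inverse)
    have "s \<in> H" unfolding s_def using E(2) by (intro sum_H scaleC_H) auto
    hence bH: "b \<in> H" unfolding b_def using insert.prems by (intro scaleC_H diff_H) auto
    have a: "a = of_real (norm (a - s)) *\<^sub>C b + s"
      using False by (simp add: b_def)
    show ?thesis
    proof (intro exI[of _ "insert b E"] conjI allI impI)
      show "orthonormal (insert b E)"
        using E(3) nb be eb by (auto simp: orthonormal_def)
      fix x assume x: "\<forall>e\<in>insert b E. x \<cdot> e = 0"
      hence "x \<cdot> a = 0" by (subst a) (simp add: cinner_simps xs)
      thus "\<forall>a\<in>insert a A. x \<cdot> a = 0" using E(4) x by auto
    qed (use E bH in auto)
  qed
qed

text \<open>Stated for arbitrary maps on \<open>H\<close>, because multiplication and Hankel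
  operators take values outside \<open>H\<close> and thus are not elements of
  \<open>bounded_operators H\<close>.\<close>

definition cpt :: "(circle_L2 \<Rightarrow> circle_L2) \<Rightarrow> bool" where
  "cpt T \<longleftrightarrow> compact (closure (T ` (H \<inter> cball 0 1)))"

lemma compact_operators_iff: "T \<in> compact_operators H \<longleftrightarrow> T \<in> B \<and> cpt T"
  by (simp add: compact_operators_def cpt_def)

text \<open>Closed balls of radius e/2 survive the passage to the closure of the image and are
  contained in the open balls of radius e that total boundedness asks for.\<close>

lemma cpt_totally_boundedI:
  assumes "\<And>e. e > 0 \<Longrightarrow> \<exists>k. finite k \<and> (\<forall>x\<in>H. norm x \<le> 1 \<longrightarrow> (\<exists>y\<in>k. norm (T x - y) \<le> e))"
  shows "cpt T"
  unfolding cpt_def compact_eq_totally_bounded complete_eq_closed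
proof (intro conjI allI impI)
  fix e :: real assume e: "e > 0"
  obtain k where k: "finite k" "\<And>x. x \<in> H \<Longrightarrow> norm x \<le> 1 \<Longrightarrow> \<exists>y\<in>k. norm (T x - y) \<le> e/2"
    using assms[of "e/2"] e by auto
  have "closed (\<Union>y\<in>k. cball y (e/2))"
    using k by (intro closed_UN) auto
  moreover have "T ` (H \<inter> cball 0 1) \<subseteq> (\<Union>y\<in>k. cball y (e/2))"
    using k(2) by (force simp: dist_norm norm_minus_commute)
  ultimately have "closure (T ` (H \<inter> cball 0 1)) \<subseteq> (\<Union>y\<in>k. cball y (e/2))"
    by (intro closure_minimal)
  also have "\<dots> \<subseteq> (\<Union>y\<in>k. ball y e)" using e by auto
  finally show "\<exists>k. finite k \<and> closure (T ` (H \<inter> cball 0 1)) \<subseteq> (\<Union>x\<in>k. ball x e)"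
    using k(1) by blast
qed auto

lemma cptD_subset:
  assumes "x \<in> H" "norm x \<le> 1" shows "T x \<in> closure (T ` (H \<inter> cball 0 1))"
proof -
  have "T x \<in> T ` (H \<inter> cball 0 1)" using assms by simp
  thus ?thesis by (rule subsetD[OF closure_subset])
qed

lemma cpt_totally_boundedD:
  assumes "cpt T" "e > 0"
  shows "\<exists>k. finite k \<and> k \<subseteq> H \<inter> cball 0 1 \<and> (\<forall>x\<in>H. norm x \<le> 1 \<longrightarrow> (\<exists>y\<in>k. norm (T x - T y) < e))"
proof -
  obtain k where k: "finite k" "closure (T ` (H \<inter> cball 0 1)) \<subseteq> (\<Union>x\<in>k. ball x (e/2))"
    using assms unfolding cpt_def compact_eq_totally_bounded by (metis half_gt_zero)
  define Q where "Q y x \<longleftrightarrow> x \<in> H \<inter> cball 0 1 \<and> norm (y - T x) < e/2" for y x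
  \<comment> \<open>A centre y that is within e/2 of some image point is traded for such a point of
    the unit ball of \<open>H\<close>; the triangle inequality then doubles the radius.\<close>
  define k' where "k' = (\<lambda>y. SOME x. Q y x) ` {y\<in>k. \<exists>x. Q y x}"
  have Q: "Q y (SOME x. Q y x)" if "\<exists>x. Q y x" for y
    using someI_ex[OF that] .
  show ?thesis
  proof (intro exI[of _ k'] conjI ballI impI)
    show "finite k'" using k by (simp add: k'_def)
    have QD: "x \<in> H \<inter> cball 0 1" if "Q y x" for x y using that by (simp add: Q_def)
    show "k' \<subseteq> H \<inter> cball 0 1" unfolding k'_def using QD[OF Q] by blast
    fix x assume x: "x \<in> H" "norm x \<le> 1"
    hence "T x \<in> closure (T ` (H \<inter> cball 0 1))"
      by (rule cptD_subset)
    then obtain y where y: "y \<in> k" "norm (y - T x) < e/2"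
      using k(2) by (auto simp: dist_norm)
    have ex: "\<exists>x. Q y x" using x y by (auto simp: Q_def)
    have "norm (T x - T (SOME x. Q y x)) \<le> norm (y - T x) + norm (y - T (SOME x. Q y x))"
      using norm_triangle_ineq4[of "y - T (SOME x. Q y x)" "y - T x"] by simp
    also have "\<dots> < e" using y Q[OF ex] unfolding Q_def by linarith
    finally show "\<exists>y\<in>k'. norm (T x - T y) < e"
      using y ex by (auto simp: k'_def)
  qed
qed

lemma cpt_subset:
  assumes "T ` (H \<inter> cball 0 1) \<subseteq> C" "compact C"
  shows "cpt T"
proof -
  have "closure (T ` (H \<inter> cball 0 1)) \<subseteq> C"
    using assms by (intro closure_minimal compact_imp_closed)
  thus ?thesis
    unfolding cpt_def using assms(2) by (metis closed_Int_compact closed_closure inf.absorb1)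
qed

lemma cpt_cong:
  assumes "\<And>x. x \<in> H \<Longrightarrow> S x = T x" "cpt S"
  shows "cpt T"
proof -
  have "T ` (H \<inter> cball 0 1) = S ` (H \<inter> cball 0 1)" using assms(1) by auto
  thus ?thesis using assms(2) by (simp add: cpt_def)
qed

lemma cpt_add:
  assumes "cpt S" "cpt T" shows "cpt (\<lambda>x. S x + T x)"
proof (rule cpt_subset)
  show "(\<lambda>x. S x + T x) ` (H \<inter> cball 0 1) \<subseteq> {x + y |x y. x \<in> closure (S ` (H \<inter> cball 0 1)) \<and> y \<in> closure (T ` (H \<inter> cball 0 1))}"
    using cptD_subset[of _ S] cptD_subset[of _ T] by fastforce
  show "compact {x + y |x y. x \<in> closure (S ` (H \<inter> cball 0 1)) \<and> y \<in> closure (T ` (H \<inter> cball 0 1))}"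
    using assms by (intro compact_sums) (auto simp: cpt_def)
qed

lemma cpt_comp_left:
  assumes "cpt T" "continuous_on (closure (T ` (H \<inter> cball 0 1))) A"
  shows "cpt (\<lambda>x. A (T x))"
proof (rule cpt_subset)
  show "compact (A ` closure (T ` (H \<inter> cball 0 1)))"
    using assms by (intro compact_continuous_image) (auto simp: cpt_def)
  show "(\<lambda>x. A (T x)) ` (H \<inter> cball 0 1) \<subseteq> A ` closure (T ` (H \<inter> cball 0 1))"
    using cptD_subset[of _ T] by auto
qed

lemma cpt_comp_bounded_linear:
  assumes "cpt T" "bounded_linear A" shows "cpt (\<lambda>x. A (T x))"
  by (rule cpt_comp_left[OF assms(1) linear_continuous_on[OF assms(2)]])

lemma cpt_scaleC: "cpt T \<Longrightarrow> cpt (\<lambda>x. c *\<^sub>C T x)"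
  by (erule cpt_comp_bounded_linear) (rule bounded_linear_scaleC)

lemma cpt_diff:
  assumes "cpt S" "cpt T" shows "cpt (\<lambda>x. S x - T x)"
  using cpt_add[OF assms(1) cpt_scaleC[OF assms(2), of "-1"]] by (simp add: scaleC_minus_one)

text \<open>A maps the unit ball of \<open>H\<close> into the ball of radius m = max M 1.
  Homogeneity of T moves the factor m outside, and a multiple of a compact set is compact.\<close>

lemma cpt_comp_right:
  assumes "cpt T" "\<And>x. x \<in> H \<Longrightarrow> A x \<in> H" "\<And>x. x \<in> H \<Longrightarrow> norm (A x) \<le> M * norm x"
    "\<And>c x. x \<in> H \<Longrightarrow> T (c *\<^sub>C x) = c *\<^sub>C T x"
  shows "cpt (\<lambda>x. T (A x))"
proof (rule cpt_subset)
  define m where "m = max M 1"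
  have m: "m > 0" "m \<ge> M" by (auto simp: m_def)
  show "compact ((\<lambda>y. of_real m *\<^sub>C y) ` closure (T ` (H \<inter> cball 0 1)))"
    using assms(1) by (intro compact_continuous_image linear_continuous_on bounded_linear_scaleC) (auto simp: cpt_def)
  show "(\<lambda>x. T (A x)) ` (H \<inter> cball 0 1) \<subseteq> (\<lambda>y. of_real m *\<^sub>C y) ` closure (T ` (H \<inter> cball 0 1))"
  proof safe
    fix x assume x: "x \<in> H" "x \<in> cball 0 1"
    define y where "y = of_real (inverse m) *\<^sub>C A x"
    have "norm (A x) \<le> m"
    proof -
      have "norm (A x) \<le> M * norm x" using assms(3) x by simp
      also have "\<dots> \<le> m * norm x" using m by (intro mult_right_mono) auto
      also have "\<dots> \<le> m" using x m by (simp add: mult_left_le)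
      finally show ?thesis .
    qed
    hence "norm y \<le> 1" using m by (simp add: y_def norm_divide field_simps)
    moreover have "y \<in> H" using x assms(2) by (simp add: y_def)
    moreover have "T (A x) = of_real m *\<^sub>C T y"
      using m x assms(2,4) by (simp add: y_def del: of_real_inverse flip: of_real_mult)
    ultimately show "T (A x) \<in> (\<lambda>y. of_real m *\<^sub>C y) ` closure (T ` (H \<inter> cball 0 1))"
      using cptD_subset by blast
  qed
qed

lemma cpt_rank_one: "cpt (\<lambda>x. (x \<cdot> f) *\<^sub>C g)"
proof (rule cpt_subset)
  have "bounded_linear (\<lambda>c. c *\<^sub>C g)"
  proof (rule bounded_linear_intro[where K = "norm g"])
    show "(c + d) *\<^sub>C g = c *\<^sub>C g + d *\<^sub>C g" for c d
      by (rule scaleC_add_left)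
    show "(r *\<^sub>R c) *\<^sub>C g = r *\<^sub>R (c *\<^sub>C g)" for r c
      unfolding L2_scaleR_scaleC scaleC_scaleC scaleR_conv_of_real ..
    show "norm (c *\<^sub>C g) \<le> norm c * norm g" for c
      by simp
  qed
  thus "compact ((\<lambda>c. c *\<^sub>C g) ` cball 0 (norm f))"
    by (intro compact_continuous_image linear_continuous_on) auto
  show "(\<lambda>x. (x \<cdot> f) *\<^sub>C g) ` (H \<inter> cball 0 1) \<subseteq> (\<lambda>c. c *\<^sub>C g) ` cball 0 (norm f)"
  proof (safe, rule imageI)
    fix x assume "x \<in> cball (0::circle_L2) 1"
    thus "x \<cdot> f \<in> cball 0 (norm f)"
      using cinner_Cauchy_Schwarz[of x f] mult_right_le_one_le[of "norm f" "norm x"] by (simp add: mult.commute)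
  qed
qed

lemma cpt_zero: "cpt (\<lambda>x. 0)"
  using cpt_rank_one[of 0 0] by simp

lemma cpt_finite_rank: "finite I \<Longrightarrow> cpt (\<lambda>x. \<Sum>i\<in>I. (x \<cdot> f i) *\<^sub>C g i)"
proof (induction I rule: finite_induct)
  case (insert i I)
  thus ?case using cpt_add[OF cpt_rank_one[of "f i" "g i"]] by simp
qed (simp add: cpt_zero)

lemma cpt_limit:
  assumes "\<And>e. e > 0 \<Longrightarrow> \<exists>S. cpt S \<and> (\<forall>x\<in>H. norm (T x - S x) \<le> e * norm x)"
  shows "cpt T"
proof (rule cpt_totally_boundedI)
  fix e :: real assume e: "e > 0"
  obtain S where S: "cpt S" "\<And>x. x\<in>H \<Longrightarrow> norm (T x - S x) \<le> e/2 * norm x"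
    using assms[of "e/2"] e by auto
  obtain k where k: "finite k" "\<And>x. x\<in>H \<Longrightarrow> norm x \<le> 1 \<Longrightarrow> \<exists>y\<in>k. norm (S x - S y) < e/2"
    using cpt_totally_boundedD[OF S(1), of "e/2"] e by auto
  show "\<exists>k. finite k \<and> (\<forall>x\<in>H. norm x \<le> 1 \<longrightarrow> (\<exists>y\<in>k. norm (T x - y) \<le> e))"
  proof (intro exI[of _ "S ` k"] conjI ballI impI)
    fix x assume x: "x \<in> H" "norm x \<le> 1"
    then obtain y where y: "y \<in> k" "norm (S x - S y) < e/2" using k by blast
    have "norm (T x - S x) \<le> e/2"
      using S(2)[OF x(1)] mult_left_le[OF x(2), of "e/2"] e by linarith
    hence "norm (T x - S y) \<le> e"
      using norm_triangle_ineq[of "T x - S x" "S x - S y"] y by simp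
    thus "\<exists>y\<in>S ` k. norm (T x - y) \<le> e" using y by blast
  qed (use k in auto)
qed

text \<open>The sum is T applied to the projection of x onto the span of E. The remaining part of x
  is orthogonal to E, where T is small, and is not longer than x.\<close>

lemma finite_rank_approximation:
  assumes E: "orthonormal E" "finite E" "E \<subseteq> H" "0 \<le> e"
    and small: "\<And>x. x \<in> H \<Longrightarrow> (\<And>f. f \<in> E \<Longrightarrow> x \<cdot> f = 0) \<Longrightarrow> norm (T x) \<le> e * norm x"
    and add: "\<And>x y. x \<in> H \<Longrightarrow> y \<in> H \<Longrightarrow> T (x + y) = T x + T y"
    and scale: "\<And>c x. x \<in> H \<Longrightarrow> T (c *\<^sub>C x) = c *\<^sub>C T x"
    and x: "x \<in> H"
  shows "norm (T x - (\<Sum>f\<in>E. (x \<cdot> f) *\<^sub>C T f)) \<le> e * norm x"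
proof -
  have T0: "T 0 = 0" using scale[OF zero_H, of 0] by simp
  have Tsum: "T (\<Sum>f\<in>F. (x \<cdot> f) *\<^sub>C f) = (\<Sum>f\<in>F. (x \<cdot> f) *\<^sub>C T f)" if "finite F" "F \<subseteq> H" for F
    using that
  proof (induction F rule: finite_induct)
    case (insert f F)
    thus ?case
      by (simp add: sum_H subset_iff add scale)
  qed (simp add: T0)
  define s where "s = (\<Sum>f\<in>E. (x \<cdot> f) *\<^sub>C f)"
  have s: "s \<in> H" unfolding s_def using E by auto
  have "T x = T (x - s) + T s" using add[of "x - s" s] x s by simp
  hence "norm (T x - (\<Sum>f\<in>E. (x \<cdot> f) *\<^sub>C T f)) = norm (T (x - s))"
    using Tsum[OF E(2,3)] by (simp add: s_def)
  also have "\<dots> \<le> e * norm (x - s)"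
    using x s orthonormal_residual[OF E(1,2)] by (intro small) (auto simp: s_def)
  also have "\<dots> \<le> e * norm x"
    using norm_residual_le[OF E(1,2), of x] E(4) by (intro mult_left_mono) (auto simp: s_def)
  finally show ?thesis .
qed

text \<open>A finite orthonormal set on which |T f| \<ge> e has at most C / e^2 elements. For such a
  set E of greatest cardinality, T is bounded by e on the complement of E: a normalized
  counterexample could be adjoined to E. Thus T is a limit of finite-rank maps.\<close>

lemma Hilbert_Schmidt_cpt:
  assumes add: "\<And>x y. x \<in> H \<Longrightarrow> y \<in> H \<Longrightarrow> T (x + y) = T x + T y"
    and scale: "\<And>c x. x \<in> H \<Longrightarrow> T (c *\<^sub>C x) = c *\<^sub>C T x"
    and HS: "\<And>E. finite E \<Longrightarrow> E \<subseteq> H \<Longrightarrow> orthonormal E \<Longrightarrow> (\<Sum>e\<in>E. (norm (T e))\<^sup>2) \<le> C"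
  shows "cpt T"
proof (rule cpt_limit)
  fix e :: real assume e: "e > 0"
  define \<E> where "\<E> = {E. finite E \<and> E \<subseteq> H \<and> orthonormal E \<and> (\<forall>f\<in>E. norm (T f) \<ge> e)}"
  have bd: "real (card E) \<le> C / e\<^sup>2" if "E \<in> \<E>" for E
  proof -
    have "real (card E) * e\<^sup>2 = (\<Sum>f\<in>E. e\<^sup>2)" by simp
    also have "\<dots> \<le> (\<Sum>f\<in>E. (norm (T f))\<^sup>2)"
      using that e by (intro sum_mono power_mono) (auto simp: \<E>_def)
    also have "\<dots> \<le> C" using that by (intro HS) (auto simp: \<E>_def)
    finally show ?thesis using e by (simp add: field_simps)
  qed
  have "card E \<le> nat \<lfloor>C / e\<^sup>2\<rfloor>" if "E \<in> \<E>" for E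
    using bd[OF that] by (simp add: le_nat_floor)
  moreover have "{} \<in> \<E>" by (auto simp: \<E>_def orthonormal_def)
  ultimately obtain E where E: "E \<in> \<E>" "\<And>F. F \<in> \<E> \<Longrightarrow> card F \<le> card E"
    using ex_has_greatest_nat[of "\<lambda>E. E \<in> \<E>" "{}" card "Suc (nat \<lfloor>C / e\<^sup>2\<rfloor>)"] by (auto simp: less_Suc_eq_le)
  have E': "orthonormal E" "finite E" "E \<subseteq> H" using E by (auto simp: \<E>_def)
  have "norm (T x - (\<Sum>f\<in>E. (x \<cdot> f) *\<^sub>C T f)) \<le> e * norm x" if x: "x \<in> H" for x
  proof (rule finite_rank_approximation[OF E'])
    fix x assume x: "x \<in> H" "\<And>f. f \<in> E \<Longrightarrow> x \<cdot> f = 0"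
    show "norm (T x) \<le> e * norm x"
    proof (rule ccontr)
      assume *: "\<not> norm (T x) \<le> e * norm x"
      have "x \<noteq> 0"
      proof
        assume "x = 0"
        thus False using * scale[OF zero_H, of 0] by simp
      qed
      define y where "y = of_real (inverse (norm x)) *\<^sub>C x"
      have ny: "norm y = 1" using \<open>x \<noteq> 0\<close> by (simp add: y_def norm_inverse)
      have "norm (T y) = inverse (norm x) * norm (T x)"
        unfolding y_def by (subst scale[OF x(1)]) (simp add: norm_inverse)
      hence "norm x * norm (T y) = norm (T x)" using \<open>x \<noteq> 0\<close> by (simp add: field_simps)
      hence "norm x * e < norm x * norm (T y)" using * by (simp add: mult.commute)
      hence nT: "norm (T y) \<ge> e" using \<open>x \<noteq> 0\<close> by simp
      have ort: "y \<cdot> f = 0" "f \<cdot> y = 0" if "f \<in> E" for f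
        using x(2)[OF that] cinner_swap_eq_zero[of f x] by (simp_all add: y_def cinner_simps)
      have "y \<notin> E"
      proof
        assume "y \<in> E"
        hence "y \<cdot> y = 0" by (rule ort)
        thus False using ny by (simp add: cinner_self)
      qed
      moreover have "insert y E \<in> \<E>"
        using E ny nT ort x by (auto simp: \<E>_def orthonormal_def y_def)
      ultimately show False using E(2)[of "insert y E"] E'(2) by simp
    qed
  qed (use e add scale x in auto)
  thus "\<exists>S. cpt S \<and> (\<forall>x\<in>H. norm (T x - S x) \<le> e * norm x)"
    using cpt_finite_rank[OF E'(2), of "\<lambda>f. f" T] by blast
qed

section \<open>The ideal of compact operators\<close>

abbreviation K where "K \<equiv> compact_operators H"

lemma K_B [simp, intro]: "T \<in> K \<Longrightarrow> T \<in> B"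
  by (simp add: compact_operators_iff)

lemma K_cpt: "T \<in> K \<Longrightarrow> cpt T"
  by (simp add: compact_operators_iff)

lemma K_I: "T \<in> B \<Longrightarrow> cpt S \<Longrightarrow> (\<And>x. x \<in> H \<Longrightarrow> T x = S x) \<Longrightarrow> T \<in> K"
  using cpt_cong[of S T] by (auto simp: compact_operators_iff)

lemma zero_K [simp, intro]: "\<zero>\<^bsub>R\<^esub> \<in> K"
  by (rule K_I[OF _ cpt_zero]) auto

lemma add_K [simp, intro]: "S \<in> K \<Longrightarrow> T \<in> K \<Longrightarrow> S \<oplus>\<^bsub>R\<^esub> T \<in> K"
  by (rule K_I[OF _ cpt_add[of S T]]) (auto simp: K_cpt)

lemma smult_K [simp, intro]: "T \<in> K \<Longrightarrow> c \<odot>\<^bsub>R\<^esub> T \<in> K"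
  by (rule K_I[OF _ cpt_scaleC[of T]]) (auto simp: K_cpt)

lemma minus_K [simp, intro]: "S \<in> K \<Longrightarrow> T \<in> K \<Longrightarrow> S \<ominus>\<^bsub>R\<^esub> T \<in> K"
  by (rule K_I[OF _ cpt_diff[of S T]]) (auto simp: K_cpt)

lemma mult_K_right [simp, intro]: assumes "S \<in> K" "T \<in> B" shows "S \<otimes>\<^bsub>R\<^esub> T \<in> K"
proof -
  obtain M where M: "M > 0" "\<And>x. x \<in> H \<Longrightarrow> norm (T x) \<le> M * norm x"
    using op_bound[OF assms(2)] by blast
  show ?thesis
    by (rule K_I[OF _ cpt_comp_right[of S T M]]) (use assms M in \<open>auto simp: K_cpt opD\<close>)
qed

lemma mult_K_left [simp, intro]: assumes "S \<in> B" "T \<in> K" shows "S \<otimes>\<^bsub>R\<^esub> T \<in> K"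
proof -
  have "closure (T ` (H \<inter> cball 0 1)) \<subseteq> H"
    using assms by (intro closure_minimal closed_H) (auto simp: opD)
  hence "continuous_on (closure (T ` (H \<inter> cball 0 1))) S"
    using op_continuous[OF assms(1)] continuous_on_subset by blast
  thus ?thesis
    by (intro K_I[OF _ cpt_comp_left[of T S]]) (use assms in \<open>auto simp: K_cpt\<close>)
qed

lemma K_limit:
  assumes "T \<in> B" "\<And>e. e > 0 \<Longrightarrow> \<exists>F\<in>K. \<forall>x\<in>H. norm (T x - F x) \<le> e * norm x"
  shows "T \<in> K"
proof (rule K_I[OF assms(1) cpt_limit])
  fix e :: real assume "e > 0"
  then obtain F where "F \<in> K" "\<forall>x\<in>H. norm (T x - F x) \<le> e * norm x" using assms(2) by blast
  thus "\<exists>S. cpt S \<and> (\<forall>x\<in>H. norm (T x - S x) \<le> e * norm x)" using K_cpt by blast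
qed simp

lemma uminus_K [simp, intro]: "T \<in> K \<Longrightarrow> \<ominus>\<^bsub>R\<^esub> T \<in> K"
  by (simp add: uminus_R)

lemma ideal_K: "ideal K R"
proof (rule idealI)
  show "subgroup K (add_monoid R)"
  proof (rule subgroup.intro)
    show "inv\<^bsub>add_monoid R\<^esub> x \<in> K" if "x \<in> K" for x
      using uminus_K[OF that] by (simp only: a_inv_def)
  qed auto
qed (auto intro: ring_R)

text \<open>Schauder's argument: with S the adjoint of T, |S d|^2 is the inner product of T S d with
  d, so a finite net for the image under T S is one for the image under S. Differences d of vectors
  in the unit ball have norm at most 2, whence the radius e^2 / 2.\<close>

lemma adj_K [simp, intro]: assumes "T \<in> K" shows "adj R T \<in> K"
proof (rule K_I[OF _ cpt_totally_boundedI[of "adj R T"]])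
  have TB: "T \<in> B" using assms by simp
  fix e :: real assume e: "e > 0"
  have "cpt (T \<otimes>\<^bsub>R\<^esub> adj R T)" using assms TB by (intro K_cpt) auto
  then obtain k where k: "finite k" "k \<subseteq> H \<inter> cball 0 1"
    "\<And>x. x \<in> H \<Longrightarrow> norm x \<le> 1 \<Longrightarrow> \<exists>y\<in>k. norm ((T \<otimes>\<^bsub>R\<^esub> adj R T) x - (T \<otimes>\<^bsub>R\<^esub> adj R T) y) < e\<^sup>2 / 2"
    using cpt_totally_boundedD[of "T \<otimes>\<^bsub>R\<^esub> adj R T" "e\<^sup>2 / 2"] e
    by (metis half_gt_zero zero_less_power)
  show "\<exists>k. finite k \<and> (\<forall>x\<in>H. norm x \<le> 1 \<longrightarrow> (\<exists>y\<in>k. norm (adj R T x - y) \<le> e))"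
  proof (intro exI[of _ "adj R T ` k"] conjI ballI impI)
    fix x assume x: "x \<in> H" "norm x \<le> 1"
    obtain y where y: "y \<in> k" "norm ((T \<otimes>\<^bsub>R\<^esub> adj R T) x - (T \<otimes>\<^bsub>R\<^esub> adj R T) y) < e\<^sup>2 / 2"
      using k(3)[OF x] by blast
    have yH: "y \<in> H" "norm y \<le> 1" using k(2) y by auto
    define d where "d = x - y"
    have d: "d \<in> H" "norm d \<le> 2" using x yH norm_triangle_ineq4[of x y] by (auto simp: d_def)
    have "(norm (adj R T d))\<^sup>2 = Re (T (adj R T d) \<cdot> d)"
      using adj_props(2)[OF TB opD(1)[OF adj_B[OF TB] d(1)] d(1)] by (simp only: cinner_self_Re)
    also have "\<dots> \<le> norm (T (adj R T d)) * norm d"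
      using complex_Re_le_cmod cinner_Cauchy_Schwarz order_trans by blast
    also have "\<dots> \<le> (e\<^sup>2 / 2) * 2"
    proof (rule mult_mono)
      have "T (adj R T d) = (T \<otimes>\<^bsub>R\<^esub> adj R T) x - (T \<otimes>\<^bsub>R\<^esub> adj R T) y"
        using x yH TB by (simp add: d_def op_diff opD(1)[OF adj_B])
      thus "norm (T (adj R T d)) \<le> e\<^sup>2 / 2" using y(2) by simp
    qed (use d in auto)
    finally have "norm (adj R T d) \<le> e"
      using e by (intro power2_le_imp_le[of "norm (adj R T d)" e]) auto
    thus "\<exists>y\<in>adj R T ` k. norm (adj R T x - y) \<le> e"
      using y(1) x yH TB by (auto simp: d_def op_diff intro!: bexI[of _ y])
  qed (use k in auto)
qed (use assms in auto)

text \<open>Total boundedness is applied to the adjoint. If x is orthogonal to the adjoint images of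
  a net, then pairing T x with its own direction y gives a value within e |x| of 0, and that value
  is |T x|. Gram--Schmidt replaces the net images by an orthonormal set.\<close>

lemma compact_finite_rank:
  assumes T: "T \<in> K" and e: "e > 0"
  shows "\<exists>E. finite E \<and> E \<subseteq> H \<and> (\<forall>x\<in>H. norm (T x - (\<Sum>f\<in>E. (x \<cdot> f) *\<^sub>C T f)) \<le> e * norm x)"
proof -
  have TB: "T \<in> B" using T by simp
  obtain k where k: "finite k" "k \<subseteq> H \<inter> cball 0 1"
    "\<And>x. x \<in> H \<Longrightarrow> norm x \<le> 1 \<Longrightarrow> \<exists>y\<in>k. norm (adj R T x - adj R T y) < e"
    using cpt_totally_boundedD[OF K_cpt[OF adj_K[OF T]] e] by blast
  obtain E where E: "finite E" "E \<subseteq> H" "orthonormal E"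
    "\<And>x. (\<forall>f\<in>E. x \<cdot> f = 0) \<Longrightarrow> (\<forall>a\<in>adj R T ` k. x \<cdot> a = 0)"
    using Gram_Schmidt[of "adj R T ` k"] k TB opD(1)[OF adj_B[OF TB]] by (auto simp: image_subset_iff subset_iff)
  have "norm (T x - (\<Sum>f\<in>E. (x \<cdot> f) *\<^sub>C T f)) \<le> e * norm x" if x: "x \<in> H" for x
  proof (rule finite_rank_approximation[OF E(3,1,2)])
    fix x assume x: "x \<in> H" "\<And>f. f \<in> E \<Longrightarrow> x \<cdot> f = 0"
    show "norm (T x) \<le> e * norm x"
    proof (cases "T x = 0")
      case False
      define y where "y = of_real (inverse (norm (T x))) *\<^sub>C T x"
      have y: "y \<in> H" "norm y \<le> 1" using False TB x by (auto simp: y_def norm_inverse opD(1))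
      obtain z where z: "z \<in> k" "norm (adj R T y - adj R T z) < e" using k(3)[OF y] by blast
      have "x \<cdot> adj R T z = 0" using E(4)[of x] x(2) z by blast
      hence "x \<cdot> (adj R T y - adj R T z) = T x \<cdot> y"
        using x y TB by (simp add: cinner_diff_right adj_props(2))
      also have "\<dots> = of_real (norm (T x))"
        using False by (simp add: y_def cinner_simps cinner_self power2_eq_square)
      finally have "norm (T x) = norm (x \<cdot> (adj R T y - adj R T z))" by simp
      also have "\<dots> \<le> norm x * norm (adj R T y - adj R T z)" by (rule cinner_Cauchy_Schwarz)
      also have "\<dots> \<le> norm x * e" using z by (intro mult_left_mono) auto
      finally show ?thesis by (simp add: mult.commute)
    qed (use e in simp)
  qed (use e TB x in \<open>auto simp: opD\<close>)
  thus ?thesis using E by blast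
qed

text \<open>Up to an error e/2 the operator has finite rank, and a finite-rank operator only sees
  finitely many inner products of its argument, each of which tends to 0.\<close>

lemma compact_weakly_null:
  assumes T: "T \<in> K" and X: "\<And>n. X n \<in> H" "\<And>n. norm (X n) \<le> 1"
    and weak: "\<And>y. y \<in> H \<Longrightarrow> (\<lambda>n. X n \<cdot> y) \<longlonglongrightarrow> 0"
  shows "(\<lambda>n. T (X n)) \<longlonglongrightarrow> 0"
proof (rule LIMSEQ_I)
  fix e :: real assume e: "e > 0"
  obtain E where E: "finite E" "E \<subseteq> H"
    "\<And>x. x\<in>H \<Longrightarrow> norm (T x - (\<Sum>f\<in>E. (x \<cdot> f) *\<^sub>C T f)) \<le> e/2 * norm x"
    using compact_finite_rank[OF T, of "e/2"] e by auto
  have "(\<lambda>n. \<Sum>f\<in>E. norm (X n \<cdot> f) * norm (T f)) \<longlonglongrightarrow> (\<Sum>f\<in>E. norm (0::complex) * norm (T f))"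
    using E(2) by (intro tendsto_sum tendsto_mult tendsto_norm weak tendsto_const) auto
  hence "\<exists>N. \<forall>n\<ge>N. norm ((\<Sum>f\<in>E. norm (X n \<cdot> f) * norm (T f)) - 0) < e/2"
    using e by (intro LIMSEQ_D) auto
  then obtain N where N': "\<forall>n\<ge>N. norm ((\<Sum>f\<in>E. norm (X n \<cdot> f) * norm (T f)) - 0) < e/2"
    by blast
  have N: "(\<Sum>f\<in>E. norm (X n \<cdot> f) * norm (T f)) < e/2" if "n \<ge> N" for n
    using N'[rule_format, OF that] abs_ge_self[of "\<Sum>f\<in>E. norm (X n \<cdot> f) * norm (T f)"]
    unfolding real_norm_def diff_0_right by linarith
  show "\<exists>no. \<forall>n\<ge>no. norm (T (X n) - 0) < e"
  proof (intro exI[of _ N] allI impI)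
    fix n assume n: "n \<ge> N"
    have "norm (T (X n)) \<le> norm (T (X n) - (\<Sum>f\<in>E. (X n \<cdot> f) *\<^sub>C T f)) + norm (\<Sum>f\<in>E. (X n \<cdot> f) *\<^sub>C T f)"
      by (metis add.commute norm_triangle_sub)
    also have "norm (\<Sum>f\<in>E. (X n \<cdot> f) *\<^sub>C T f) \<le> (\<Sum>f\<in>E. norm (X n \<cdot> f) * norm (T f))"
      by (rule order_trans[OF norm_sum]) simp
    also have "norm (T (X n) - (\<Sum>f\<in>E. (X n \<cdot> f) *\<^sub>C T f)) \<le> e/2"
      using E(3)[OF X(1)[of n]] mult_left_le[OF X(2)[of n], of "e/2"] e by linarith
    finally show "norm (T (X n) - 0) < e" using N[OF n] by simp
  qed
qed

definition rank_one where "rank_one x y = (\<lambda>z\<in>H. (z \<cdot> y) *\<^sub>C x)"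

lemma rank_one_apply [simp]: "z \<in> H \<Longrightarrow> rank_one x y z = (z \<cdot> y) *\<^sub>C x"
  by (simp add: rank_one_def)

lemma rank_one_B [simp, intro]: "x \<in> H \<Longrightarrow> rank_one x y \<in> B"
proof (rule bounded_operatorsI[where M = "norm y * norm x"])
  fix z assume "z \<in> H"
  thus "norm (rank_one x y z) \<le> norm y * norm x * norm z"
    using mult_right_mono[OF cinner_Cauchy_Schwarz[of z y], of "norm x"] by (simp add: mult_ac)
qed (auto simp: cinner_simps scaleC_add_left, simp add: rank_one_def)

lemma rank_one_K [simp, intro]: "x \<in> H \<Longrightarrow> rank_one x y \<in> K"
  by (rule K_I[OF _ cpt_rank_one[of y x]]) auto

text \<open>Serves two inclusions: of the compact operators in the generated algebra, and in every
  closed ideal that contains the commutators. The approximants are sums of the operators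
  \<open>rank_one (T f) f\<close>.\<close>

lemma compact_in_closed_span:
  assumes "\<zero>\<^bsub>R\<^esub> \<in> I" "\<And>S T. S \<in> I \<Longrightarrow> T \<in> I \<Longrightarrow> S \<oplus>\<^bsub>R\<^esub> T \<in> I" "I \<subseteq> B"
    and "\<And>x y. x \<in> H \<Longrightarrow> y \<in> H \<Longrightarrow> rank_one x y \<in> I"
    and closed: "\<And>T. T \<in> K \<Longrightarrow> (\<And>e. e > 0 \<Longrightarrow> \<exists>F\<in>I. \<forall>x\<in>H. norm (T x - F x) \<le> e * norm x) \<Longrightarrow> T \<in> I"
  shows "K \<subseteq> I"
proof
  fix T assume T: "T \<in> K"
  have *: "\<exists>F\<in>I. \<forall>x\<in>H. F x = (\<Sum>f\<in>E. (x \<cdot> f) *\<^sub>C T f)" if "finite E" "E \<subseteq> H" for E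
    using that
  proof (induction E rule: finite_induct)
    case empty
    show ?case using assms(1) by (intro bexI[of _ "\<zero>\<^bsub>R\<^esub>"]) auto
  next
    case (insert f E)
    then obtain F where "F \<in> I" "\<forall>x\<in>H. F x = (\<Sum>f\<in>E. (x \<cdot> f) *\<^sub>C T f)" by auto
    thus ?case
      using insert T opD(1)[OF K_B[OF T]] assms(2)[of "rank_one (T f) f" F] assms(4)[of "T f" f]
      by (intro bexI[of _ "rank_one (T f) f \<oplus>\<^bsub>R\<^esub> F"]) auto
  qed
  show "T \<in> I"
  proof (rule closed[OF T])
    fix e :: real assume "e > 0"
    then obtain E where E: "finite E" "E \<subseteq> H" "\<forall>x\<in>H. norm (T x - (\<Sum>f\<in>E. (x \<cdot> f) *\<^sub>C T f)) \<le> e * norm x"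
      using compact_finite_rank[OF T] by blast
    thus "\<exists>F\<in>I. \<forall>x\<in>H. norm (T x - F x) \<le> e * norm x"
      using *[OF E(1,2)] by metis
  qed
qed

end

section \<open>The Hardy space\<close>

text \<open>One fixed sequence of radii tending to 1 turns radial limits into countable limits, as
  measurability and Fatou arguments require. It starts at 1/2, so that - ln r is at most a multiple
  of 1 - r^2 along it.\<close>

definition radii :: "nat \<Rightarrow> real" where "radii n = 1 - 1 / real (n + 2)"

lemma radii: "0 < radii n" "radii n < 1"
  by (auto simp: radii_def field_simps)

lemma radii_at_left: "filterlim radii (at_left 1) sequentially"
  unfolding filterlim_at
proof (intro conjI always_eventually allI)
  have "(\<lambda>n. 1 / real (n + 2)) \<longlonglongrightarrow> 0"
    using LIMSEQ_ignore_initial_segment[OF lim_1_over_n, of 2] by simp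
  hence "(\<lambda>n. 1 - 1 / real (n + 2)) \<longlonglongrightarrow> 1 - 0"
    by (intro tendsto_intros)
  moreover have "radii = (\<lambda>n. 1 - 1 / real (n + 2))" by (simp add: radii_def fun_eq_iff)
  ultimately show "radii \<longlonglongrightarrow> 1" by simp
qed (use radii in \<open>auto simp: less_imp_neq\<close>)

lemma slice_holomorphic:
  assumes "f holomorphic_on ball 0 1" "0 < r"
  shows "(\<lambda>z. f (of_real r * z)) holomorphic_on ball 0 (1/r)"
proof -
  have "(f \<circ> (\<lambda>z. of_real r * z)) holomorphic_on ball 0 (1/r)"
  proof (rule holomorphic_on_compose_gen[OF _ assms(1)])
    show "(\<lambda>z. complex_of_real r * z) holomorphic_on ball 0 (1/r)" by (intro holomorphic_intros)
    show "(\<lambda>z. complex_of_real r * z) ` ball 0 (1/r) \<subseteq> ball 0 1"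
      using assms(2) by (auto simp: norm_mult field_simps)
  qed
  thus ?thesis by (simp add: comp_def)
qed

lemma slice_continuous:
  assumes "f holomorphic_on ball 0 1" "0 \<le> r" "r < 1"
  shows "continuous_on (sphere 0 1) (\<lambda>z. f (of_real r * z))"
  by (rule continuous_on_compose2[OF holomorphic_on_imp_continuous_on[OF assms(1)]])
     (use assms in \<open>auto intro!: continuous_intros simp: norm_mult\<close>)

lemma hardy_disk_holomorphic: "hardy_disk f \<Longrightarrow> f holomorphic_on ball 0 1"
  by (simp add: hardy_disk_def)

lemma hardy_disk_bound:
  assumes "hardy_disk f"
  obtains M where "0 \<le> M" "\<And>r. 0 \<le> r \<Longrightarrow> r < 1 \<Longrightarrow> (\<integral>\<zeta>. (norm (f (of_real r * \<zeta>)))\<^sup>2 \<partial>\<mu>) \<le> M"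
proof -
  obtain M where M: "\<And>r. r \<in> {0..<1} \<Longrightarrow> (\<integral>\<zeta>. (norm (f (of_real r * \<zeta>)))\<^sup>2 \<partial>\<mu>) \<le> M"
    using assms unfolding hardy_disk_def bdd_above_def by blast
  show ?thesis
  proof (rule that[of "max M 0"])
    fix r :: real assume "0 \<le> r" "r < 1"
    thus "(\<integral>\<zeta>. (norm (f (of_real r * \<zeta>)))\<^sup>2 \<partial>\<mu>) \<le> max M 0"
      using M[of r] by auto
  qed simp
qed

lemma hardy_diskI:
  assumes "f holomorphic_on ball 0 1"
    and "\<And>r. 0 \<le> r \<Longrightarrow> r < 1 \<Longrightarrow> (\<integral>\<zeta>. (norm (f (of_real r * \<zeta>)))\<^sup>2 \<partial>\<mu>) \<le> M"
  shows "hardy_disk f"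
  unfolding hardy_disk_def using assms by (auto intro!: bdd_aboveI[where M = M])

lemma slice_integrable:
  assumes "f holomorphic_on ball 0 1" "0 \<le> r" "r < 1"
  shows "integrable \<mu> (\<lambda>\<zeta>. (norm (f (of_real r * \<zeta>)))\<^sup>2)"
  by (intro circle_integrable_continuous continuous_intros slice_continuous assms)

lemma hardy_disk_bounded:
  assumes "f holomorphic_on ball 0 1" "\<And>z. norm z < 1 \<Longrightarrow> norm (f z) \<le> C"
  shows "hardy_disk f"
proof (rule hardy_diskI[OF assms(1)])
  fix r :: real assume r: "0 \<le> r" "r < 1"
  have "(\<integral>\<zeta>. (norm (f (of_real r * \<zeta>)))\<^sup>2 \<partial>\<mu>) \<le> (\<integral>\<zeta>. C\<^sup>2 \<partial>\<mu>)"
  proof (rule integral_mono_AE[OF slice_integrable[OF assms(1) r]])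
    show "AE \<zeta> in circle_measure. (norm (f (of_real r * \<zeta>)))\<^sup>2 \<le> C\<^sup>2"
      using r assms(2) by (intro AE_I2 power_mono) (auto simp: norm_mult)
  qed simp
  thus "(\<integral>\<zeta>. (norm (f (of_real r * \<zeta>)))\<^sup>2 \<partial>\<mu>) \<le> C\<^sup>2" by simp
qed

lemma hardy_disk_mult:
  assumes f: "hardy_disk f" and g: "g holomorphic_on ball 0 1" "\<And>z. norm z < 1 \<Longrightarrow> norm (g z) \<le> C"
  shows "hardy_disk (\<lambda>z. g z * f z)"
proof -
  obtain M where M: "0 \<le> M" "\<And>r. 0 \<le> r \<Longrightarrow> r < 1 \<Longrightarrow> (\<integral>\<zeta>. (norm (f (of_real r * \<zeta>)))\<^sup>2 \<partial>\<mu>) \<le> M"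
    using hardy_disk_bound[OF f] by blast
  have hol: "(\<lambda>z. g z * f z) holomorphic_on ball 0 1"
    using g(1) hardy_disk_holomorphic[OF f] by (intro holomorphic_intros)
  show ?thesis
  proof (rule hardy_diskI[OF hol, where M = "C\<^sup>2 * M"])
    fix r :: real assume r: "0 \<le> r" "r < 1"
    have "(\<integral>\<zeta>. (norm (g (of_real r * \<zeta>) * f (of_real r * \<zeta>)))\<^sup>2 \<partial>\<mu>) \<le> (\<integral>\<zeta>. C\<^sup>2 * (norm (f (of_real r * \<zeta>)))\<^sup>2 \<partial>\<mu>)"
    proof (rule integral_mono_AE[OF slice_integrable[OF hol r]])
      show "integrable \<mu> (\<lambda>\<zeta>. C\<^sup>2 * (norm (f (of_real r * \<zeta>)))\<^sup>2)"
        using slice_integrable[OF hardy_disk_holomorphic[OF f] r] by simp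
      show "AE \<zeta> in circle_measure. (norm (g (of_real r * \<zeta>) * f (of_real r * \<zeta>)))\<^sup>2 \<le> C\<^sup>2 * (norm (f (of_real r * \<zeta>)))\<^sup>2"
        using r g(2) by (intro AE_I2) (auto simp: norm_mult power_mult_distrib intro!: mult_right_mono power_mono)
    qed
    also have "\<dots> \<le> C\<^sup>2 * M"
      using M(2)[OF r] by (simp add: mult_left_mono)
    finally show "(\<integral>\<zeta>. (norm (g (of_real r * \<zeta>) * f (of_real r * \<zeta>)))\<^sup>2 \<partial>\<mu>) \<le> C\<^sup>2 * M" .
  qed
qed

lemma norm_add_square_le: "(norm (a + b :: complex))\<^sup>2 \<le> 2 * (norm a)\<^sup>2 + 2 * (norm b)\<^sup>2"
proof -
  have "(norm (a + b))\<^sup>2 \<le> (norm a + norm b)\<^sup>2"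
    by (simp add: norm_triangle_ineq power_mono)
  also have "\<dots> \<le> 2 * (norm a)\<^sup>2 + 2 * (norm b)\<^sup>2"
    using sum_squares_bound[of "norm a" "norm b"] by (simp add: power2_sum)
  finally show ?thesis .
qed

lemma hardy_disk_add:
  assumes f: "hardy_disk f" and g: "hardy_disk g"
  shows "hardy_disk (\<lambda>z. f z + g z)"
proof -
  obtain M where M: "\<And>r. 0 \<le> r \<Longrightarrow> r < 1 \<Longrightarrow> (\<integral>\<zeta>. (norm (f (of_real r * \<zeta>)))\<^sup>2 \<partial>\<mu>) \<le> M"
    using hardy_disk_bound[OF f] by blast
  obtain N where N: "\<And>r. 0 \<le> r \<Longrightarrow> r < 1 \<Longrightarrow> (\<integral>\<zeta>. (norm (g (of_real r * \<zeta>)))\<^sup>2 \<partial>\<mu>) \<le> N"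
    using hardy_disk_bound[OF g] by blast
  have hol: "(\<lambda>z. f z + g z) holomorphic_on ball 0 1"
    using hardy_disk_holomorphic[OF f] hardy_disk_holomorphic[OF g] by (intro holomorphic_intros)
  show ?thesis
  proof (rule hardy_diskI[OF hol, where M = "2 * M + 2 * N"])
    fix r :: real assume r: "0 \<le> r" "r < 1"
    note i = slice_integrable[OF hardy_disk_holomorphic[OF f] r] slice_integrable[OF hardy_disk_holomorphic[OF g] r]
    have "(\<integral>\<zeta>. (norm (f (of_real r * \<zeta>) + g (of_real r * \<zeta>)))\<^sup>2 \<partial>\<mu>) \<le> (\<integral>\<zeta>. 2 * (norm (f (of_real r * \<zeta>)))\<^sup>2 + 2 * (norm (g (of_real r * \<zeta>)))\<^sup>2 \<partial>\<mu>)"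
      using i by (intro integral_mono_AE[OF slice_integrable[OF hol r]] AE_I2 norm_add_square_le) auto
    also have "\<dots> \<le> 2 * M + 2 * N"
      using i M[OF r] N[OF r] by simp
    finally show "(\<integral>\<zeta>. (norm (f (of_real r * \<zeta>) + g (of_real r * \<zeta>)))\<^sup>2 \<partial>\<mu>) \<le> 2 * M + 2 * N" .
  qed
qed

lemma hardy_disk_const: "hardy_disk (\<lambda>z. c)"
  by (rule hardy_disk_bounded[where C = "norm c"]) auto

lemma hardy_disk_cmult: "hardy_disk f \<Longrightarrow> hardy_disk (\<lambda>z. c * f z)"
  by (erule hardy_disk_mult[where C = "norm c"]) auto

text \<open>The dilates are bounded in L2 and converge almost everywhere, hence they converge in L1.
  This is enough to pass to the limit in integrals against bounded kernels, in particular in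
  Cauchy's formula.\<close>

lemma hardy_L1_convergence:
  assumes f: "hardy_disk f" and F: "boundary_value f F"
  shows "(\<lambda>n. \<integral>z. norm (f (of_real (radii n) * z) - rep_circle_L2 F z) \<partial>\<mu>) \<longlonglongrightarrow> 0"
proof -
  obtain M where M: "\<And>r. 0 \<le> r \<Longrightarrow> r < 1 \<Longrightarrow> (\<integral>\<zeta>. (norm (f (of_real r * \<zeta>)))\<^sup>2 \<partial>\<mu>) \<le> M"
    using hardy_disk_bound[OF f] by blast
  have r: "0 \<le> radii n" "radii n < 1" for n using radii[of n] by auto
  have sq: "square_integrable (\<lambda>z. f (of_real (radii n) * z))" for n
    by (intro square_integrable_continuous slice_continuous hardy_disk_holomorphic f r)
  show ?thesis
  proof (rule AE_tendsto_imp_L1)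
    show "square_integrable (\<lambda>z. f (of_real (radii n) * z) - rep_circle_L2 F z)" for n
      by (intro square_integrable_diff sq square_integrable_rep)
    show "AE z in circle_measure. (\<lambda>n. f (of_real (radii n) * z) - rep_circle_L2 F z) \<longlonglongrightarrow> 0"
      using F unfolding boundary_value_def
    proof eventually_elim
      case (elim z)
      have "(\<lambda>n. f (of_real (radii n) * z)) \<longlonglongrightarrow> rep_circle_L2 F z"
        by (rule filterlim_compose[OF elim radii_at_left])
      thus ?case by (simp add: LIM_zero)
    qed
    fix n
    have "(\<integral>z. (norm (f (of_real (radii n) * z) - rep_circle_L2 F z))\<^sup>2 \<partial>\<mu>)
        \<le> (\<integral>z. 2 * (norm (f (of_real (radii n) * z)))\<^sup>2 + 2 * (norm (rep_circle_L2 F z))\<^sup>2 \<partial>\<mu>)"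
    proof (rule integral_mono_AE)
      show "integrable \<mu> (\<lambda>z. (norm (f (of_real (radii n) * z) - rep_circle_L2 F z))\<^sup>2)"
        using square_integrable_diff[OF sq[of n] square_integrable_rep[of F]] by (simp add: square_integrable_def)
      show "integrable \<mu> (\<lambda>z. 2 * (norm (f (of_real (radii n) * z)))\<^sup>2 + 2 * (norm (rep_circle_L2 F z))\<^sup>2)"
        using sq[of n] rep_integrable_square[of F] by (simp add: square_integrable_def)
      show "AE z in circle_measure. (norm (f (of_real (radii n) * z) - rep_circle_L2 F z))\<^sup>2 \<le> 2 * (norm (f (of_real (radii n) * z)))\<^sup>2 + 2 * (norm (rep_circle_L2 F z))\<^sup>2"
        using norm_add_square_le[of _ "- rep_circle_L2 F _"] by (intro AE_I2) simp
    qed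
    also have "\<dots> \<le> 2 * M + 2 * (norm F)\<^sup>2"
      using sq[of n] rep_integrable_square[of F] M[OF r, of n] by (simp add: square_integrable_def L2_norm_square)
    finally show "(\<integral>z. (norm (f (of_real (radii n) * z) - rep_circle_L2 F z))\<^sup>2 \<partial>\<mu>) \<le> 2 * M + 2 * (norm F)\<^sup>2" .
  qed
qed

lemma hardy_integral_limit:
  assumes f: "hardy_disk f" and F: "boundary_value f F" and g: "bounded_symbol g"
  shows "(\<lambda>n. \<integral>z. f (of_real (radii n) * z) * g z \<partial>\<mu>) \<longlonglongrightarrow> (\<integral>z. rep_circle_L2 F z * g z \<partial>\<mu>)"
proof -
  obtain C where C: "\<And>z. z \<in> sphere 0 1 \<Longrightarrow> norm (g z) \<le> C"
    using g unfolding bounded_symbol_def by blast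
  have gm [measurable]: "g \<in> borel_measurable \<mu>" using g by (simp add: bounded_symbol_def)
  have r: "0 \<le> radii n" "radii n < 1" for n using radii[of n] by auto
  have sq: "square_integrable (\<lambda>z. f (of_real (radii n) * z))" for n
    by (intro square_integrable_continuous slice_continuous hardy_disk_holomorphic f r)
  have int: "integrable \<mu> (\<lambda>z. h z * g z)" if "square_integrable h" for h
    using circle_integral_norm_le(2)[OF square_integrable_mult[OF g that]] by (simp add: mult.commute)
  have "(\<lambda>n. (\<integral>z. f (of_real (radii n) * z) * g z \<partial>\<mu>) - (\<integral>z. rep_circle_L2 F z * g z \<partial>\<mu>)) \<longlonglongrightarrow> 0"
  proof (rule Lim_null_comparison[OF always_eventually])
    show "(\<lambda>n. (\<integral>z. norm (f (of_real (radii n) * z) - rep_circle_L2 F z) \<partial>\<mu>) * C) \<longlonglongrightarrow> 0"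
      using tendsto_mult_right[OF hardy_L1_convergence[OF f F], of C] by simp
    show "\<forall>n. norm ((\<integral>z. f (of_real (radii n) * z) * g z \<partial>\<mu>) - (\<integral>z. rep_circle_L2 F z * g z \<partial>\<mu>))
       \<le> (\<integral>z. norm (f (of_real (radii n) * z) - rep_circle_L2 F z) \<partial>\<mu>) * C"
    proof
      fix n
      have d: "square_integrable (\<lambda>z. f (of_real (radii n) * z) - rep_circle_L2 F z)"
        by (intro square_integrable_diff sq square_integrable_rep)
      have "(\<integral>z. f (of_real (radii n) * z) * g z \<partial>\<mu>) - (\<integral>z. rep_circle_L2 F z * g z \<partial>\<mu>)
         = (\<integral>z. (f (of_real (radii n) * z) - rep_circle_L2 F z) * g z \<partial>\<mu>)"
        by (subst Bochner_Integration.integral_diff[symmetric]) (auto intro!: int sq simp: left_diff_distrib)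
      also have "norm \<dots> \<le> (\<integral>z. norm ((f (of_real (radii n) * z) - rep_circle_L2 F z) * g z) \<partial>\<mu>)"
        by (rule integral_norm_bound)
      also have "\<dots> \<le> (\<integral>z. norm (f (of_real (radii n) * z) - rep_circle_L2 F z) * C \<partial>\<mu>)"
        using integrable_norm[OF int[OF d]] circle_integral_norm_le(1)[OF d] C
        by (intro integral_mono_AE AE_I2) (auto simp: norm_mult intro!: mult_left_mono)
      finally show "norm ((\<integral>z. f (of_real (radii n) * z) * g z \<partial>\<mu>) - (\<integral>z. rep_circle_L2 F z * g z \<partial>\<mu>))
       \<le> (\<integral>z. norm (f (of_real (radii n) * z) - rep_circle_L2 F z) \<partial>\<mu>) * C" by simp
    qed
  qed
  thus ?thesis by (rule LIM_zero_cancel)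
qed

section \<open>Szego kernels and Cauchy's formula for boundary values\<close>

lemma one_minus_mult_nonzero:
  assumes "norm l < 1" "norm z \<le> 1" shows "1 - l * z \<noteq> (0::complex)"
proof
  assume "1 - l * z = 0"
  hence "norm (l * z) = 1" by simp
  moreover have "norm (l * z) < 1"
    using assms mult_right_mono[of "norm z" 1 "norm l"] by (simp add: norm_mult mult.commute)
  ultimately show False by simp
qed

definition szego :: "complex \<Rightarrow> circle_L2" where
  "szego l = abs_circle_L2 (\<lambda>z. 1 / (1 - cnj l * z))"

text \<open>The antianalytic part of the Poisson kernel at l: together with \<open>szego l\<close>
  it adds up to the Poisson kernel, and it is orthogonal to the Hardy space.\<close>

definition coszego :: "complex \<Rightarrow> circle_L2" where
  "coszego l = abs_circle_L2 (\<lambda>z. l * cnj z / (1 - l * cnj z))"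

lemma szego_continuous: "norm l < 1 \<Longrightarrow> continuous_on (sphere 0 1) (\<lambda>z. 1 / (1 - cnj l * z))"
  by (intro continuous_intros) (use one_minus_mult_nonzero[of "cnj l"] in auto)

lemma coszego_continuous: "norm l < 1 \<Longrightarrow> continuous_on (sphere 0 1) (\<lambda>z. l * cnj z / (1 - l * cnj z))"
  by (intro continuous_intros) (use one_minus_mult_nonzero[of l] in auto)

lemma cinner_abs_right:
  assumes "square_integrable g"
  shows "F \<cdot> abs_circle_L2 g = (\<integral>z. rep_circle_L2 F z * cnj (g z) \<partial>\<mu>)"
  using L2_cinner_abs[OF square_integrable_rep[of F] assms] by simp

lemma cinner_szego:
  assumes "norm l < 1"
  shows "F \<cdot> szego l = (\<integral>z. rep_circle_L2 F z * (1 / (1 - l * cnj z)) \<partial>\<mu>)"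
  unfolding szego_def cinner_abs_right[OF square_integrable_continuous[OF szego_continuous[OF assms]]] by simp

lemma cinner_coszego:
  assumes "norm l < 1"
  shows "F \<cdot> coszego l = (\<integral>z. rep_circle_L2 F z * (cnj l * z / (1 - cnj l * z)) \<partial>\<mu>)"
  unfolding coszego_def cinner_abs_right[OF square_integrable_continuous[OF coszego_continuous[OF assms]]] by simp

text \<open>Cauchy's formula holds for the dilates. As the radii tend to 1, one side converges by
  continuity of f at l and the other by L1 convergence to the boundary values.\<close>

lemma hardy_Cauchy:
  assumes f: "hardy_disk f" and F: "boundary_value f F" and l: "norm l < 1"
  shows "f l = F \<cdot> szego l"
proof -
  have bs: "bounded_symbol (\<lambda>z. 1 / (1 - l * cnj z))"
    by (intro continuous_bounded_symbol continuous_intros) (use one_minus_mult_nonzero[of l] l in auto)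
  have "(\<integral>z. f (of_real (radii n) * z) * (1 / (1 - l * cnj z)) \<partial>\<mu>) = f (of_real (radii n) * l)" for n
    using circle_Cauchy[OF slice_holomorphic[OF hardy_disk_holomorphic[OF f] radii(1)[of n]] _ l] radii[of n]
    by (simp add: field_simps)
  hence 1: "(\<lambda>n. f (of_real (radii n) * l)) \<longlonglongrightarrow> F \<cdot> szego l"
    using hardy_integral_limit[OF f F bs] cinner_szego[OF l] by simp
  have "radii \<longlonglongrightarrow> 1" using radii_at_left by (simp add: filterlim_at)
  hence "(\<lambda>n. of_real (radii n) * l) \<longlonglongrightarrow> of_real 1 * l" by (intro tendsto_intros)
  hence lim: "(\<lambda>n. of_real (radii n) * l) \<longlonglongrightarrow> l" by simp
  have "isCont f l"
    using holomorphic_on_imp_continuous_on[OF hardy_disk_holomorphic[OF f]] l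
    by (simp add: continuous_on_eq_continuous_at)
  hence "(\<lambda>n. f (of_real (radii n) * l)) \<longlonglongrightarrow> f l"
    using lim by (rule isCont_tendsto_compose)
  from LIMSEQ_unique[OF this 1] show ?thesis .
qed

lemma hardy_cinner_coszego:
  assumes f: "hardy_disk f" and F: "boundary_value f F" and l: "norm l < 1"
  shows "F \<cdot> coszego l = 0"
proof -
  have bs: "bounded_symbol (\<lambda>z. cnj l * z / (1 - cnj l * z))"
    by (intro continuous_bounded_symbol continuous_intros) (use one_minus_mult_nonzero[of "cnj l"] l in auto)
  have "(\<integral>z. f (of_real (radii n) * z) * (cnj l * z / (1 - cnj l * z)) \<partial>\<mu>) = 0" for n
  proof -
    \<comment> \<open>The dilate is holomorphic up to radius 1 / \<open>radii n\<close>, and the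
      kernel has its pole at modulus 1 / |l|. Both exceed 1, so the integral over the circle is the
      value at 0, which vanishes because of the factor z.\<close>
    define R where "R = min (1 / radii n) (if l = 0 then 2 else 1 / norm l)"
    have R: "R > 1" using radii[of n] l by (auto simp: R_def)
    have nz: "1 - cnj l * z \<noteq> 0" if "z \<in> ball 0 R" for z
    proof
      assume "1 - cnj l * z = 0"
      hence "norm (cnj l * z) = 1" by simp
      thus False using that by (auto simp: R_def norm_mult field_simps split: if_splits)
    qed
    have "(\<lambda>z. f (of_real (radii n) * z)) holomorphic_on ball 0 R"
      by (rule holomorphic_on_subset[OF slice_holomorphic[OF hardy_disk_holomorphic[OF f] radii(1)[of n]]]) (auto simp: R_def)
    hence "(\<lambda>z. f (of_real (radii n) * z) * (cnj l * z / (1 - cnj l * z))) holomorphic_on ball 0 R"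
      using nz by (intro holomorphic_intros) auto
    from circle_mean_value[OF this R] show ?thesis by simp
  qed
  thus ?thesis
    using hardy_integral_limit[OF f F bs] cinner_coszego[OF l] by (simp add: LIMSEQ_const_iff)
qed

section \<open>Operations on boundary values\<close>

lemma boundary_value_unique:
  assumes "boundary_value f F" "boundary_value f G" shows "F = G"
proof (rule circle_L2_eqI)
  show "AE z in circle_measure. rep_circle_L2 F z = rep_circle_L2 G z"
    using assms unfolding boundary_value_def
    by eventually_elim (rule tendsto_unique[OF trivial_limit_at_left_real])
qed

lemma boundary_value_add:
  assumes "boundary_value f F" "boundary_value g G" shows "boundary_value (\<lambda>z. f z + g z) (F + G)"
  using assms rep_add[of F G] unfolding boundary_value_def
  by eventually_elim (simp add: tendsto_add)

lemma boundary_value_diff: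
  assumes "boundary_value f F" "boundary_value g G" shows "boundary_value (\<lambda>z. f z - g z) (F - G)"
  using assms rep_diff[of F G] unfolding boundary_value_def
  by eventually_elim (simp add: tendsto_diff)

lemma boundary_value_cmult:
  assumes "boundary_value f F" shows "boundary_value (\<lambda>z. c * f z) (c *\<^sub>C F)"
  using assms rep_scaleC[of c F] unfolding boundary_value_def
  by eventually_elim (simp add: tendsto_mult)

lemma of_real_at_left: "((\<lambda>r. complex_of_real r) \<longlongrightarrow> 1) (at_left 1)"
  by (rule tendsto_eq_intros filterlim_ident)+ (auto intro: tendsto_intros)

lemma boundary_value_L2_mult:
  assumes F: "boundary_value f F" and g: "bounded_symbol \<phi>"
    and lim: "AE \<zeta> in circle_measure. ((\<lambda>r. g (of_real r * \<zeta>)) \<longlongrightarrow> \<phi> \<zeta>) (at_left 1)"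
  shows "boundary_value (\<lambda>z. g z * f z) (L2_mult \<phi> F)"
  using F lim rep_L2_mult[OF g, of F] unfolding boundary_value_def
  by eventually_elim (simp add: tendsto_mult)

lemma boundary_value_continuous:
  assumes "continuous_on (cball 0 1) f"
  shows "boundary_value f (abs_circle_L2 f)"
proof -
  have sq: "square_integrable f"
    by (rule square_integrable_continuous) (rule continuous_on_subset[OF assms], auto)
  have "((\<lambda>r. f (of_real r * z)) \<longlongrightarrow> f z) (at_left 1)" if z: "norm z = 1" for z
  proof (rule continuous_on_tendsto_compose[OF assms])
    show "((\<lambda>r. complex_of_real r * z) \<longlongrightarrow> z) (at_left 1)"
      using tendsto_mult_right[OF of_real_at_left, of z] by simp
    show "\<forall>\<^sub>F r in at_left 1. complex_of_real r * z \<in> cball 0 1"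
      using eventually_at_left_real[of 0 1] by (rule eventually_mono) (use z in \<open>auto simp: norm_mult\<close>)
  qed (use z in auto)
  hence "AE z in circle_measure. ((\<lambda>r. f (of_real r * z)) \<longlongrightarrow> f z) (at_left 1)"
    by (intro AE_I2) auto
  thus ?thesis unfolding boundary_value_def
    using rep_abs_AE[OF sq] by eventually_elim simp
qed

lemma hardy_H2E:
  assumes "F \<in> hardy_H2"
  obtains f where "hardy_disk f" "boundary_value f F" "\<And>l. norm l < 1 \<Longrightarrow> f l = F \<cdot> szego l"
  using assms hardy_Cauchy unfolding hardy_H2_def by blast

lemma hardy_H2_zero: "0 \<in> hardy_H2"
proof -
  have "boundary_value (\<lambda>z. 0) 0"
    using rep_zero unfolding boundary_value_def by eventually_elim simp
  thus ?thesis using hardy_disk_const[of 0] by (auto simp: hardy_H2_def)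
qed

lemma hardy_H2_add: "F \<in> hardy_H2 \<Longrightarrow> G \<in> hardy_H2 \<Longrightarrow> F + G \<in> hardy_H2"
  unfolding hardy_H2_def using hardy_disk_add boundary_value_add by blast

lemma hardy_H2_scaleC: "F \<in> hardy_H2 \<Longrightarrow> c *\<^sub>C F \<in> hardy_H2"
  unfolding hardy_H2_def using hardy_disk_cmult boundary_value_cmult by blast

lemma hardy_H2_diff: "F \<in> hardy_H2 \<Longrightarrow> G \<in> hardy_H2 \<Longrightarrow> F - G \<in> hardy_H2"
  using hardy_H2_add[OF _ hardy_H2_scaleC[of G "-1"], of F] by (simp add: scaleC_minus_one)

section \<open>Fatou's theorem: the Hardy space is closed\<close>

definition poisson :: "complex \<Rightarrow> complex \<Rightarrow> real" where
  "poisson z w = (1 - (norm z)\<^sup>2) / (norm (w - z))\<^sup>2"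

lemma poisson_nonneg: "norm z < 1 \<Longrightarrow> 0 \<le> poisson z w"
  by (simp add: poisson_def power_le_one)

lemma poisson_eq:
  assumes "norm z < 1" "norm w = 1"
  shows "1 / (1 - z * cnj w) + cnj z * w / (1 - cnj z * w) = complex_of_real (poisson z w)"
proof -
  have nz: "1 - z * cnj w \<noteq> 0" "1 - cnj z * w \<noteq> 0"
    using one_minus_mult_nonzero[of z "cnj w"] one_minus_mult_nonzero[of "cnj z" w] assms by auto
  have w: "w * cnj w = 1" using assms circle_z_cnj[of w] by simp
  have "complex_of_real ((norm (w - z))\<^sup>2) = (w - z) * cnj (w - z)"
    by (rule complex_norm_square)
  also have "\<dots> = (1 - z * cnj w) * (1 - cnj z * w)"
    using w by (simp add: algebra_simps)
  finally have d: "complex_of_real ((norm (w - z))\<^sup>2) = (1 - z * cnj w) * (1 - cnj z * w)" .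
  have "1 / (1 - z * cnj w) + cnj z * w / (1 - cnj z * w) = ((1 - cnj z * w) + cnj z * w * (1 - z * cnj w)) / ((1 - z * cnj w) * (1 - cnj z * w))"
    using nz by (simp add: field_simps)
  also have "(1 - cnj z * w) + cnj z * w * (1 - z * cnj w) = 1 - z * cnj z * (w * cnj w)"
    by (simp add: algebra_simps)
  also have "\<dots> = complex_of_real (1 - (norm z)\<^sup>2)"
    unfolding w of_real_diff complex_norm_square by simp
  finally show ?thesis
    unfolding poisson_def of_real_divide d .
qed

lemma poisson_continuous: "norm z < 1 \<Longrightarrow> continuous_on (sphere 0 1) (poisson z)"
  unfolding poisson_def by (intro continuous_intros) auto

text \<open>Exchanges the directions of the evaluation point and of the boundary point. After
  Fubini's theorem the integration in the evaluation point thereby becomes the normalization of the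
  Poisson kernel.\<close>

lemma poisson_symmetric:
  assumes "0 \<le> r" "norm w = 1" "norm \<zeta> = 1"
  shows "poisson (of_real r * \<zeta>) w = poisson (of_real r * w) \<zeta>"
proof -
  have "(norm (a - of_real r * b))\<^sup>2 = 1 + r\<^sup>2 - 2 * r * Re (a * cnj b)" if "norm a = 1" "norm b = 1" for a b
  proof -
    have "(norm (a - of_real r * b))\<^sup>2 = (norm a)\<^sup>2 + r\<^sup>2 * (norm b)\<^sup>2 - 2 * r * Re (a * cnj b)"
      unfolding cmod_power2 by (simp add: power2_eq_square algebra_simps)
    thus ?thesis using that by simp
  qed
  moreover have "Re (w * cnj \<zeta>) = Re (\<zeta> * cnj w)" by simp
  ultimately show ?thesis using assms by (simp add: poisson_def norm_mult)
qed

lemma poisson_integral: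
  assumes "norm z < 1" shows "(\<integral>w. poisson z w \<partial>\<mu>) = 1"
proof -
  have c: "continuous_on (sphere 0 1) (\<lambda>w. 1 / (1 - z * cnj w))" "continuous_on (sphere 0 1) (\<lambda>w. cnj z * w / (1 - cnj z * w))"
    using one_minus_mult_nonzero[of z] one_minus_mult_nonzero[of "cnj z"] assms by (auto intro!: continuous_intros)
  have "complex_of_real (\<integral>w. poisson z w \<partial>\<mu>) = (\<integral>w. complex_of_real (poisson z w) \<partial>\<mu>)"
    by simp
  also have "\<dots> = (\<integral>w. 1 / (1 - z * cnj w) + cnj z * w / (1 - cnj z * w) \<partial>\<mu>)"
    by (rule Bochner_Integration.integral_cong) (use poisson_eq assms in auto)
  also have "\<dots> = (\<integral>w. 1 / (1 - z * cnj w) \<partial>\<mu>) + (\<integral>w. cnj z * w / (1 - cnj z * w) \<partial>\<mu>)"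
    by (rule Bochner_Integration.integral_add) (intro circle_integrable_continuous c)+
  also have "(\<integral>w. 1 / (1 - z * cnj w) \<partial>\<mu>) = 1"
    using circle_Cauchy[of "\<lambda>_. 1" 2 z] assms by simp
  also have "(\<integral>w. cnj z * w / (1 - cnj z * w) \<partial>\<mu>) = 0"
  proof -
    define R where "R = (if z = 0 then 2 else 1 / norm z)"
    have R: "R > 1" using assms by (auto simp: R_def)
    have nz: "1 - cnj z * w \<noteq> 0" if "w \<in> ball 0 R" for w
    proof
      assume "1 - cnj z * w = 0"
      hence "norm (cnj z * w) = 1" by simp
      thus False using that by (auto simp: R_def norm_mult field_simps split: if_splits)
    qed
    hence "(\<lambda>w. cnj z * w / (1 - cnj z * w)) holomorphic_on ball 0 R"
      by (intro holomorphic_intros) auto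
    from circle_mean_value[OF this R] show ?thesis by simp
  qed
  finally show ?thesis by simp
qed

text \<open>Orthogonality to \<open>coszego z\<close> allows the antianalytic part to be added to
  the Szego kernel without changing the value; the resulting kernel is positive, which the later
  estimates exploit.\<close>

lemma poisson_representation:
  assumes z: "norm z < 1" and G: "G \<cdot> coszego z = 0"
  shows "G \<cdot> szego z = (\<integral>w. rep_circle_L2 G w * complex_of_real (poisson z w) \<partial>\<mu>)"
proof -
  have c: "continuous_on (sphere 0 1) (\<lambda>w. 1 / (1 - z * cnj w))" "continuous_on (sphere 0 1) (\<lambda>w. cnj z * w / (1 - cnj z * w))"
    using one_minus_mult_nonzero[of z] one_minus_mult_nonzero[of "cnj z"] z by (auto intro!: continuous_intros)
  have int: "integrable \<mu> (\<lambda>w. rep_circle_L2 G w * g w)" if "continuous_on (sphere 0 1) g" for g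
    using circle_integral_norm_le(2)[OF square_integrable_mult[OF continuous_bounded_symbol[OF that] square_integrable_rep[of G]]]
    by (simp add: mult.commute)
  have "G \<cdot> szego z = G \<cdot> szego z + G \<cdot> coszego z" using G by simp
  also have "\<dots> = (\<integral>w. rep_circle_L2 G w * (1 / (1 - z * cnj w)) + rep_circle_L2 G w * (cnj z * w / (1 - cnj z * w)) \<partial>\<mu>)"
    unfolding cinner_szego[OF z] cinner_coszego[OF z]
    by (rule Bochner_Integration.integral_add[symmetric]) (intro int c)+
  also have "\<dots> = (\<integral>w. rep_circle_L2 G w * complex_of_real (poisson z w) \<partial>\<mu>)"
    by (rule Bochner_Integration.integral_cong) (simp_all add: poisson_eq[OF z, symmetric] distrib_left)
  finally show ?thesis .
qed

lemma integrable_rep_mult_bounded: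
  fixes g :: "complex \<Rightarrow> real"
  assumes "g \<in> borel_measurable \<mu>" "\<And>w. w \<in> sphere 0 1 \<Longrightarrow> \<bar>g w\<bar> \<le> C"
  shows "integrable \<mu> (\<lambda>w. norm (rep_circle_L2 G w) * g w)"
proof (rule Bochner_Integration.integrable_bound)
  have [measurable]: "g \<in> borel_measurable \<mu>" by fact
  show "integrable \<mu> (\<lambda>w. norm (rep_circle_L2 G w) * C)"
    using circle_integral_norm_le(1)[OF square_integrable_rep] by simp
  show "(\<lambda>w. norm (rep_circle_L2 G w) * g w) \<in> borel_measurable \<mu>" by measurable
  show "AE w in circle_measure. norm (norm (rep_circle_L2 G w) * g w) \<le> norm (norm (rep_circle_L2 G w) * C)"
    using assms(2) by (intro AE_I2) (auto simp: abs_mult intro!: mult_left_mono order_trans[OF assms(2) abs_ge_self])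
qed

lemma norm_poisson_le:
  assumes z: "norm z < 1" and G: "G \<cdot> coszego z = 0"
  shows "norm (G \<cdot> szego z) \<le> (\<integral>w. norm (rep_circle_L2 G w) * poisson z w \<partial>\<mu>)"
  unfolding poisson_representation[OF assms]
  using integral_norm_bound[of \<mu> "\<lambda>w. rep_circle_L2 G w * complex_of_real (poisson z w)"] poisson_nonneg[OF z]
  by (simp add: norm_mult)

text \<open>Jensen's inequality for the probability density \<open>poisson z\<close>, obtained from
  Cauchy--Schwarz by splitting the kernel into two factors q, its square root.\<close>

lemma norm_poisson_square_le:
  assumes z: "norm z < 1" and G: "G \<cdot> coszego z = 0"
  shows "(norm (G \<cdot> szego z))\<^sup>2 \<le> (\<integral>w. (norm (rep_circle_L2 G w))\<^sup>2 * poisson z w \<partial>\<mu>)"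
proof -
  define q where "q w = complex_of_real (sqrt (poisson z w))" for w
  have qc: "continuous_on (sphere 0 1) q"
    unfolding q_def by (intro continuous_intros poisson_continuous z)
  note qs = square_integrable_mult[OF continuous_bounded_symbol[OF qc] square_integrable_rep[of G]]
  have q2: "q w * cnj (q w) = complex_of_real (poisson z w)" for w
    using poisson_nonneg[OF z] by (simp add: q_def flip: of_real_mult)
  have nq: "(norm (q w))\<^sup>2 = poisson z w" for w
    using poisson_nonneg[OF z, of w] by (simp add: q_def)
  have "G \<cdot> szego z = abs_circle_L2 (\<lambda>w. q w * rep_circle_L2 G w) \<cdot> abs_circle_L2 q"
    unfolding poisson_representation[OF assms] L2_cinner_abs[OF qs square_integrable_continuous[OF qc]]
    by (intro Bochner_Integration.integral_cong refl) (simp add: q2[symmetric] mult_ac)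
  hence "(norm (G \<cdot> szego z))\<^sup>2 \<le> (norm (abs_circle_L2 (\<lambda>w. q w * rep_circle_L2 G w)) * norm (abs_circle_L2 q))\<^sup>2"
    using cinner_Cauchy_Schwarz by (simp add: power_mono)
  also have "\<dots> = (\<integral>w. (norm (rep_circle_L2 G w))\<^sup>2 * poisson z w \<partial>\<mu>) * (\<integral>w. poisson z w \<partial>\<mu>)"
    unfolding power_mult_distrib L2_norm_abs_square[OF qs] L2_norm_abs_square[OF square_integrable_continuous[OF qc]]
    by (simp add: norm_mult power_mult_distrib nq mult.commute)
  finally show ?thesis using poisson_integral[OF z] by simp
qed

lemma poisson_measurable:
  "(\<lambda>(\<zeta>, w). poisson (of_real r * \<zeta>) w) \<in> borel_measurable (\<mu> \<Otimes>\<^sub>M \<mu>)"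
  unfolding poisson_def by measurable

text \<open>The Jensen bound is integrated in the evaluation point and the order of integration
  exchanged; by symmetry the inner integral is 1. Uniformity in r is what the Hardy class
  requires.\<close>

lemma norm_poisson_mean_square:
  assumes r: "0 \<le> r" "r < 1" and G: "\<And>z. norm z < 1 \<Longrightarrow> G \<cdot> coszego z = 0"
  shows "(\<integral>\<^sup>+\<zeta>. ennreal ((norm (G \<cdot> szego (of_real r * \<zeta>)))\<^sup>2) \<partial>\<mu>) \<le> ennreal ((norm G)\<^sup>2)"
proof -
  interpret P: pair_sigma_finite \<mu> \<mu> ..
  define g where "g w = ennreal ((norm (rep_circle_L2 G w))\<^sup>2)" for w
  have [measurable]: "g \<in> borel_measurable \<mu>" unfolding g_def by measurable
  note poisson_measurable[of r, measurable]
  have nr: "norm (of_real r * \<zeta>) < 1" if "norm \<zeta> = 1" for \<zeta> :: complex using that r by (simp add: norm_mult)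
  have "(\<integral>\<^sup>+\<zeta>. ennreal ((norm (G \<cdot> szego (of_real r * \<zeta>)))\<^sup>2) \<partial>\<mu>)
     \<le> (\<integral>\<^sup>+\<zeta>. (\<integral>\<^sup>+w. g w * ennreal (poisson (of_real r * \<zeta>) w) \<partial>\<mu>) \<partial>\<mu>)"
  proof (rule nn_integral_mono)
    fix \<zeta> assume "\<zeta> \<in> space \<mu>"
    hence z: "norm (of_real r * \<zeta>) < 1" using nr by simp
    have "compact (poisson (of_real r * \<zeta>) ` sphere 0 1)"
      by (intro compact_continuous_image poisson_continuous z) auto
    then obtain C where C: "\<And>w. w \<in> sphere 0 1 \<Longrightarrow> norm (poisson (of_real r * \<zeta>) w) \<le> C"
      using compact_imp_bounded bounded_iff by (metis imageI)
    have m [measurable]: "poisson (of_real r * \<zeta>) \<in> borel_measurable \<mu>"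
      by (intro continuous_imp_measurable_circle poisson_continuous z)
    have i: "integrable \<mu> (\<lambda>w. (norm (rep_circle_L2 G w))\<^sup>2 * poisson (of_real r * \<zeta>) w)"
    proof (rule Bochner_Integration.integrable_bound)
      show "integrable \<mu> (\<lambda>w. (norm (rep_circle_L2 G w))\<^sup>2 * C)"
        using rep_integrable_square by simp
      show "AE w in circle_measure. norm ((norm (rep_circle_L2 G w))\<^sup>2 * poisson (of_real r * \<zeta>) w) \<le> norm ((norm (rep_circle_L2 G w))\<^sup>2 * C)"
        using C by (intro AE_I2) (auto simp: abs_mult intro!: mult_left_mono order_trans[OF C[unfolded real_norm_def] abs_ge_self])
    qed measurable
    have "ennreal ((norm (G \<cdot> szego (of_real r * \<zeta>)))\<^sup>2) \<le> ennreal (\<integral>w. (norm (rep_circle_L2 G w))\<^sup>2 * poisson (of_real r * \<zeta>) w \<partial>\<mu>)"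
      by (intro ennreal_leI norm_poisson_square_le z G)
    also have "\<dots> = (\<integral>\<^sup>+w. ennreal ((norm (rep_circle_L2 G w))\<^sup>2 * poisson (of_real r * \<zeta>) w) \<partial>\<mu>)"
      by (rule nn_integral_eq_integral[symmetric, OF i]) (auto simp: poisson_nonneg[OF z])
    finally show "ennreal ((norm (G \<cdot> szego (of_real r * \<zeta>)))\<^sup>2) \<le> (\<integral>\<^sup>+w. g w * ennreal (poisson (of_real r * \<zeta>) w) \<partial>\<mu>)"
      by (simp add: g_def ennreal_mult poisson_nonneg[OF z])
  qed
  also have "\<dots> = (\<integral>\<^sup>+w. (\<integral>\<^sup>+\<zeta>. g w * ennreal (poisson (of_real r * \<zeta>) w) \<partial>\<mu>) \<partial>\<mu>)"
    by (rule P.Fubini'[symmetric]) measurable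
  also have "\<dots> = (\<integral>\<^sup>+w. g w \<partial>\<mu>)"
  proof (rule nn_integral_cong)
    fix w assume w: "w \<in> space \<mu>"
    have z: "norm (of_real r * w) < 1" using nr w by simp
    have "(\<integral>\<^sup>+\<zeta>. g w * ennreal (poisson (of_real r * \<zeta>) w) \<partial>\<mu>) = (\<integral>\<^sup>+\<zeta>. g w * ennreal (poisson (of_real r * w) \<zeta>) \<partial>\<mu>)"
      using w poisson_symmetric[OF r(1)] by (intro nn_integral_cong) auto
    also have "\<dots> = g w * (\<integral>\<^sup>+\<zeta>. ennreal (poisson (of_real r * w) \<zeta>) \<partial>\<mu>)"
      by (intro nn_integral_cmult measurable_compose[OF continuous_imp_measurable_circle[OF poisson_continuous[OF z]] measurable_ennreal])
    also have "(\<integral>\<^sup>+\<zeta>. ennreal (poisson (of_real r * w) \<zeta>) \<partial>\<mu>) = ennreal (\<integral>\<zeta>. poisson (of_real r * w) \<zeta> \<partial>\<mu>)"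
      by (intro nn_integral_eq_integral circle_integrable_continuous poisson_continuous z) (auto simp: poisson_nonneg[OF z])
    finally show "(\<integral>\<^sup>+\<zeta>. g w * ennreal (poisson (of_real r * \<zeta>) w) \<partial>\<mu>) = g w"
      by (simp add: poisson_integral[OF z])
  qed
  finally show ?thesis by (simp add: g_def L2_norm_square_nn)
qed

text \<open>A dyadic decomposition around \<open>\<zeta>\<close> dominates the Poisson integral at \<open>r\<zeta>\<close> by the maximal function at \<open>\<zeta>\<close>.\<close>

lemma poisson_dyadic_bound:
  assumes h: "0 \<le> r" "r < 1" and n: "norm \<zeta> = 1" "norm w = 1"
    and m: "dist \<zeta> w < 2^(N+1) * (1 - r)"
  shows "poisson (of_real r * \<zeta>) w
     \<le> (\<Sum>k\<le>N. 8 / (4^k * (1 - r)) * indicator (ball \<zeta> (2^(k+1) * (1 - r))) w)"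
proof -
  define h where "h = 1 - r"
  have hp: "h > 0" using h by (simp add: h_def)
  define d where "d = norm (w - of_real r * \<zeta>)"
  have d1: "h \<le> d"
    using norm_triangle_ineq2[of w "of_real r * \<zeta>"] n h by (simp add: d_def h_def norm_mult)
  have d2: "dist \<zeta> w \<le> 2 * d"
  proof -
    have "norm (\<zeta> - of_real r * \<zeta>) = h"
    proof -
      have "\<zeta> - of_real r * \<zeta> = of_real h * \<zeta>" by (simp add: h_def algebra_simps)
      thus ?thesis using n hp by (simp add: norm_mult)
    qed
    moreover have "dist \<zeta> w \<le> norm (\<zeta> - of_real r * \<zeta>) + norm (w - of_real r * \<zeta>)"
      using norm_triangle_ineq4[of "\<zeta> - of_real r * \<zeta>" "w - of_real r * \<zeta>"] by (simp add: dist_norm)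
    ultimately show ?thesis using d1 by (simp add: d_def)
  qed
  have p: "poisson (of_real r * \<zeta>) w \<le> 2 * h / d\<^sup>2"
  proof -
    have "1 - r\<^sup>2 \<le> 2 * h" using h by (simp add: h_def power2_eq_square algebra_simps) (sos)
    thus ?thesis using n h by (simp add: poisson_def d_def norm_mult divide_right_mono)
  qed
  have m: "dist \<zeta> w < 2^(N+1) * h" using m by (simp add: h_def)
  \<comment> \<open>k is the dyadic shell of w. Unless k = 0, the distance is at least 2^k h, hence
    d \<ge> 2^(k-1) h and the kernel is at most 2 h / d^2 \<le> 8 / (4^k h). For k = 0 the bound d
    \<ge> h is enough.\<close>
  define k where "k = (LEAST k. dist \<zeta> w < 2^(k+1) * h)"
  have k: "dist \<zeta> w < 2^(k+1) * h" unfolding k_def by (rule LeastI[of _ N]) (rule m)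
  have N: "k \<le> N" unfolding k_def by (rule Least_le) (rule m)
  have pk: "poisson (of_real r * \<zeta>) w \<le> 8 / (4^k * h)"
  proof (cases k)
    case 0
    have "2 * h / d\<^sup>2 \<le> 2 * h / h\<^sup>2" using d1 hp by (intro divide_left_mono power_mono) auto
    also have "\<dots> \<le> 8 / h" using hp by (simp add: power2_eq_square field_simps)
    finally show ?thesis using p 0 by simp
  next
    case (Suc j)
    have "\<not> dist \<zeta> w < 2^(j+1) * h" using not_less_Least[of j "\<lambda>k. dist \<zeta> w < 2^(k+1) * h"] Suc by (simp add: k_def)
    hence "2^k * h \<le> 2 * d" using d2 Suc by simp
    hence "(2^k * h)\<^sup>2 \<le> (2 * d)\<^sup>2" using hp by (intro power_mono) auto
    hence "4^k * h\<^sup>2 / 4 \<le> d\<^sup>2"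
    proof -
      have "(4::real)^k = (2^k)\<^sup>2" by (simp add: power2_eq_square flip: power_mult_distrib)
      thus ?thesis using \<open>(2^k * h)\<^sup>2 \<le> (2 * d)\<^sup>2\<close> by (simp add: power_mult_distrib)
    qed
    hence "2 * h / d\<^sup>2 \<le> 2 * h / (4^k * h\<^sup>2 / 4)" using hp d1 by (intro divide_left_mono) auto
    also have "\<dots> = 8 / (4^k * h)" using hp by (simp add: power2_eq_square field_simps)
    finally show ?thesis using p by simp
  qed
  show ?thesis
  proof -
    have "8 / (4^k * h) = (\<Sum>i\<in>{k}. 8 / (4^i * h) * indicator (ball \<zeta> (2^(i+1) * h)) w)"
      using k by (simp add: indicator_def)
    also have "\<dots> \<le> (\<Sum>k\<le>N. 8 / (4^k * h) * indicator (ball \<zeta> (2^(k+1) * h)) w)"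
      using N hp by (intro sum_mono2) auto
    finally show ?thesis
      using pk by (simp add: h_def)
  qed
qed

section \<open>Maximal functions and the weak-type inequality\<close>

lemma indicator_ball_measurable [measurable]:
  "(indicator (ball a s) :: complex \<Rightarrow> real) \<in> borel_measurable \<mu>"
proof -
  have "(indicator (ball a s) :: complex \<Rightarrow> real) \<in> borel_measurable borel"
    by (rule borel_measurable_indicator) simp
  hence "(indicator (ball a s) :: complex \<Rightarrow> real) \<in> borel_measurable (restrict_space borel (sphere 0 1))"
    by (rule measurable_restrict_space1)
  thus ?thesis using measurable_cong_sets[OF sets_circle_measure refl] by blast
qed

text \<open>By the assumption on balls the k-th shell contributes at most 8 / (4^k h) times l
  2^(k+1) h, that is 16 l / 2^k; the geometric series sums to at most 32 l, independently of
  r.\<close>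

lemma poisson_maximal_bound:
  assumes r: "0 \<le> r" "r < 1" and n: "norm \<zeta> = 1"
    and max: "\<And>s. s > 0 \<Longrightarrow> (\<integral>w. norm (rep_circle_L2 G w) * indicator (ball \<zeta> s) w \<partial>\<mu>) \<le> l * s"
  shows "(\<integral>w. norm (rep_circle_L2 G w) * poisson (of_real r * \<zeta>) w \<partial>\<mu>) \<le> 32 * l"
proof -
  define h where "h = 1 - r"
  have hp: "h > 0" using r by (simp add: h_def)
  have l: "0 \<le> l"
    using order_trans[OF Bochner_Integration.integral_nonneg max[of 1]] by simp
  define S where "S N w = (\<Sum>k\<le>N. 8 / (4^k * h) * indicator (ball \<zeta> (2^(k+1) * h)) w)" for N :: nat and w
  have int1: "integrable \<mu> (\<lambda>w. norm (rep_circle_L2 G w) * indicator (ball \<zeta> s) w)" for s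
    by (rule integrable_rep_mult_bounded[where C = 1]) (auto simp: indicator_def)
  have eqS: "norm (rep_circle_L2 G w) * S N w = (\<Sum>k\<le>N. 8 / (4^k * h) * (norm (rep_circle_L2 G w) * indicator (ball \<zeta> (2^(k+1) * h)) w))" for N w
    by (simp add: S_def sum_distrib_left mult_ac)
  have intS: "integrable \<mu> (\<lambda>w. norm (rep_circle_L2 G w) * S N w)" for N
    unfolding eqS by (intro Bochner_Integration.integrable_sum integrable_mult_right int1)
  have bS: "(\<integral>w. norm (rep_circle_L2 G w) * S N w \<partial>\<mu>) \<le> 32 * l" for N
  proof -
    have "(\<integral>w. norm (rep_circle_L2 G w) * S N w \<partial>\<mu>) = (\<Sum>k\<le>N. 8 / (4^k * h) * (\<integral>w. norm (rep_circle_L2 G w) * indicator (ball \<zeta> (2^(k+1) * h)) w \<partial>\<mu>))"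
      unfolding eqS by (subst Bochner_Integration.integral_sum) (auto intro!: integrable_mult_right int1)
    also have "\<dots> \<le> (\<Sum>k\<le>N. 8 / (4^k * h) * (l * (2^(k+1) * h)))"
      using hp by (intro sum_mono mult_left_mono max) auto
    also have "\<dots> = (\<Sum>k\<le>N. 16 * l * (1/2)^k)"
    proof (rule sum.cong[OF refl])
      fix k
      have "(4::real)^k = 2^k * 2^k" by (simp flip: power_mult_distrib)
      thus "8 / (4^k * h) * (l * (2^(k+1) * h)) = 16 * l * (1/2)^k"
        using hp by (simp add: field_simps)
    qed
    also have "\<dots> = 16 * l * (\<Sum>k\<le>N. (1/2)^k)" by (simp add: sum_distrib_left)
    also have "(\<Sum>k\<le>N. (1/2)^k) \<le> (2::real)"
      by (simp add: sum_gp0)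
    finally show ?thesis using l by (simp add: mult_left_mono)
  qed
  have z: "norm (of_real r * \<zeta>) < 1" using r n by (simp add: norm_mult)
  have mz [measurable]: "poisson (of_real r * \<zeta>) \<in> borel_measurable \<mu>"
    by (intro continuous_imp_measurable_circle poisson_continuous z)
  \<comment> \<open>The circle has diameter 2, so with this N the largest ball of the dyadic sum
    contains every w and the sum dominates the kernel on the whole circle.\<close>
  obtain N where N: "2 < 2^(N+1) * h"
  proof -
    obtain m where "2 / h < 2^m" using real_arch_pow[of 2 "2 / h"] by auto
    hence "2 < 2^m * h" using hp by (simp add: field_simps)
    also have "\<dots> \<le> 2^(m+1) * h" using hp by simp
    finally show ?thesis by (rule that)
  qed
  have pS: "poisson (of_real r * \<zeta>) w \<le> S N w" if w: "norm w = 1" for w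
  proof -
    have "dist \<zeta> w \<le> 2" using norm_triangle_ineq4[of \<zeta> w] n w by (simp add: dist_norm)
    thus ?thesis
      using poisson_dyadic_bound[OF r n w, of N] N by (simp add: S_def h_def)
  qed
  have "(\<integral>w. norm (rep_circle_L2 G w) * poisson (of_real r * \<zeta>) w \<partial>\<mu>) \<le> (\<integral>w. norm (rep_circle_L2 G w) * S N w \<partial>\<mu>)"
  proof (rule integral_mono_AE[OF _ intS])
    have "integrable \<mu> (\<lambda>w. norm (complex_of_real (poisson (of_real r * \<zeta>) w) * rep_circle_L2 G w))"
      by (intro circle_integral_norm_le(1) square_integrable_mult continuous_bounded_symbol
          continuous_intros poisson_continuous z square_integrable_rep)
    thus "integrable \<mu> (\<lambda>w. norm (rep_circle_L2 G w) * poisson (of_real r * \<zeta>) w)"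
      using poisson_nonneg[OF z] by (simp add: norm_mult mult.commute)
    show "AE w in circle_measure. norm (rep_circle_L2 G w) * poisson (of_real r * \<zeta>) w \<le> norm (rep_circle_L2 G w) * S N w"
      using pS by (intro AE_I2 mult_left_mono) auto
  qed
  also have "\<dots> \<le> 32 * l" by (rule bS)
  finally show ?thesis .
qed

text \<open>Continuity from below along an enumeration. It passes from the finite subfamilies, where
  sums and disjointness are exploited, to the countable family that Vitali's lemma supplies.\<close>

lemma measure_countable_UN_le:
  assumes C: "countable C" and sets: "\<And>i. i \<in> C \<Longrightarrow> X i \<in> sets \<mu>"
    and fin: "\<And>F. finite F \<Longrightarrow> F \<subseteq> C \<Longrightarrow> measure \<mu> (\<Union>i\<in>F. X i) \<le> c"
  shows "measure \<mu> (\<Union>i\<in>C. X i) \<le> c"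
proof (cases "C = {}")
  case True
  thus ?thesis using fin[of "{}"] by simp
next
  case False
  define Y where "Y n = (\<Union>i\<in>from_nat_into C ` {..n}. X i)" for n
  have sub: "from_nat_into C ` {..n} \<subseteq> C" for n
    using from_nat_into[OF False] by auto
  have "(\<Union>i\<in>C. X i) = (\<Union>n. Y n)"
  proof -
    have "C = range (from_nat_into C)" using range_from_nat_into[OF False C] by simp
    hence "(\<Union>i\<in>C. X i) = (\<Union>n. X (from_nat_into C n))" by (metis image_image)
    thus ?thesis by (auto simp: Y_def)
  qed
  moreover have "(\<lambda>n. measure \<mu> (Y n)) \<longlonglongrightarrow> measure \<mu> (\<Union>n. Y n)"
  proof (rule circle_measure.finite_Lim_measure_incseq)
    show "range Y \<subseteq> sets \<mu>"
      using sub sets unfolding Y_def by (intro image_subsetI sets.finite_UN) auto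
    show "incseq Y" unfolding Y_def by (intro incseq_SucI UN_mono) auto
  qed
  moreover have "measure \<mu> (Y n) \<le> c" for n
    unfolding Y_def using sub by (intro fin) auto
  ultimately show ?thesis by (simp add: LIMSEQ_le_const2)
qed

text \<open>Means over balls are compared with the radius s instead of the measure of the arc.
  Vitali's lemma gives disjoint balls whose 5-fold enlargements cover the bad set A. An enlargement
  has measure at most 45 r / pi, r is below J / l, and by disjointness the J sum up to at most the
  L1 norm. W is the union of the enlargements, a countable union of measurable sets.\<close>

lemma Hardy_Littlewood_weak_type:
  assumes l: "l > 0"
  obtains W where "W \<in> sets \<mu>" "measure \<mu> W \<le> 45 / (pi * l) * norm G"
    "\<And>\<zeta> s. norm \<zeta> = 1 \<Longrightarrow> \<zeta> \<notin> W \<Longrightarrow> s > 0 \<Longrightarrow> (\<integral>w. norm (rep_circle_L2 G w) * indicator (ball \<zeta> s) w \<partial>\<mu>) \<le> l * s"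
proof -
  define J where "J \<zeta> s = (\<integral>w. norm (rep_circle_L2 G w) * indicator (ball \<zeta> s) w \<partial>\<mu>)" for \<zeta> s
  define A where "A = {\<zeta>. norm \<zeta> = 1 \<and> (\<exists>s>0. J \<zeta> s > l * s)}"
  obtain r where r: "\<And>\<zeta>. \<zeta> \<in> A \<Longrightarrow> r \<zeta> > 0 \<and> J \<zeta> (r \<zeta>) > l * r \<zeta>"
  proof -
    have "\<forall>\<zeta>\<in>A. \<exists>s. s > 0 \<and> J \<zeta> s > l * s" by (auto simp: A_def)
    then obtain r where "\<forall>\<zeta>\<in>A. r \<zeta> > 0 \<and> J \<zeta> (r \<zeta>) > l * r \<zeta>" by (rule bchoice[THEN exE])
    thus ?thesis using that by blast
  qed
  have iG: "integrable \<mu> (\<lambda>w. norm (rep_circle_L2 G w))"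
    by (rule circle_integral_norm_le(1)) simp
  have nG: "(\<integral>w. norm (rep_circle_L2 G w) \<partial>\<mu>) \<le> norm G"
    using circle_integral_norm_le(3)[OF square_integrable_rep[of G]] by simp
  have iJ: "integrable \<mu> (\<lambda>w. norm (rep_circle_L2 G w) * indicator (ball \<zeta> s) w)" for \<zeta> s
    by (rule integrable_rep_mult_bounded[where C = 1]) (auto simp: indicator_def)
  have JG: "J \<zeta> s \<le> norm G" for \<zeta> s
  proof -
    have "J \<zeta> s \<le> (\<integral>w. norm (rep_circle_L2 G w) \<partial>\<mu>)"
      unfolding J_def by (intro integral_mono iJ iG) (auto simp: indicator_def)
    thus ?thesis using nG by simp
  qed
  have rB: "0 < r \<zeta> \<and> r \<zeta> \<le> norm G / l" if "\<zeta> \<in> A" for \<zeta>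
    using r[OF that] JG[of \<zeta> "r \<zeta>"] l by (auto simp: field_simps)
  obtain C where C: "countable C" "C \<subseteq> A"
     "pairwise (\<lambda>i j. disjnt (cball i (r i)) (cball j (r j))) C"
     "\<And>i. i \<in> A \<Longrightarrow> \<exists>j. j \<in> C \<and> \<not> disjnt (cball i (r i)) (cball j (r j)) \<and> cball i (r i) \<subseteq> ball j (5 * r j)"
    using Vitali_covering_lemma_cballs_balls[of A r "norm G / l" "\<lambda>x. x", OF rB] by blast
  define X where "X j = ball j (5 * r j) \<inter> sphere 0 1" for j :: complex
  have XC: "X j \<in> sets \<mu>" "measure \<mu> (X j) \<le> 9 * (5 * r j) / pi" if "j \<in> C" for j
    using measure_circle_ball[of j "5 * r j"] that C(2) rB by (auto simp: X_def A_def)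
  show ?thesis
  proof (rule that[of "\<Union>j\<in>C. X j"])
    show "(\<Union>j\<in>C. X j) \<in> sets \<mu>" using C(1) XC by auto
    show "measure \<mu> (\<Union>j\<in>C. X j) \<le> 45 / (pi * l) * norm G"
    proof (rule measure_countable_UN_le[OF C(1) XC(1)])
      fix F assume F: "finite F" "F \<subseteq> C"
      have "measure \<mu> (\<Union>j\<in>F. X j) \<le> (\<Sum>j\<in>F. measure \<mu> (X j))"
        using F XC by (intro measure_UNION_le) auto
      also have "\<dots> \<le> (\<Sum>j\<in>F. 45 / (pi * l) * J j (r j))"
      proof (rule sum_mono)
        fix j assume j: "j \<in> F"
        hence "j \<in> A" using F C by auto
        have "measure \<mu> (X j) \<le> 45 / pi * r j" using XC(2)[of j] j F by auto
        also have "\<dots> \<le> 45 / pi * (J j (r j) / l)"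
          using r[OF \<open>j \<in> A\<close>] l by (intro mult_left_mono) (auto simp: field_simps)
        finally show "measure \<mu> (X j) \<le> 45 / (pi * l) * J j (r j)" by simp
      qed
      also have "\<dots> = 45 / (pi * l) * (\<Sum>j\<in>F. J j (r j))" by (simp add: sum_distrib_left)
      also have "\<dots> \<le> 45 / (pi * l) * norm G"
      proof (rule mult_left_mono)
        have "(\<Sum>j\<in>F. J j (r j)) = (\<integral>w. (\<Sum>j\<in>F. norm (rep_circle_L2 G w) * indicator (ball j (r j)) w) \<partial>\<mu>)"
          unfolding J_def by (rule Bochner_Integration.integral_sum[symmetric]) (rule iJ)
        also have "\<dots> \<le> (\<integral>w. norm (rep_circle_L2 G w) \<partial>\<mu>)"
        proof (rule integral_mono[OF _ iG])
          show "integrable \<mu> (\<lambda>w. \<Sum>j\<in>F. norm (rep_circle_L2 G w) * indicator (ball j (r j)) w)"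
            by (intro Bochner_Integration.integrable_sum iJ)
          fix w
          have "(\<Sum>j\<in>F. indicator (ball j (r j)) w) \<le> (1::real)"
          proof (cases "\<exists>j\<in>F. w \<in> ball j (r j)")
            case True
            then obtain j where j: "j \<in> F" "w \<in> ball j (r j)" by blast
            have "w \<notin> ball i (r i)" if i: "i \<in> F" "i \<noteq> j" for i
            proof
              assume "w \<in> ball i (r i)"
              moreover have "disjnt (cball i (r i)) (cball j (r j))"
                using C(3) i j F unfolding pairwise_def by blast
              moreover have "ball i (r i) \<subseteq> cball i (r i)" "ball j (r j) \<subseteq> cball j (r j)" by auto
              ultimately show False using j(2) unfolding disjnt_iff by blast
            qed
            hence "(\<Sum>j\<in>F. indicator (ball j (r j)) w) = (\<Sum>i\<in>F. if i = j then 1 else (0::real))"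
              using j(2) by (intro sum.cong) (auto simp: indicator_def)
            thus ?thesis using F(1) j(1) by simp
          qed (simp add: indicator_def)
          hence "norm (rep_circle_L2 G w) * (\<Sum>j\<in>F. indicator (ball j (r j)) w) \<le> norm (rep_circle_L2 G w) * 1"
            by (intro mult_left_mono) auto
          thus "(\<Sum>j\<in>F. norm (rep_circle_L2 G w) * indicator (ball j (r j)) w) \<le> norm (rep_circle_L2 G w)"
            by (simp add: sum_distrib_left)
        qed
        finally show "(\<Sum>j\<in>F. J j (r j)) \<le> norm G" using nG by simp
      qed (use l in simp)
      finally show "measure \<mu> (\<Union>j\<in>F. X j) \<le> 45 / (pi * l) * norm G" .
    qed
    fix \<zeta> s assume z: "norm \<zeta> = 1" "\<zeta> \<notin> (\<Union>j\<in>C. X j)" "s > (0::real)"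
    have "\<zeta> \<notin> A"
    proof
      assume "\<zeta> \<in> A"
      then obtain j where "j \<in> C" "cball \<zeta> (r \<zeta>) \<subseteq> ball j (5 * r j)" using C(4) by blast
      moreover have "\<zeta> \<in> cball \<zeta> (r \<zeta>)" using rB[OF \<open>\<zeta> \<in> A\<close>] by simp
      ultimately have "\<zeta> \<in> ball j (5 * r j)" by blast
      hence "\<zeta> \<in> X j" using z(1) by (simp add: X_def)
      thus False using z(2) \<open>j \<in> C\<close> by blast
    qed
    hence "\<not> (\<exists>s>0. l * s < J \<zeta> s)" using z(1) by (simp add: A_def)
    hence "J \<zeta> s \<le> l * s" using z(3) by (meson not_less)
    thus "(\<integral>w. norm (rep_circle_L2 G w) * indicator (ball \<zeta> s) w \<partial>\<mu>) \<le> l * s" by (simp add: J_def)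
  qed
qed

text \<open>The bound is uniform on compact parts of the disk, so L2 convergence of boundary values
  implies locally uniform convergence of the functions.\<close>

lemma norm_szego_le:
  assumes "norm z < 1" shows "norm (szego z) \<le> 1 / (1 - norm z)"
proof (rule power2_le_imp_le)
  have "(norm (szego z))\<^sup>2 = (\<integral>w. (norm (1 / (1 - cnj z * w)))\<^sup>2 \<partial>\<mu>)"
    unfolding szego_def by (rule L2_norm_abs_square[OF square_integrable_continuous[OF szego_continuous[OF assms]]])
  also have "\<dots> \<le> (\<integral>w. (1 / (1 - norm z))\<^sup>2 \<partial>\<mu>)"
  proof (rule integral_mono_AE)
    show "integrable \<mu> (\<lambda>w. (norm (1 / (1 - cnj z * w)))\<^sup>2)"
      by (intro circle_integrable_continuous continuous_intros szego_continuous assms)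
    show "AE w in circle_measure. (norm (1 / (1 - cnj z * w)))\<^sup>2 \<le> (1 / (1 - norm z))\<^sup>2"
    proof (rule AE_I2)
      fix w assume "w \<in> space \<mu>"
      hence "1 - norm z \<le> norm (1 - cnj z * w)"
        using norm_triangle_ineq2[of 1 "cnj z * w"] by (simp add: norm_mult)
      hence "norm (1 / (1 - cnj z * w)) \<le> 1 / (1 - norm z)"
        using assms by (simp add: norm_divide frac_le)
      thus "(norm (1 / (1 - cnj z * w)))\<^sup>2 \<le> (1 / (1 - norm z))\<^sup>2" by (intro power_mono) auto
    qed
  qed simp
  finally show "(norm (szego z))\<^sup>2 \<le> (1 / (1 - norm z))\<^sup>2" by simp
qed (use assms in simp)

text \<open>The candidate f z is the inner product of F with \<open>szego z\<close>; it is
  holomorphic by locally uniform convergence and in the Hardy class by the Poisson mean. Outside W j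
  the Poisson integral of G j is at most 32 (1/2)^j along the whole radius, and outside V j the
  boundary values of F and its approximant differ by less than (1/2)^j. By Borel--Cantelli almost
  every point avoids W j and V j for all large j, so the radial limits of the approximants carry
  over to f.\<close>

lemma closed_hardy_H2: "closed hardy_H2"
  unfolding closed_sequential_limits
proof (intro allI impI)
  fix Fk F assume "(\<forall>n. Fk n \<in> hardy_H2) \<and> Fk \<longlonglongrightarrow> F"
  hence Fk: "\<And>n. Fk n \<in> hardy_H2" "Fk \<longlonglongrightarrow> F" by auto
  have "\<exists>f. hardy_disk f \<and> boundary_value f (Fk n) \<and> (\<forall>l. norm l < 1 \<longrightarrow> f l = Fk n \<cdot> szego l)" for n
    using hardy_H2E[OF Fk(1)[of n]] by metis
  then obtain fk where fk: "\<And>n. hardy_disk (fk n)" "\<And>n. boundary_value (fk n) (Fk n)"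
    "\<And>n l. norm l < 1 \<Longrightarrow> fk n l = Fk n \<cdot> szego l" by metis
  define f where "f z = F \<cdot> szego z" for z
  have cosz: "F \<cdot> coszego z = 0" if "norm z < 1" for z
  proof -
    have "(\<lambda>n. Fk n \<cdot> coszego z) \<longlonglongrightarrow> F \<cdot> coszego z"
      by (rule tendsto_cinner_left[OF Fk(2)])
    thus ?thesis
      using hardy_cinner_coszego[OF fk(1,2) that] by (simp add: LIMSEQ_const_iff)
  qed
  have diff: "norm (fk n z - f z) \<le> norm (Fk n - F) * (1 / (1 - norm z))" if "norm z < 1" for n z
  proof -
    have "norm (fk n z - f z) \<le> norm (Fk n - F) * norm (szego z)"
      unfolding fk(3)[OF that] f_def cinner_diff_left[symmetric] by (rule cinner_Cauchy_Schwarz)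
    also have "\<dots> \<le> norm (Fk n - F) * (1 / (1 - norm z))"
      using norm_szego_le[OF that] by (intro mult_left_mono) auto
    finally show ?thesis .
  qed
  have d0: "(\<lambda>n. norm (Fk n - F)) \<longlonglongrightarrow> 0"
    using Fk(2) tendsto_norm_zero LIM_zero by blast
  have "f holomorphic_on ball 0 1"
  proof (rule holomorphic_uniform_sequence[of _ fk])
    show "fk n holomorphic_on ball 0 1" for n by (rule hardy_disk_holomorphic[OF fk(1)])
    fix x :: complex assume x: "x \<in> ball 0 1"
    define d where "d = (1 - norm x) / 2"
    have d: "d > 0" "norm x + d < 1" using x by (auto simp: d_def field_simps)
    have nz: "norm z \<le> norm x + d" if "z \<in> cball x d" for z
      using that norm_triangle_sub[of z x] by (simp add: dist_norm norm_minus_commute)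
    have "uniform_limit (cball x d) fk f sequentially"
    proof (rule uniform_limitI)
      fix e :: real assume e: "e > 0"
      have "(\<lambda>n. norm (Fk n - F) * (1 / (1 - (norm x + d)))) \<longlonglongrightarrow> 0"
        using tendsto_mult_right[OF d0, of "1 / (1 - (norm x + d))"] by simp
      hence "\<forall>\<^sub>F n in sequentially. norm (Fk n - F) * (1 / (1 - (norm x + d))) < e"
        by (rule order_tendstoD(2)[OF _ e])
      thus "\<forall>\<^sub>F n in sequentially. \<forall>z\<in>cball x d. dist (fk n z) (f z) < e"
      proof eventually_elim
        case (elim n)
        show ?case
        proof
          fix z assume z: "z \<in> cball x d"
          have "norm (fk n z - f z) \<le> norm (Fk n - F) * (1 / (1 - norm z))"
            using nz[OF z] d by (intro diff) simp
          also have "\<dots> \<le> norm (Fk n - F) * (1 / (1 - (norm x + d)))"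
            using nz[OF z] d by (intro mult_left_mono divide_left_mono) auto
          finally show "dist (fk n z) (f z) < e" using elim by (simp add: dist_norm)
        qed
      qed
    qed
    moreover have "cball x d \<subseteq> ball 0 1" using nz d by fastforce
    ultimately show "\<exists>d>0. cball x d \<subseteq> ball 0 1 \<and> uniform_limit (cball x d) fk f sequentially"
      using d by blast
  qed simp
  note f_hol = this
  have f_hardy: "hardy_disk f"
  proof (rule hardy_diskI[OF f_hol])
    fix r :: real assume r: "0 \<le> r" "r < 1"
    have "ennreal (\<integral>\<zeta>. (norm (f (of_real r * \<zeta>)))\<^sup>2 \<partial>\<mu>) = (\<integral>\<^sup>+\<zeta>. ennreal ((norm (f (of_real r * \<zeta>)))\<^sup>2) \<partial>\<mu>)"
      by (rule nn_integral_eq_integral[symmetric, OF slice_integrable[OF f_hol r]]) auto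
    also have "\<dots> \<le> ennreal ((norm F)\<^sup>2)"
      unfolding f_def by (rule norm_poisson_mean_square[OF r cosz])
    finally show "(\<integral>\<zeta>. (norm (f (of_real r * \<zeta>)))\<^sup>2 \<partial>\<mu>) \<le> (norm F)\<^sup>2"
      by simp
  qed
  \<comment> \<open>Distances (1/4)^j against thresholds (1/2)^j make the measures of both
    exceptional sets summable.\<close>
  have "\<forall>j. \<exists>n. norm (F - Fk n) \<le> (1/4)^j"
  proof
    fix j :: nat
    have "\<forall>\<^sub>F n in sequentially. norm (Fk n - F) < (1/4)^j"
      by (rule order_tendstoD(2)[OF d0]) simp
    thus "\<exists>n. norm (F - Fk n) \<le> (1/4)^j"
      by (auto simp: eventually_sequentially norm_minus_commute intro: less_imp_le)
  qed
  then obtain k where k: "\<And>j. norm (F - Fk (k j)) \<le> (1/4)^j" by metis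
  define G where "G j = F - Fk (k j)" for j
  have "\<exists>W. W \<in> sets \<mu> \<and> measure \<mu> W \<le> 45 / (pi * (1/2)^j) * norm (G j) \<and>
     (\<forall>\<zeta> s. norm \<zeta> = 1 \<longrightarrow> \<zeta> \<notin> W \<longrightarrow> s > 0 \<longrightarrow> (\<integral>w. norm (rep_circle_L2 (G j) w) * indicator (ball \<zeta> s) w \<partial>\<mu>) \<le> (1/2)^j * s)" for j
  proof -
    have "(1/2::real)^j > 0" by simp
    then obtain W where "W \<in> sets \<mu>" "measure \<mu> W \<le> 45 / (pi * (1/2)^j) * norm (G j)"
      "\<And>\<zeta> s. norm \<zeta> = 1 \<Longrightarrow> \<zeta> \<notin> W \<Longrightarrow> s > 0 \<Longrightarrow> (\<integral>w. norm (rep_circle_L2 (G j) w) * indicator (ball \<zeta> s) w \<partial>\<mu>) \<le> (1/2)^j * s"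
      by (rule Hardy_Littlewood_weak_type[where G = "G j"]) (rule that)
    thus ?thesis by (intro exI[of _ W]) simp
  qed
  from choice[OF allI[OF this]] obtain W where W0: "\<forall>j. W j \<in> sets \<mu> \<and> measure \<mu> (W j) \<le> 45 / (pi * (1/2)^j) * norm (G j) \<and>
     (\<forall>\<zeta> s. norm \<zeta> = 1 \<longrightarrow> \<zeta> \<notin> W j \<longrightarrow> s > 0 \<longrightarrow> (\<integral>w. norm (rep_circle_L2 (G j) w) * indicator (ball \<zeta> s) w \<partial>\<mu>) \<le> (1/2)^j * s)" ..
  hence W: "\<And>j. W j \<in> sets \<mu>" "\<And>j. measure \<mu> (W j) \<le> 45 / (pi * (1/2)^j) * norm (G j)"
    "\<And>j \<zeta> s. norm \<zeta> = 1 \<Longrightarrow> \<zeta> \<notin> W j \<Longrightarrow> s > 0 \<Longrightarrow> (\<integral>w. norm (rep_circle_L2 (G j) w) * indicator (ball \<zeta> s) w \<partial>\<mu>) \<le> (1/2)^j * s"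
    by simp_all
  define V where "V j = {z \<in> space circle_measure. (1/2)^j \<le> norm (rep_circle_L2 (G j) z)}" for j
  have Vm: "V j \<in> sets \<mu>" for j unfolding V_def by measurable
  have q: "(1/4)^j / (1/2)^j = (1/2::real)^j" for j
    by (simp add: power_divide[symmetric] flip: power_divide)
  have mW: "norm (measure \<mu> (W j)) \<le> 45 / pi * (1/2)^j" for j
  proof -
    have "measure \<mu> (W j) \<le> 45 / (pi * (1/2)^j) * (1/4)^j"
      using W(2)[of j] k[of j] by (intro order_trans[OF W(2)] mult_left_mono) (auto simp: G_def)
    also have "\<dots> = 45 / pi * ((1/4)^j / (1/2)^j)" by simp
    finally show ?thesis unfolding q by simp
  qed
  have mV: "norm (measure \<mu> (V j)) \<le> (1/2)^j" for j
  proof -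
    have "measure \<mu> (V j) \<le> (\<integral>w. norm (rep_circle_L2 (G j) w) \<partial>\<mu>) / (1/2)^j"
      unfolding V_def using sets.top[of \<mu>]
      by (intro integral_Markov_inequality_measure[where A = "space \<mu>"])
        (auto intro!: circle_integral_norm_le(1))
    also have "\<dots> \<le> (1/4)^j / (1/2)^j"
      using circle_integral_norm_le(3)[OF square_integrable_rep, of "G j"] k[of j]
      by (intro divide_right_mono) (auto simp: G_def)
    finally show ?thesis unfolding q by simp
  qed
  have geo: "summable (\<lambda>j. (1/2::real)^j)" by (intro summable_geometric) simp
  have "AE \<zeta> in circle_measure. \<forall>\<^sub>F j in sequentially. \<zeta> \<in> space \<mu> - W j"
    by (rule borel_cantelli_AE1[OF W(1)])
       (auto intro!: summable_comparison_test'[OF summable_mult[OF geo, of "45/pi"]] mW simp: circle_measure.emeasure_eq_measure)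
  moreover have "AE \<zeta> in circle_measure. \<forall>\<^sub>F j in sequentially. \<zeta> \<in> space \<mu> - V j"
    by (rule borel_cantelli_AE1[OF Vm])
       (auto intro!: summable_comparison_test'[OF geo] mV simp: circle_measure.emeasure_eq_measure)
  moreover have "AE \<zeta> in circle_measure. \<forall>n. ((\<lambda>r. fk n (of_real r * \<zeta>)) \<longlongrightarrow> rep_circle_L2 (Fk n) \<zeta>) (at_left 1)"
    using fk(2) unfolding boundary_value_def by (intro AE_all_countable[THEN iffD2] allI)
  moreover have "AE \<zeta> in circle_measure. \<forall>j. rep_circle_L2 (G j) \<zeta> = rep_circle_L2 F \<zeta> - rep_circle_L2 (Fk (k j)) \<zeta>"
    unfolding G_def by (intro AE_all_countable[THEN iffD2] allI rep_diff)
  ultimately have "boundary_value f F"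
    unfolding boundary_value_def
  proof eventually_elim
    case (elim \<zeta>)
    show ?case
    proof (rule tendstoI)
      fix e :: real assume e: "e > 0"
      \<comment> \<open>33 is 32 for the Poisson integral plus 1 for the boundary values; the other
        e / 2 is spent on the radial limit of the approximant.\<close>
      have "\<forall>\<^sub>F j in sequentially. 33 * (1/2)^j < e / 2"
      proof -
        have "(\<lambda>j. 33 * (1/2::real)^j) \<longlonglongrightarrow> 33 * 0" by (intro tendsto_intros LIMSEQ_power_zero) simp
        thus ?thesis by (rule order_tendstoD(2)) (use e in simp)
      qed
      with elim(1,2) have "\<forall>\<^sub>F j in sequentially. \<zeta> \<in> space \<mu> - W j \<and> \<zeta> \<in> space \<mu> - V j \<and> 33 * (1/2)^j < e / 2"
        by eventually_elim auto
      then obtain j where j: "norm \<zeta> = 1" "\<zeta> \<notin> W j" "\<zeta> \<notin> V j" "33 * (1/2)^j < e / 2"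
        by (auto simp: eventually_sequentially)
      have "\<forall>\<^sub>F r in at_left 1. dist (fk (k j) (of_real r * \<zeta>)) (rep_circle_L2 (Fk (k j)) \<zeta>) < e / 2"
        using elim(3) e by (intro tendstoD) auto
      moreover have "\<forall>\<^sub>F r in at_left (1::real). r \<in> {0<..<1}"
        by (rule eventually_at_left_real) simp
      ultimately show "\<forall>\<^sub>F r in at_left 1. dist (f (of_real r * \<zeta>)) (rep_circle_L2 F \<zeta>) < e"
      proof eventually_elim
        case (elim r)
        have z: "norm (of_real r * \<zeta>) < 1" using elim(2) j(1) by (simp add: norm_mult)
        have "norm (f (of_real r * \<zeta>) - fk (k j) (of_real r * \<zeta>)) = norm (G j \<cdot> szego (of_real r * \<zeta>))"
          unfolding fk(3)[OF z] f_def G_def cinner_diff_left ..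
        also have "\<dots> \<le> (\<integral>w. norm (rep_circle_L2 (G j) w) * poisson (of_real r * \<zeta>) w \<partial>\<mu>)"
          using cosz[OF z] hardy_cinner_coszego[OF fk(1,2) z]
          by (intro norm_poisson_le z) (simp add: G_def cinner_diff_left)
        also have "\<dots> \<le> 32 * (1/2)^j"
          using elim(2) by (intro poisson_maximal_bound W(3) j) auto
        finally have 1: "norm (f (of_real r * \<zeta>) - fk (k j) (of_real r * \<zeta>)) \<le> 32 * (1/2)^j" .
        have 2: "norm (rep_circle_L2 (Fk (k j)) \<zeta> - rep_circle_L2 F \<zeta>) \<le> (1/2)^j"
          using j(1,3) \<open>\<forall>j. rep_circle_L2 (G j) \<zeta> = rep_circle_L2 F \<zeta> - rep_circle_L2 (Fk (k j)) \<zeta>\<close>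
          by (auto simp: V_def norm_minus_commute)
        have "dist (f (of_real r * \<zeta>)) (rep_circle_L2 F \<zeta>) \<le> norm (f (of_real r * \<zeta>) - fk (k j) (of_real r * \<zeta>))
           + dist (fk (k j) (of_real r * \<zeta>)) (rep_circle_L2 (Fk (k j)) \<zeta>) + norm (rep_circle_L2 (Fk (k j)) \<zeta> - rep_circle_L2 F \<zeta>)"
          unfolding dist_norm
          using norm_triangle_ineq[of "f (of_real r * \<zeta>) - fk (k j) (of_real r * \<zeta>)" "fk (k j) (of_real r * \<zeta>) - rep_circle_L2 F \<zeta>"]
            norm_triangle_ineq[of "fk (k j) (of_real r * \<zeta>) - rep_circle_L2 (Fk (k j)) \<zeta>" "rep_circle_L2 (Fk (k j)) \<zeta> - rep_circle_L2 F \<zeta>"]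
          by simp
        thus ?case using 1 2 elim(1) j(4) by simp
      qed
    qed
  qed
  with f_hardy show "F \<in> hardy_H2" by (auto simp: hardy_H2_def)
qed

section \<open>Model spaces\<close>

definition L2_one :: circle_L2 where "L2_one = abs_circle_L2 (\<lambda>z. 1)"

definition shift :: "circle_L2 \<Rightarrow> circle_L2" where "shift = L2_mult (\<lambda>z. z)"

definition coshift :: "circle_L2 \<Rightarrow> circle_L2" where "coshift = L2_mult cnj"

lemma bounded_symbol_id: "bounded_symbol (\<lambda>z. z)"
  and bounded_symbol_cnj_id: "bounded_symbol cnj"
  by (intro continuous_bounded_symbol continuous_intros)+

lemma L2_one_szego: "L2_one = szego 0"
  by (simp add: L2_one_def szego_def)

lemma L2_one_hardy: "L2_one \<in> hardy_H2"
  using boundary_value_continuous[of "\<lambda>_. 1"] hardy_disk_const by (auto simp: hardy_H2_def L2_one_def)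

lemma norm_L2_one: "norm L2_one = 1"
proof -
  have "(norm L2_one)\<^sup>2 = 1"
    unfolding L2_one_def by (subst L2_norm_abs_square) (auto intro!: square_integrable_continuous)
  thus ?thesis using norm_ge_zero[of L2_one] by (auto simp: power2_eq_1_iff simp del: norm_ge_zero)
qed

lemma shift_coshift [simp]: "shift (coshift F) = F"
proof -
  have "L2_mult (\<lambda>z. z * cnj z) F = L2_mult (\<lambda>z. 1) F"
    by (rule L2_mult_cong) (auto intro: circle_z_cnj bounded_symbol_mult bounded_symbol_id bounded_symbol_cnj_id)
  thus ?thesis
    unfolding shift_def coshift_def L2_mult_mult[OF bounded_symbol_id bounded_symbol_cnj_id, symmetric]
    by (simp add: L2_mult_const)
qed

lemma coshift_shift [simp]: "coshift (shift F) = F"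
proof -
  have "L2_mult (\<lambda>z. cnj z * z) F = L2_mult (\<lambda>z. 1) F"
    by (rule L2_mult_cong) (auto intro: bounded_symbol_mult bounded_symbol_id bounded_symbol_cnj_id simp: circle_z_cnj mult.commute)
  thus ?thesis
    unfolding shift_def coshift_def L2_mult_mult[OF bounded_symbol_cnj_id bounded_symbol_id, symmetric]
    by (simp add: L2_mult_const)
qed

lemma shift_linear: "shift (F + G) = shift F + shift G" "shift (c *\<^sub>C F) = c *\<^sub>C shift F"
  by (simp_all add: shift_def L2_mult_add L2_mult_scaleC bounded_symbol_id)

lemma coshift_linear: "coshift (F + G) = coshift F + coshift G" "coshift (c *\<^sub>C F) = c *\<^sub>C coshift F"
  by (simp_all add: coshift_def L2_mult_add L2_mult_scaleC bounded_symbol_cnj_id)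

lemma coshift_diff: "coshift (F - G) = coshift F - coshift G"
  using coshift_linear(1)[of F "- G"] coshift_linear(2)[of "-1" G] by (simp add: scaleC_minus_one)

lemma shift_diff: "shift (F - G) = shift F - shift G"
  using shift_linear(1)[of F "- G"] shift_linear(2)[of "-1" G] by (simp add: scaleC_minus_one)

lemma cinner_shift: "shift F \<cdot> G = F \<cdot> coshift G"
  using cinner_L2_mult[OF bounded_symbol_id] by (simp add: shift_def coshift_def)

lemma cinner_coshift: "coshift F \<cdot> G = F \<cdot> shift G"
  using cinner_shift[of "coshift F" "shift G"] by simp

lemma norm_shift [simp]: "norm (shift F) = norm F"
proof -
  have "complex_of_real ((norm (shift F))\<^sup>2) = complex_of_real ((norm F)\<^sup>2)"
    unfolding cinner_self[symmetric] cinner_shift by simp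
  hence "(norm (shift F))\<^sup>2 = (norm F)\<^sup>2" using of_real_eq_iff by blast
  thus ?thesis by simp
qed

lemma norm_coshift [simp]: "norm (coshift F) = norm F"
  using norm_shift[of "coshift F"] by simp

lemma shift_boundary_value:
  assumes "boundary_value f F" shows "boundary_value (\<lambda>z. z * f z) (shift F)"
  unfolding shift_def
proof (rule boundary_value_L2_mult[OF assms bounded_symbol_id])
  show "AE \<zeta> in circle_measure. ((\<lambda>r. of_real r * \<zeta>) \<longlongrightarrow> \<zeta>) (at_left 1)"
    using tendsto_mult_right[OF of_real_at_left] by (intro AE_I2) simp
qed

lemma shift_hardy: assumes "F \<in> hardy_H2" shows "shift F \<in> hardy_H2"
proof -
  obtain f where f: "hardy_disk f" "boundary_value f F" using hardy_H2E[OF assms] by metis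
  have "hardy_disk (\<lambda>z. z * f z)" by (rule hardy_disk_mult[OF f(1), where C = 1]) auto
  thus ?thesis using shift_boundary_value[OF f(2)] by (auto simp: hardy_H2_def)
qed

lemma shift_hardy_szego:
  assumes "F \<in> hardy_H2" "norm l < 1" shows "shift F \<cdot> szego l = l * (F \<cdot> szego l)"
proof -
  obtain f where f: "hardy_disk f" "boundary_value f F" "\<And>l. norm l < 1 \<Longrightarrow> f l = F \<cdot> szego l" 
    using hardy_H2E[OF assms(1)] by metis
  have "hardy_disk (\<lambda>z. z * f z)" by (rule hardy_disk_mult[OF f(1), where C = 1]) auto
  from hardy_Cauchy[OF this shift_boundary_value[OF f(2)] assms(2)] show ?thesis using f(3)[OF assms(2)] by simp
qed

lemma shift_hardy_one: "F \<in> hardy_H2 \<Longrightarrow> shift F \<cdot> L2_one = 0"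
  using shift_hardy_szego[of F 0] by (simp add: L2_one_szego)

text \<open>This is the backward shift (f - f 0) / z. The quotient g is bounded on the disk of
  radius 1/2 around its removable singularity, and outside it division by z costs a factor of at
  most 2, hence 4 in the mean square.\<close>

lemma coshift_hardy:
  assumes F: "F \<in> hardy_H2"
  shows "coshift (F - (F \<cdot> L2_one) *\<^sub>C L2_one) \<in> hardy_H2"
proof -
  obtain f where f: "hardy_disk f" "boundary_value f F" "\<And>l. norm l < 1 \<Longrightarrow> f l = F \<cdot> szego l" 
    using hardy_H2E[OF F] by metis
  have f0: "f 0 = F \<cdot> L2_one" using f(3)[of 0] by (simp add: L2_one_szego)
  define g where "g z = (if z = 0 then deriv f 0 else (f z - f 0) / (z - 0))" for z
  have ghol: "g holomorphic_on ball 0 1"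
    unfolding g_def using pole_lemma[OF hardy_disk_holomorphic[OF f(1)], of 0] by (simp add: fun_eq_iff)
  define h where "h z = f z + (- f 0)" for z
  have h: "hardy_disk h" unfolding h_def by (intro hardy_disk_add f hardy_disk_const)
  obtain M where M: "0 \<le> M" "\<And>r. 0 \<le> r \<Longrightarrow> r < 1 \<Longrightarrow> (\<integral>\<zeta>. (norm (h (of_real r * \<zeta>)))\<^sup>2 \<partial>\<mu>) \<le> M"
    using hardy_disk_bound[OF h] by blast
  have "compact (g ` cball 0 (1/2))"
    by (intro compact_continuous_image continuous_on_subset[OF holomorphic_on_imp_continuous_on[OF ghol]]) auto
  then obtain C where C: "\<And>z. z \<in> cball 0 (1/2) \<Longrightarrow> norm (g z) \<le> C"
    using compact_imp_bounded bounded_iff by (metis imageI)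
  have "hardy_disk g"
  proof (rule hardy_diskI[OF ghol, where M = "max (C\<^sup>2) (4 * M)"])
    fix r :: real assume r: "0 \<le> r" "r < 1"
    show "(\<integral>\<zeta>. (norm (g (of_real r * \<zeta>)))\<^sup>2 \<partial>\<mu>) \<le> max (C\<^sup>2) (4 * M)"
    proof (cases "r \<le> 1/2")
      case True
      have "(\<integral>\<zeta>. (norm (g (of_real r * \<zeta>)))\<^sup>2 \<partial>\<mu>) \<le> (\<integral>\<zeta>. C\<^sup>2 \<partial>\<mu>)"
        by (rule integral_mono_AE[OF slice_integrable[OF ghol r]])
           (use C r True in \<open>auto intro!: AE_I2 power_mono simp: norm_mult\<close>)
      thus ?thesis by simp
    next
      case False
      have "(\<integral>\<zeta>. (norm (g (of_real r * \<zeta>)))\<^sup>2 \<partial>\<mu>) \<le> (\<integral>\<zeta>. 4 * (norm (h (of_real r * \<zeta>)))\<^sup>2 \<partial>\<mu>)"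
      proof (rule integral_mono_AE[OF slice_integrable[OF ghol r]])
        show "integrable \<mu> (\<lambda>\<zeta>. 4 * (norm (h (of_real r * \<zeta>)))\<^sup>2)"
          using slice_integrable[OF hardy_disk_holomorphic[OF h] r] by simp
        show "AE \<zeta> in circle_measure. (norm (g (of_real r * \<zeta>)))\<^sup>2 \<le> 4 * (norm (h (of_real r * \<zeta>)))\<^sup>2"
        proof (rule AE_I2)
          fix \<zeta> assume "\<zeta> \<in> space \<mu>"
          hence z: "norm \<zeta> = 1" by simp
          hence nz: "of_real r * \<zeta> \<noteq> 0" using False by auto
          have "norm (g (of_real r * \<zeta>)) = norm (h (of_real r * \<zeta>)) / r"
            using nz False z by (simp add: g_def h_def norm_divide norm_mult)
          also have "\<dots> \<le> norm (h (of_real r * \<zeta>)) / (1/2)"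
            using False by (intro divide_left_mono) auto
          finally have "norm (g (of_real r * \<zeta>)) \<le> 2 * norm (h (of_real r * \<zeta>))" by simp
          hence "(norm (g (of_real r * \<zeta>)))\<^sup>2 \<le> (2 * norm (h (of_real r * \<zeta>)))\<^sup>2" by (rule power_mono) simp
          thus "(norm (g (of_real r * \<zeta>)))\<^sup>2 \<le> 4 * (norm (h (of_real r * \<zeta>)))\<^sup>2" by (simp add: power_mult_distrib)
        qed
      qed
      also have "\<dots> \<le> 4 * M" using M(2)[OF r] by simp
      finally show ?thesis by simp
    qed
  qed
  moreover have "boundary_value g (coshift (F - (F \<cdot> L2_one) *\<^sub>C L2_one))"
  proof -
    have one: "boundary_value (\<lambda>z. 1) L2_one"
      unfolding L2_one_def by (rule boundary_value_continuous) (rule continuous_intros)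
    have "boundary_value (\<lambda>z. f z - f 0 * 1) (F - (F \<cdot> L2_one) *\<^sub>C L2_one)"
      unfolding f0[symmetric] by (intro boundary_value_diff boundary_value_cmult f one)
    thus ?thesis
      using rep_L2_mult[OF bounded_symbol_cnj_id, of "F - (F \<cdot> L2_one) *\<^sub>C L2_one"] AE_space[of \<mu>]
      unfolding boundary_value_def coshift_def
    proof eventually_elim
      case (elim \<zeta>)
      hence z: "\<zeta> \<noteq> 0" "cnj \<zeta> = inverse \<zeta>" using circle_cnj[of \<zeta>] by auto
      have "((\<lambda>r. of_real r * \<zeta>) \<longlongrightarrow> 1 * \<zeta>) (at_left 1)" by (intro tendsto_intros of_real_at_left)
      hence "((\<lambda>r. (f (of_real r * \<zeta>) - f 0 * 1) / (of_real r * \<zeta>)) \<longlongrightarrow> rep_circle_L2 (F - (F \<cdot> L2_one) *\<^sub>C L2_one) \<zeta> / (1 * \<zeta>)) (at_left 1)"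
        using elim(1) z by (intro tendsto_divide) auto
      moreover have "\<forall>\<^sub>F r in at_left (1::real). r \<in> {0<..<1}" by (rule eventually_at_left_real) simp
      hence "\<forall>\<^sub>F r in at_left 1. (f (of_real r * \<zeta>) - f 0 * 1) / (of_real r * \<zeta>) = g (of_real r * \<zeta>)"
        by eventually_elim (use z in \<open>auto simp: g_def\<close>)
      ultimately have "((\<lambda>r. g (of_real r * \<zeta>)) \<longlongrightarrow> rep_circle_L2 (F - (F \<cdot> L2_one) *\<^sub>C L2_one) \<zeta> / (1 * \<zeta>)) (at_left 1)"
        using tendsto_cong by fastforce
      thus ?case using elim(2) z by (simp add: divide_inverse mult.commute)
    qed
  qed
  ultimately show ?thesis by (auto simp: hardy_H2_def)
qed

text \<open>The Szego kernels are total: the inner products with them are the values of the function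
  in the disk, and the radial limits of 0 are 0.\<close>

lemma hardy_H2_eq_0:
  assumes F: "F \<in> hardy_H2" and 0: "\<And>l. norm l < 1 \<Longrightarrow> F \<cdot> szego l = 0"
  shows "F = 0"
proof -
  obtain f where f: "boundary_value f F" "\<And>l. norm l < 1 \<Longrightarrow> f l = F \<cdot> szego l" 
    using hardy_H2E[OF F] by metis
  have "boundary_value f 0"
    using rep_zero AE_space[of \<mu>] unfolding boundary_value_def
  proof eventually_elim
    case (elim \<zeta>)
    have "\<forall>\<^sub>F r in at_left (1::real). r \<in> {0<..<1}" by (rule eventually_at_left_real) simp
    hence "\<forall>\<^sub>F r in at_left 1. f (of_real r * \<zeta>) = 0"
      by eventually_elim (use f(2) 0 elim(2) in \<open>auto simp: norm_mult\<close>)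
    thus ?case unfolding elim(1) by (rule tendsto_eventually)
  qed
  thus ?thesis using boundary_value_unique[OF f(1)] by simp
qed

lemma szego_hardy:
  assumes l: "norm l < 1"
  shows "szego l \<in> hardy_H2" "norm m < 1 \<Longrightarrow> szego l \<cdot> szego m = 1 / (1 - cnj l * m)"
proof -
  have nz: "1 - cnj l * z \<noteq> 0" if "norm z \<le> 1" for z
    using one_minus_mult_nonzero[of "cnj l" z] l that by simp
  have c: "continuous_on (cball 0 1) (\<lambda>z. 1 / (1 - cnj l * z))"
    using nz by (intro continuous_intros) auto
  have "compact ((\<lambda>z. 1 / (1 - cnj l * z)) ` cball 0 1)"
    by (intro compact_continuous_image c) auto
  then obtain C where C: "\<And>z. z \<in> cball 0 1 \<Longrightarrow> norm (1 / (1 - cnj l * z)) \<le> C"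
    using compact_imp_bounded bounded_iff by (metis (no_types, lifting) imageI)
  have h: "hardy_disk (\<lambda>z. 1 / (1 - cnj l * z))"
    by (rule hardy_disk_bounded[where C = C]) (use nz C in \<open>auto intro!: holomorphic_intros\<close>)
  have b: "boundary_value (\<lambda>z. 1 / (1 - cnj l * z)) (szego l)"
    unfolding szego_def by (rule boundary_value_continuous[OF c])
  show "szego l \<in> hardy_H2" using h b by (auto simp: hardy_H2_def)
  show "norm m < 1 \<Longrightarrow> szego l \<cdot> szego m = 1 / (1 - cnj l * m)"
    using hardy_Cauchy[OF h b, of m] by simp
qed

section \<open>The inner function and its boundary values\<close>

locale nonconstant_inner =
  fixes u :: "complex \<Rightarrow> complex"
  assumes inner: "inner_function u" and nonconstant: "\<not> u constant_on ball 0 1"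
begin

lemma u_holomorphic: "u holomorphic_on ball 0 1"
  using inner by (simp add: inner_function_def)

lemma norm_u_le: "norm z < 1 \<Longrightarrow> norm (u z) \<le> 1"
  using inner by (simp add: inner_function_def)

lemma norm_u_0: "norm (u 0) < 1"
proof (rule ccontr)
  assume "\<not> norm (u 0) < 1"
  hence "norm (u z) \<le> norm (u 0)" if "z \<in> ball 0 1" for z
    using norm_u_le[of z] that by simp
  hence "u constant_on ball 0 1"
    by (intro maximum_modulus_principle[OF u_holomorphic, of "ball 0 1" 0]) auto
  thus False using nonconstant by simp
qed

text \<open>A representative of the boundary function that is unimodular everywhere. The limit is
  taken along \<open>radii\<close>, which yields measurability, and replaced by 1 where it is not
  unimodular.\<close>

definition ub :: "complex \<Rightarrow> complex" where
  "ub \<zeta> = (let w = lim (\<lambda>n. u (of_real (radii n) * \<zeta>)) in if norm w = 1 then w else 1)"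

lemma norm_ub [simp]: "norm (ub \<zeta>) = 1"
  by (simp add: ub_def Let_def)

lemma ub_measurable: "ub \<in> borel_measurable \<mu>"
proof -
  have [measurable]: "(\<lambda>\<zeta>. u (of_real (radii n) * \<zeta>)) \<in> borel_measurable \<mu>" for n
    by (intro continuous_imp_measurable_circle slice_continuous u_holomorphic) (use radii[of n] in auto)
  have [measurable]: "(\<lambda>\<zeta>. lim (\<lambda>n. u (of_real (radii n) * \<zeta>))) \<in> borel_measurable \<mu>"
    by (rule borel_measurable_lim_metric) measurable
  show ?thesis unfolding ub_def[abs_def] Let_def by measurable
qed

lemma ub_symbol: "bounded_symbol ub" "bounded_symbol (\<lambda>z. cnj (ub z))"
proof -
  show "bounded_symbol ub" unfolding bounded_symbol_def using ub_measurable by (auto intro!: exI[of _ 1])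
  thus "bounded_symbol (\<lambda>z. cnj (ub z))" by (rule bounded_symbol_cnj)
qed

lemma ub_limit: "AE \<zeta> in circle_measure. ((\<lambda>r. u (of_real r * \<zeta>)) \<longlongrightarrow> ub \<zeta>) (at_left 1)"
proof -
  have "AE \<zeta> in circle_measure. \<exists>w. ((\<lambda>r. u (of_real r * \<zeta>)) \<longlongrightarrow> w) (at_left 1) \<and> norm w = 1"
    using inner by (simp add: inner_function_def)
  thus ?thesis
  proof eventually_elim
    case (elim \<zeta>)
    then obtain w where w: "((\<lambda>r. u (of_real r * \<zeta>)) \<longlongrightarrow> w) (at_left 1)" "norm w = 1" by blast
    have "(\<lambda>n. u (of_real (radii n) * \<zeta>)) \<longlonglongrightarrow> w" by (rule filterlim_compose[OF w(1) radii_at_left])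
    hence "lim (\<lambda>n. u (of_real (radii n) * \<zeta>)) = w" by (rule limI)
    thus ?case using w by (simp add: ub_def)
  qed
qed

lemma cnj_ub: "cnj (ub z) * ub z = 1" "ub z * cnj (ub z) = 1"
  using complex_norm_square[of "ub z"] by (simp_all add: mult.commute)

definition M where "M = L2_mult ub"

lemma M_linear: "M (F + G) = M F + M G" "M (c *\<^sub>C F) = c *\<^sub>C M F"
  by (simp_all add: M_def L2_mult_add L2_mult_scaleC ub_symbol)

lemma M_cancel: "L2_mult (\<lambda>z. cnj (ub z)) (M F) = F" "M (L2_mult (\<lambda>z. cnj (ub z)) F) = F"
  unfolding M_def L2_mult_mult[OF ub_symbol(2) ub_symbol(1), symmetric] L2_mult_mult[OF ub_symbol(1) ub_symbol(2), symmetric]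
  by (simp_all add: cnj_ub L2_mult_const)

lemma M_isometry: "M F \<cdot> M G = F \<cdot> G"
proof -
  have "M F \<cdot> M G = F \<cdot> L2_mult (\<lambda>z. cnj (ub z)) (M G)"
    unfolding M_def by (rule cinner_L2_mult[OF ub_symbol(1)])
  thus ?thesis by (simp add: M_cancel)
qed

lemma norm_M [simp]: "norm (M F) = norm F"
  unfolding norm_circle_L2_def M_isometry ..

lemma M_shift: "M (shift F) = shift (M F)"
  unfolding M_def shift_def L2_mult_mult[OF ub_symbol(1) bounded_symbol_id, symmetric] L2_mult_mult[OF bounded_symbol_id ub_symbol(1), symmetric]
  by (simp add: mult.commute)

lemma M_boundary_value: "boundary_value f F \<Longrightarrow> boundary_value (\<lambda>z. u z * f z) (M F)"
  unfolding M_def by (rule boundary_value_L2_mult[OF _ ub_symbol(1) ub_limit])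

lemma M_hardy: assumes "F \<in> hardy_H2" shows "M F \<in> hardy_H2" "norm l < 1 \<Longrightarrow> M F \<cdot> szego l = u l * (F \<cdot> szego l)"
proof -
  obtain f where f: "hardy_disk f" "boundary_value f F" "\<And>l. norm l < 1 \<Longrightarrow> f l = F \<cdot> szego l" 
    using hardy_H2E[OF assms] by metis
  have h: "hardy_disk (\<lambda>z. u z * f z)" by (rule hardy_disk_mult[OF f(1) u_holomorphic norm_u_le])
  show "M F \<in> hardy_H2" using M_boundary_value[OF f(2)] h by (auto simp: hardy_H2_def)
  show "norm l < 1 \<Longrightarrow> M F \<cdot> szego l = u l * (F \<cdot> szego l)"
    using hardy_Cauchy[OF h M_boundary_value[OF f(2)], of l] f(3)[of l] by simp
qed

text \<open>In \<open>inner_times_H2\<close> the boundary value belongs to the product u f. The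
  boundary value of f itself is recovered by dividing by u, whose radial limit is nonzero almost
  everywhere.\<close>

lemma inner_times_H2_eq: "inner_times_H2 u = M ` hardy_H2"
proof
  show "M ` hardy_H2 \<subseteq> inner_times_H2 u"
    using M_boundary_value by (auto simp: hardy_H2_def inner_times_H2_def)
  show "inner_times_H2 u \<subseteq> M ` hardy_H2"
  proof
    fix F assume "F \<in> inner_times_H2 u"
    then obtain f where f: "hardy_disk f" "boundary_value (\<lambda>z. u z * f z) F" by (auto simp: inner_times_H2_def)
    have "boundary_value f (L2_mult (\<lambda>z. cnj (ub z)) F)"
      using f(2) ub_limit rep_L2_mult[OF ub_symbol(2), of F] unfolding boundary_value_def
    proof eventually_elim
      case (elim \<zeta>)
      have nz: "ub \<zeta> \<noteq> 0" using norm_ub[of \<zeta>] by (metis norm_zero zero_neq_one)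
      have "((\<lambda>r. (u (of_real r * \<zeta>) * f (of_real r * \<zeta>)) / u (of_real r * \<zeta>)) \<longlongrightarrow> rep_circle_L2 F \<zeta> / ub \<zeta>) (at_left 1)"
        by (intro tendsto_divide elim nz)
      moreover have "\<forall>\<^sub>F r in at_left 1. u (of_real r * \<zeta>) \<noteq> 0"
        by (rule tendsto_imp_eventually_ne[OF elim(2) nz])
      hence "\<forall>\<^sub>F r in at_left 1. (u (of_real r * \<zeta>) * f (of_real r * \<zeta>)) / u (of_real r * \<zeta>) = f (of_real r * \<zeta>)"
        by eventually_elim simp
      ultimately have "((\<lambda>r. f (of_real r * \<zeta>)) \<longlongrightarrow> rep_circle_L2 F \<zeta> / ub \<zeta>) (at_left 1)"
        using tendsto_cong by fastforce
      moreover have "rep_circle_L2 F \<zeta> / ub \<zeta> = cnj (ub \<zeta>) * rep_circle_L2 F \<zeta>"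
        using nz cnj_ub(1)[of \<zeta>] by (simp add: field_simps)
      ultimately show ?case using elim(3) by simp
    qed
    hence "L2_mult (\<lambda>z. cnj (ub z)) F \<in> hardy_H2" using f by (auto simp: hardy_H2_def)
    thus "F \<in> M ` hardy_H2" using M_cancel(2)[of F] by (metis imageI)
  qed
qed

section \<open>The model space, its projection and its kernels\<close>

abbreviation H where "H \<equiv> model_space u"

lemma model_space_iff: "F \<in> H \<longleftrightarrow> F \<in> hardy_H2 \<and> (\<forall>G\<in>hardy_H2. F \<cdot> M G = 0)"
  unfolding model_space_def inner_times_H2_eq by simp

lemma model_hardy: "F \<in> H \<Longrightarrow> F \<in> hardy_H2"
  by (simp add: model_space_iff)

lemma model_orthogonal: "F \<in> H \<Longrightarrow> G \<in> hardy_H2 \<Longrightarrow> F \<cdot> M G = 0"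
  by (simp add: model_space_iff)

lemma model_hilbert: "hilbert_subspace H"
proof
  have "closed {F. F \<cdot> M G = 0}" for G
    by (intro closed_Collect_eq linear_continuous_on bounded_linear_cinner_left continuous_on_const)
  hence "closed (hardy_H2 \<inter> (\<Inter>G\<in>hardy_H2. {F. F \<cdot> M G = 0}))"
    by (intro closed_Int closed_hardy_H2 closed_INT) auto
  moreover have "H = hardy_H2 \<inter> (\<Inter>G\<in>hardy_H2. {F. F \<cdot> M G = 0})"
    unfolding set_eq_iff Int_iff INT_iff mem_Collect_eq model_space_iff by blast
  ultimately show "closed H" by (simp only:)
qed (auto simp: model_space_iff hardy_H2_zero hardy_H2_add hardy_H2_scaleC cinner_simps)

sublocale hilbert_subspace H by (rule model_hilbert)

definition U where "U = M L2_one"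

lemma norm_U: "norm U = 1" by (simp add: U_def norm_L2_one)

lemma U_orthogonal: "F \<in> H \<Longrightarrow> F \<cdot> U = 0"
  by (simp add: U_def model_orthogonal L2_one_hardy)

text \<open>A general element u G splits as z u G1 + G(0) u with G1 the backward shift of G. Since F
  is orthogonal to u G1, z F is orthogonal to the first summand, so only its component along u has
  to be removed.\<close>

lemma proj_shift:
  assumes F: "F \<in> H" shows "P (shift F) = shift F - (shift F \<cdot> U) *\<^sub>C U"
proof (rule orth_proj_unique)
  define c where "c = shift F \<cdot> U"
  have "(shift F - c *\<^sub>C U) \<cdot> M G = 0" if G: "G \<in> hardy_H2" for G
  proof -
    define g where "g = G \<cdot> L2_one"
    define G1 where "G1 = coshift (G - g *\<^sub>C L2_one)"
    have G1: "G1 \<in> hardy_H2" unfolding G1_def g_def by (rule coshift_hardy[OF G])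
    have "G = shift G1 + g *\<^sub>C L2_one" by (simp add: G1_def)
    hence MG: "M G = shift (M G1) + g *\<^sub>C U"
      by (simp add: M_linear M_shift U_def)
    have "shift F \<cdot> shift (M G1) = 0"
      using model_orthogonal[OF F G1] by (simp add: cinner_shift)
    moreover have "U \<cdot> shift (M G1) = 0"
      using shift_hardy_one[OF G1] cinner_swap_eq_zero unfolding U_def M_shift[symmetric] M_isometry by blast
    ultimately show ?thesis
      unfolding MG using norm_U by (simp add: cinner_simps cinner_self c_def)
  qed
  thus "shift F - (shift F \<cdot> U) *\<^sub>C U \<in> H"
    using F unfolding model_space_iff c_def[symmetric]
    by (auto intro!: hardy_H2_diff hardy_H2_scaleC shift_hardy M_hardy(1) L2_one_hardy simp: U_def)
  fix h assume "h \<in> H"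
  hence "U \<cdot> h = 0" using U_orthogonal cinner_swap_eq_zero by blast
  thus "(shift F - (shift F - (shift F \<cdot> U) *\<^sub>C U)) \<cdot> h = 0" by (simp add: cinner_simps)
qed

text \<open>Removing the constant term before dividing by z stays in the Hardy space. Orthogonality
  to u G persists, because z u G lies in u H^2, to which F is orthogonal, and has value 0 at the
  origin.\<close>

lemma proj_coshift:
  assumes F: "F \<in> H" shows "P (coshift F) = coshift (F - (F \<cdot> L2_one) *\<^sub>C L2_one)"
proof (rule orth_proj_unique)
  have "coshift (F - (F \<cdot> L2_one) *\<^sub>C L2_one) \<cdot> M G = 0" if G: "G \<in> hardy_H2" for G
  proof -
    have "L2_one \<cdot> shift (M G) = 0"
      using shift_hardy_one[OF M_hardy(1)[OF G]] cinner_swap_eq_zero by blast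
    moreover have "F \<cdot> shift (M G) = 0"
      using model_orthogonal[OF F shift_hardy[OF G]] by (simp add: M_shift)
    ultimately show ?thesis by (simp add: cinner_coshift cinner_simps)
  qed
  thus "coshift (F - (F \<cdot> L2_one) *\<^sub>C L2_one) \<in> H"
    using F coshift_hardy by (simp add: model_space_iff)
  fix h assume "h \<in> H"
  hence "L2_one \<cdot> shift h = 0"
    using shift_hardy_one[OF model_hardy] cinner_swap_eq_zero by blast
  thus "(coshift F - coshift (F - (F \<cdot> L2_one) *\<^sub>C L2_one)) \<cdot> h = 0"
    unfolding coshift_diff[symmetric] cinner_coshift by (simp add: cinner_simps)
qed

text \<open>The reproducing kernel (1 - cnj (u l) u) / (1 - cnj l z) of the model space.\<close>

definition kernel where "kernel l = szego l - cnj (u l) *\<^sub>C M (szego l)"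

lemma kernel_in:
  assumes l: "norm l < 1" shows "kernel l \<in> H"
proof -
  have "kernel l \<cdot> M G = 0" if G: "G \<in> hardy_H2" for G
  proof -
    have "szego l \<cdot> M G = cnj (u l * (G \<cdot> szego l))"
      by (subst L2_cinner_cnj) (simp add: M_hardy(2)[OF G l])
    moreover have "M (szego l) \<cdot> M G = cnj (G \<cdot> szego l)"
      unfolding M_isometry by (rule L2_cinner_cnj)
    ultimately show ?thesis by (simp add: kernel_def cinner_simps)
  qed
  thus ?thesis
    using szego_hardy(1)[OF l] by (simp add: model_space_iff kernel_def hardy_H2_diff hardy_H2_scaleC M_hardy)
qed

lemma kernel_reproducing:
  assumes "norm l < 1" "F \<in> H" shows "F \<cdot> kernel l = F \<cdot> szego l"
  using model_orthogonal[OF assms(2) szego_hardy(1)[OF assms(1)]] by (simp add: kernel_def cinner_simps)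

lemma norm_kernel:
  assumes l: "norm l < 1" shows "(norm (kernel l))\<^sup>2 = (1 - (norm (u l))\<^sup>2) / (1 - (norm l)\<^sup>2)"
proof -
  have 1: "1 - cnj l * l = complex_of_real (1 - (norm l)\<^sup>2)"
    unfolding of_real_diff complex_norm_square by (simp add: mult.commute)
  have 2: "1 - cnj (u l) * u l = complex_of_real (1 - (norm (u l))\<^sup>2)"
    unfolding of_real_diff complex_norm_square by (simp add: mult.commute)
  have "kernel l \<cdot> kernel l = kernel l \<cdot> szego l"
    by (rule kernel_reproducing[OF l kernel_in[OF l]])
  also have "\<dots> = (1 - cnj (u l) * u l) / (1 - cnj l * l)"
    using szego_hardy(2)[OF l l] M_hardy(2)[OF szego_hardy(1)[OF l] l]
    by (simp add: kernel_def cinner_simps diff_divide_distrib)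
  also have "\<dots> = complex_of_real ((1 - (norm (u l))\<^sup>2) / (1 - (norm l)\<^sup>2))"
    unfolding 1 2 by simp
  finally show ?thesis unfolding cinner_self using of_real_eq_iff by blast
qed

text \<open>(z - l) / (1 - cnj l z) is unimodular on the circle, so the two terms of the kernel
  contribute at most 1 and |u l|. The bound is independent of the norm of the kernel; dividing by a
  large norm makes kernels approximate eigenvectors of the shift.\<close>

lemma norm_shift_kernel:
  assumes l: "norm l < 1" shows "norm (shift (kernel l) - l *\<^sub>C kernel l) \<le> 2"
proof -
  have b: "bounded_symbol (\<lambda>z. z - l)" by (intro continuous_bounded_symbol continuous_intros)
  have sq: "square_integrable (\<lambda>z. 1 / (1 - cnj l * z))"
    by (rule square_integrable_continuous[OF szego_continuous[OF l]])
  have eq: "shift F - l *\<^sub>C F = L2_mult (\<lambda>z. z - l) F" for F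
    using L2_mult_add_symbol[OF bounded_symbol_id bounded_symbol_const[of "- l"], of F] b
    by (simp add: shift_def L2_mult_const)
  have cont: "continuous_on (sphere 0 1) (\<lambda>z. (z - l) * (1 / (1 - cnj l * z)))"
    by (intro continuous_intros szego_continuous l)
  have "L2_mult (\<lambda>z. z - l) (szego l) = abs_circle_L2 (\<lambda>z. (z - l) * (1 / (1 - cnj l * z)))"
    unfolding L2_mult_def szego_def
    by (subst abs_eq_iff[OF square_integrable_mult[OF b square_integrable_rep] square_integrable_continuous[OF cont]])
       (use rep_abs_AE[OF sq] in eventually_elim, simp)
  moreover have "(norm (abs_circle_L2 (\<lambda>z. (z - l) * (1 / (1 - cnj l * z)))))\<^sup>2 = 1"
  proof -
    have "norm ((z - l) * (1 / (1 - cnj l * z))) = 1" if "norm z = 1" for z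
    proof -
      have "1 - cnj l * z = z * cnj (z - l)" using circle_z_cnj[of z] that by (simp add: algebra_simps)
      hence "norm (1 - cnj l * z) = norm (z - l)" using that by (simp add: norm_mult flip: complex_cnj_diff)
      moreover have "z \<noteq> l" using that l by auto
      ultimately show ?thesis by (simp add: norm_mult norm_divide)
    qed
    hence "(\<integral>z. (norm ((z - l) * (1 / (1 - cnj l * z))))\<^sup>2 \<partial>\<mu>) = (\<integral>z. 1 \<partial>\<mu>)"
      by (intro Bochner_Integration.integral_cong refl) auto
    thus ?thesis by (subst L2_norm_abs_square[OF square_integrable_continuous[OF cont]]) simp
  qed
  ultimately have n1: "norm (shift (szego l) - l *\<^sub>C szego l) = 1"
    unfolding eq by (metis abs_norm_cancel one_power2 power2_eq_iff_nonneg norm_ge_zero zero_le_one)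
  have "shift (kernel l) - l *\<^sub>C kernel l = (shift (szego l) - l *\<^sub>C szego l) - cnj (u l) *\<^sub>C M (shift (szego l) - l *\<^sub>C szego l)"
    using M_linear(1)[of "shift (szego l)" "- (l *\<^sub>C szego l)"] M_linear(2)[of "- l" "szego l"]
    by (simp add: kernel_def shift_diff shift_linear M_shift scaleC_diff_right mult.commute)
  also have "norm \<dots> \<le> norm (shift (szego l) - l *\<^sub>C szego l) + norm (cnj (u l) *\<^sub>C M (shift (szego l) - l *\<^sub>C szego l))"
    by (rule norm_triangle_ineq4)
  also have "\<dots> = 1 + norm (u l)" by (simp add: n1)
  also have "\<dots> \<le> 2" using norm_u_le[OF l] by simp
  finally show ?thesis .
qed

lemma proj_one: "P L2_one = kernel 0"
proof (rule orth_proj_unique)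
  fix h assume "h \<in> H"
  hence "U \<cdot> h = 0" using U_orthogonal cinner_swap_eq_zero by blast
  thus "(L2_one - kernel 0) \<cdot> h = 0"
    by (simp add: kernel_def L2_one_szego[symmetric] U_def[symmetric] cinner_simps)
qed (simp add: kernel_in)

lemma cinner_one_kernel: "F \<in> H \<Longrightarrow> F \<cdot> L2_one = F \<cdot> kernel 0"
  using kernel_reproducing[of 0 F] by (simp add: L2_one_szego)

lemma kernel_0_nonzero: "kernel 0 \<noteq> 0"
proof
  assume "kernel 0 = 0"
  hence "(norm (u 0))\<^sup>2 = 1" using norm_kernel[of 0] by simp
  thus False using norm_u_0 by (simp add: abs_square_eq_1)
qed

end

section \<open>Truncated Toeplitz operators modulo the compact operators\<close>

text \<open>Stone--Weierstrass as an induction principle: a property Q of functions is checked on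
  constants, z and its conjugate, and on sums and products. Real-linear functionals of z enter
  through Re z = (z + cnj z) / 2 and Im z = - i (z - cnj z) / 2.\<close>

lemma circle_polynomial_approximation:
  assumes Qconst: "\<And>c. Q (\<lambda>z. c)" and Qid: "Q (\<lambda>z. z)" and Qcnj: "Q cnj"
    and Qadd: "\<And>f g. Q f \<Longrightarrow> Q g \<Longrightarrow> Q (\<lambda>z. f z + g z)"
    and Qmult: "\<And>f g. Q f \<Longrightarrow> Q g \<Longrightarrow> Q (\<lambda>z. f z * g z)"
    and cont: "continuous_on (sphere 0 1) \<phi>" and e: "e > 0"
  shows "\<exists>\<psi>. Q \<psi> \<and> (\<forall>z\<in>sphere 0 1. norm (\<phi> z - \<psi> z) < e)"
proof -
  have real: "Q (\<lambda>z. complex_of_real (f z))" if "real_polynomial_function f" for f :: "complex \<Rightarrow> real"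
    using that
  proof (induction f rule: real_polynomial_function.induct)
    case (linear f)
    interpret bounded_linear f by fact
    have "complex_of_real (f z) = of_real (f 1) * ((1/2) * (z + cnj z)) + of_real (f \<i>) * ((-\<i>/2) * (z + (-1) * cnj z))" for z
    proof -
      have "f z = f (Re z *\<^sub>R 1 + Im z *\<^sub>R \<i>)"
        by (rule arg_cong[of _ _ f]) (simp add: complex_eq_iff)
      also have "\<dots> = Re z * f 1 + Im z * f \<i>"
        by (simp add: add scaleR)
      finally have "f z = Re z * f 1 + Im z * f \<i>" .
      moreover have "z + cnj z = of_real (2 * Re z)" "z + (-1) * cnj z = of_real (2 * Im z) * \<i>"
        by (simp_all add: complex_eq_iff)
      ultimately show ?thesis by (simp only:) (simp add: complex_eq_iff)
    qed
    hence eq: "(\<lambda>z. complex_of_real (f z)) = (\<lambda>z. of_real (f 1) * ((1/2) * (z + cnj z)) + of_real (f \<i>) * ((-\<i>/2) * (z + (-1) * cnj z)))"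
      by (rule ext)
    show ?case
      by (subst eq) (intro Qadd Qmult Qconst Qid Qcnj)
  next
    case (const c)
    show ?case by (rule Qconst)
  next
    case (add f g)
    thus ?case using Qadd by simp
  next
    case (mult f g)
    thus ?case using Qmult by simp
  qed
  obtain g where g: "polynomial_function g" "\<And>z. z \<in> sphere 0 1 \<Longrightarrow> norm (\<phi> z - g z) < e"
    using Stone_Weierstrass_polynomial_function[OF compact_sphere cont e] by blast
  have "real_polynomial_function (Re \<circ> g)" "real_polynomial_function (Im \<circ> g)"
    using g(1) bounded_linear_Re bounded_linear_Im by (auto simp: polynomial_function_def)
  hence "Q (\<lambda>z. complex_of_real ((Re \<circ> g) z) + \<i> * complex_of_real ((Im \<circ> g) z))"
    by (intro Qadd Qmult Qconst real)
  moreover have "complex_of_real ((Re \<circ> g) z) + \<i> * complex_of_real ((Im \<circ> g) z) = g z" for z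
    by (simp add: complex_eq_iff)
  ultimately have "Q g" by simp
  with g(2) show ?thesis by blast
qed

lemma L2_mult_diff_symbol:
  assumes "continuous_on (sphere 0 1) \<phi>" "continuous_on (sphere 0 1) \<psi>"
  shows "L2_mult (\<lambda>z. \<phi> z - \<psi> z) F = L2_mult \<phi> F - L2_mult \<psi> F"
proof -
  have "L2_mult (\<lambda>z. (\<phi> z - \<psi> z) + \<psi> z) F = L2_mult (\<lambda>z. \<phi> z - \<psi> z) F + L2_mult \<psi> F"
    by (rule L2_mult_add_symbol) (intro continuous_bounded_symbol continuous_intros assms)+
  thus ?thesis by simp
qed

lemma bounded_linear_L2_mult:
  assumes "bounded_symbol \<phi>" shows "bounded_linear (L2_mult \<phi>)"
proof -
  obtain M where M: "\<And>z. z \<in> sphere 0 1 \<Longrightarrow> norm (\<phi> z) \<le> M"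
    using assms unfolding bounded_symbol_def by blast
  show ?thesis
    by (rule bounded_linear_intro[where K = M])
       (use norm_L2_mult_le[OF assms M] in \<open>simp_all add: L2_mult_add L2_mult_scaleC assms L2_scaleR_scaleC mult.commute\<close>)
qed

lemma (in hilbert_subspace) bounded_linear_orth_proj: "bounded_linear P"
  by (rule bounded_linear_intro[where K = 1])
     (simp_all add: orth_proj_add orth_proj_scaleC L2_scaleR_scaleC norm_orth_proj_le)

lemma (in hilbert_subspace) bounded_linear_orth_compl: "bounded_linear (\<lambda>x. x - P x)"
  by (intro bounded_linear_sub bounded_linear_ident bounded_linear_orth_proj)

context nonconstant_inner
begin

section \<open>Truncated Toeplitz and Hankel operators\<close>

abbreviation circle_continuous where "circle_continuous \<phi> \<equiv> continuous_on (sphere 0 1) \<phi>"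

abbreviation A where "A \<equiv> truncated_toeplitz u"

lemma A_apply [simp]: "x \<in> H \<Longrightarrow> A \<phi> x = P (L2_mult \<phi> x)"
  by (simp add: truncated_toeplitz_def)

lemma norm_A_le:
  assumes "circle_continuous \<phi>" "\<And>z. z \<in> sphere 0 1 \<Longrightarrow> norm (\<phi> z) \<le> C" "x \<in> H"
  shows "norm (A \<phi> x) \<le> C * norm x"
  using norm_orth_proj_le[of "L2_mult \<phi> x"] norm_L2_mult_le[OF continuous_bounded_symbol[OF assms(1)] assms(2), of x] assms(3)
  by simp

lemma A_B [simp, intro]:
  assumes "circle_continuous \<phi>" shows "A \<phi> \<in> B"
proof -
  have b: "bounded_symbol \<phi>" using assms by (rule continuous_bounded_symbol)
  then obtain C where C: "\<And>z. z \<in> sphere 0 1 \<Longrightarrow> norm (\<phi> z) \<le> C" unfolding bounded_symbol_def by blast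
  show ?thesis
  proof (rule bounded_operatorsI[where M = C])
    show "norm (A \<phi> x) \<le> C * norm x" if "x \<in> H" for x by (rule norm_A_le[OF assms C that])
  qed (auto simp: L2_mult_add[OF b] L2_mult_scaleC[OF b] orth_proj_add orth_proj_scaleC, simp add: truncated_toeplitz_def)
qed

lemma A_const: "x \<in> H \<Longrightarrow> A (\<lambda>z. c) x = c *\<^sub>C x"
  by (simp add: L2_mult_const)

lemma A_add:
  assumes "circle_continuous \<phi>" "circle_continuous \<psi>"
  shows "A (\<lambda>z. \<phi> z + \<psi> z) = A \<phi> \<oplus>\<^bsub>R\<^esub> A \<psi>"
proof (rule op_ext)
  fix x assume "x \<in> H"
  thus "A (\<lambda>z. \<phi> z + \<psi> z) x = (A \<phi> \<oplus>\<^bsub>R\<^esub> A \<psi>) x"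
    using assms by (simp add: L2_mult_add_symbol continuous_bounded_symbol continuous_on_add orth_proj_add)
qed (use assms in \<open>auto intro!: continuous_intros\<close>)

lemma A_diff:
  assumes "circle_continuous \<phi>" "circle_continuous \<psi>"
  shows "A (\<lambda>z. \<phi> z - \<psi> z) = A \<phi> \<ominus>\<^bsub>R\<^esub> A \<psi>"
proof (rule op_ext)
  fix x assume "x \<in> H"
  thus "A (\<lambda>z. \<phi> z - \<psi> z) x = (A \<phi> \<ominus>\<^bsub>R\<^esub> A \<psi>) x"
    using assms by (simp add: L2_mult_diff_symbol orth_proj_diff)
qed (use assms in \<open>auto intro!: continuous_intros\<close>)

lemma A_cmult:
  assumes "circle_continuous \<phi>"
  shows "A (\<lambda>z. c * \<phi> z) = c \<odot>\<^bsub>R\<^esub> A \<phi>"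
proof (rule op_ext)
  fix x assume "x \<in> H"
  thus "A (\<lambda>z. c * \<phi> z) x = (c \<odot>\<^bsub>R\<^esub> A \<phi>) x"
    using assms L2_mult_mult[OF bounded_symbol_const[of c] continuous_bounded_symbol[OF assms]]
    by (simp add: L2_mult_const orth_proj_scaleC)
qed (use assms in \<open>auto intro!: continuous_intros\<close>)

lemma A_one: "A (\<lambda>z. 1) = \<one>\<^bsub>R\<^esub>"
  by (rule op_ext) (auto simp: L2_mult_const)

lemma adj_A:
  assumes "circle_continuous \<phi>" shows "adj R (A \<phi>) = A (\<lambda>z. cnj (\<phi> z))"
proof (rule adj_eqI, unfold is_adjoint_def, intro conjI ballI)
  show "A (\<lambda>z. cnj (\<phi> z)) \<in> B" using assms by (auto intro!: continuous_intros)
  fix x y assume "x \<in> H" "y \<in> H"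
  thus "A \<phi> x \<cdot> y = x \<cdot> A (\<lambda>z. cnj (\<phi> z)) y"
    by (simp add: cinner_orth_proj cinner_orth_proj_right cinner_L2_mult[OF continuous_bounded_symbol[OF assms]])
qed

text \<open>The Hankel operator of \<phi>: the part of \<phi> x that leaves the model space. Its
  values lie in the orthogonal complement, so its compactness is expressed by
  \<open>cpt\<close>.\<close>

definition hankel where "hankel \<phi> x = L2_mult \<phi> x - P (L2_mult \<phi> x)"

text \<open>For z and its conjugate the operator has rank one, by \<open>proj_shift\<close> and
  \<open>proj_coshift\<close>. Products reduce to the factors by splitting g x into P (g x) and
  \<open>hankel g x\<close> before multiplying by f. Uniform approximation of the symbol is
  approximation in norm, since passing to the complement does not increase norms.\<close>

lemma hankel_cpt:
  assumes "circle_continuous \<phi>" shows "cpt (hankel \<phi>)"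
proof (rule cpt_limit)
  fix e :: real assume e: "e > 0"
  define Q where "Q \<phi> \<longleftrightarrow> circle_continuous \<phi> \<and> cpt (hankel \<phi>)" for \<phi>
  have "\<exists>\<psi>. Q \<psi> \<and> (\<forall>z\<in>sphere 0 1. norm (\<phi> z - \<psi> z) < e)"
  proof (rule circle_polynomial_approximation[of Q, OF _ _ _ _ _ assms e])
    fix c show "Q (\<lambda>z. c)" unfolding Q_def
      by (intro conjI continuous_intros cpt_cong[OF _ cpt_zero]) (simp add: hankel_def L2_mult_const)
  next
    have "cpt (hankel (\<lambda>z. z))"
    proof (rule cpt_cong[OF _ cpt_rank_one[of "coshift U" U]])
      fix x assume x: "x \<in> H"
      show "(x \<cdot> coshift U) *\<^sub>C U = hankel (\<lambda>z. z) x"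
        using proj_shift[OF x] by (simp add: hankel_def shift_def[symmetric] cinner_shift)
    qed
    thus "Q (\<lambda>z. z)" by (auto simp: Q_def intro: continuous_intros)
  next
    have "cpt (hankel cnj)"
    proof (rule cpt_cong[OF _ cpt_rank_one[of L2_one "coshift L2_one"]])
      fix x assume x: "x \<in> H"
      show "(x \<cdot> L2_one) *\<^sub>C coshift L2_one = hankel cnj x"
        using proj_coshift[OF x] by (simp add: hankel_def coshift_def[symmetric] coshift_diff coshift_linear)
    qed
    thus "Q cnj" by (auto simp: Q_def intro: continuous_intros)
  next
    fix f g assume Q: "Q f" "Q g"
    hence c: "circle_continuous f" "circle_continuous g" by (auto simp: Q_def)
    note b = continuous_bounded_symbol[OF c(1)] continuous_bounded_symbol[OF c(2)]
    have "cpt (hankel (\<lambda>z. f z + g z))"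
    proof (rule cpt_cong[OF _ cpt_add[of "hankel f" "hankel g"]])
      have "bounded_symbol (\<lambda>z. f z + g z)" by (intro continuous_bounded_symbol continuous_intros c)
      thus "hankel f x + hankel g x = hankel (\<lambda>z. f z + g z) x" for x
        by (simp add: hankel_def L2_mult_add_symbol[OF b] orth_proj_add)
    qed (use Q in \<open>simp_all add: Q_def\<close>)
    thus "Q (\<lambda>z. f z + g z)" using c by (auto simp: Q_def intro: continuous_intros)
    have "cpt (\<lambda>x. hankel f (A g x) + (L2_mult f (hankel g x) - P (L2_mult f (hankel g x))))"
    proof (rule cpt_add)
      obtain C where C: "\<And>z. z \<in> sphere 0 1 \<Longrightarrow> norm (g z) \<le> C"
        using b(2) unfolding bounded_symbol_def by blast
      show "cpt (\<lambda>x. hankel f (A g x))"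
      proof (rule cpt_comp_right[where M = C and T = "hankel f" and A = "A g"])
        show "cpt (hankel f)" using Q by (simp add: Q_def)
        show "A g x \<in> H" if "x \<in> H" for x using that by simp
        show "norm (A g x) \<le> C * norm x" if "x \<in> H" for x by (rule norm_A_le[OF c(2) C that])
        show "hankel f (a *\<^sub>C x) = a *\<^sub>C hankel f x" for a x
          by (simp only: hankel_def L2_mult_scaleC[OF b(1)] orth_proj_scaleC scaleC_diff_right)
      qed
      show "cpt (\<lambda>x. L2_mult f (hankel g x) - P (L2_mult f (hankel g x)))"
        using Q by (intro cpt_comp_bounded_linear[OF cpt_comp_bounded_linear[OF _ bounded_linear_L2_mult[OF b(1)]] bounded_linear_orth_compl])
          (auto simp: Q_def)
    qed
    hence "cpt (hankel (\<lambda>z. f z * g z))"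
    proof (rule cpt_cong[rotated])
      fix x assume "x \<in> H"
      have "L2_mult f (L2_mult g x) = L2_mult f (P (L2_mult g x)) + L2_mult f (hankel g x)"
        unfolding L2_mult_add[OF b(1), symmetric] by (simp add: hankel_def)
      thus "hankel f (A g x) + (L2_mult f (hankel g x) - P (L2_mult f (hankel g x))) = hankel (\<lambda>z. f z * g z) x"
        using \<open>x \<in> H\<close> by (simp add: hankel_def[of f] hankel_def[of "\<lambda>z. f z * g z"] L2_mult_mult[OF b] orth_proj_add)
    qed
    thus "Q (\<lambda>z. f z * g z)" using c by (auto simp: Q_def intro: continuous_intros)
  qed
  then obtain \<psi> where \<psi>: "circle_continuous \<psi>" "cpt (hankel \<psi>)" "\<And>z. z \<in> sphere 0 1 \<Longrightarrow> norm (\<phi> z - \<psi> z) \<le> e"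
    unfolding Q_def by (blast intro: less_imp_le)
  have "norm (hankel \<phi> x - hankel \<psi> x) \<le> e * norm x" for x
  proof -
    have "hankel \<phi> x - hankel \<psi> x = L2_mult (\<lambda>z. \<phi> z - \<psi> z) x - P (L2_mult (\<lambda>z. \<phi> z - \<psi> z) x)"
      unfolding L2_mult_diff_symbol[OF assms \<psi>(1)] orth_proj_diff by (simp add: hankel_def)
    also have "norm \<dots> \<le> norm (L2_mult (\<lambda>z. \<phi> z - \<psi> z) x)" by (rule norm_orth_compl_le)
    also have "\<dots> \<le> e * norm x"
      by (intro norm_L2_mult_le \<psi>(3) continuous_bounded_symbol continuous_intros assms \<psi>(1))
    finally show ?thesis .
  qed
  thus "\<exists>S. cpt S \<and> (\<forall>x\<in>H. norm (hankel \<phi> x - S x) \<le> e * norm x)" using \<psi>(2) by blast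
qed

text \<open>The failure of multiplicativity is P (\<phi> (hankel \<psi> x)), which is compact
  because \<open>hankel \<psi>\<close> is.\<close>

lemma semicommutator_K:
  assumes c: "circle_continuous \<phi>" "circle_continuous \<psi>"
  shows "A (\<lambda>z. \<phi> z * \<psi> z) \<ominus>\<^bsub>R\<^esub> A \<phi> \<otimes>\<^bsub>R\<^esub> A \<psi> \<in> K"
proof (rule K_I)
  note b = continuous_bounded_symbol[OF c(1)] continuous_bounded_symbol[OF c(2)]
  have cp: "circle_continuous (\<lambda>z. \<phi> z * \<psi> z)" using c by (intro continuous_intros)
  show "A (\<lambda>z. \<phi> z * \<psi> z) \<ominus>\<^bsub>R\<^esub> A \<phi> \<otimes>\<^bsub>R\<^esub> A \<psi> \<in> B" using c cp by auto
  show "cpt (\<lambda>x. P (L2_mult \<phi> (hankel \<psi> x)))"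
    by (intro cpt_comp_bounded_linear[OF cpt_comp_bounded_linear[OF _ bounded_linear_L2_mult[OF b(1)]] bounded_linear_orth_proj] hankel_cpt c)
  fix x assume x: "x \<in> H"
  have "L2_mult \<phi> (L2_mult \<psi> x) = L2_mult \<phi> (P (L2_mult \<psi> x)) + L2_mult \<phi> (hankel \<psi> x)"
    unfolding L2_mult_add[OF b(1), symmetric] by (simp add: hankel_def)
  thus "(A (\<lambda>z. \<phi> z * \<psi> z) \<ominus>\<^bsub>R\<^esub> A \<phi> \<otimes>\<^bsub>R\<^esub> A \<psi>) x = P (L2_mult \<phi> (hankel \<psi> x))"
    using x c cp by (simp add: L2_mult_mult[OF b] orth_proj_add)
qed

section \<open>The spectrum on the circle and asymptotic eigenvectors\<close>

definition Y where "Y = inner_spectrum u \<inter> sphere 0 1"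

text \<open>The liminf is a supremum of infima of a nonnegative function, so it is 0 exactly when
  all these infima are. The centre w excluded in the filter lies on the circle, hence its removal
  takes no point from the disk.\<close>

lemma Y_iff:
  assumes w: "norm w = 1"
  shows "w \<in> Y \<longleftrightarrow> (\<forall>d>0. \<forall>e>0. \<exists>z. norm z < 1 \<and> dist w z < d \<and> norm (u z) < e)"
proof -
  define L where "L d = (INF z\<in>(ball 0 1 \<inter> ball w d - {w}). ereal (norm (u z)))" for d
  have S: "ball 0 1 \<inter> ball w d - {w} = {z. norm z < 1 \<and> dist w z < d}" for d
    using w by auto
  have L0: "0 \<le> L d" for d unfolding L_def by (rule INF_greatest) simp
  have "w \<in> Y \<longleftrightarrow> (SUP d\<in>{0<..}. L d) = 0"
    using w by (simp add: Y_def inner_spectrum_def Liminf_within L_def)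
  also have "\<dots> \<longleftrightarrow> (\<forall>d>0. L d \<le> 0)"
  proof
    assume "(SUP d\<in>{0<..}. L d) = 0"
    thus "\<forall>d>0. L d \<le> 0" by (metis SUP_upper greaterThan_iff)
  next
    assume "\<forall>d>0. L d \<le> 0"
    hence "(SUP d\<in>{0<..}. L d) \<le> 0" by (intro SUP_least) auto
    moreover have "0 \<le> (SUP d\<in>{0<..}. L d)" by (rule SUP_upper2[of 1]) (auto simp: L0)
    ultimately show "(SUP d\<in>{0<..}. L d) = 0" by (rule antisym)
  qed
  also have "\<dots> \<longleftrightarrow> (\<forall>d>0. \<forall>e>0. \<exists>z. norm z < 1 \<and> dist w z < d \<and> norm (u z) < e)"
  proof (intro all_cong)
    fix d :: real
    have "L d \<le> 0 \<longleftrightarrow> (\<forall>e>0. L d < ereal e)"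
    proof (intro iffI allI impI)
      fix e :: real assume a: "L d \<le> 0" "0 < e"
      have "0 < ereal e" using a(2) by simp
      thus "L d < ereal e" by (rule le_less_trans[OF a(1)])
    next
      show "\<forall>e>0. L d < ereal e \<Longrightarrow> L d \<le> 0"
        by (rule ereal_le_epsilon2) (auto intro: less_imp_le)
    qed
    also have "\<dots> \<longleftrightarrow> (\<forall>e>0. \<exists>z. norm z < 1 \<and> dist w z < d \<and> norm (u z) < e)"
      unfolding L_def S by (auto simp: INF_less_iff)
    finally show "L d \<le> 0 \<longleftrightarrow> (\<forall>e>0. \<exists>z. norm z < 1 \<and> dist w z < d \<and> norm (u z) < e)" .
  qed
  finally show ?thesis .
qed

lemma Y_subset: "Y \<subseteq> sphere 0 1" by (simp add: Y_def)

lemma closed_Y: "closed Y"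
proof -
  have "w \<in> Y" if w: "w \<in> closure Y" for w
  proof -
    have "closure Y \<subseteq> sphere 0 1" by (rule closure_minimal[OF Y_subset]) simp
    hence n: "norm w = 1" using w by auto
    show ?thesis unfolding Y_iff[OF n]
    proof (intro allI impI)
      fix d e :: real assume d: "d > 0" "e > 0"
      obtain v where v: "v \<in> Y" "dist v w < d/2" using w d by (metis closure_approachable half_gt_zero)
      have nv: "norm v = 1" using v Y_subset by auto
      obtain z where "norm z < 1" "dist v z < d/2" "norm (u z) < e"
        using v(1)[unfolded Y_iff[OF nv]] d by (meson half_gt_zero)
      thus "\<exists>z. norm z < 1 \<and> dist w z < d \<and> norm (u z) < e"
        using v(2) dist_triangle3[of w z v] by (intro exI[of _ z]) auto
    qed
  qed
  thus ?thesis using closure_subset_eq by blast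
qed

text \<open>Normalized kernels at points approaching \<open>\<zeta> \<in> Y\<close> along which \<open>u\<close> tends to 0:
  since \<open>\<bar>z - \<lambda>\<bar> = \<bar>1 - cnj \<lambda> z\<bar>\<close> on the circle, they are approximate eigenvectors of multiplication by \<open>z\<close>.\<close>

lemma kernel_sequence:
  assumes zY: "\<zeta> \<in> Y"
  obtains X where "\<And>n. X n \<in> H" "\<And>n::nat. norm (X n) = 1" "\<And>y. y \<in> H \<Longrightarrow> (\<lambda>n. X n \<cdot> y) \<longlonglongrightarrow> 0"
    "\<And>\<phi>. circle_continuous \<phi> \<Longrightarrow> (\<lambda>n. L2_mult \<phi> (X n) - \<phi> \<zeta> *\<^sub>C X n) \<longlonglongrightarrow> 0"
proof -
  have nz: "norm \<zeta> = 1" using zY Y_subset by auto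
  \<comment> \<open>The bound 1/2 keeps the numerator in \<open>norm_kernel\<close> above 1/2, while
    the denominator tends to 0 as the points approach the circle; the norms k n thus grow without
    bound.\<close>
  have "\<exists>z. norm z < 1 \<and> dist \<zeta> z < 1 / real (Suc n) \<and> norm (u z) < 1/2" for n
    using zY[unfolded Y_iff[OF nz], rule_format, of "1 / real (Suc n)" "1/2"] by simp
  then obtain l where l: "\<And>n. norm (l n) < 1" "\<And>n. dist \<zeta> (l n) < 1 / real (Suc n)" "\<And>n. norm (u (l n)) < 1/2"
    by metis
  define k where "k n = norm (kernel (l n))" for n
  define \<epsilon> where "\<epsilon> n = sqrt (4 / real (Suc n))" for n
  have eps: "\<epsilon> \<longlonglongrightarrow> 0"
  proof -
    have "(\<lambda>n. 4 * (1 / real (Suc n))) \<longlonglongrightarrow> 4 * 0" by (intro tendsto_intros LIMSEQ_Suc lim_1_over_n)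
    hence "(\<lambda>n. sqrt (4 * (1 / real (Suc n)))) \<longlonglongrightarrow> sqrt 0" by (intro tendsto_intros) simp
    moreover have "\<epsilon> = (\<lambda>n. sqrt (4 * (1 / real (Suc n))))" by (simp add: \<epsilon>_def fun_eq_iff)
    ultimately show ?thesis by simp
  qed
  have k2: "1 / (k n)\<^sup>2 \<le> 4 / real (Suc n)" and kp: "k n > 0" for n
  proof -
    have "(norm (u (l n)))\<^sup>2 \<le> (1/2)\<^sup>2" using l(3)[of n] by (intro power_mono) auto
    hence a: "1/2 \<le> 1 - (norm (u (l n)))\<^sup>2" by (simp add: power2_eq_square)
    have "1 - norm (l n) \<le> dist \<zeta> (l n)" using norm_triangle_ineq2[of \<zeta> "l n"] nz by (simp add: dist_norm)
    hence b: "1 - norm (l n) < 1 / real (Suc n)" using l(2)[of n] by simp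
    have "1 - (norm (l n))\<^sup>2 = (1 - norm (l n)) * (1 + norm (l n))" by (simp add: power2_eq_square algebra_simps)
    also have "\<dots> \<le> (1 - norm (l n)) * 2" using l(1)[of n] by (intro mult_left_mono) auto
    also have "\<dots> \<le> (1 / real (Suc n)) * 2" using b by (intro mult_right_mono) auto
    finally have c: "1 - (norm (l n))\<^sup>2 \<le> 2 / real (Suc n)" by simp
    have d: "0 < 1 - (norm (l n))\<^sup>2" using l(1)[of n] by (simp add: abs_square_less_1)
    have kk: "(k n)\<^sup>2 = (1 - (norm (u (l n)))\<^sup>2) / (1 - (norm (l n))\<^sup>2)"
      unfolding k_def by (rule norm_kernel[OF l(1)])
    hence "(k n)\<^sup>2 > 0" using a d by simp
    thus "k n > 0" by (simp add: k_def)
    have "1 / (k n)\<^sup>2 = (1 - (norm (l n))\<^sup>2) / (1 - (norm (u (l n)))\<^sup>2)" by (simp add: kk)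
    also have "\<dots> \<le> (2 / real (Suc n)) / (1/2)" using a c d by (intro frac_le) auto
    finally show "1 / (k n)\<^sup>2 \<le> 4 / real (Suc n)" by simp
  qed
  have ke: "1 / k n \<le> \<epsilon> n" for n
    unfolding \<epsilon>_def using kp[of n] k2[of n] by (intro real_le_rsqrt) (simp add: power_divide)
  define X where "X n = of_real (1 / k n) *\<^sub>C kernel (l n)" for n
  have XH: "X n \<in> H" for n using kernel_in[OF l(1)] by (simp add: X_def)
  have nX: "norm (X n) = 1" for n using kp[of n] by (simp add: X_def k_def norm_divide)
  have lim0: "(\<lambda>n. 1 / k n) \<longlonglongrightarrow> 0"
    by (rule tendsto_sandwich[OF _ _ tendsto_const eps]) (use kp ke in \<open>auto intro!: always_eventually simp: less_imp_le\<close>)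
  have weak_kernel: "(\<lambda>n. X n \<cdot> kernel m) \<longlonglongrightarrow> 0" if m: "norm m < 1" for m
  proof (rule Lim_null_comparison)
    show "(\<lambda>n. 1 / k n * (2 / (1 - norm m))) \<longlonglongrightarrow> 0" using tendsto_mult_right[OF lim0, of "2 / (1 - norm m)"] by simp
    show "\<forall>\<^sub>F n in sequentially. norm (X n \<cdot> kernel m) \<le> 1 / k n * (2 / (1 - norm m))"
    proof (intro always_eventually allI)
      fix n
      have d: "1 - norm m \<le> norm (1 - cnj (l n) * m)"
      proof -
        have "norm (cnj (l n) * m) \<le> norm m" using l(1)[of n] by (simp add: norm_mult mult_left_le_one_le)
        thus ?thesis using norm_triangle_ineq2[of 1 "cnj (l n) * m"] by simp
      qed
      have "kernel (l n) \<cdot> kernel m = kernel (l n) \<cdot> szego m"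
        by (rule kernel_reproducing[OF m kernel_in[OF l(1)]])
      also have "\<dots> = (1 - cnj (u (l n)) * u m) / (1 - cnj (l n) * m)"
        using szego_hardy(2)[OF l(1) m] M_hardy(2)[OF szego_hardy(1)[OF l(1)] m]
        by (simp add: kernel_def cinner_simps diff_divide_distrib)
      also have "norm \<dots> \<le> 2 / (1 - norm m)"
      proof -
        have "norm (1 - cnj (u (l n)) * u m) \<le> 1 + norm (u (l n)) * norm (u m)"
          using norm_triangle_ineq4[of 1 "cnj (u (l n)) * u m"] by (simp add: norm_mult)
        also have "\<dots> \<le> 1 + 1 * 1" using norm_u_le[OF l(1)] norm_u_le[OF m] by (intro add_mono mult_mono) auto
        finally show ?thesis unfolding norm_divide using d m by (intro frac_le) auto
      qed
      finally show "norm (X n \<cdot> kernel m) \<le> 1 / k n * (2 / (1 - norm m))"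
        using kp[of n] unfolding X_def L2_cinner_scaleC_left norm_mult
        by (intro mult_mono) (auto simp: norm_divide)
    qed
  qed
  \<comment> \<open>The vectors against which X n tends to 0 form a closed subspace, because the X n
    are unit vectors. It contains all kernels, and a vector of \<open>H\<close> orthogonal to all
    kernels vanishes, so D is all of \<open>H\<close>.\<close>
  define D where "D = {y \<in> H. (\<lambda>n. X n \<cdot> y) \<longlonglongrightarrow> 0}"
  have "closed D"
    unfolding closed_sequential_limits
  proof (intro allI impI)
    fix ys y assume ys: "(\<forall>n. ys n \<in> D) \<and> ys \<longlonglongrightarrow> y"
    hence y: "y \<in> H" using closed_sequentially[OF closed_H, of ys y] by (auto simp: D_def)
    have "(\<lambda>n. X n \<cdot> y) \<longlonglongrightarrow> 0"
    proof (rule LIMSEQ_I)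
      fix e :: real assume e: "e > 0"
      obtain j where j: "norm (ys j - y) < e/2" using LIMSEQ_D[of ys y "e/2"] ys e by auto
      obtain N where N: "\<And>n. n \<ge> N \<Longrightarrow> norm (X n \<cdot> ys j) < e/2"
        using LIMSEQ_D[of "\<lambda>n. X n \<cdot> ys j" 0 "e/2"] ys e by (auto simp: D_def)
      show "\<exists>no. \<forall>n\<ge>no. norm (X n \<cdot> y - 0) < e"
      proof (intro exI[of _ N] allI impI)
        fix n assume n: "n \<ge> N"
        have "X n \<cdot> y = X n \<cdot> ys j - X n \<cdot> (ys j - y)" by (simp add: cinner_diff_right)
        hence "norm (X n \<cdot> y) \<le> norm (X n \<cdot> ys j) + norm (X n \<cdot> (ys j - y))" by (metis norm_triangle_ineq4)
        also have "norm (X n \<cdot> (ys j - y)) \<le> norm (ys j - y)" using cinner_Cauchy_Schwarz[of "X n" "ys j - y"] nX by simp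
        finally show "norm (X n \<cdot> y - 0) < e" using N[OF n] j by simp
      qed
    qed
    thus "y \<in> D" using y by (simp add: D_def)
  qed
  then interpret D: hilbert_subspace D
  proof unfold_locales
    show "x + y \<in> D" if "x \<in> D" "y \<in> D" for x y
      using that tendsto_add[of "\<lambda>n. X n \<cdot> x" 0 sequentially "\<lambda>n. X n \<cdot> y" 0] by (simp add: D_def cinner_add_right)
    show "c *\<^sub>C x \<in> D" if "x \<in> D" for c x
      using that tendsto_mult_left[of "\<lambda>n. X n \<cdot> x" 0 sequentially "cnj c"] by (simp add: D_def cinner_scaleC_right)
  qed (auto simp: D_def)
  have weak: "(\<lambda>n. X n \<cdot> y) \<longlonglongrightarrow> 0" if y: "y \<in> H" for y
  proof -
    have PD: "D.P y \<in> D" by (rule D.orth_proj_in)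
    have eH: "y - D.P y \<in> H" using y PD by (auto simp: D_def)
    have "y - D.P y = 0"
    proof (rule hardy_H2_eq_0)
      fix m :: complex assume m: "norm m < 1"
      have "kernel m \<in> D" using weak_kernel[OF m] kernel_in[OF m] by (simp add: D_def)
      hence "(y - D.P y) \<cdot> kernel m = 0" by (rule D.orth_proj_props(2))
      thus "(y - D.P y) \<cdot> szego m = 0" using kernel_reproducing[OF m eH] by simp
    qed (rule model_hardy[OF eH])
    thus ?thesis using PD by (simp add: D_def)
  qed
  define Q where "Q \<phi> \<longleftrightarrow> circle_continuous \<phi> \<and> (\<lambda>n. L2_mult \<phi> (X n) - \<phi> \<zeta> *\<^sub>C X n) \<longlonglongrightarrow> 0" for \<phi>
  have Qz: "Q (\<lambda>z. z)"
  proof -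
    have "(\<lambda>n. shift (X n) - \<zeta> *\<^sub>C X n) \<longlonglongrightarrow> 0"
    proof (rule Lim_null_comparison)
      have "(\<lambda>n. 2 * (1 / k n) + 1 / real (Suc n)) \<longlonglongrightarrow> 2 * 0 + 0" by (intro tendsto_intros lim0 LIMSEQ_Suc lim_1_over_n)
      thus "(\<lambda>n. 2 * (1 / k n) + 1 / real (Suc n)) \<longlonglongrightarrow> 0" by simp
      show "\<forall>\<^sub>F n in sequentially. norm (shift (X n) - \<zeta> *\<^sub>C X n) \<le> 2 * (1 / k n) + 1 / real (Suc n)"
      proof (intro always_eventually allI)
        fix n
        have "shift (X n) - \<zeta> *\<^sub>C X n = of_real (1 / k n) *\<^sub>C (shift (kernel (l n)) - l n *\<^sub>C kernel (l n)) - (\<zeta> - l n) *\<^sub>C X n"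
          by (simp add: X_def shift_linear scaleC_diff_right scaleC_diff_left mult.commute diff_divide_distrib)
        hence "norm (shift (X n) - \<zeta> *\<^sub>C X n) \<le> norm (of_real (1 / k n) *\<^sub>C (shift (kernel (l n)) - l n *\<^sub>C kernel (l n))) + norm ((\<zeta> - l n) *\<^sub>C X n)"
          by (simp only: norm_triangle_ineq4)
        also have "\<dots> \<le> (1 / k n) * 2 + 1 / real (Suc n)"
          using kp[of n] norm_shift_kernel[OF l(1)[of n]] l(2)[of n] nX
          by (intro add_mono) (auto simp: norm_divide dist_norm intro!: divide_right_mono)
        finally show "norm (shift (X n) - \<zeta> *\<^sub>C X n) \<le> 2 * (1 / k n) + 1 / real (Suc n)" by simp
      qed
    qed
    thus ?thesis by (auto simp: Q_def shift_def intro: continuous_intros)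
  qed
  have Qall: "(\<lambda>n. L2_mult \<phi> (X n) - \<phi> \<zeta> *\<^sub>C X n) \<longlonglongrightarrow> 0" if cont: "circle_continuous \<phi>" for \<phi>
  proof (rule LIMSEQ_I)
    fix e :: real assume e: "e > 0"
    have "\<exists>\<psi>. Q \<psi> \<and> (\<forall>z\<in>sphere 0 1. norm (\<phi> z - \<psi> z) < e/3)"
    proof (rule circle_polynomial_approximation[of Q])
      show "Q (\<lambda>z. c)" for c by (auto simp: Q_def L2_mult_const intro: continuous_intros)
      show "Q (\<lambda>z. z)" by (rule Qz)
      show "Q cnj"
      proof -
        \<comment> \<open>On the circle cnj z - cnj \<zeta> = - cnj \<zeta> cnj z (z - \<zeta>),
          which deduces the case of the conjugate from that of z.\<close>
        have "(\<lambda>n. (- cnj \<zeta>) *\<^sub>C coshift (shift (X n) - \<zeta> *\<^sub>C X n)) \<longlonglongrightarrow> (- cnj \<zeta>) *\<^sub>C coshift 0"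
          using Qz unfolding Q_def coshift_def shift_def
          by (intro tendsto_scaleC bounded_linear.tendsto[OF bounded_linear_L2_mult[OF bounded_symbol_cnj_id]]) auto
        moreover have "coshift 0 = 0" using coshift_linear(2)[of 0 0] by simp
        moreover have "(- cnj \<zeta>) *\<^sub>C coshift (shift (X n) - \<zeta> *\<^sub>C X n) = L2_mult cnj (X n) - cnj \<zeta> *\<^sub>C X n" for n
          using circle_z_cnj[of \<zeta>] nz by (simp add: coshift_diff coshift_linear scaleC_diff_right mult.commute coshift_def[symmetric])
        ultimately have "(\<lambda>n. L2_mult cnj (X n) - cnj \<zeta> *\<^sub>C X n) \<longlonglongrightarrow> 0" by (simp only: scaleC_zero_right)
        thus ?thesis by (auto simp: Q_def intro: continuous_intros)
      qed
      fix f g assume fg: "Q f" "Q g"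
      hence c: "circle_continuous f" "circle_continuous g" by (auto simp: Q_def)
      note b = continuous_bounded_symbol[OF c(1)] continuous_bounded_symbol[OF c(2)]
      have "(\<lambda>n. (L2_mult f (X n) - f \<zeta> *\<^sub>C X n) + (L2_mult g (X n) - g \<zeta> *\<^sub>C X n)) \<longlonglongrightarrow> 0 + 0"
        using fg unfolding Q_def by (intro tendsto_add) auto
      thus "Q (\<lambda>z. f z + g z)"
        using c by (auto simp: Q_def L2_mult_add_symbol b continuous_bounded_symbol continuous_on_add scaleC_add_left algebra_simps)
      have "(\<lambda>n. L2_mult f (L2_mult g (X n) - g \<zeta> *\<^sub>C X n) + g \<zeta> *\<^sub>C (L2_mult f (X n) - f \<zeta> *\<^sub>C X n)) \<longlonglongrightarrow> L2_mult f 0 + g \<zeta> *\<^sub>C 0"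
        using fg unfolding Q_def
        by (intro tendsto_add tendsto_scaleC bounded_linear.tendsto[OF bounded_linear_L2_mult[OF b(1)]]) auto
      moreover have "L2_mult f 0 = 0" using L2_mult_scaleC[OF b(1), of 0 0] by simp
      moreover have "L2_mult f (L2_mult g (X n) - g \<zeta> *\<^sub>C X n) + g \<zeta> *\<^sub>C (L2_mult f (X n) - f \<zeta> *\<^sub>C X n) = L2_mult (\<lambda>z. f z * g z) (X n) - (f \<zeta> * g \<zeta>) *\<^sub>C X n" for n
      proof -
        have "L2_mult f (L2_mult g (X n) - g \<zeta> *\<^sub>C X n) = L2_mult f (L2_mult g (X n)) - g \<zeta> *\<^sub>C L2_mult f (X n)"
          using linear_diff[OF bounded_linear.linear[OF bounded_linear_L2_mult[OF b(1)]]] L2_mult_scaleC[OF b(1)] by simp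
        thus ?thesis by (simp add: L2_mult_mult[OF b] scaleC_diff_right mult.commute)
      qed
      ultimately show "Q (\<lambda>z. f z * g z)"
        using c by (auto simp: Q_def intro: continuous_intros)
    qed (use cont e in auto)
    then obtain \<psi> where \<psi>: "circle_continuous \<psi>" "(\<lambda>n. L2_mult \<psi> (X n) - \<psi> \<zeta> *\<^sub>C X n) \<longlonglongrightarrow> 0" "\<And>z. z \<in> sphere 0 1 \<Longrightarrow> norm (\<phi> z - \<psi> z) < e/3"
      unfolding Q_def by blast
    obtain N where N: "\<And>n. n \<ge> N \<Longrightarrow> norm (L2_mult \<psi> (X n) - \<psi> \<zeta> *\<^sub>C X n) < e/3"
      using LIMSEQ_D[OF \<psi>(2), of "e/3"] e by auto
    show "\<exists>no. \<forall>n\<ge>no. norm (L2_mult \<phi> (X n) - \<phi> \<zeta> *\<^sub>C X n - 0) < e"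
    proof (intro exI[of _ N] allI impI)
      fix n assume n: "n \<ge> N"
      have "L2_mult \<phi> (X n) - \<phi> \<zeta> *\<^sub>C X n = L2_mult (\<lambda>z. \<phi> z - \<psi> z) (X n) + (L2_mult \<psi> (X n) - \<psi> \<zeta> *\<^sub>C X n) - (\<phi> \<zeta> - \<psi> \<zeta>) *\<^sub>C X n"
        by (simp add: L2_mult_diff_symbol[OF cont \<psi>(1)] scaleC_diff_left)
      hence "norm (L2_mult \<phi> (X n) - \<phi> \<zeta> *\<^sub>C X n) \<le> norm (L2_mult (\<lambda>z. \<phi> z - \<psi> z) (X n)) + norm (L2_mult \<psi> (X n) - \<psi> \<zeta> *\<^sub>C X n) + norm ((\<phi> \<zeta> - \<psi> \<zeta>) *\<^sub>C X n)"
        by (simp only:) (intro order_trans[OF norm_triangle_ineq4] add_mono norm_triangle_ineq order_refl)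
      also have "norm (L2_mult (\<lambda>z. \<phi> z - \<psi> z) (X n)) \<le> e/3 * norm (X n)"
        by (intro norm_L2_mult_le continuous_bounded_symbol continuous_intros cont \<psi>(1) less_imp_le[OF \<psi>(3)])
      also have "norm ((\<phi> \<zeta> - \<psi> \<zeta>) *\<^sub>C X n) \<le> e/3" using \<psi>(3)[of \<zeta>] nz nX by simp
      finally show "norm (L2_mult \<phi> (X n) - \<phi> \<zeta> *\<^sub>C X n - 0) < e" using N[OF n] nX by simp
    qed
  qed
  show ?thesis by (rule that[OF XH nX weak Qall])
qed

end

section \<open>Compactness away from the spectrum\<close>

text \<open>By periodicity the parameter interval can be centred at z0, so that an arc around z0
  becomes a single interval around 0.\<close>

lemma circle_integral_rotated:
  fixes f :: "complex \<Rightarrow> 'a :: euclidean_space"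
  assumes c: "continuous_on (sphere 0 1) f" and z0: "norm z0 = 1"
  shows "(\<integral>z. f z \<partial>\<mu>) = integral {-pi..pi} (\<lambda>t. f (z0 * cis t)) /\<^sub>R (2*pi)"
proof -
  define k where "k t = f (cis t)" for t
  have kc: "continuous_on S k" for S
    unfolding k_def by (rule continuous_on_compose2[OF c]) (auto intro!: continuous_intros)
  have per: "k (t + 2 * pi) = k t" for t by (simp add: k_def cis_mult[symmetric] del: cis_mult)
  have ki: "k integrable_on {x..y}" for x y :: real by (rule integrable_continuous_real[OF kc])
  obtain b where b: "0 \<le> b" "b \<le> 2 * pi" "z0 = cis (b + pi)"
  proof -
    have "(Re z0)\<^sup>2 + (Im z0)\<^sup>2 = 1"
      using z0 by (simp add: cmod_def)
    then obtain t where t: "0 \<le> t" "t < 2 * pi" "Re z0 = cos t" "Im z0 = sin t"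
      using sincos_total_2pi by blast
    hence z: "z0 = cis t" by (simp add: complex_eq_iff)
    show ?thesis
    proof (cases "t \<ge> pi")
      case True thus ?thesis using t z by (intro that[of "t - pi"]) auto
    next
      case False
      have "cis (t + pi + pi) = cis t" by (simp add: cis_mult[symmetric] del: cis_mult)
      thus ?thesis using t z False by (intro that[of "t + pi"]) auto
    qed
  qed
  have "integral {-pi..pi} (\<lambda>t. f (z0 * cis t)) = integral {-pi..pi} (k \<circ> (\<lambda>t. t + (b + pi)))"
    by (simp add: k_def b(3) cis_mult comp_def add.commute)
  also have "\<dots> = integral {b..b + 2*pi} k"
    using integral_shift[OF kc, of "-pi" pi "b + pi"] by (simp add: add.commute add.left_commute)
  also have "\<dots> = integral {b..2*pi} k + integral {2*pi..b + 2*pi} k"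
    by (rule Henstock_Kurzweil_Integration.integral_combine[symmetric]) (use b ki in auto)
  also have "integral {2*pi..b + 2*pi} k = integral {0..b} (k \<circ> (\<lambda>t. t + 2*pi))"
    using integral_shift[OF kc, of 0 b "2*pi"] by simp
  also have "\<dots> = integral {0..b} k" by (simp add: comp_def per)
  also have "integral {b..2*pi} k + integral {0..b} k = integral {0..2*pi} k"
    using Henstock_Kurzweil_Integration.integral_combine[of 0 b "2*pi" k] b ki by (simp add: add.commute)
  finally have "integral {-pi..pi} (\<lambda>t. f (z0 * cis t)) = integral {0..2*pi} k" .
  moreover have "k = (\<lambda>t. f (cis t))" by (simp add: k_def fun_eq_iff)
  ultimately show ?thesis
    unfolding circle_integral_continuous[OF c] by simp
qed

text \<open>The mean value theorem bounds the first derivative on the half of the interval next to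
  0, hence L is Lipschitz there. The sequence S anchors the estimate: L tends to 0 along it as it
  approaches 0.\<close>

lemma bounded_second_derivative_linear_bound:
  fixes L L1 L2 :: "real \<Rightarrow> real"
  assumes d: "d > 0"
    and D1: "\<And>s. -d < s \<Longrightarrow> s < 0 \<Longrightarrow> (L has_real_derivative L1 s) (at s)"
    and D2: "\<And>s. -d < s \<Longrightarrow> s < 0 \<Longrightarrow> (L1 has_real_derivative L2 s) (at s)"
    and bd: "\<And>s. -d < s \<Longrightarrow> s < 0 \<Longrightarrow> \<bar>L2 s\<bar> \<le> C"
    and sq: "S \<longlonglongrightarrow> 0" "\<And>n. S n < 0" "(\<lambda>n. L (S n)) \<longlonglongrightarrow> 0"
  shows "\<exists>C'\<ge>0. \<forall>s. -d/2 \<le> s \<longrightarrow> s < 0 \<longrightarrow> \<bar>L s\<bar> \<le> C' * \<bar>s\<bar>"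
proof -
  have "\<bar>L2 (-d/2)\<bar> \<le> C" using bd[of "-d/2"] d by simp
  hence C: "0 \<le> C" by linarith
  define C' where "C' = \<bar>L1 (-d/2)\<bar> + C * d"
  have L1: "\<bar>L1 s\<bar> \<le> C'" if "-d/2 \<le> s" "s < 0" for s
  proof (cases "s = -d/2")
    case True thus ?thesis using C d by (simp add: C'_def)
  next
    case False
    hence "\<exists>z>-d/2. z < s \<and> L1 s - L1 (-d/2) = (s - (-d/2)) * L2 z"
      using that d by (intro MVT2 D2) auto
    then obtain z where z: "-d/2 < z" "z < s" "L1 s - L1 (-d/2) = (s - (-d/2)) * L2 z" by blast
    have "\<bar>(s - (-d/2)) * L2 z\<bar> \<le> d * C"
      unfolding abs_mult using that z d bd[of z] by (intro mult_mono) auto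
    thus ?thesis using z(3) unfolding C'_def by (simp add: mult.commute)
  qed
  have C'0: "0 \<le> C'" using C d by (simp add: C'_def)
  have "\<bar>L s\<bar> \<le> C' * \<bar>s\<bar>" if s: "-d/2 \<le> s" "s < 0" for s
  proof -
    have lip: "\<bar>L t - L s\<bar> \<le> C' * (t - s)" if "s < t" "t < 0" for t
    proof -
      have "\<exists>z>s. z < t \<and> L t - L s = (t - s) * L1 z"
        using that s d by (intro MVT2 D1) auto
      then obtain z where z: "s < z" "z < t" "L t - L s = (t - s) * L1 z" by blast
      have "\<bar>L t - L s\<bar> = (t - s) * \<bar>L1 z\<bar>" using that z(3) by (simp add: abs_mult)
      also have "\<dots> \<le> (t - s) * C'" using that z s L1[of z] by (intro mult_left_mono) auto
      finally show ?thesis by (simp add: mult.commute)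
    qed
    have ev: "\<forall>\<^sub>F n in sequentially. s < S n" using order_tendstoD(1)[OF sq(1) s(2)] .
    have "(\<lambda>n. \<bar>L (S n) - L s\<bar>) \<longlonglongrightarrow> \<bar>0 - L s\<bar>" by (intro tendsto_intros sq)
    moreover have "(\<lambda>n. C' * (S n - s)) \<longlonglongrightarrow> C' * (0 - s)" by (intro tendsto_intros sq)
    moreover have "\<forall>\<^sub>F n in sequentially. \<bar>L (S n) - L s\<bar> \<le> C' * (S n - s)"
      using ev by eventually_elim (use lip sq(2) in auto)
    ultimately have "\<bar>0 - L s\<bar> \<le> C' * (0 - s)" by (intro tendsto_le[OF sequentially_bot])
    thus ?thesis using s by simp
  qed
  thus ?thesis using C'0 by blast
qed

context nonconstant_inner
begin

text \<open>In the coordinate z = z0 exp w the circle becomes the imaginary axis, and the disk near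
  z0 corresponds to a half-disk. The half-disk is convex and u has no zeros over it, so u has a
  holomorphic logarithm there. The bounds of \<rho> and \<delta> by 1 are normalizations.\<close>

lemma away_from_spectrum_logarithm:
  assumes z0: "norm z0 = 1" "z0 \<notin> Y"
  obtains \<rho> \<delta> g where "0 < \<rho>" "\<rho> \<le> 1" "0 < \<delta>" "\<delta> \<le> 1" "g holomorphic_on {w. norm w < \<rho> \<and> Re w < 0}"
    "\<And>w. norm w < \<rho> \<Longrightarrow> Re w < 0 \<Longrightarrow> \<delta> \<le> norm (u (z0 * exp w)) \<and> Re (g w) = ln (norm (u (z0 * exp w)))"
proof -
  obtain d e where de: "d > 0" "e > 0" "\<And>z. norm z < 1 \<Longrightarrow> dist z0 z < d \<Longrightarrow> e \<le> norm (u z)"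
    using z0(2)[unfolded Y_iff[OF z0(1)]] by (meson not_less)
  have "isCont (\<lambda>w. z0 * exp w) 0" by (intro continuous_intros)
  then obtain r where r: "r > 0" "\<And>w. norm w < r \<Longrightarrow> dist (z0 * exp w) z0 < d"
    using de(1) unfolding continuous_at_eps_delta by (auto simp: dist_norm)
  define \<rho> where "\<rho> = min r 1"
  define \<Omega> where "\<Omega> = {w. norm w < \<rho> \<and> Re w < 0}"
  have \<Omega>: "\<Omega> = ball 0 \<rho> \<inter> {w. Re w < 0}" by (auto simp: \<Omega>_def)
  have conv: "convex \<Omega>" "open \<Omega>" unfolding \<Omega> by (intro convex_Int open_Int convex_ball open_ball convex_halfspace_Re_lt open_halfspace_Re_lt)+
  have n1: "norm (z0 * exp w) < 1" if "w \<in> \<Omega>" for w using that z0 by (simp add: \<Omega>_def norm_mult)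
  have lb: "e \<le> norm (u (z0 * exp w))" if "w \<in> \<Omega>" for w
    using that r(2)[of w] by (intro de(3) n1) (auto simp: \<Omega>_def \<rho>_def dist_commute)
  have "((u \<circ> (\<lambda>w. z0 * exp w))) holomorphic_on \<Omega>"
    by (rule holomorphic_on_compose_gen[OF _ u_holomorphic]) (use n1 in \<open>auto intro!: holomorphic_intros\<close>)
  then obtain g where g: "g holomorphic_on \<Omega>" "\<And>w. w \<in> \<Omega> \<Longrightarrow> (u \<circ> (\<lambda>w. z0 * exp w)) w = exp (g w)"
    by (rule contractible_imp_holomorphic_log[OF _ convex_imp_contractible[OF conv(1)]]) (use lb de(2) in force)+
  have "Re (g w) = ln (norm (u (z0 * exp w)))" if "w \<in> \<Omega>" for w
    using g(2)[OF that] by simp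
  thus ?thesis
    using that[of \<rho> "min e 1" g] r(1) de(2) lb g(1) by (auto simp: \<rho>_def \<Omega>_def intro: min.coboundedI1)
qed

text \<open>At z0 times \<open>cis t\<close> this is max 0 (cos t - cos a), so for small a it lives
  on the arc |t| \<le> a. Its square and the first derivative of the square vanish at the ends of
  the arc, as two integrations by parts require.\<close>

definition bump :: "complex \<Rightarrow> real \<Rightarrow> complex \<Rightarrow> real" where
  "bump z0 a z = max 0 (Re (z * cnj z0) - cos a)"

lemma bump_continuous: "continuous_on S (bump z0 a)"
  unfolding bump_def by (intro continuous_intros)

lemma bump_bound: "norm z0 = 1 \<Longrightarrow> norm z = 1 \<Longrightarrow> 0 \<le> bump z0 a z \<and> bump z0 a z \<le> 2"
proof -
  assume n: "norm z0 = 1" "norm z = 1"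
  have "Re (z * cnj z0) \<le> 1" using complex_Re_le_cmod[of "z * cnj z0"] n by (simp add: norm_mult)
  moreover have "-1 \<le> cos a" by (rule cos_ge_minus_one)
  ultimately have "Re (z * cnj z0) - cos a \<le> 2" by linarith
  thus ?thesis by (simp add: bump_def del: times_complex.sel)
qed

text \<open>With \<open>\<phi> = (cos t - cos a)\<^sup>2\<close> and \<open>u (z\<^sub>0 exp w) = exp (g w)\<close>, integration by parts shows that
  the function \<open>L s = \<integral> \<phi> t * Re (g (s + \<i> t)) dt\<close>, \<open>\<bar>t\<bar> \<le> a\<close>, has a bounded second derivative.
  Since \<open>\<bar>u\<bar> = 1\<close> almost everywhere on the circle, \<open>L\<close> tends to 0 at 0, whence \<open>\<bar>L s\<bar> = O(\<bar>s\<bar>)\<close>.\<close>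

lemma log_integral_derivatives:
  assumes g: "g holomorphic_on {w. norm w < \<rho> \<and> Re w < 0}" and \<rho>: "0 < \<rho>" "\<rho> \<le> 1"
    and bd: "\<And>w. norm w < \<rho> \<Longrightarrow> Re w < 0 \<Longrightarrow> \<bar>Re (g w)\<bar> \<le> C"
  defines "L \<equiv> \<lambda>s. integral {-\<rho>/2..\<rho>/2} (\<lambda>t. (cos t - cos (\<rho>/2))\<^sup>2 * Re (g (of_real s + \<i> * of_real t)))"
  shows "\<exists>L1 L2. \<forall>s. -\<rho>/2 < s \<longrightarrow> s < 0 \<longrightarrow> (L has_real_derivative L1 s) (at s) \<and> (L1 has_real_derivative L2 s) (at s) \<and> \<bar>L2 s\<bar> \<le> 6 * C"
proof -
  define a where "a = \<rho>/2"
  define \<Omega> where "\<Omega> = {w. norm w < \<rho> \<and> Re w < 0}"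
  have \<Omega>o: "open \<Omega>"
  proof -
    have "\<Omega> = ball 0 \<rho> \<inter> {w. Re w < 0}" by (auto simp: \<Omega>_def)
    thus ?thesis by (simp add: open_Int open_halfspace_Re_lt)
  qed
  define V where "V = ball 0 a \<inter> {w::complex. Re w < 0}"
  have V: "open V" "convex V" unfolding V_def by (intro convex_Int open_Int convex_ball open_ball convex_halfspace_Re_lt open_halfspace_Re_lt)+
  have in\<Omega>: "s + \<i> * of_real t \<in> \<Omega>" if "s \<in> V" "t \<in> {-a..a}" for s t
  proof -
    have "norm (s + \<i> * of_real t) \<le> norm s + norm (\<i> * of_real t)" by (rule norm_triangle_ineq)
    also have "\<dots> < a + a" using that by (intro add_less_le_mono) (auto simp: V_def norm_mult)
    finally show ?thesis using that by (simp add: \<Omega>_def V_def a_def)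
  qed
  define \<phi> where "\<phi> t = (cos t - cos a)\<^sup>2" for t :: real
  define \<phi>1 where "\<phi>1 t = - 2 * (cos t - cos a) * sin t" for t :: real
  define \<phi>2 where "\<phi>2 t = 2 * (sin t)\<^sup>2 - 2 * (cos t - cos a) * cos t" for t :: real
  have d\<phi>: "(\<phi> has_real_derivative \<phi>1 t) (at t within S)" "(\<phi>1 has_real_derivative \<phi>2 t) (at t within S)" for t S
    unfolding \<phi>_def[abs_def] \<phi>1_def[abs_def] \<phi>2_def
    by (auto intro!: derivative_eq_intros simp: power2_eq_square algebra_simps)
  have c\<phi>: "continuous_on S \<phi>" "continuous_on S \<phi>1" "continuous_on S \<phi>2" for S
    unfolding \<phi>_def[abs_def] \<phi>1_def[abs_def] \<phi>2_def[abs_def] by (intro continuous_intros)+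
  \<comment> \<open>Differentiation under the integral is carried out in a complex parameter s and
    for a general holomorphic h, so that it applies to g and to its derivative; the real derivatives
    of L are read off at real s.\<close>
  have leib: "((\<lambda>s. integral {-a..a} (\<lambda>t. of_real (\<phi> t) * h (s + \<i> * of_real t))) has_field_derivative
        integral {-a..a} (\<lambda>t. of_real (\<phi> t) * deriv h (s + \<i> * of_real t))) (at s)"
    if h: "h holomorphic_on \<Omega>" and s: "s \<in> V" for h s
  proof -
    have hc: "continuous_on \<Omega> h" by (rule holomorphic_on_imp_continuous_on[OF h])
    have dhc: "continuous_on \<Omega> (deriv h)"
      by (rule holomorphic_on_imp_continuous_on[OF holomorphic_deriv[OF h \<Omega>o]])
    have "((\<lambda>s. integral (cbox (-a) a) (\<lambda>t. of_real (\<phi> t) * h (s + \<i> * of_real t))) has_field_derivative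
        integral (cbox (-a) a) (\<lambda>t. of_real (\<phi> t) * deriv h (s + \<i> * of_real t))) (at s within V)"
    proof (rule leibniz_rule_field_derivative[where fx = "\<lambda>s t. of_real (\<phi> t) * deriv h (s + \<i> * of_real t)"])
      fix x t assume x: "x \<in> V" "t \<in> cbox (-a) a"
      hence "x + \<i> * of_real t \<in> \<Omega>" using in\<Omega> by auto
      hence "(h has_field_derivative deriv h (x + \<i> * of_real t)) (at (x + \<i> * of_real t))"
        by (rule holomorphic_derivI[OF h \<Omega>o])
      hence "((\<lambda>x. h (x + \<i> * of_real t)) has_field_derivative deriv h (x + \<i> * of_real t)) (at x)"
        using DERIV_shift[of h _ x "\<i> * of_real t"] by simp
      thus "((\<lambda>x. of_real (\<phi> t) * h (x + \<i> * of_real t)) has_field_derivative of_real (\<phi> t) * deriv h (x + \<i> * of_real t)) (at x within V)"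
        by (rule DERIV_cmult[OF has_field_derivative_at_within])
    next
      fix x assume "x \<in> V"
      thus "(\<lambda>t. of_real (\<phi> t) * h (x + \<i> * of_real t)) integrable_on cbox (-a) a"
        using in\<Omega> by (intro integrable_continuous continuous_intros c\<phi> continuous_on_compose2[OF hc]) auto
    next
      show "continuous_on (V \<times> cbox (-a) a) (\<lambda>(x, t). of_real (\<phi> t) * deriv h (x + \<i> * of_real t))"
        unfolding case_prod_beta
        using in\<Omega> by (intro continuous_intros continuous_on_compose2[OF c\<phi>(1)[of UNIV]] continuous_on_compose2[OF dhc]) auto
    qed (use s V in auto)
    thus ?thesis using at_within_open[OF s V(1)] by simp
  qed
  define N where "N s = integral {-a..a} (\<lambda>t. of_real (\<phi> t) * g (s + \<i> * of_real t))" for s :: complex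
  define N1 where "N1 s = integral {-a..a} (\<lambda>t. of_real (\<phi> t) * deriv g (s + \<i> * of_real t))" for s :: complex
  define N2 where "N2 s = integral {-a..a} (\<lambda>t. of_real (\<phi> t) * deriv (deriv g) (s + \<i> * of_real t))" for s :: complex
  have g\<Omega>: "g holomorphic_on \<Omega>" using g by (simp add: \<Omega>_def)
  have g1\<Omega>: "deriv g holomorphic_on \<Omega>" by (rule holomorphic_deriv[OF g\<Omega> \<Omega>o])
  have g2\<Omega>: "deriv (deriv g) holomorphic_on \<Omega>" by (rule holomorphic_deriv[OF g1\<Omega> \<Omega>o])
  have DN: "(N has_field_derivative N1 s) (at s)" "(N1 has_field_derivative N2 s) (at s)" if "s \<in> V" for s
    using leib[OF g\<Omega> that] leib[OF g1\<Omega> that] by (simp_all add: N_def[abs_def] N1_def[abs_def] N2_def)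
  have parts: "N2 s = - integral {-a..a} (\<lambda>t. of_real (\<phi>2 t) * g (s + \<i> * of_real t))" if s: "s \<in> V" for s
  proof -
    \<comment> \<open>Since d/dt acts on functions of s + i t as i times the complex derivative, the
      cross terms cancel and F has derivative \<phi> g'' + \<phi>2 g. F vanishes at both ends
      because \<phi> and \<phi>1 do: both integrations by parts happen at once.\<close>
    define F where "F t = - \<i> * of_real (\<phi> t) * deriv g (s + \<i> * of_real t) + of_real (\<phi>1 t) * g (s + \<i> * of_real t)" for t :: real
    have "((\<lambda>t. of_real (\<phi> t) * deriv (deriv g) (s + \<i> * of_real t) + of_real (\<phi>2 t) * g (s + \<i> * of_real t)) has_integral F a - F (-a)) {-a..a}"
    proof (rule fundamental_theorem_of_calculus)
      fix t assume t: "t \<in> {-a..a}"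
      have vd: "((\<lambda>t. h (s + \<i> * of_real t)) has_vector_derivative \<i> * deriv h (s + \<i> * of_real t)) (at t within {-a..a})" if h: "h holomorphic_on \<Omega>" for h
      proof -
        have "((\<lambda>t. s + \<i> * of_real t) has_vector_derivative \<i>) (at t within {-a..a})"
          by (auto intro!: derivative_eq_intros has_vector_derivative_real_field)
        moreover have "(h has_field_derivative deriv h (s + \<i> * of_real t)) (at (s + \<i> * of_real t))"
          by (rule holomorphic_derivI[OF h \<Omega>o in\<Omega>[OF s t]])
        ultimately have "((h \<circ> (\<lambda>t. s + \<i> * of_real t)) has_vector_derivative \<i> * deriv h (s + \<i> * of_real t)) (at t within {-a..a})"
          using field_vector_diff_chain_within[of "\<lambda>t. s + \<i> * of_real t" \<i> t "{-a..a}" h "deriv h (s + \<i> * of_real t)"] by (simp add: has_field_derivative_at_within)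
        thus ?thesis by (simp add: comp_def)
      qed
      have v\<phi>: "((\<lambda>t. complex_of_real (\<phi> t)) has_vector_derivative of_real (\<phi>1 t)) (at t within {-a..a})"
        "((\<lambda>t. complex_of_real (\<phi>1 t)) has_vector_derivative of_real (\<phi>2 t)) (at t within {-a..a})"
        using d\<phi> by (auto intro!: has_vector_derivative_of_real simp: has_real_derivative_iff_has_vector_derivative[symmetric])
      show "(F has_vector_derivative of_real (\<phi> t) * deriv (deriv g) (s + \<i> * of_real t) + of_real (\<phi>2 t) * g (s + \<i> * of_real t)) (at t within {-a..a})"
        unfolding F_def[abs_def]
        by (rule has_vector_derivative_eq_rhs[OF has_vector_derivative_add[OF has_vector_derivative_mult[OF has_vector_derivative_mult_right[OF v\<phi>(1)] vd[OF g1\<Omega>]] has_vector_derivative_mult[OF v\<phi>(2) vd[OF g\<Omega>]]]])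
           (simp add: algebra_simps)
    qed (use \<rho> in \<open>simp add: a_def\<close>)
    moreover have "F a = 0" "F (-a) = 0" by (simp_all add: F_def \<phi>_def \<phi>1_def)
    ultimately have z: "((\<lambda>t. of_real (\<phi> t) * deriv (deriv g) (s + \<i> * of_real t) + of_real (\<phi>2 t) * g (s + \<i> * of_real t)) has_integral 0) {-a..a}" by simp
    have i: "(\<lambda>t. of_real (\<phi> t) * deriv (deriv g) (s + \<i> * of_real t)) integrable_on {-a..a}"
      "(\<lambda>t. of_real (\<phi>2 t) * g (s + \<i> * of_real t)) integrable_on {-a..a}"
      using in\<Omega>[OF s]
      by (auto intro!: integrable_continuous_real continuous_intros c\<phi> continuous_on_compose2[OF holomorphic_on_imp_continuous_on[OF g2\<Omega>]] continuous_on_compose2[OF holomorphic_on_imp_continuous_on[OF g\<Omega>]])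
    have "N2 s + integral {-a..a} (\<lambda>t. of_real (\<phi>2 t) * g (s + \<i> * of_real t)) = 0"
      using integral_unique[OF z] unfolding Henstock_Kurzweil_Integration.integral_add[OF i] by (simp add: N2_def)
    thus ?thesis by (simp add: eq_neg_iff_add_eq_0)
  qed
  have reV: "complex_of_real s \<in> V" if "-\<rho>/2 < s" "s < 0" for s
    using that by (auto simp: V_def a_def)
  have LN: "L s = Re (N (of_real s))" if "-\<rho>/2 < s" "s < 0" for s
  proof -
    have "(\<lambda>t. of_real (\<phi> t) * g (of_real s + \<i> * of_real t)) integrable_on {-a..a}"
      using in\<Omega>[OF reV[OF that]]
      by (auto intro!: integrable_continuous_real continuous_intros c\<phi> continuous_on_compose2[OF holomorphic_on_imp_continuous_on[OF g\<Omega>]])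
    from integral_linear[OF this bounded_linear_Re]
    show ?thesis by (simp add: L_def N_def a_def \<phi>_def comp_def)
  qed
  have DL: "((\<lambda>s. Re (h (of_real s))) has_real_derivative Re h') (at s)" if "(h has_field_derivative h') (at (complex_of_real s))" for h h' and s :: real
    unfolding has_real_derivative_iff_has_vector_derivative
    by (rule bounded_linear.has_vector_derivative[OF bounded_linear_Re has_vector_derivative_real_field[OF that]])
  have main: "(L has_real_derivative Re (N1 (of_real s))) (at s) \<and> ((\<lambda>s. Re (N1 (of_real s))) has_real_derivative Re (N2 (of_real s))) (at s) \<and> \<bar>Re (N2 (of_real s))\<bar> \<le> 6 * C"
    if s: "-\<rho>/2 < s" "s < 0" for s
  proof (intro conjI)
    have "((\<lambda>s. Re (N (of_real s))) has_real_derivative Re (N1 (of_real s))) (at s)" by (rule DL[OF DN(1)[OF reV[OF s]]])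
    thus "(L has_real_derivative Re (N1 (of_real s))) (at s)"
      by (rule has_field_derivative_transform_within_open[where S = "{-\<rho>/2<..<0}"]) (use s LN in auto)
    show "((\<lambda>s. Re (N1 (of_real s))) has_real_derivative Re (N2 (of_real s))) (at s)" by (rule DL[OF DN(2)[OF reV[OF s]]])
    have i: "(\<lambda>t. of_real (\<phi>2 t) * g (of_real s + \<i> * of_real t)) integrable_on {-a..a}"
      using in\<Omega>[OF reV[OF s]]
      by (auto intro!: integrable_continuous_real continuous_intros c\<phi> continuous_on_compose2[OF holomorphic_on_imp_continuous_on[OF g\<Omega>]])
    have "Re (N2 (of_real s)) = - integral {-a..a} (\<lambda>t. \<phi>2 t * Re (g (of_real s + \<i> * of_real t)))"
      unfolding parts[OF reV[OF s]] using integral_linear[OF i bounded_linear_Re] by (simp add: comp_def)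
    \<comment> \<open>The factor 6 is a bound 2 + 4 for |\<phi>2|, and the interval has length 2 a =
      \<rho> \<le> 1.\<close>
    moreover have "norm (integral {-a..a} (\<lambda>t. \<phi>2 t * Re (g (of_real s + \<i> * of_real t)))) \<le> integral {-a..a} (\<lambda>t. 6 * C)"
    proof (rule integral_norm_bound_integral)
      show "(\<lambda>t. \<phi>2 t * Re (g (of_real s + \<i> * of_real t))) integrable_on {-a..a}"
        using in\<Omega>[OF reV[OF s]]
        by (auto intro!: integrable_continuous_real continuous_intros c\<phi> continuous_on_compose2[OF holomorphic_on_imp_continuous_on[OF g\<Omega>]])
      show "(\<lambda>t. 6 * C) integrable_on {-a..a}" by (rule integrable_const_ivl)
      fix t assume t: "t \<in> {-a..a}"
      have "(sin t)\<^sup>2 \<le> 1" by (simp add: abs_square_le_1)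
      have "\<bar>cos t - cos a\<bar> \<le> 2"
        using abs_cos_le_one[of t] abs_cos_le_one[of a] by linarith
      hence "\<bar>(cos t - cos a) * cos t\<bar> \<le> 2 * 1"
        unfolding abs_mult by (rule mult_mono) auto
      moreover have "\<phi>2 t = 2 * (sin t)\<^sup>2 - 2 * ((cos t - cos a) * cos t)" by (simp add: \<phi>2_def mult.assoc)
      ultimately have "\<bar>\<phi>2 t\<bar> \<le> 6" using zero_le_power2[of "sin t"] \<open>(sin t)\<^sup>2 \<le> 1\<close> by linarith
      moreover have "\<bar>Re (g (of_real s + \<i> * of_real t))\<bar> \<le> C"
        using in\<Omega>[OF reV[OF s] t] by (intro bd) (auto simp: \<Omega>_def)
      ultimately show "norm (\<phi>2 t * Re (g (of_real s + \<i> * of_real t))) \<le> 6 * C"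
        unfolding real_norm_def abs_mult by (intro mult_mono) auto
    qed
    moreover have "integral {-a..a} (\<lambda>t. 6 * C) \<le> 6 * C"
    proof -
      have "0 \<le> C" using order_trans[OF abs_ge_zero bd[of "of_real s"]] s \<rho> by simp
      moreover have "2 * a \<le> 1" using \<rho> by (simp add: a_def)
      moreover have "integral {-a..a} (\<lambda>t. 6 * C) = (2 * a) * (6 * C)" using \<rho> by (simp add: a_def)
      ultimately show ?thesis using \<rho> by (simp add: mult_left_le_one_le a_def)
    qed
    ultimately show "\<bar>Re (N2 (of_real s))\<bar> \<le> 6 * C" by simp
  qed
  show ?thesis
    by (rule exI[of _ "\<lambda>s. Re (N1 (of_real s))"], rule exI[of _ "\<lambda>s. Re (N2 (of_real s))"], intro allI impI, rule main)
qed

lemma radii_half: "1/2 \<le> radii n"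
  by (auto simp: radii_def field_simps)

lemma bump_rotated: "norm z0 = 1 \<Longrightarrow> bump z0 a (z0 * cis t) = max 0 (cos t - cos a)"
proof -
  assume "norm z0 = 1"
  hence eq: "z0 * cis t * cnj z0 = cis t" using circle_z_cnj[of z0] by (simp add: mult_ac)
  show ?thesis unfolding bump_def eq by simp
qed

lemma bump_outside:
  assumes "\<bar>t\<bar> \<le> pi" "0 < a" "a \<le> pi" "a \<le> \<bar>t\<bar>" shows "max 0 (cos t - cos a) = 0"
proof -
  have "cos \<bar>t\<bar> \<le> cos a" using assms by (intro cos_monotone_0_pi_le) auto
  thus ?thesis by simp
qed

text \<open>The fraction is the squared norm of the kernel at r z. By 1 - m^2 \<le> - 2 ln m, its
  weighted mean is controlled by the weighted mean of - ln |u|, which at r = exp s is - L s / (2 pi)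
  and so of order |s| = - ln r. For r \<ge> 1/2 this is at most a multiple of 1 - r^2, which cancels
  the denominator. The bound holds eventually, once the circle of radius r enters the region where
  the logarithm g lives.\<close>

lemma kernel_growth_bound:
  assumes z0: "norm z0 = 1" "z0 \<notin> Y"
  obtains a C where "bump z0 a z0 > 0"
    "\<forall>\<^sub>F n in sequentially. (\<integral>z. (bump z0 a z)\<^sup>2 * ((1 - (norm (u (of_real (radii n) * z)))\<^sup>2) / (1 - (radii n)\<^sup>2)) \<partial>\<mu>) \<le> C"
proof -
  obtain \<rho> \<delta> g where g: "0 < \<rho>" "\<rho> \<le> 1" "0 < \<delta>" "\<delta> \<le> 1" "g holomorphic_on {w. norm w < \<rho> \<and> Re w < 0}"
    and ug: "\<And>w. norm w < \<rho> \<Longrightarrow> Re w < 0 \<Longrightarrow> \<delta> \<le> norm (u (z0 * exp w)) \<and> Re (g w) = ln (norm (u (z0 * exp w)))"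
    by (rule away_from_spectrum_logarithm[OF z0]) (rule that)
  define a where "a = \<rho>/2"
  have a: "0 < a" "a \<le> 1/2" "a < pi" using g pi_gt3 by (auto simp: a_def)
  have bdg: "\<bar>Re (g w)\<bar> \<le> - ln \<delta>" if w: "norm w < \<rho>" "Re w < 0" for w
  proof -
    have "norm (z0 * exp w) < 1" using w z0 by (simp add: norm_mult)
    hence "norm (u (z0 * exp w)) \<le> 1" by (rule norm_u_le)
    moreover have "\<delta> \<le> norm (u (z0 * exp w))" using ug[OF w] by simp
    ultimately have "ln \<delta> \<le> ln (norm (u (z0 * exp w))) \<and> ln (norm (u (z0 * exp w))) \<le> 0"
      using g(3) ln_le_cancel_iff[of \<delta> "norm (u (z0 * exp w))"] ln_le_zero_iff[of "norm (u (z0 * exp w))"] by linarith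
    thus ?thesis using ug[OF w] by simp
  qed
  define L where "L s = integral {-\<rho>/2..\<rho>/2} (\<lambda>t. (cos t - cos (\<rho>/2))\<^sup>2 * Re (g (of_real s + \<i> * of_real t)))" for s
  obtain L1 L2 where L12: "\<And>s. -\<rho>/2 < s \<Longrightarrow> s < 0 \<Longrightarrow> (L has_real_derivative L1 s) (at s) \<and> (L1 has_real_derivative L2 s) (at s) \<and> \<bar>L2 s\<bar> \<le> 6 * (- ln \<delta>)"
    using log_integral_derivatives[OF g(5,1,2) bdg] unfolding L_def[abs_def] by blast
  \<comment> \<open>The logarithm is truncated below at ln \<delta>, which makes h continuous and
    bounded on the whole circle. On the support of the bump and for r near 1 the truncation is
    inactive, so h there is the integrand of L.\<close>
  define h where "h r z = (bump z0 a z)\<^sup>2 * ln (max \<delta> (norm (u (of_real r * z))))" for r :: real and z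
  have hc: "continuous_on (sphere 0 1) (h r)" if "0 \<le> r" "r < 1" for r
    unfolding h_def using g(3)
    by (intro continuous_intros bump_continuous slice_continuous[OF u_holomorphic that]) (auto simp: max_def)
  have Lh: "L s = 2 * pi * (\<integral>z. h (exp s) z \<partial>\<mu>)" if s: "-\<rho>/2 < s" "s < 0" for s
  proof -
    have "(\<integral>z. h (exp s) z \<partial>\<mu>) = integral {-pi..pi} (\<lambda>t. h (exp s) (z0 * cis t)) /\<^sub>R (2*pi)"
      by (rule circle_integral_rotated[OF hc z0(1)]) (use s in auto)
    also have "integral {-pi..pi} (\<lambda>t. h (exp s) (z0 * cis t)) = integral {-pi..pi} (\<lambda>t. if t \<in> {-a..a} then (cos t - cos a)\<^sup>2 * Re (g (of_real s + \<i> * of_real t)) else 0)"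
    proof (rule integral_cong)
      fix t assume t: "t \<in> {-pi..pi}"
      show "h (exp s) (z0 * cis t) = (if t \<in> {-a..a} then (cos t - cos a)\<^sup>2 * Re (g (of_real s + \<i> * of_real t)) else 0)"
      proof (cases "t \<in> {-a..a}")
        case True
        define w where "w = complex_of_real s + \<i> * of_real t"
        have "norm w \<le> \<bar>s\<bar> + \<bar>t\<bar>" using norm_triangle_ineq[of "complex_of_real s" "\<i> * of_real t"] by (simp add: w_def norm_mult)
        also have "\<dots> < \<rho>" using s True by (simp add: a_def) linarith
        finally have w: "norm w < \<rho>" "Re w < 0" using s by (auto simp: w_def)
        have e: "of_real (exp s) * (z0 * cis t) = z0 * exp w"
          by (simp add: w_def exp_add cis_conv_exp exp_of_real mult_ac)
        have "cos a \<le> cos \<bar>t\<bar>" using True a by (intro cos_monotone_0_pi_le) auto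
        thus ?thesis
          using True ug[OF w] unfolding h_def bump_rotated[OF z0(1)] e by (simp add: w_def[symmetric])
      next
        case False
        thus ?thesis using t a bump_outside[of t a] unfolding h_def bump_rotated[OF z0(1)] by auto
      qed
    qed
    also have "\<dots> = L s"
    proof -
      have eq: "{-pi..pi} \<inter> {-a..a} = {-a..a}" "{-a..a} \<inter> {-pi..pi} = {-a..a}" using a by auto
      have "integral {-pi..pi} (\<lambda>t. if t \<in> {-a..a} then (cos t - cos a)\<^sup>2 * Re (g (of_real s + \<i> * of_real t)) else 0)
          = integral {-a..a} (\<lambda>t. (cos t - cos a)\<^sup>2 * Re (g (of_real s + \<i> * of_real t)))"
        unfolding integral_restrict_Int eq ..
      thus ?thesis by (simp only: L_def a_def minus_divide_left)
    qed
    finally show ?thesis by (simp add: field_simps)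
  qed
  define S where "S n = ln (radii n)" for n
  have S: "S n < 0" "exp (S n) = radii n" for n using radii[of n] by (auto simp: S_def)
  have rl: "radii \<longlonglongrightarrow> 1" using radii_at_left by (simp add: filterlim_at)
  have "(\<lambda>n. ln (radii n)) \<longlonglongrightarrow> ln 1" by (intro tendsto_ln rl) simp
  moreover have "S = (\<lambda>n. ln (radii n))" by (simp add: S_def fun_eq_iff)
  ultimately have S0: "S \<longlonglongrightarrow> 0" by simp
  have evS: "\<forall>\<^sub>F n in sequentially. -\<rho>/2/2 < S n" using order_tendstoD(1)[OF S0, of "-\<rho>/2/2"] g(1) by simp
  have ln_bd: "\<bar>ln (max \<delta> (norm (u (of_real (radii n) * z))))\<bar> \<le> - ln \<delta>" if "norm z = 1" for n z
  proof -
    have "norm (u (of_real (radii n) * z)) \<le> 1" using radii[of n] that by (intro norm_u_le) (simp add: norm_mult)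
    hence "max \<delta> (norm (u (of_real (radii n) * z))) \<le> 1" using g(4) by simp
    hence "ln (max \<delta> (norm (u (of_real (radii n) * z)))) \<le> 0" using g(3) by (subst ln_le_zero_iff) auto
    moreover have "ln \<delta> \<le> ln (max \<delta> (norm (u (of_real (radii n) * z))))" using g(3) by (subst ln_le_cancel_iff) auto
    ultimately show ?thesis by simp
  qed
  \<comment> \<open>This is where u being inner enters: its radial limits are unimodular almost
    everywhere, so the truncated logarithm tends to ln 1 = 0, and the truncation provides the
    dominating constant.\<close>
  have "(\<lambda>n. \<integral>z. h (radii n) z \<partial>\<mu>) \<longlonglongrightarrow> (\<integral>z. 0 \<partial>\<mu>)"
  proof (rule integral_dominated_convergence[where w = "\<lambda>_. 4 * (- ln \<delta>)"])
    show "h (radii n) \<in> borel_measurable \<mu>" for n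
      using radii[of n] by (intro continuous_imp_measurable_circle hc) auto
    show "AE z in circle_measure. (\<lambda>n. h (radii n) z) \<longlonglongrightarrow> 0"
      using ub_limit
    proof eventually_elim
      case (elim z)
      have "(\<lambda>n. u (of_real (radii n) * z)) \<longlonglongrightarrow> ub z" by (rule filterlim_compose[OF elim radii_at_left])
      hence "(\<lambda>n. (bump z0 a z)\<^sup>2 * ln (max \<delta> (norm (u (of_real (radii n) * z))))) \<longlonglongrightarrow> (bump z0 a z)\<^sup>2 * ln (max \<delta> (norm (ub z)))"
        using g(3) by (intro tendsto_intros) (auto simp: max_def)
      thus ?case using g(4) by (simp add: h_def max_def)
    qed
    show "AE z in circle_measure. norm (h (radii n) z) \<le> 4 * (- ln \<delta>)" for n
    proof (rule AE_I2)
      fix z assume "z \<in> space \<mu>"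
      hence z: "norm z = 1" by simp
      have "(bump z0 a z)\<^sup>2 \<le> 2\<^sup>2" using bump_bound[OF z0(1) z, of a] by (intro power_mono) auto
      thus "norm (h (radii n) z) \<le> 4 * (- ln \<delta>)"
        unfolding h_def real_norm_def abs_mult using ln_bd[OF z, of n] by (intro mult_mono) auto
    qed
  qed auto
  hence "(\<lambda>n. 2 * pi * (\<integral>z. h (radii n) z \<partial>\<mu>)) \<longlonglongrightarrow> 2 * pi * 0" by (intro tendsto_intros) simp
  moreover have "\<forall>\<^sub>F n in sequentially. 2 * pi * (\<integral>z. h (radii n) z \<partial>\<mu>) = L (S n)"
    using evS by eventually_elim (use Lh S g(1) in auto)
  ultimately have "(\<lambda>n. L (S n)) \<longlonglongrightarrow> 2 * pi * 0" by (rule Lim_transform_eventually)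
  hence LS: "(\<lambda>n. L (S n)) \<longlonglongrightarrow> 0" by simp
  have "\<exists>C'\<ge>0. \<forall>s. -(\<rho>/2)/2 \<le> s \<longrightarrow> s < 0 \<longrightarrow> \<bar>L s\<bar> \<le> C' * \<bar>s\<bar>"
    by (rule bounded_second_derivative_linear_bound[where L = L and ?L1.0 = L1 and ?L2.0 = L2 and C = "6 * (- ln \<delta>)", OF _ _ _ _ S0 S(1) LS]) (use L12 g(1) in simp_all)
  then obtain C' where C': "C' \<ge> 0" "\<And>s. -(\<rho>/2)/2 \<le> s \<Longrightarrow> s < 0 \<Longrightarrow> \<bar>L s\<bar> \<le> C' * \<bar>s\<bar>" by blast
  have "\<forall>\<^sub>F n in sequentially. (\<integral>z. (bump z0 a z)\<^sup>2 * ((1 - (norm (u (of_real (radii n) * z)))\<^sup>2) / (1 - (radii n)\<^sup>2)) \<partial>\<mu>) \<le> 2 * C'"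
    using evS
  proof eventually_elim
    case (elim n)
    define r where "r = radii n"
    have r: "0 < r" "r < 1" using radii by (auto simp: r_def)
    have d: "1 - r\<^sup>2 > 0" using r by (simp add: abs_square_less_1)
    have pos: "- S n \<le> 2 * (1 - r\<^sup>2)"
    proof -
      have "- S n = ln (1 / r)" using r by (simp add: S_def r_def ln_div)
      also have "\<dots> \<le> 1 / r - 1" using r by (intro ln_le_minus_one) auto
      also have "\<dots> = (1 - r) / r" using r by (simp add: field_simps)
      also have "\<dots> \<le> (1 - r) / (1/2)" using r radii_half by (intro divide_left_mono) (auto simp: r_def)
      also have "\<dots> = 2 * ((1 - r) * 1)" by simp
      also have "\<dots> \<le> 2 * ((1 - r) * (1 + r))" using r by (intro mult_left_mono) auto
      also have "\<dots> = 2 * (1 - r\<^sup>2)" by (simp add: power2_eq_square algebra_simps)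
      finally show ?thesis .
    qed
    have i1: "integrable \<mu> (\<lambda>z. (bump z0 a z)\<^sup>2 * (1 - (norm (u (of_real r * z)))\<^sup>2))"
      using r by (intro circle_integrable_continuous continuous_intros bump_continuous slice_continuous u_holomorphic) auto
    have ih: "integrable \<mu> (\<lambda>z. -2 * h r z)"
      using r by (intro circle_integrable_continuous continuous_intros hc) auto
    have "(\<integral>z. (bump z0 a z)\<^sup>2 * (1 - (norm (u (of_real r * z)))\<^sup>2) \<partial>\<mu>) \<le> (\<integral>z. -2 * h r z \<partial>\<mu>)"
    proof (rule integral_mono_AE[OF i1 ih AE_I2])
      fix z assume "z \<in> space \<mu>"
      define m where "m = max \<delta> (norm (u (of_real r * z)))"
      have m: "m > 0" "norm (u (of_real r * z)) \<le> m" using g(3) by (auto simp: m_def)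
      show "(bump z0 a z)\<^sup>2 * (1 - (norm (u (of_real r * z)))\<^sup>2) \<le> -2 * h r z"
      proof (cases "\<delta> \<le> norm (u (of_real r * z))")
        case True
        hence mu: "m = norm (u (of_real r * z))" by (simp add: m_def)
        have "ln (m\<^sup>2) \<le> m\<^sup>2 - 1" using m by (intro ln_le_minus_one) simp
        moreover have "ln (m\<^sup>2) = 2 * ln m" using m by (simp add: ln_realpow)
        ultimately have "1 - m\<^sup>2 \<le> -2 * ln m" by linarith
        hence "(bump z0 a z)\<^sup>2 * (1 - m\<^sup>2) \<le> (bump z0 a z)\<^sup>2 * (-2 * ln m)" by (rule mult_left_mono) simp
        moreover have "h r z = (bump z0 a z)\<^sup>2 * ln m" by (simp add: h_def m_def)
        moreover have "(bump z0 a z)\<^sup>2 * (-2 * ln m) = -2 * ((bump z0 a z)\<^sup>2 * ln m)" by simp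
        ultimately show ?thesis unfolding mu[symmetric] by linarith
      next
        case False
        \<comment> \<open>A point z with nonzero bump lies over the arc |t| < a, where r z = z0 exp
          w with w in the half-disk and |u| \<ge> \<delta>; values below \<delta> thus occur only
          where the bump vanishes.\<close>
        have "bump z0 a z = 0"
        proof (rule ccontr)
          assume nz: "bump z0 a z \<noteq> 0"
          have "norm (z * cnj z0) = 1" using \<open>z \<in> space \<mu>\<close> z0 by (simp add: norm_mult)
          hence "cis (Arg (z * cnj z0)) = z * cnj z0"
            using cis_Arg[of "z * cnj z0"] by (force simp: sgn_div_norm)
          moreover define t where "t = Arg (z * cnj z0)"
          ultimately have t: "\<bar>t\<bar> \<le> pi" "z * cnj z0 = cis t"
            using Arg_bounded[of "z * cnj z0"] by (simp_all add: t_def abs_le_iff del: times_complex.sel)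
          have z: "z = z0 * cis t"
            unfolding t(2)[symmetric] using circle_z_cnj[of z0] z0 by (simp add: mult_ac)
          hence "\<bar>t\<bar> < a" using nz t(1) a bump_outside[of t a] unfolding z bump_rotated[OF z0(1)] by force
          define w where "w = complex_of_real (S n) + \<i> * of_real t"
          have "norm w \<le> \<bar>S n\<bar> + \<bar>t\<bar>" using norm_triangle_ineq[of "complex_of_real (S n)" "\<i> * of_real t"] by (simp add: w_def norm_mult)
          also have "\<dots> < \<rho>" using elim S(1)[of n] \<open>\<bar>t\<bar> < a\<close> g(1) by (simp add: a_def)
          finally have w: "norm w < \<rho>" "Re w < 0" using S(1) by (auto simp: w_def)
          have "of_real r * z = z0 * exp w"
            unfolding z r_def S(2)[symmetric] by (simp add: w_def exp_add cis_conv_exp exp_of_real mult_ac)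
          thus False using ug[OF w] False by simp
        qed
        thus ?thesis by (simp add: h_def)
      qed
    qed
    also have "\<dots> = -2 * (\<integral>z. h r z \<partial>\<mu>)" by simp
    also have "\<dots> = - L (S n) / pi" using Lh[of "S n"] elim S g(1) by (simp add: r_def field_simps)
    also have "\<dots> \<le> \<bar>L (S n)\<bar> / pi" by (intro divide_right_mono) auto
    also have "\<dots> \<le> \<bar>L (S n)\<bar> / 1" using pi_gt3 by (intro divide_left_mono) auto
    also have "\<dots> \<le> C' * \<bar>S n\<bar>" using C'(2)[of "S n"] elim S(1)[of n] by simp
    also have "\<dots> \<le> C' * (2 * (1 - r\<^sup>2))" using pos S(1)[of n] C'(1) by (intro mult_left_mono) auto
    finally have le: "(\<integral>z. (bump z0 a z)\<^sup>2 * (1 - (norm (u (of_real r * z)))\<^sup>2) \<partial>\<mu>) \<le> 2 * C' * (1 - r\<^sup>2)" by (simp only: mult_ac)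
    have "(\<integral>z. (bump z0 a z)\<^sup>2 * ((1 - (norm (u (of_real r * z)))\<^sup>2) / (1 - r\<^sup>2)) \<partial>\<mu>)
        = (\<integral>z. (bump z0 a z)\<^sup>2 * (1 - (norm (u (of_real r * z)))\<^sup>2) \<partial>\<mu>) / (1 - r\<^sup>2)"
      by simp
    also have "\<dots> \<le> 2 * C'" using le d by (simp add: divide_le_eq)
    finally show ?case by (simp add: r_def)
  qed
  moreover have "bump z0 a z0 > 0"
  proof -
    have "cos a < cos 0" using a by (intro cos_monotone_0_pi) auto
    thus ?thesis using bump_rotated[OF z0(1), of a 0] by simp
  qed
  ultimately show ?thesis using that by blast
qed

end

section \<open>Compactness for symbols vanishing on the spectrum\<close>

context nonconstant_inner
begin

text \<open>For a finite orthonormal set in \<open>H\<close>, Bessel's inequality bounds the sum of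
  the squared moduli at r z by the squared norm of the kernel at r z. Weighting by the squared bump,
  integrating and letting r tend to 1 with Fatou's lemma gives the Hilbert--Schmidt bound with the
  constant of \<open>kernel_growth_bound\<close>.\<close>

lemma bump_multiplication_cpt:
  assumes z0: "norm z0 = 1" "z0 \<notin> Y"
  obtains a where "bump z0 a z0 > 0" "cpt (L2_mult (\<lambda>z. complex_of_real (bump z0 a z)))"
proof -
  obtain a C where a: "bump z0 a z0 > 0"
    and C: "\<forall>\<^sub>F n in sequentially. (\<integral>z. (bump z0 a z)\<^sup>2 * ((1 - (norm (u (of_real (radii n) * z)))\<^sup>2) / (1 - (radii n)\<^sup>2)) \<partial>\<mu>) \<le> C"
    by (rule kernel_growth_bound[OF z0]) (rule that)
  define q where "q z = complex_of_real (bump z0 a z)" for z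
  have qc: "circle_continuous q" unfolding q_def by (intro continuous_intros bump_continuous)
  note qb = continuous_bounded_symbol[OF qc]
  have qm [measurable]: "q \<in> borel_measurable \<mu>" by (rule continuous_imp_measurable_circle[OF qc])
  \<comment> \<open>The final estimate is obtained in the extended nonnegative reals; the sign of C
    permits the return to real numbers.\<close>
  have C0: "0 \<le> C"
  proof -
    have "\<exists>n. (\<integral>z. (bump z0 a z)\<^sup>2 * ((1 - (norm (u (of_real (radii n) * z)))\<^sup>2) / (1 - (radii n)\<^sup>2)) \<partial>\<mu>) \<le> C"
      using C by (auto simp: eventually_sequentially)
    then obtain n where n: "(\<integral>z. (bump z0 a z)\<^sup>2 * ((1 - (norm (u (of_real (radii n) * z)))\<^sup>2) / (1 - (radii n)\<^sup>2)) \<partial>\<mu>) \<le> C" ..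
    have "0 \<le> (\<integral>z. (bump z0 a z)\<^sup>2 * ((1 - (norm (u (of_real (radii n) * z)))\<^sup>2) / (1 - (radii n)\<^sup>2)) \<partial>\<mu>)"
    proof (rule integral_nonneg_AE, rule AE_I2)
      fix z assume "z \<in> space \<mu>"
      hence "norm (u (of_real (radii n) * z)) \<le> 1" using radii[of n] by (intro norm_u_le) (simp add: norm_mult)
      thus "0 \<le> (bump z0 a z)\<^sup>2 * ((1 - (norm (u (of_real (radii n) * z)))\<^sup>2) / (1 - (radii n)\<^sup>2))"
        using radii[of n] by (intro mult_nonneg_nonneg divide_nonneg_nonneg) (auto simp: abs_square_le_1)
    qed
    thus ?thesis using n by linarith
  qed
  have "cpt (L2_mult q)"
  proof (rule Hilbert_Schmidt_cpt[where C = C])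
    fix E assume E: "finite E" "E \<subseteq> H" "orthonormal E"
    have "\<exists>f. hardy_disk f \<and> boundary_value f e \<and> (\<forall>l. norm l < 1 \<longrightarrow> f l = e \<cdot> szego l)" if "e \<in> E" for e
      using hardy_H2E[OF model_hardy, of e] that E(2) by (metis subsetD)
    then obtain f where f: "\<And>e. e \<in> E \<Longrightarrow> hardy_disk (f e)" "\<And>e. e \<in> E \<Longrightarrow> boundary_value (f e) e"
      "\<And>e l. e \<in> E \<Longrightarrow> norm l < 1 \<Longrightarrow> f e l = e \<cdot> szego l" by metis
    define s where "s n z = (norm (q z))\<^sup>2 * (\<Sum>e\<in>E. (norm (f e (of_real (radii n) * z)))\<^sup>2)" for n z
    have sc: "continuous_on (sphere 0 1) (s n)" for n
      unfolding s_def using radii[of n]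
      by (intro continuous_intros qc slice_continuous hardy_disk_holomorphic f(1)) auto
    have s_nn: "0 \<le> s n z" for n z by (simp add: s_def sum_nonneg)
    have s_le: "(\<integral>z. s n z \<partial>\<mu>) \<le> (\<integral>z. (bump z0 a z)\<^sup>2 * ((1 - (norm (u (of_real (radii n) * z)))\<^sup>2) / (1 - (radii n)\<^sup>2)) \<partial>\<mu>)" for n
    proof (rule integral_mono_AE)
      show "integrable \<mu> (s n)" by (rule circle_integrable_continuous[OF sc])
      have "continuous_on (sphere 0 1) (\<lambda>z. (bump z0 a z)\<^sup>2 * ((1 - (norm (u (of_real (radii n) * z)))\<^sup>2) / (1 - (radii n)\<^sup>2)))"
        using radii[of n] by (intro continuous_intros bump_continuous slice_continuous u_holomorphic) (auto simp: power2_eq_1_iff)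
      thus "integrable \<mu> (\<lambda>z. (bump z0 a z)\<^sup>2 * ((1 - (norm (u (of_real (radii n) * z)))\<^sup>2) / (1 - (radii n)\<^sup>2)))"
        by (rule circle_integrable_continuous)
      show "AE z in circle_measure. s n z \<le> (bump z0 a z)\<^sup>2 * ((1 - (norm (u (of_real (radii n) * z)))\<^sup>2) / (1 - (radii n)\<^sup>2))"
      proof (rule AE_I2)
        fix z assume "z \<in> space \<mu>"
        hence z: "norm z = 1" by simp
        define l where "l = of_real (radii n) * z"
        have nl: "norm l = radii n" "norm l < 1" using z radii[of n] by (auto simp: l_def norm_mult)
        have "(\<Sum>e\<in>E. (norm (f e l))\<^sup>2) = (\<Sum>e\<in>E. (norm (kernel l \<cdot> e))\<^sup>2)"
        proof (rule sum.cong[OF refl])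
          fix e assume e: "e \<in> E"
          have "f e l = e \<cdot> kernel l" using f(3)[OF e nl(2)] kernel_reproducing[OF nl(2), of e] e E(2) by auto
          thus "(norm (f e l))\<^sup>2 = (norm (kernel l \<cdot> e))\<^sup>2"
            using L2_cinner_cnj[of e "kernel l"] by simp
        qed
        also have "\<dots> \<le> (norm (kernel l))\<^sup>2" by (rule Bessel_inequality[OF E(3,1)])
        also have "\<dots> = (1 - (norm (u l))\<^sup>2) / (1 - (radii n)\<^sup>2)" using norm_kernel[OF nl(2)] nl(1) by simp
        finally have "(\<Sum>e\<in>E. (norm (f e l))\<^sup>2) \<le> (1 - (norm (u l))\<^sup>2) / (1 - (radii n)\<^sup>2)" .
        thus "s n z \<le> (bump z0 a z)\<^sup>2 * ((1 - (norm (u (of_real (radii n) * z)))\<^sup>2) / (1 - (radii n)\<^sup>2))"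
          unfolding s_def l_def[symmetric] by (intro mult_mono) (auto simp: q_def sum_nonneg)
      qed
    qed
    have nn: "ennreal ((norm (L2_mult q e))\<^sup>2) = (\<integral>\<^sup>+z. ennreal ((norm (q z * rep_circle_L2 e z))\<^sup>2) \<partial>\<mu>)" for e
    proof -
      have sq: "square_integrable (\<lambda>z. q z * rep_circle_L2 e z)" by (rule square_integrable_mult[OF qb square_integrable_rep])
      show ?thesis unfolding L2_mult_def L2_norm_abs_square[OF sq]
        by (rule nn_integral_eq_integral[symmetric]) (use sq in \<open>auto simp: square_integrable_def\<close>)
    qed
    have "ennreal (\<Sum>e\<in>E. (norm (L2_mult q e))\<^sup>2) = (\<Sum>e\<in>E. ennreal ((norm (L2_mult q e))\<^sup>2))"
      by (simp add: sum_ennreal)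
    also have "\<dots> = (\<integral>\<^sup>+z. (\<Sum>e\<in>E. ennreal ((norm (q z * rep_circle_L2 e z))\<^sup>2)) \<partial>\<mu>)"
      unfolding nn by (rule nn_integral_sum[symmetric]) measurable
    also have "\<dots> = (\<integral>\<^sup>+z. liminf (\<lambda>n. ennreal (s n z)) \<partial>\<mu>)"
    proof (rule nn_integral_cong_AE)
      have "AE z in circle_measure. \<forall>e\<in>E. ((\<lambda>r. f e (of_real r * z)) \<longlongrightarrow> rep_circle_L2 e z) (at_left 1)"
        using f(2) E(1) unfolding boundary_value_def by (intro AE_finite_allI) auto
      thus "AE z in circle_measure. (\<Sum>e\<in>E. ennreal ((norm (q z * rep_circle_L2 e z))\<^sup>2)) = liminf (\<lambda>n. ennreal (s n z))"
      proof eventually_elim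
        case (elim z)
        have "(\<lambda>n. f e (of_real (radii n) * z)) \<longlonglongrightarrow> rep_circle_L2 e z" if "e \<in> E" for e
          using filterlim_compose[OF bspec[OF elim that] radii_at_left] .
        hence "(\<lambda>n. s n z) \<longlonglongrightarrow> (norm (q z))\<^sup>2 * (\<Sum>e\<in>E. (norm (rep_circle_L2 e z))\<^sup>2)"
          unfolding s_def by (intro tendsto_intros)
        hence "(\<lambda>n. ennreal (s n z)) \<longlonglongrightarrow> ennreal ((norm (q z))\<^sup>2 * (\<Sum>e\<in>E. (norm (rep_circle_L2 e z))\<^sup>2))"
          by (rule tendsto_ennrealI)
        hence "liminf (\<lambda>n. ennreal (s n z)) = ennreal ((norm (q z))\<^sup>2 * (\<Sum>e\<in>E. (norm (rep_circle_L2 e z))\<^sup>2))"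
          by (rule lim_imp_Liminf[OF sequentially_bot])
        thus ?case by (simp add: sum_ennreal norm_mult power_mult_distrib sum_distrib_left)
      qed
    qed
    also have "\<dots> \<le> liminf (\<lambda>n. (\<integral>\<^sup>+z. ennreal (s n z) \<partial>\<mu>))"
      by (rule nn_integral_liminf) (intro measurable_compose[OF continuous_imp_measurable_circle[OF sc] measurable_ennreal])
    also have "\<dots> \<le> liminf (\<lambda>n. ennreal C)"
    proof (rule Liminf_mono)
      show "\<forall>\<^sub>F n in sequentially. (\<integral>\<^sup>+z. ennreal (s n z) \<partial>\<mu>) \<le> ennreal C"
        using C
      proof eventually_elim
        case (elim n)
        have "(\<integral>\<^sup>+z. ennreal (s n z) \<partial>\<mu>) = ennreal (\<integral>z. s n z \<partial>\<mu>)"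
          by (intro nn_integral_eq_integral circle_integrable_continuous sc) (simp add: s_nn)
        thus ?case using s_le[of n] elim by (simp add: ennreal_leI)
      qed
    qed
    finally show "(\<Sum>e\<in>E. (norm (L2_mult q e))\<^sup>2) \<le> C"
      using C0 by (simp add: Liminf_const)
  qed (simp_all add: L2_mult_add L2_mult_scaleC qb)
  thus ?thesis using that[of a] a unfolding q_def[abs_def] by blast
qed

lemma K_diff_cancel:
  assumes "S \<in> B" "T \<in> B" "S \<ominus>\<^bsub>R\<^esub> T \<in> K" "T \<in> K" shows "S \<in> K"
proof -
  have "S = (S \<ominus>\<^bsub>R\<^esub> T) \<oplus>\<^bsub>R\<^esub> T" by (rule op_ext) (use assms in auto)
  thus ?thesis using add_K[OF assms(3,4)] by simp
qed

lemma A_K_mult: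
  assumes "circle_continuous \<phi>" "circle_continuous \<psi>" "A \<psi> \<in> K"
  shows "A (\<lambda>z. \<phi> z * \<psi> z) \<in> K"
  by (rule K_diff_cancel[OF _ _ semicommutator_K[OF assms(1,2)]]) (use assms in \<open>auto intro!: continuous_intros\<close>)

lemma A_K_limit:
  assumes c: "circle_continuous \<phi>"
    and "\<And>e. e > 0 \<Longrightarrow> \<exists>\<psi>. circle_continuous \<psi> \<and> A \<psi> \<in> K \<and> (\<forall>z\<in>sphere 0 1. norm (\<phi> z - \<psi> z) \<le> e)"
  shows "A \<phi> \<in> K"
proof (rule K_limit)
  fix e :: real assume "e > 0"
  then obtain \<psi> where \<psi>: "circle_continuous \<psi>" "A \<psi> \<in> K" "\<And>z. z \<in> sphere 0 1 \<Longrightarrow> norm (\<phi> z - \<psi> z) \<le> e" using assms(2) by blast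
  have "norm (A \<phi> x - A \<psi> x) \<le> e * norm x" if x: "x \<in> H" for x
  proof -
    have "A \<phi> x - A \<psi> x = A (\<lambda>z. \<phi> z - \<psi> z) x" unfolding A_diff[OF c \<psi>(1)] using x \<psi>(1) by simp
    thus ?thesis using norm_A_le[OF _ \<psi>(3) x] c \<psi>(1) by (simp add: continuous_on_diff del: A_apply)
  qed
  thus "\<exists>F\<in>K. \<forall>x\<in>H. norm (A \<phi> x - F x) \<le> e * norm x" using \<psi>(2) by blast
qed (use c in auto)

text \<open>Finitely many bumps whose multiplication is compact cover the set E where |\<phi>| \<ge>
  e; Q is the sum of their squares. Replacing \<phi> by \<phi> n Q / (1 + n Q) gives a compact
  operator and changes the symbol by \<phi> / (1 + n Q). This error is at most e on E for large n,
  since Q \<ge> m there, and at most |\<phi>| < e elsewhere.\<close>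

lemma compact_if_vanishing:
  assumes c: "circle_continuous \<phi>" and van: "\<And>\<zeta>. \<zeta> \<in> Y \<Longrightarrow> \<phi> \<zeta> = 0"
  shows "A \<phi> \<in> K"
proof (rule A_K_limit[OF c])
  fix e :: real assume e: "e > 0"
  define E where "E = {z \<in> sphere 0 1. e \<le> norm (\<phi> z)}"
  have "closedin (top_of_set (sphere 0 1)) E"
  proof -
    have "E = sphere 0 1 \<inter> (\<lambda>z. norm (\<phi> z)) -` {e..}" by (auto simp: E_def)
    thus ?thesis using continuous_closedin_preimage[OF continuous_on_norm[OF c] closed_atLeast] by simp
  qed
  hence cE: "compact E" using closedin_compact compact_sphere by blast
  have EY: "norm z = 1 \<and> z \<notin> Y" if "z \<in> E" for z using that van e by (auto simp: E_def)
  have "\<exists>a. bump z a z > 0 \<and> cpt (L2_mult (\<lambda>w. complex_of_real (bump z a w)))" if "z \<in> E" for z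
    using bump_multiplication_cpt[of z] EY[OF that] by metis
  then obtain a where a: "\<And>z. z \<in> E \<Longrightarrow> bump z (a z) z > 0" "\<And>z. z \<in> E \<Longrightarrow> cpt (L2_mult (\<lambda>w. complex_of_real (bump z (a z) w)))"
    by metis
  obtain F where F: "F \<subseteq> E" "finite F" "E \<subseteq> (\<Union>z\<in>F. {w. bump z (a z) w > 0})"
  proof (rule compactE_image[OF cE, of E "\<lambda>z. {w. bump z (a z) w > 0}"])
    show "open {w. bump z (a z) w > 0}" for z
      by (intro open_Collect_less bump_continuous continuous_on_const)
    show "E \<subseteq> (\<Union>z\<in>E. {w. bump z (a z) w > 0})" using a(1) by auto
  qed blast
  define Q where "Q w = (\<Sum>z\<in>F. (bump z (a z) w)\<^sup>2)" for w
  have Qc: "continuous_on S Q" for S unfolding Q_def by (intro continuous_intros bump_continuous)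
  have Q0: "0 \<le> Q w" for w by (simp add: Q_def sum_nonneg)
  have QE: "0 < Q w" if "w \<in> E" for w
  proof -
    obtain z where z: "z \<in> F" "bump z (a z) w > 0" using F(3) \<open>w \<in> E\<close> by auto
    have "(bump z (a z) w)\<^sup>2 \<le> Q w" unfolding Q_def by (rule member_le_sum) (use z F in auto)
    thus ?thesis using z(2) by (meson less_le_trans zero_less_power)
  qed
  have AQ: "A (\<lambda>w. complex_of_real (Q w)) \<in> K"
  proof -
    have "A (\<lambda>w. complex_of_real (\<Sum>z\<in>G. (bump z (a z) w)\<^sup>2)) \<in> K" if "finite G" "G \<subseteq> F" for G
      using that
    proof (induction G rule: finite_induct)
      case empty
      have "A (\<lambda>w. 0) = \<zero>\<^bsub>R\<^esub>" by (rule op_ext) (auto simp: L2_mult_const intro: continuous_intros)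
      thus ?case by simp
    next
      case (insert z G)
      define b where "b w = complex_of_real (bump z (a z) w)" for w
      have bc: "circle_continuous b" unfolding b_def by (intro continuous_intros bump_continuous)
      have "A b \<in> K"
      proof (rule K_I[OF A_B[OF bc]])
        have "cpt (L2_mult b)" using a(2)[of z] insert.prems F(1) by (auto simp: b_def[abs_def])
        thus "cpt (\<lambda>x. P (L2_mult b x))" by (rule cpt_comp_bounded_linear[OF _ bounded_linear_orth_proj])
      qed simp
      hence "A (\<lambda>w. b w * b w) \<in> K" by (intro A_K_mult bc)
      moreover have "A (\<lambda>w. complex_of_real (\<Sum>z\<in>G. (bump z (a z) w)\<^sup>2)) \<in> K" using insert by simp
      ultimately have "A (\<lambda>w. b w * b w) \<oplus>\<^bsub>R\<^esub> A (\<lambda>w. complex_of_real (\<Sum>z\<in>G. (bump z (a z) w)\<^sup>2)) \<in> K" by (rule add_K)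
      moreover have "A (\<lambda>w. b w * b w) \<oplus>\<^bsub>R\<^esub> A (\<lambda>w. complex_of_real (\<Sum>z\<in>G. (bump z (a z) w)\<^sup>2)) = A (\<lambda>w. b w * b w + complex_of_real (\<Sum>z\<in>G. (bump z (a z) w)\<^sup>2))"
        by (rule A_add[symmetric]) (intro continuous_intros bc bump_continuous)+
      moreover have "(\<lambda>w. b w * b w + complex_of_real (\<Sum>z\<in>G. (bump z (a z) w)\<^sup>2)) = (\<lambda>w. complex_of_real (\<Sum>z\<in>insert z G. (bump z (a z) w)\<^sup>2))"
        using insert.hyps by (simp add: b_def power2_eq_square fun_eq_iff)
      ultimately show ?case by simp
    qed
    from this[OF F(2) order_refl] show ?thesis by (simp add: Q_def)
  qed
  obtain m where m: "m > 0" "\<And>w. w \<in> E \<Longrightarrow> m \<le> Q w"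
  proof (cases "E = {}")
    case False
    then obtain w0 where "w0 \<in> E" "\<And>w. w \<in> E \<Longrightarrow> Q w0 \<le> Q w"
      using continuous_attains_inf[OF cE False Qc] by blast
    thus ?thesis using QE by (intro that[of "Q w0"]) auto
  qed (auto intro: that[of 1])
  obtain C where C: "\<And>z. z \<in> sphere 0 1 \<Longrightarrow> norm (\<phi> z) \<le> C"
    using continuous_bounded_symbol[OF c] unfolding bounded_symbol_def by blast
  obtain n :: nat where n: "C / (e * m) < real n" using reals_Archimedean2 by blast
  define \<psi> where "\<psi> w = (\<phi> w * of_real (real n / (1 + real n * Q w))) * of_real (Q w)" for w
  have nzQ: "1 + real n * Q w > 0" for w using Q0[of w] by (simp add: add_pos_nonneg)
  have c1: "circle_continuous (\<lambda>w. \<phi> w * of_real (real n / (1 + real n * Q w)))"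
    using nzQ by (intro continuous_intros c Qc) (metis less_irrefl)
  have c2: "circle_continuous (\<lambda>w. complex_of_real (Q w))" by (intro continuous_intros Qc)
  have "circle_continuous \<psi>" unfolding \<psi>_def by (intro continuous_on_mult c1 c2)
  moreover have "A \<psi> \<in> K" unfolding \<psi>_def[abs_def] by (rule A_K_mult[OF c1 c2 AQ])
  moreover have "norm (\<phi> z - \<psi> z) \<le> e" if z: "z \<in> sphere 0 1" for z
  proof -
    have "\<phi> z - \<psi> z = \<phi> z * of_real (1 / (1 + real n * Q z))"
    proof -
      have "1 - real n / (1 + real n * Q z) * Q z = 1 / (1 + real n * Q z)"
        using nzQ[of z] by (simp add: field_simps)
      thus ?thesis
        by (simp only: \<psi>_def mult.assoc flip: of_real_mult) (metis (no_types) mult.right_neutral of_real_1 of_real_diff right_diff_distrib)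
    qed
    hence eq: "norm (\<phi> z - \<psi> z) = norm (\<phi> z) / (1 + real n * Q z)"
      using nzQ[of z] by (simp add: norm_mult norm_divide del: of_real_add of_real_mult of_real_divide)
    show ?thesis
    proof (cases "z \<in> E")
      case True
      have "C \<le> e * (real n * m)" using n e m(1) by (simp add: field_simps)
      also have "\<dots> \<le> e * (real n * Q z)" using e m(2)[OF True] by (intro mult_left_mono) auto
      also have "\<dots> \<le> e * (1 + real n * Q z)" using e by simp
      finally have "norm (\<phi> z) \<le> e * (1 + real n * Q z)" using C[OF z] by simp
      thus ?thesis unfolding eq using nzQ[of z] by (simp add: divide_le_eq)
    next
      case False
      hence "norm (\<phi> z) \<le> e" using z by (simp add: E_def)
      moreover have "norm (\<phi> z) / (1 + real n * Q z) \<le> norm (\<phi> z) / 1"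
        using Q0[of z] nzQ[of z] by (intro divide_left_mono) simp_all
      ultimately show ?thesis unfolding eq by simp
    qed
  qed
  ultimately show "\<exists>\<psi>. circle_continuous \<psi> \<and> A \<psi> \<in> K \<and> (\<forall>z\<in>sphere 0 1. norm (\<phi> z - \<psi> z) \<le> e)" by blast
qed

end

section \<open>Continuous functions of a unitary operator\<close>

context hilbert_subspace
begin

lemma op_tendsto:
  assumes T: "T \<in> B" and X: "\<And>n. X n \<in> H" "x \<in> H" "X \<longlonglongrightarrow> x"
  shows "(\<lambda>n. T (X n)) \<longlonglongrightarrow> T x"
  using op_continuous[OF T] X unfolding continuous_on_sequentially by (auto simp: comp_def)

text \<open>The Cauchy condition has the form e m + e n because it comes from comparing two
  approximants of one target through the triangle inequality.\<close>

lemma op_limit: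
  assumes T: "\<And>n. T n \<in> B" and e: "e \<longlonglongrightarrow> 0"
    and C: "\<And>m n x. x \<in> H \<Longrightarrow> norm (T m x - T n x) \<le> (e m + e n) * norm x"
  obtains S where "S \<in> B" "\<And>x. x \<in> H \<Longrightarrow> (\<lambda>n. T n x) \<longlonglongrightarrow> S x"
    "\<And>n x. x \<in> H \<Longrightarrow> norm (S x - T n x) \<le> e n * norm x"
proof -
  have "convergent (\<lambda>n. T n x)" if x: "x \<in> H" for x
  proof (rule Cauchy_convergent, rule CauchyI)
    fix d :: real assume d: "0 < d"
    have "(\<lambda>n. e n * norm x) \<longlonglongrightarrow> 0 * norm x" by (intro tendsto_intros e)
    hence "\<forall>\<^sub>F n in sequentially. e n * norm x < d/2" using d by (intro order_tendstoD) auto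
    then obtain N where N: "\<And>n. n \<ge> N \<Longrightarrow> e n * norm x < d/2" unfolding eventually_sequentially by blast
    have "norm (T m x - T n x) < d" if "m \<ge> N" "n \<ge> N" for m n
      using C[OF x, of m n] N[OF that(1)] N[OF that(2)] unfolding distrib_right by linarith
    thus "\<exists>M. \<forall>m\<ge>M. \<forall>n\<ge>M. norm (T m x - T n x) < d" by blast
  qed
  define S where "S = (\<lambda>x\<in>H. lim (\<lambda>n. T n x))"
  have lim: "(\<lambda>n. T n x) \<longlonglongrightarrow> S x" if "x \<in> H" for x
    using \<open>x \<in> H \<Longrightarrow> convergent (\<lambda>n. T n x)\<close> that by (simp add: S_def convergent_LIMSEQ_iff)
  have S_H: "S x \<in> H" if "x \<in> H" for x
    by (rule closed_sequentially[OF closed_H opD(1)[OF T that] lim[OF that]])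
  have err: "norm (S x - T n x) \<le> e n * norm x" if x: "x \<in> H" for n x
  proof (rule LIMSEQ_le)
    show "(\<lambda>m. norm (T m x - T n x)) \<longlonglongrightarrow> norm (S x - T n x)" by (intro tendsto_intros lim x)
    have "(\<lambda>m. (e m + e n) * norm x) \<longlonglongrightarrow> (0 + e n) * norm x" by (intro tendsto_intros e)
    thus "(\<lambda>m. (e m + e n) * norm x) \<longlonglongrightarrow> e n * norm x" by simp
  qed (use C[OF x] in blast)
  obtain M where M: "\<And>x. x \<in> H \<Longrightarrow> norm (T 0 x) \<le> M * norm x" using op_bound[OF T, of 0] by blast
  have "S \<in> B"
  proof (rule bounded_operatorsI[OF S_H])
    show "S x = undefined" if "x \<notin> H" for x using that by (simp add: S_def)
    show "S (x + y) = S x + S y" if "x \<in> H" "y \<in> H" for x y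
      using lim[of "x + y"] tendsto_add[OF lim[OF that(1)] lim[OF that(2)]] that
      by (intro LIMSEQ_unique[of "\<lambda>n. T n (x + y)"]) (simp_all add: opD(3)[OF T])
    show "S (c *\<^sub>C x) = c *\<^sub>C S x" if "x \<in> H" for c x
      using lim[of "c *\<^sub>C x"] tendsto_scaleC[OF lim[OF that], of c] that
      by (intro LIMSEQ_unique[of "\<lambda>n. T n (c *\<^sub>C x)"]) (simp_all add: opD(4)[OF T])
    show "norm (S x) \<le> (e 0 + M) * norm x" if "x \<in> H" for x
      using norm_triangle_ineq[of "S x - T 0 x" "T 0 x"] err[OF that, of 0] M[OF that]
      unfolding distrib_right by simp
  qed
  thus ?thesis using that lim err by blast
qed

lemma adj_one: "adj R \<one>\<^bsub>R\<^esub> = \<one>\<^bsub>R\<^esub>"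
  by (rule adj_eqI) (auto simp: is_adjoint_def)

end

locale hilbert_unitary = hilbert_subspace +
  fixes W V
  assumes W_B: "W \<in> B" and V_B: "V \<in> B"
    and VW: "x \<in> H \<Longrightarrow> V (W x) = x" and WV: "x \<in> H \<Longrightarrow> W (V x) = x"
    and W_adj: "x \<in> H \<Longrightarrow> y \<in> H \<Longrightarrow> W x \<cdot> y = x \<cdot> V y"
begin

text \<open>Polynomials in z and its conjugate, paired with the operators obtained by substituting W
  and V. As a relation it follows the way an expression is built; that functions agreeing on the
  circle give the same operator is a consequence of \<open>calculus_diff_le\<close>.\<close>

inductive calculus :: "(complex \<Rightarrow> complex) \<Rightarrow> (circle_L2 \<Rightarrow> circle_L2) \<Rightarrow> bool" where
  calculus_const: "calculus (\<lambda>z. c) (c \<odot>\<^bsub>R\<^esub> \<one>\<^bsub>R\<^esub>)"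
| calculus_id: "calculus (\<lambda>z. z) W"
| calculus_cnj: "calculus (\<lambda>z. cnj z) V"
| calculus_add: "calculus f S \<Longrightarrow> calculus g T \<Longrightarrow> calculus (\<lambda>z. f z + g z) (S \<oplus>\<^bsub>R\<^esub> T)"
| calculus_mult: "calculus f S \<Longrightarrow> calculus g T \<Longrightarrow> calculus (\<lambda>z. f z * g z) (S \<otimes>\<^bsub>R\<^esub> T)"

lemma calculus_B: "calculus f T \<Longrightarrow> T \<in> B"
  by (induction rule: calculus.induct) (auto simp: W_B V_B)

lemma calculus_continuous: "calculus f T \<Longrightarrow> continuous_on S f"
  by (induction rule: calculus.induct) (auto intro: continuous_intros)

lemma calculus_diff: "calculus f S \<Longrightarrow> calculus g T \<Longrightarrow>
    calculus (\<lambda>z. f z + (-1) * g z) (S \<oplus>\<^bsub>R\<^esub> ((-1) \<odot>\<^bsub>R\<^esub> \<one>\<^bsub>R\<^esub>) \<otimes>\<^bsub>R\<^esub> T)"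
  by (intro calculus_add calculus_mult calculus_const)

lemma adj_W: "adj R W = V" and adj_V: "adj R V = W"
proof -
  show W: "adj R W = V" by (rule adj_eqI) (simp add: is_adjoint_def V_B W_adj)
  show "adj R V = W" using adj_adj[OF W_B] by (simp add: W)
qed

lemma calculus_adj: "calculus f T \<Longrightarrow> calculus (\<lambda>z. cnj (f z)) (adj R T)"
proof (induction rule: calculus.induct)
  case (calculus_const c)
  thus ?case using calculus.calculus_const[of "cnj c"] by (simp add: adj_smult adj_one)
next
  case calculus_id
  thus ?case using calculus.calculus_cnj by (simp add: adj_W)
next
  case calculus_cnj
  thus ?case using calculus.calculus_id by (simp add: adj_V)
next
  case (calculus_add f S g T)
  thus ?case using calculus.calculus_add[OF calculus_add.IH] by (simp add: adj_add calculus_B)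
next
  case (calculus_mult f S g T)
  thus ?case using calculus.calculus_mult[OF calculus_mult.IH(2,1)] by (simp add: adj_mult calculus_B mult.commute)
qed

lemma commute_calculus:
  assumes S: "S \<in> B" "\<And>x. x \<in> H \<Longrightarrow> S (W x) = W (S x)" "\<And>x. x \<in> H \<Longrightarrow> S (V x) = V (S x)"
    and T: "calculus f T"
  shows "x \<in> H \<Longrightarrow> S (T x) = T (S x)"
  using T
proof (induction arbitrary: x rule: calculus.induct)
  case (calculus_const c)
  thus ?case using S(1) by (simp add: opD)
next
  case (calculus_add f F g G)
  thus ?case using calculus_B[OF calculus_add.hyps(1)] calculus_B[OF calculus_add.hyps(2)] S(1)
    by (simp add: opD)
next
  case (calculus_mult f F g G)
  thus ?case using calculus_B[OF calculus_mult.hyps(1)] calculus_B[OF calculus_mult.hyps(2)] S(1)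
    by (simp add: opD)
qed (use S in auto)

lemma calculus_commute:
  assumes "calculus f S" "calculus g T" "x \<in> H" shows "S (T x) = T (S x)"
proof -
  have "W (S x) = S (W x)" if "x \<in> H" for x
    by (rule commute_calculus[OF W_B _ _ assms(1) that]) (auto simp: VW WV)
  moreover have "V (S x) = S (V x)" if "x \<in> H" for x
    by (rule commute_calculus[OF V_B _ _ assms(1) that]) (auto simp: VW WV)
  ultimately show ?thesis
    by (intro commute_calculus[OF calculus_B[OF assms(1)] _ _ assms(2,3)]) simp_all
qed

section \<open>Orbits and the norm bound for polynomials\<close>

lemma iter_H [simp, intro]: "x \<in> H \<Longrightarrow> (V ^^ n) x \<in> H"
  by (induction n) (auto simp: opD(1)[OF V_B])

lemma iter_add: "x \<in> H \<Longrightarrow> y \<in> H \<Longrightarrow> (V ^^ n) (x + y) = (V ^^ n) x + (V ^^ n) y"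
  by (induction n) (auto simp: opD(3)[OF V_B])

lemma iter_scaleC: "x \<in> H \<Longrightarrow> (V ^^ n) (c *\<^sub>C x) = c *\<^sub>C (V ^^ n) x"
  by (induction n) (auto simp: opD(4)[OF V_B])

lemma norm_V: assumes "x \<in> H" shows "norm (V x) = norm x"
proof -
  have "W (V x) \<cdot> x = V x \<cdot> V x" using assms by (intro W_adj) (auto simp: opD(1)[OF V_B])
  hence "complex_of_real ((norm x)\<^sup>2) = complex_of_real ((norm (V x))\<^sup>2)"
    by (simp only: WV[OF assms] cinner_self)
  hence "(norm x)\<^sup>2 = (norm (V x))\<^sup>2" using of_real_eq_iff by blast
  thus ?thesis by simp
qed

lemma norm_W: "x \<in> H \<Longrightarrow> norm (W x) = norm x"
  using norm_V[of "W x"] by (simp add: VW opD(1)[OF W_B])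

lemma norm_iter: "x \<in> H \<Longrightarrow> norm ((V ^^ n) x) = norm x"
  by (induction n) (auto simp: norm_V)

text \<open>On \<open>orbit N z x\<close> the operator \<open>W\<close> acts like multiplication by \<open>z\<close>, up to an error that is
  bounded independently of \<open>N\<close>, whereas the mean square of the orbit grows like \<open>N\<close>.\<close>

definition orbit where "orbit N z x = (\<Sum>n<N. z ^ n *\<^sub>C (V ^^ n) x)"

lemma orbit_add: "x \<in> H \<Longrightarrow> y \<in> H \<Longrightarrow> orbit N z (x + y) = orbit N z x + orbit N z y"
  by (simp add: orbit_def iter_add scaleC_add_right sum.distrib)

lemma orbit_scaleC: "x \<in> H \<Longrightarrow> orbit N z (c *\<^sub>C x) = c *\<^sub>C orbit N z x"
  by (simp add: orbit_def iter_scaleC scaleC_sum_right mult.commute)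

lemma orbit_Suc: "orbit (Suc N) z x = orbit N z x + z ^ N *\<^sub>C (V ^^ N) x"
  by (simp add: orbit_def)

text \<open>Because V (W x) = x, the orbit of W x is z times the orbit of x with the index shifted
  by one. The difference telescopes, leaving one term from each end.\<close>

lemma orbit_W_eq: "x \<in> H \<Longrightarrow> z *\<^sub>C orbit (Suc N) z x - orbit (Suc N) z (W x) = z ^ Suc N *\<^sub>C (V ^^ N) x - W x"
proof (induction N)
  case (Suc N)
  have "(V ^^ Suc N) (W x) = (V ^^ N) x" using Suc.prems by (simp only: funpow_Suc_right comp_def VW)
  hence "z *\<^sub>C orbit (Suc (Suc N)) z x - orbit (Suc (Suc N)) z (W x)
      = (z *\<^sub>C orbit (Suc N) z x - orbit (Suc N) z (W x)) + z ^ Suc (Suc N) *\<^sub>C (V ^^ Suc N) x - z ^ Suc N *\<^sub>C (V ^^ N) x"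
    unfolding orbit_Suc[of "Suc N"] by (simp add: scaleC_add_right del: funpow.simps)
  thus ?case unfolding Suc.IH[OF Suc.prems] by simp
qed (simp add: orbit_def)

lemma orbit_W:
  assumes "x \<in> H" "z \<in> sphere 0 1"
  shows "norm (z *\<^sub>C orbit N z x - orbit N z (W x)) \<le> 2 * norm x"
proof (cases N)
  case (Suc m)
  have "norm (z ^ Suc m *\<^sub>C (V ^^ m) x - W x) \<le> norm (z ^ Suc m *\<^sub>C (V ^^ m) x) + norm (W x)" by (rule norm_triangle_ineq4)
  also have "\<dots> = 2 * norm x" using assms by (simp add: norm_iter norm_W norm_mult norm_power)
  finally show ?thesis unfolding Suc orbit_W_eq[OF assms(1)] .
qed (simp add: orbit_def)

lemma orbit_V:
  assumes "x \<in> H" "z \<in> sphere 0 1"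
  shows "norm (cnj z *\<^sub>C orbit N z x - orbit N z (V x)) \<le> 2 * norm x"
proof -
  have "z *\<^sub>C (cnj z *\<^sub>C orbit N z x - orbit N z (V x)) = orbit N z (W (V x)) - z *\<^sub>C orbit N z (V x)"
    using circle_z_cnj[OF assms(2)] WV[OF assms(1)] by (simp add: scaleC_diff_right)
  hence "norm (z *\<^sub>C (cnj z *\<^sub>C orbit N z x - orbit N z (V x))) = norm (z *\<^sub>C orbit N z (V x) - orbit N z (W (V x)))"
    by (simp only: norm_minus_commute)
  moreover have "norm z = 1" using assms(2) by simp
  ultimately show ?thesis using orbit_W[OF opD(1)[OF V_B assms(1)] assms(2), of N] norm_V[OF assms(1)] by simp
qed

text \<open>Structural induction with D uniform in N, x and z. For a product, replacing g by T costs
  the error of T times a bound F of |f| on the circle, and replacing f by S at the vector T x costs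
  the error of S times a bound M of T.\<close>

lemma calculus_orbit:
  "calculus f T \<Longrightarrow> \<exists>D\<ge>0. \<forall>N. \<forall>x\<in>H. \<forall>z\<in>sphere 0 1. norm (f z *\<^sub>C orbit N z x - orbit N z (T x)) \<le> D * norm x"
proof (induction rule: calculus.induct)
  case (calculus_const c)
  show ?case by (rule exI[of _ 0]) (simp add: orbit_scaleC)
next
  case calculus_id
  show ?case by (rule exI[of _ 2]) (simp add: orbit_W del: mem_sphere_0)
next
  case calculus_cnj
  show ?case by (rule exI[of _ 2]) (simp add: orbit_V del: mem_sphere_0)
next
  case (calculus_add f S g T)
  obtain D E where D: "D \<ge> 0" "\<And>N x z. x \<in> H \<Longrightarrow> z \<in> sphere 0 1 \<Longrightarrow> norm (f z *\<^sub>C orbit N z x - orbit N z (S x)) \<le> D * norm x"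
    and E: "E \<ge> 0" "\<And>N x z. x \<in> H \<Longrightarrow> z \<in> sphere 0 1 \<Longrightarrow> norm (g z *\<^sub>C orbit N z x - orbit N z (T x)) \<le> E * norm x"
    using calculus_add.IH by metis
  have B: "S \<in> B" "T \<in> B" using calculus_add.hyps calculus_B by auto
  have "norm ((f z + g z) *\<^sub>C orbit N z x - orbit N z ((S \<oplus>\<^bsub>R\<^esub> T) x)) \<le> (D + E) * norm x"
    if x: "x \<in> H" "z \<in> sphere 0 1" for N x z
  proof -
    have "(f z + g z) *\<^sub>C orbit N z x - orbit N z ((S \<oplus>\<^bsub>R\<^esub> T) x)
      = (f z *\<^sub>C orbit N z x - orbit N z (S x)) + (g z *\<^sub>C orbit N z x - orbit N z (T x))"
      using x by (simp add: scaleC_add_left orbit_add opD(1)[OF B(1)] opD(1)[OF B(2)])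
    thus ?thesis
      using norm_triangle_le[OF add_mono[OF D(2)[OF x, of N] E(2)[OF x, of N]]] by (simp only: distrib_right)
  qed
  thus ?case using D(1) E(1) by (intro exI[of _ "D + E"]) auto
next
  case (calculus_mult f S g T)
  obtain D E where D: "D \<ge> 0" "\<And>N x z. x \<in> H \<Longrightarrow> z \<in> sphere 0 1 \<Longrightarrow> norm (f z *\<^sub>C orbit N z x - orbit N z (S x)) \<le> D * norm x"
    and E: "E \<ge> 0" "\<And>N x z. x \<in> H \<Longrightarrow> z \<in> sphere 0 1 \<Longrightarrow> norm (g z *\<^sub>C orbit N z x - orbit N z (T x)) \<le> E * norm x"
    using calculus_mult.IH by metis
  have B: "S \<in> B" "T \<in> B" using calculus_mult.hyps calculus_B by auto
  obtain M where M: "M > 0" "\<And>x. x \<in> H \<Longrightarrow> norm (T x) \<le> M * norm x" by (rule op_bound[OF B(2)]) (rule that)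
  obtain F where F: "\<And>z. z \<in> sphere 0 1 \<Longrightarrow> norm (f z) \<le> F"
    using continuous_bounded_symbol[OF calculus_continuous[OF calculus_mult.hyps(1)]] unfolding bounded_symbol_def by blast
  have F0: "0 \<le> F" using order_trans[OF norm_ge_zero F[of 1]] by simp
  have "norm ((f z * g z) *\<^sub>C orbit N z x - orbit N z ((S \<otimes>\<^bsub>R\<^esub> T) x)) \<le> (D * M + F * E) * norm x"
    if x: "x \<in> H" "z \<in> sphere 0 1" for N x z
  proof -
    have eq: "(f z * g z) *\<^sub>C orbit N z x - orbit N z ((S \<otimes>\<^bsub>R\<^esub> T) x)
      = (f z *\<^sub>C orbit N z (T x) - orbit N z (S (T x))) + f z *\<^sub>C (g z *\<^sub>C orbit N z x - orbit N z (T x))"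
      using x by (simp add: scaleC_diff_right)
    have "norm (f z *\<^sub>C orbit N z (T x) - orbit N z (S (T x))) \<le> D * norm (T x)" by (rule D(2)[OF opD(1)[OF B(2) x(1)] x(2)])
    also have "\<dots> \<le> D * (M * norm x)" using D(1) M(2)[OF x(1)] by (intro mult_left_mono)
    finally have 1: "norm (f z *\<^sub>C orbit N z (T x) - orbit N z (S (T x))) \<le> D * M * norm x" by simp
    have 2: "norm (f z *\<^sub>C (g z *\<^sub>C orbit N z x - orbit N z (T x))) \<le> F * (E * norm x)"
      unfolding norm_scaleC by (rule mult_mono[OF F[OF x(2)] E(2)[OF x] F0]) simp
    show ?thesis unfolding eq using norm_triangle_le[OF add_mono[OF 1 2]] by (simp only: distrib_right mult.assoc)
  qed
  moreover have "D * M + F * E \<ge> 0" using D(1) E(1) M(1) F0 by simp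
  ultimately show ?case by blast
qed

lemma orbit_continuous: "continuous_on S (\<lambda>z. orbit N z x)"
proof -
  have "continuous_on S (\<lambda>z. z ^ n *\<^sub>C y)" for n y
  proof -
    have "z ^ n *\<^sub>C y = Re (z ^ n) *\<^sub>R y + Im (z ^ n) *\<^sub>R (\<i> *\<^sub>C y)" for z :: complex
      unfolding L2_scaleR_scaleC scaleC_scaleC by (subst complex_eq[of "z ^ n"]) (simp add: scaleC_add_left mult.commute)
    thus ?thesis by (simp only:) (intro continuous_intros)
  qed
  thus ?thesis unfolding orbit_def by (intro continuous_on_sum)
qed

text \<open>The N terms of the orbit have norm |x| each and are orthogonal in the mean over the
  circle: the inner product h of the next term with the previous orbit is a polynomial in z without
  constant term.\<close>

lemma orbit_integral:
  assumes x: "x \<in> H"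
  shows "(\<integral>z. (norm (orbit N z x))\<^sup>2 \<partial>\<mu>) = real N * (norm x)\<^sup>2"
proof (induction N)
  case (Suc N)
  define a where "a n = (V ^^ N) x \<cdot> (V ^^ n) x" for n
  define h where "h z = (\<Sum>n<N. z ^ (N - n) * a n)" for z
  have h: "(z ^ N *\<^sub>C (V ^^ N) x) \<cdot> orbit N z x = h z" if z: "z \<in> sphere 0 1" for z
  proof -
    have "z ^ N * cnj (z ^ n) = z ^ (N - n)" if "n < N" for n
    proof -
      have "z ^ N = z ^ (N - n) * z ^ n" using that by (simp flip: power_add)
      thus ?thesis using circle_z_cnj[OF z] by (simp add: mult.assoc flip: power_mult_distrib)
    qed
    moreover have "(z ^ N *\<^sub>C (V ^^ N) x) \<cdot> (z ^ n *\<^sub>C (V ^^ n) x) = (z ^ N * cnj (z ^ n)) * a n" for n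
      by (simp add: a_def cinner_simps mult_ac)
    ultimately show ?thesis
      unfolding orbit_def h_def cinner_sum_right by (intro sum.cong refl) (simp del: complex_cnj_power)
  qed
  have "(\<integral>z. h z \<partial>\<mu>) = h 0"
    by (rule circle_mean_value[of _ 2]) (auto simp: h_def intro!: holomorphic_intros)
  also have "h 0 = 0" unfolding h_def by (rule sum.neutral) (simp add: power_0_left)
  finally have ih0: "(\<integral>z. h z \<partial>\<mu>) = 0" .
  have ih: "integrable \<mu> h" by (intro circle_integrable_continuous) (auto simp: h_def intro!: continuous_intros)
  have io: "integrable \<mu> (\<lambda>z. (norm (orbit N z x))\<^sup>2)"
    by (intro circle_integrable_continuous continuous_intros orbit_continuous)
  have "(norm (orbit (Suc N) z x))\<^sup>2 = ((norm x)\<^sup>2 + (norm (orbit N z x))\<^sup>2) + 2 * Re (h z)" if z: "z \<in> sphere 0 1" for z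
  proof -
    have eq: "orbit (Suc N) z x = z ^ N *\<^sub>C (V ^^ N) x + orbit N z x" by (simp add: orbit_def)
    have "norm z = 1" using z by simp
    hence n: "norm (z ^ N *\<^sub>C (V ^^ N) x) = norm x" by (simp add: norm_iter[OF x] norm_power)
    show ?thesis unfolding eq norm_add_square n h[OF z] ..
  qed
  hence "(\<integral>z. (norm (orbit (Suc N) z x))\<^sup>2 \<partial>\<mu>)
      = (\<integral>z. ((norm x)\<^sup>2 + (norm (orbit N z x))\<^sup>2) + 2 * Re (h z) \<partial>\<mu>)"
    by (intro Bochner_Integration.integral_cong refl) simp
  also have "\<dots> = (norm x)\<^sup>2 + real N * (norm x)\<^sup>2 + 2 * Re (\<integral>z. h z \<partial>\<mu>)"
    using ih io Suc.IH by (simp add: integral_Re)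
  finally show ?case unfolding ih0 by (simp add: algebra_simps)
qed (simp add: orbit_def)

text \<open>The orbit of T x is f z times the orbit of x up to an error independent of N. Mean
  squares over the circle are N |T x|^2 and N |x|^2, so the error disappears relative to them as N
  grows and the sup-norm constant C remains.\<close>

lemma calculus_norm_le:
  assumes T: "calculus f T" and C: "\<And>z. z \<in> sphere 0 1 \<Longrightarrow> norm (f z) \<le> C" and x: "x \<in> H"
  shows "norm (T x) \<le> C * norm x"
proof -
  have C0: "0 \<le> C" using order_trans[OF norm_ge_zero C[of 1]] by simp
  obtain D where D: "D \<ge> 0" "\<And>N z. z \<in> sphere 0 1 \<Longrightarrow> norm (f z *\<^sub>C orbit N z x - orbit N z (T x)) \<le> D * norm x"
    using calculus_orbit[OF T] x by metis
  define d where "d = D * norm x"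
  have Tx: "T x \<in> H" by (rule opD(1)[OF calculus_B[OF T] x])
  have main: "(norm (T x))\<^sup>2 \<le> (C\<^sup>2 + e) * (norm x)\<^sup>2" if e: "e > 0" for e
  proof -
    have pw: "(norm (orbit N z (T x)))\<^sup>2 \<le> (C\<^sup>2 + e) * (norm (orbit N z x))\<^sup>2 + (C\<^sup>2 / e + 1) * d\<^sup>2" if z: "z \<in> sphere 0 1" for N z
    proof -
      define a where "a = norm (orbit N z x)"
      have "norm (orbit N z (T x)) \<le> norm (f z *\<^sub>C orbit N z x) + norm (f z *\<^sub>C orbit N z x - orbit N z (T x))"
        using norm_triangle_ineq4[of "f z *\<^sub>C orbit N z x" "f z *\<^sub>C orbit N z x - orbit N z (T x)"] by simp
      moreover have "norm (f z *\<^sub>C orbit N z x) \<le> C * a"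
        unfolding norm_scaleC a_def by (rule mult_right_mono[OF C[OF z]]) simp
      ultimately have "norm (orbit N z (T x)) \<le> C * a + d" using D(2)[OF z, of N] unfolding d_def by linarith
      hence "(norm (orbit N z (T x)))\<^sup>2 \<le> (C * a + d)\<^sup>2" by (rule power_mono) simp
      also have "\<dots> \<le> (C\<^sup>2 + e) * a\<^sup>2 + (C\<^sup>2 / e + 1) * d\<^sup>2"
      proof -
        \<comment> \<open>Completing the square: the mixed term 2 C a d is absorbed into e a^2 plus
          a multiple of d^2, so that a^2 keeps a coefficient arbitrarily close to C^2.\<close>
        have "0 \<le> (e * a - C * d)\<^sup>2 / e" using e by simp
        also have "\<dots> = (C\<^sup>2 + e) * a\<^sup>2 + (C\<^sup>2 / e + 1) * d\<^sup>2 - (C * a + d)\<^sup>2"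
          using e by (simp add: field_simps power2_eq_square)
        finally show ?thesis by simp
      qed
      finally show ?thesis by (simp add: a_def)
    qed
    have N: "real N * (norm (T x))\<^sup>2 \<le> (C\<^sup>2 + e) * (real N * (norm x)\<^sup>2) + (C\<^sup>2 / e + 1) * d\<^sup>2" for N
    proof -
      have i: "integrable \<mu> (\<lambda>z. (norm (orbit N z y))\<^sup>2)" for y
        by (intro circle_integrable_continuous continuous_intros orbit_continuous)
      have "real N * (norm (T x))\<^sup>2 = (\<integral>z. (norm (orbit N z (T x)))\<^sup>2 \<partial>\<mu>)"
        by (rule orbit_integral[OF Tx, symmetric])
      also have "\<dots> \<le> (\<integral>z. (C\<^sup>2 + e) * (norm (orbit N z x))\<^sup>2 + (C\<^sup>2 / e + 1) * d\<^sup>2 \<partial>\<mu>)"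
        by (rule integral_mono_AE[OF i], intro circle_integrable_continuous continuous_intros orbit_continuous, rule AE_I2, rule pw) simp
      also have "\<dots> = (C\<^sup>2 + e) * (real N * (norm x)\<^sup>2) + (C\<^sup>2 / e + 1) * d\<^sup>2"
        unfolding orbit_integral[OF x, symmetric] using i[of x] by simp
      finally show ?thesis .
    qed
    show ?thesis
    proof (rule ccontr)
      assume "\<not> ?thesis"
      hence "0 < (norm (T x))\<^sup>2 - (C\<^sup>2 + e) * (norm x)\<^sup>2" by simp
      then obtain N :: nat where "(C\<^sup>2 / e + 1) * d\<^sup>2 < real N * ((norm (T x))\<^sup>2 - (C\<^sup>2 + e) * (norm x)\<^sup>2)"
        using reals_Archimedean3 by blast
      thus False using N[of N] by (simp add: algebra_simps)
    qed
  qed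
  have "(norm (T x))\<^sup>2 \<le> (C * norm x)\<^sup>2"
  proof (rule field_le_epsilon)
    fix e :: real assume e: "e > 0"
    \<comment> \<open>The parameter is scaled so that its product with |x|^2 is at most e; the added
      1 covers x = 0.\<close>
    have "(norm (T x))\<^sup>2 \<le> (C\<^sup>2 + e / ((norm x)\<^sup>2 + 1)) * (norm x)\<^sup>2" using e by (intro main) (simp add: add_nonneg_pos)
    also have "\<dots> = (C * norm x)\<^sup>2 + e * ((norm x)\<^sup>2 / ((norm x)\<^sup>2 + 1))" by (simp add: power_mult_distrib distrib_right)
    also have "e * ((norm x)\<^sup>2 / ((norm x)\<^sup>2 + 1)) \<le> e * 1"
      using e by (intro mult_left_mono) (auto simp: divide_le_eq add_nonneg_pos)
    finally show "(norm (T x))\<^sup>2 \<le> (C * norm x)\<^sup>2 + e" by simp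
  qed
  thus ?thesis using C0 by (intro power2_le_imp_le[of "norm (T x)"]) auto
qed

lemma calculus_diff_le:
  assumes "calculus f S" "calculus g T" "\<And>z. z \<in> sphere 0 1 \<Longrightarrow> norm (f z - g z) \<le> C" "x \<in> H"
  shows "norm (S x - T x) \<le> C * norm x"
proof -
  have "norm ((S \<oplus>\<^bsub>R\<^esub> ((-1) \<odot>\<^bsub>R\<^esub> \<one>\<^bsub>R\<^esub>) \<otimes>\<^bsub>R\<^esub> T) x) \<le> C * norm x"
    by (rule calculus_norm_le[OF calculus_diff[OF assms(1,2)] _ assms(4)]) (use assms(3) in simp)
  thus ?thesis using assms(4) opD(1)[OF calculus_B[OF assms(2)] assms(4)] by simp
qed

text \<open>Polynomials approximating \<phi> give operators that are Cauchy in norm, and so are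
  their adjoints; commutation passes to the limit in one factor at a time. The approximants are part
  of the conclusion because the comparison with \<open>A \<phi>\<close> modulo compact operators is
  made for them.\<close>

lemma continuous_calculus:
  assumes c: "continuous_on (sphere 0 1) \<phi>"
  obtains N where "N \<in> B" "normal_operator H N"
    "\<And>e. e > 0 \<Longrightarrow> \<exists>\<psi> T. calculus \<psi> T \<and> (\<forall>z\<in>sphere 0 1. norm (\<phi> z - \<psi> z) \<le> e) \<and> (\<forall>x\<in>H. norm (N x - T x) \<le> e * norm x)"
proof -
  define e where "e n = 1 / real (Suc n)" for n
  have e: "e n > 0" for n by (simp add: e_def)
  have e0: "e \<longlonglongrightarrow> 0" unfolding e_def by (rule LIMSEQ_Suc[OF lim_1_over_n])
  have "\<exists>\<psi>. (\<exists>T. calculus \<psi> T) \<and> (\<forall>z\<in>sphere 0 1. norm (\<phi> z - \<psi> z) < e n)" for n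
    by (rule circle_polynomial_approximation[OF _ _ _ _ _ c e]) (blast intro: calculus.intros)+
  then obtain \<psi> T where T: "\<And>n. calculus (\<psi> n) (T n)" and \<psi>: "\<And>n z. z \<in> sphere 0 1 \<Longrightarrow> norm (\<phi> z - \<psi> n z) < e n"
    by metis
  have TB: "T n \<in> B" for n using T calculus_B by blast
  have d: "norm (\<psi> m z - \<psi> n z) \<le> e m + e n" if "z \<in> sphere 0 1" for m n z
    using norm_triangle_ineq4[of "\<phi> z - \<psi> n z" "\<phi> z - \<psi> m z"] \<psi>[OF that, of m] \<psi>[OF that, of n] by simp
  have d': "norm (cnj (\<psi> m z) - cnj (\<psi> n z)) \<le> e m + e n" if "z \<in> sphere 0 1" for m n z
    using d[OF that, of m n] by (simp flip: complex_cnj_diff)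
  have T_le: "norm (T m x - T n x) \<le> (e m + e n) * norm x" if "x \<in> H" for m n x
    by (rule calculus_diff_le[OF T T d that])
  have T'_le: "norm (adj R (T m) x - adj R (T n) x) \<le> (e m + e n) * norm x" if "x \<in> H" for m n x
    by (rule calculus_diff_le[OF calculus_adj[OF T] calculus_adj[OF T] d' that])
  obtain N where N: "N \<in> B" "\<And>x. x \<in> H \<Longrightarrow> (\<lambda>n. T n x) \<longlonglongrightarrow> N x" "\<And>n x. x \<in> H \<Longrightarrow> norm (N x - T n x) \<le> e n * norm x"
    by (rule op_limit[OF TB e0 T_le], assumption, rule that)
  obtain N' where N': "N' \<in> B" "\<And>x. x \<in> H \<Longrightarrow> (\<lambda>n. adj R (T n) x) \<longlonglongrightarrow> N' x"
    by (rule op_limit[OF adj_B[OF TB] e0 T'_le], assumption, rule that)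
  have adj: "adj R N = N'"
  proof (rule adj_eqI, unfold is_adjoint_def, intro conjI ballI)
    fix x y assume x: "x \<in> H" and y: "y \<in> H"
    have "(\<lambda>n. T n x \<cdot> y) \<longlonglongrightarrow> N x \<cdot> y" by (rule tendsto_cinner_left[OF N(2)[OF x]])
    moreover have "(\<lambda>n. T n x \<cdot> y) \<longlonglongrightarrow> x \<cdot> N' y"
      unfolding adj_props(2)[OF TB x y] by (rule tendsto_cinner_right[OF N'(2)[OF y]])
    ultimately show "N x \<cdot> y = x \<cdot> N' y" by (rule LIMSEQ_unique)
  qed (rule N'(1))
  have "N (N' x) = N' (N x)" if x: "x \<in> H" for x
  proof -
    have 1: "T n (N' x) = N' (T n x)" for n
    proof (rule LIMSEQ_unique)
      show "(\<lambda>m. T n (adj R (T m) x)) \<longlonglongrightarrow> T n (N' x)"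
        by (intro op_tendsto[OF TB] N'(2) opD(1)[OF N'(1)] opD(1)[OF adj_B[OF TB]] x)
      show "(\<lambda>m. T n (adj R (T m) x)) \<longlonglongrightarrow> N' (T n x)"
        unfolding calculus_commute[OF T calculus_adj[OF T] x] by (intro N'(2) opD(1)[OF TB] x)
    qed
    show ?thesis
    proof (rule LIMSEQ_unique)
      show "(\<lambda>n. T n (N' x)) \<longlonglongrightarrow> N (N' x)" by (intro N(2) opD(1)[OF N'(1)] x)
      show "(\<lambda>n. T n (N' x)) \<longlonglongrightarrow> N' (N x)"
        unfolding 1 by (intro op_tendsto[OF N'(1)] N(2) opD(1)[OF TB] opD(1)[OF N(1)] x)
    qed
  qed
  hence "normal_operator H N"
    unfolding normal_operator_def adj using N(1) N'(1) by (auto intro!: op_ext)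
  moreover have "\<exists>\<psi> T. calculus \<psi> T \<and> (\<forall>z\<in>sphere 0 1. norm (\<phi> z - \<psi> z) \<le> r) \<and> (\<forall>x\<in>H. norm (N x - T x) \<le> r * norm x)" if r: "r > 0" for r
  proof -
    obtain n where n: "e n < r" using order_tendstoD(2)[OF e0 r] unfolding eventually_sequentially by blast
    show ?thesis
    proof (intro exI conjI ballI)
      show "calculus (\<psi> n) (T n)" by (rule T)
      show "norm (\<phi> z - \<psi> n z) \<le> r" if "z \<in> sphere 0 1" for z using \<psi>[OF that, of n] n by linarith
      show "norm (N x - T n x) \<le> r * norm x" if "x \<in> H" for x
        using order_trans[OF N(3)[OF that, of n] mult_right_mono[of "e n" r "norm x"]] n by simp
    qed
  qed
  ultimately show ?thesis using that N(1) by blast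
qed

end

section \<open>Normal plus compact\<close>

context nonconstant_inner
begin

lemma U_one: "U \<cdot> L2_one = u 0" "L2_one \<cdot> U = cnj (u 0)"
proof -
  have "L2_one \<cdot> L2_one = 1" by (simp add: cinner_self norm_L2_one)
  thus 1: "U \<cdot> L2_one = u 0"
    using M_hardy(2)[OF L2_one_hardy, of 0] by (simp add: U_def L2_one_szego[symmetric])
  show "L2_one \<cdot> U = cnj (u 0)" by (subst L2_cinner_cnj) (simp add: 1)
qed

text \<open>The conjugate reproducing kernel (u - u 0) / z at the origin. It spans the range of the
  perturbation of the adjoint, as \<open>kernel 0\<close> does for the compressed shift.\<close>

definition cokernel where "cokernel = coshift (U - u 0 *\<^sub>C L2_one)"

lemma cokernel_in: "cokernel \<in> H"
  unfolding model_space_iff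
proof (intro conjI ballI)
  have "U \<in> hardy_H2" unfolding U_def by (rule M_hardy(1)[OF L2_one_hardy])
  thus "cokernel \<in> hardy_H2" using coshift_hardy[of U] by (simp add: U_one cokernel_def)
  fix G assume G: "G \<in> hardy_H2"
  have "cokernel \<cdot> M G = U \<cdot> M (shift G) - u 0 * (L2_one \<cdot> shift (M G))"
    unfolding cokernel_def cinner_coshift by (simp add: cinner_diff_left cinner_simps M_shift)
  moreover have "U \<cdot> M (shift G) = 0"
    unfolding U_def M_isometry using shift_hardy_one[OF G] cinner_swap_eq_zero by blast
  moreover have "L2_one \<cdot> shift (M G) = 0"
    using shift_hardy_one[OF M_hardy(1)[OF G]] cinner_swap_eq_zero by blast
  ultimately show "cokernel \<cdot> M G = 0" by simp
qed

text \<open>A rank-one perturbation of the compressed shift (Clark).\<close>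

definition clark_coeff where "clark_coeff = (1 + u 0) / (1 - u 0 * cnj (u 0))"

text \<open>Equivalent to the two normalizations that make \<open>clark\<close> and
  \<open>clark_adj\<close> inverse to each other: \<open>clark_vector\<close> pairs to 1 with the
  constant function and to -1 with u.\<close>

lemma clark_coeff: "1 + clark_coeff * cnj (u 0) = cnj clark_coeff" "1 + cnj clark_coeff * u 0 = clark_coeff"
proof -
  have "u 0 * cnj (u 0) \<noteq> 1"
  proof
    assume "u 0 * cnj (u 0) = 1"
    hence "(norm (u 0))\<^sup>2 = 1" unfolding complex_norm_square[symmetric] by (metis of_real_1 of_real_eq_iff)
    thus False using norm_u_0 by (simp add: abs_square_eq_1)
  qed
  hence nz: "1 - u 0 * cnj (u 0) \<noteq> 0" "1 - cnj (u 0) * u 0 \<noteq> 0" by (simp_all add: mult.commute)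
  thus "1 + clark_coeff * cnj (u 0) = cnj clark_coeff" "1 + cnj clark_coeff * u 0 = clark_coeff"
    unfolding clark_coeff_def by (simp_all add: field_simps)
qed

definition clark_vector where "clark_vector = clark_coeff *\<^sub>C L2_one - cnj clark_coeff *\<^sub>C U"

definition clark where "clark = A (\<lambda>z. z) \<oplus>\<^bsub>R\<^esub> rank_one (clark_coeff *\<^sub>C kernel 0) (coshift U)"

definition clark_adj where "clark_adj = A (\<lambda>z. cnj z) \<oplus>\<^bsub>R\<^esub> rank_one (cnj clark_coeff *\<^sub>C cokernel) L2_one"

lemma rank_clark: "rank_one (clark_coeff *\<^sub>C kernel 0) (coshift U) \<in> K" "rank_one (cnj clark_coeff *\<^sub>C cokernel) L2_one \<in> K"
  by (intro rank_one_K scaleC_H kernel_in cokernel_in; simp)+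

lemma clark_B: "clark \<in> B" "clark_adj \<in> B"
  unfolding clark_def clark_adj_def by (intro add_B A_B K_B rank_clark continuous_intros)+

lemma kernel_0: "kernel 0 = L2_one - cnj (u 0) *\<^sub>C U"
  by (simp add: kernel_def U_def L2_one_szego)

text \<open>The projection subtracts the component of z x along u, and the perturbation adds a
  multiple of \<open>kernel 0\<close> with the same coefficient. Together they are one multiple of
  \<open>clark_vector\<close>, so unitarity can be checked with the plain shift.\<close>

lemma clark_apply:
  assumes x: "x \<in> H" shows "clark x = shift x + (shift x \<cdot> U) *\<^sub>C clark_vector"
proof -
  define s where "s = shift x \<cdot> U"
  have "clark x = (shift x - s *\<^sub>C U) + s *\<^sub>C (clark_coeff *\<^sub>C kernel 0)"
    using x proj_shift[OF x] by (simp add: clark_def s_def cinner_shift shift_def[symmetric] del: A_apply add: A_apply)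
  also have "clark_coeff *\<^sub>C kernel 0 = clark_vector + U"
  proof -
    have "cnj clark_coeff *\<^sub>C U = U + (clark_coeff * cnj (u 0)) *\<^sub>C U"
      unfolding clark_coeff(1)[symmetric] by (simp add: scaleC_add_left)
    thus ?thesis by (simp add: clark_vector_def kernel_0 scaleC_diff_right)
  qed
  finally show ?thesis by (simp add: s_def scaleC_add_right)
qed

lemma clark_adj_apply:
  assumes y: "y \<in> H" shows "clark_adj y = coshift (y - (y \<cdot> L2_one) *\<^sub>C clark_vector)"
proof -
  define t where "t = y \<cdot> L2_one"
  have v: "clark_vector = L2_one - cnj clark_coeff *\<^sub>C (U - u 0 *\<^sub>C L2_one)"
  proof -
    have "clark_coeff *\<^sub>C L2_one = L2_one + (cnj clark_coeff * u 0) *\<^sub>C L2_one"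
      by (subst clark_coeff(2)[symmetric]) (simp add: scaleC_add_left)
    thus ?thesis by (simp add: clark_vector_def scaleC_diff_right)
  qed
  have "clark_adj y = coshift (y - t *\<^sub>C L2_one) + t *\<^sub>C (cnj clark_coeff *\<^sub>C coshift (U - u 0 *\<^sub>C L2_one))"
    using y proj_coshift[OF y] by (simp add: clark_adj_def t_def cokernel_def flip: coshift_def)
  also have "\<dots> = coshift ((y - t *\<^sub>C L2_one) + t *\<^sub>C (cnj clark_coeff *\<^sub>C (U - u 0 *\<^sub>C L2_one)))"
    by (simp only: coshift_linear)
  also have "(y - t *\<^sub>C L2_one) + t *\<^sub>C (cnj clark_coeff *\<^sub>C (U - u 0 *\<^sub>C L2_one)) = y - t *\<^sub>C clark_vector"
    unfolding v scaleC_diff_right[of t] by simp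
  finally show ?thesis by (simp add: t_def)
qed

lemma clark_unitary: "hilbert_unitary H clark clark_adj"
proof
  have 1: "clark_vector \<cdot> L2_one = 1"
    using clark_coeff(2) by (simp add: clark_vector_def cinner_diff_left cinner_simps U_one cinner_self norm_L2_one algebra_simps)
  have 2: "clark_vector \<cdot> U = - 1"
    using clark_coeff(1) by (simp add: clark_vector_def cinner_diff_left cinner_simps U_one cinner_self norm_U algebra_simps)
  note B = clark_B
  show "clark \<in> B" "clark_adj \<in> B" by (rule clark_B)+
  fix x assume x: "x \<in> H"
  have "shift x \<cdot> L2_one = 0" by (rule shift_hardy_one[OF model_hardy[OF x]])
  thus "clark_adj (clark x) = x"
    using opD(1)[OF B(1) x] by (simp add: clark_adj_apply clark_apply x cinner_simps 1)
  have "x \<cdot> U = 0" by (rule U_orthogonal[OF x])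
  thus "clark (clark_adj x) = x"
    using opD(1)[OF B(2) x] by (simp add: clark_adj_apply clark_apply x cinner_simps cinner_diff_left 2)
next
  fix x y assume x: "x \<in> H" and y: "y \<in> H"
  have U: "U \<cdot> y = 0" using U_orthogonal[OF y] cinner_swap_eq_zero by blast
  have one: "shift x \<cdot> L2_one = 0" by (rule shift_hardy_one[OF model_hardy[OF x]])
  have "L2_one \<cdot> y = cnj (y \<cdot> L2_one)" by (rule L2_cinner_cnj)
  thus "clark x \<cdot> y = x \<cdot> clark_adj y"
    unfolding clark_apply[OF x] clark_adj_apply[OF y] cinner_shift[symmetric]
    by (simp add: clark_vector_def cinner_simps cinner_diff_left cinner_diff_right U one)
qed

text \<open>\<open>A \<psi>\<close> and the operator of \<psi> in the calculus of
  \<open>clark\<close> agree modulo compact operators: on the generators they are equal or differ by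
  rank one, and at products the semicommutator accounts for the defect. Uniform approximation of
  \<phi> extends this to the normal operator N in norm.\<close>

lemma normal_plus_compact:
  assumes c: "circle_continuous \<phi>"
  obtains N where "normal_operator H N" "N \<in> B" "A \<phi> \<ominus>\<^bsub>R\<^esub> N \<in> K"
proof -
  interpret clark: hilbert_unitary H clark clark_adj by (rule clark_unitary)
  have ess: "A \<psi> \<ominus>\<^bsub>R\<^esub> T \<in> K" if "clark.calculus \<psi> T" for \<psi> T
    using that
  proof (induction rule: clark.calculus.induct)
    case (calculus_const c)
    have "A (\<lambda>z. c) \<ominus>\<^bsub>R\<^esub> c \<odot>\<^bsub>R\<^esub> \<one>\<^bsub>R\<^esub> = \<zero>\<^bsub>R\<^esub>"
      by (rule op_ext) (auto simp: A_const simp del: A_apply)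
    thus ?case by (simp only: zero_K)
  next
    case calculus_id
    have "A (\<lambda>z. z) \<ominus>\<^bsub>R\<^esub> clark = (-1) \<odot>\<^bsub>R\<^esub> rank_one (clark_coeff *\<^sub>C kernel 0) (coshift U)"
      by (rule op_ext) (use clark_B rank_clark in \<open>simp_all add: clark_def scaleC_minus_one continuous_on_id del: A_apply\<close>)
    thus ?case using rank_clark by (simp del: A_apply)
  next
    case calculus_cnj
    have "A (\<lambda>z. cnj z) \<ominus>\<^bsub>R\<^esub> clark_adj = (-1) \<odot>\<^bsub>R\<^esub> rank_one (cnj clark_coeff *\<^sub>C cokernel) L2_one"
      by (rule op_ext) (use clark_B rank_clark in \<open>simp_all add: clark_adj_def scaleC_minus_one continuous_on_cnj continuous_on_id del: A_apply\<close>)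
    thus ?case using rank_clark by (simp del: A_apply)
  next
    case (calculus_add f S g T)
    note h = clark.calculus_continuous[OF calculus_add.hyps(1)] clark.calculus_continuous[OF calculus_add.hyps(2)]
      clark.calculus_B[OF calculus_add.hyps(1)] clark.calculus_B[OF calculus_add.hyps(2)]
    have "A (\<lambda>z. f z + g z) \<ominus>\<^bsub>R\<^esub> (S \<oplus>\<^bsub>R\<^esub> T) = (A f \<ominus>\<^bsub>R\<^esub> S) \<oplus>\<^bsub>R\<^esub> (A g \<ominus>\<^bsub>R\<^esub> T)"
      unfolding A_add[OF h(1,2)] by (rule op_ext) (use h in \<open>auto simp del: A_apply\<close>)
    thus ?case using calculus_add.IH by simp
  next
    case (calculus_mult f S g T)
    note h = clark.calculus_continuous[OF calculus_mult.hyps(1)] clark.calculus_continuous[OF calculus_mult.hyps(2)]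
      clark.calculus_B[OF calculus_mult.hyps(1)] clark.calculus_B[OF calculus_mult.hyps(2)]
    have Ag: "A g x \<in> H" if "x \<in> H" for x by (rule opD(1)[OF A_B[OF h(2)] that])
    have "A (\<lambda>z. f z * g z) \<ominus>\<^bsub>R\<^esub> S \<otimes>\<^bsub>R\<^esub> T =
        ((A (\<lambda>z. f z * g z) \<ominus>\<^bsub>R\<^esub> A f \<otimes>\<^bsub>R\<^esub> A g) \<oplus>\<^bsub>R\<^esub> (A f \<ominus>\<^bsub>R\<^esub> S) \<otimes>\<^bsub>R\<^esub> A g) \<oplus>\<^bsub>R\<^esub> S \<otimes>\<^bsub>R\<^esub> (A g \<ominus>\<^bsub>R\<^esub> T)"
    proof (rule op_ext)
      have "circle_continuous (\<lambda>z. f z * g z)" by (intro continuous_intros h)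
      thus "A (\<lambda>z. f z * g z) \<ominus>\<^bsub>R\<^esub> S \<otimes>\<^bsub>R\<^esub> T \<in> B"
        by (intro minus_B mult_B A_B h)
      show "((A (\<lambda>z. f z * g z) \<ominus>\<^bsub>R\<^esub> A f \<otimes>\<^bsub>R\<^esub> A g) \<oplus>\<^bsub>R\<^esub> (A f \<ominus>\<^bsub>R\<^esub> S) \<otimes>\<^bsub>R\<^esub> A g) \<oplus>\<^bsub>R\<^esub> S \<otimes>\<^bsub>R\<^esub> (A g \<ominus>\<^bsub>R\<^esub> T) \<in> B"
        by (intro minus_B add_B mult_B A_B h \<open>circle_continuous (\<lambda>z. f z * g z)\<close>)
    qed (use h Ag in \<open>simp add: op_diff opD(1) del: A_apply\<close>)
    thus ?case using calculus_mult.IH semicommutator_K[OF h(1,2)] h by simp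
  qed
  obtain N where N: "N \<in> B" "normal_operator H N"
    "\<And>e. e > 0 \<Longrightarrow> \<exists>\<psi> T. clark.calculus \<psi> T \<and> (\<forall>z\<in>sphere 0 1. norm (\<phi> z - \<psi> z) \<le> e) \<and> (\<forall>x\<in>H. norm (N x - T x) \<le> e * norm x)"
    by (rule clark.continuous_calculus[OF c]) (rule that)
  have "A \<phi> \<ominus>\<^bsub>R\<^esub> N \<in> K"
  proof (rule K_limit)
    fix e :: real assume "e > 0"
    then obtain \<psi> T where T: "clark.calculus \<psi> T" "\<And>z. z \<in> sphere 0 1 \<Longrightarrow> norm (\<phi> z - \<psi> z) \<le> e/2"
      "\<And>x. x \<in> H \<Longrightarrow> norm (N x - T x) \<le> e/2 * norm x" using N(3)[of "e/2"] by auto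
    note h = clark.calculus_continuous[OF T(1)] clark.calculus_B[OF T(1)]
    have "norm ((A \<phi> \<ominus>\<^bsub>R\<^esub> N) x - (A \<psi> \<ominus>\<^bsub>R\<^esub> T) x) \<le> e * norm x" if x: "x \<in> H" for x
    proof -
      have "(A \<phi> \<ominus>\<^bsub>R\<^esub> N) x - (A \<psi> \<ominus>\<^bsub>R\<^esub> T) x = A (\<lambda>z. \<phi> z - \<psi> z) x - (N x - T x)"
        unfolding A_diff[OF c h(1)] using x h N(1) by (simp del: A_apply)
      moreover have "norm (A (\<lambda>z. \<phi> z - \<psi> z) x) \<le> e/2 * norm x"
        by (rule norm_A_le[OF _ T(2) x]) (intro continuous_intros c h)
      ultimately show ?thesis using norm_triangle_ineq4[of "A (\<lambda>z. \<phi> z - \<psi> z) x" "N x - T x"] T(3)[OF x] by simp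
    qed
    thus "\<exists>F\<in>K. \<forall>x\<in>H. norm ((A \<phi> \<ominus>\<^bsub>R\<^esub> N) x - F x) \<le> e * norm x" using ess[OF T(1)] by blast
  qed (use c N(1) in auto)
  thus ?thesis using that N by blast
qed

end

section \<open>Symbols modulo the compact operators\<close>

context hilbert_subspace
begin

lemma adj_minus: "S \<in> B \<Longrightarrow> T \<in> B \<Longrightarrow> adj R (S \<ominus>\<^bsub>R\<^esub> T) = adj R S \<ominus>\<^bsub>R\<^esub> adj R T"
  by (rule adj_eqI) (auto simp: is_adjoint_def adj_props(2) cinner_diff_left cinner_diff_right)

lemma adj_rank_one: "x \<in> H \<Longrightarrow> y \<in> H \<Longrightarrow> adj R (rank_one x y) = rank_one y x"
  by (rule adj_eqI) (auto simp: is_adjoint_def cinner_simps L2_cinner_cnj[of x] mult.commute)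

lemma norm_closed_K: "norm_closed R K"
  by (rule norm_closedI) (auto intro: K_limit)

lemma hilbert_subspace_complement:
  assumes D: "D \<subseteq> H" "closed D" "0 \<in> D" "\<And>x y. x \<in> D \<Longrightarrow> y \<in> D \<Longrightarrow> x + y \<in> D" "\<And>c x. x \<in> D \<Longrightarrow> c *\<^sub>C x \<in> D"
    and orth: "\<And>y. y \<in> H \<Longrightarrow> (\<And>d. d \<in> D \<Longrightarrow> y \<cdot> d = 0) \<Longrightarrow> y = 0"
  shows "D = H"
proof -
  interpret D: hilbert_subspace D by unfold_locales (use D in auto)
  have "x \<in> D" if x: "x \<in> H" for x
  proof -
    have "x - orth_proj D x \<in> H" using D.orth_proj_props(1)[of x] D(1) x by blast
    hence "x - orth_proj D x = 0" by (rule orth) (rule D.orth_proj_props(2))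
    thus ?thesis using D.orth_proj_props(1)[of x] by simp
  qed
  thus ?thesis using D(1) by blast
qed

end

section \<open>Operators with a symbol\<close>

context nonconstant_inner
begin

text \<open>A relation, because S determines \<phi> only on \<open>Y\<close>; any continuous
  function with the same values on \<open>Y\<close> is again a symbol of S.\<close>

definition has_symbol where
  "has_symbol S \<phi> \<longleftrightarrow> S \<in> B \<and> circle_continuous \<phi> \<and> S \<ominus>\<^bsub>R\<^esub> A \<phi> \<in> K"

lemma has_symbolD: assumes "has_symbol S \<phi>" shows "S \<in> B" "circle_continuous \<phi>" "S \<ominus>\<^bsub>R\<^esub> A \<phi> \<in> K"
  using assms by (auto simp: has_symbol_def)

lemma has_symbolI:
  assumes "circle_continuous \<phi>" "S \<in> B" "T \<in> K" "\<And>x. x \<in> H \<Longrightarrow> S x = A \<phi> x + T x"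
  shows "has_symbol S \<phi>"
proof -
  have "S \<ominus>\<^bsub>R\<^esub> A \<phi> = T" by (rule op_ext) (use assms in \<open>auto simp del: A_apply\<close>)
  thus ?thesis using assms by (simp add: has_symbol_def)
qed

lemma has_symbol_A: "circle_continuous \<phi> \<Longrightarrow> has_symbol (A \<phi>) \<phi>"
  by (rule has_symbolI[of _ _ "\<zero>\<^bsub>R\<^esub>"]) auto

lemma has_symbol_K: "T \<in> K \<Longrightarrow> has_symbol T (\<lambda>z. 0)"
  by (rule has_symbolI[of _ _ T]) (auto simp: A_const simp del: A_apply)

lemma has_symbol_one: "has_symbol \<one>\<^bsub>R\<^esub> (\<lambda>z. 1)"
  using has_symbol_A[of "\<lambda>z. 1"] by (simp add: A_one continuous_on_const)

lemma has_symbol_add: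
  assumes S: "has_symbol S \<phi>" and T: "has_symbol T \<psi>"
  shows "has_symbol (S \<oplus>\<^bsub>R\<^esub> T) (\<lambda>z. \<phi> z + \<psi> z)"
proof (rule has_symbolI)
  note h = has_symbolD[OF S] has_symbolD[OF T]
  show "(S \<ominus>\<^bsub>R\<^esub> A \<phi>) \<oplus>\<^bsub>R\<^esub> (T \<ominus>\<^bsub>R\<^esub> A \<psi>) \<in> K" by (intro add_K h)
  show "circle_continuous (\<lambda>z. \<phi> z + \<psi> z)" by (intro continuous_intros h)
  show "S \<oplus>\<^bsub>R\<^esub> T \<in> B" by (intro add_B h)
  show "(S \<oplus>\<^bsub>R\<^esub> T) x = A (\<lambda>z. \<phi> z + \<psi> z) x + ((S \<ominus>\<^bsub>R\<^esub> A \<phi>) \<oplus>\<^bsub>R\<^esub> (T \<ominus>\<^bsub>R\<^esub> A \<psi>)) x" if "x \<in> H" for x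
    unfolding A_add[OF h(2,5)] using h that by (simp del: A_apply)
qed

lemma has_symbol_smult:
  assumes S: "has_symbol S \<phi>" shows "has_symbol (c \<odot>\<^bsub>R\<^esub> S) (\<lambda>z. c * \<phi> z)"
proof (rule has_symbolI)
  note h = has_symbolD[OF S]
  show "c \<odot>\<^bsub>R\<^esub> (S \<ominus>\<^bsub>R\<^esub> A \<phi>) \<in> K" by (intro smult_K h)
  show "circle_continuous (\<lambda>z. c * \<phi> z)" by (intro continuous_intros h)
  show "c \<odot>\<^bsub>R\<^esub> S \<in> B" by (intro smult_B h)
  show "(c \<odot>\<^bsub>R\<^esub> S) x = A (\<lambda>z. c * \<phi> z) x + (c \<odot>\<^bsub>R\<^esub> (S \<ominus>\<^bsub>R\<^esub> A \<phi>)) x" if "x \<in> H" for x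
    unfolding A_cmult[OF h(2)] using h that by (simp add: scaleC_diff_right del: A_apply)
qed

lemma has_symbol_diff:
  assumes S: "has_symbol S \<phi>" and T: "has_symbol T \<psi>"
  shows "has_symbol (S \<ominus>\<^bsub>R\<^esub> T) (\<lambda>z. \<phi> z - \<psi> z)"
  using has_symbol_add[OF S has_symbol_smult[OF T, of "-1"]] has_symbolD(1)[OF T]
  by (simp add: a_minus_def uminus_R)

lemma has_symbol_mult:
  assumes S: "has_symbol S \<phi>" and T: "has_symbol T \<psi>"
  shows "has_symbol (S \<otimes>\<^bsub>R\<^esub> T) (\<lambda>z. \<phi> z * \<psi> z)"
proof (rule has_symbolI)
  note h = has_symbolD[OF S] has_symbolD[OF T]
  let ?K = "((S \<ominus>\<^bsub>R\<^esub> A \<phi>) \<otimes>\<^bsub>R\<^esub> T \<oplus>\<^bsub>R\<^esub> A \<phi> \<otimes>\<^bsub>R\<^esub> (T \<ominus>\<^bsub>R\<^esub> A \<psi>)) \<ominus>\<^bsub>R\<^esub> (A (\<lambda>z. \<phi> z * \<psi> z) \<ominus>\<^bsub>R\<^esub> A \<phi> \<otimes>\<^bsub>R\<^esub> A \<psi>)"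
  show c: "circle_continuous (\<lambda>z. \<phi> z * \<psi> z)" by (intro continuous_intros h)
  show "?K \<in> K" by (intro minus_K add_K mult_K_right mult_K_left semicommutator_K A_B h)
  show "S \<otimes>\<^bsub>R\<^esub> T \<in> B" by (intro mult_B h)
  fix x assume x: "x \<in> H"
  have "T x \<in> H" "A \<psi> x \<in> H" using h x by (auto intro: opD simp del: A_apply)
  thus "(S \<otimes>\<^bsub>R\<^esub> T) x = A (\<lambda>z. \<phi> z * \<psi> z) x + ?K x"
    using h c x by (simp add: op_diff[OF A_B] del: A_apply)
qed

lemma has_symbol_adj:
  assumes S: "has_symbol S \<phi>" shows "has_symbol (adj R S) (\<lambda>z. cnj (\<phi> z))"
proof -
  note h = has_symbolD[OF S]
  have "adj R (S \<ominus>\<^bsub>R\<^esub> A \<phi>) = adj R S \<ominus>\<^bsub>R\<^esub> A (\<lambda>z. cnj (\<phi> z))"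
    using h by (simp add: adj_minus adj_A)
  thus ?thesis using adj_K[OF h(3)] h by (auto simp: has_symbol_def intro!: continuous_intros)
qed

text \<open>Along normalized kernels the compact part tends to 0 by weak convergence, and
  \<open>A \<phi>\<close> acts asymptotically as the scalar \<phi> \<zeta>. One sequence X serves
  all operators and symbols, so that relations between several operators can be tested on
  it.\<close>

lemma has_symbol_asymptotic:
  assumes zY: "\<zeta> \<in> Y"
  obtains X where "\<And>n. X n \<in> H" "\<And>n::nat. norm (X n) = 1" "\<And>T. T \<in> K \<Longrightarrow> (\<lambda>n. T (X n)) \<longlonglongrightarrow> 0"
    "\<And>S \<phi>. has_symbol S \<phi> \<Longrightarrow> (\<lambda>n. S (X n) - \<phi> \<zeta> *\<^sub>C X n) \<longlonglongrightarrow> 0"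
proof -
  obtain X where X: "\<And>n. X n \<in> H" "\<And>n::nat. norm (X n) = 1" "\<And>y. y \<in> H \<Longrightarrow> (\<lambda>n. X n \<cdot> y) \<longlonglongrightarrow> 0"
    "\<And>\<phi>. circle_continuous \<phi> \<Longrightarrow> (\<lambda>n. L2_mult \<phi> (X n) - \<phi> \<zeta> *\<^sub>C X n) \<longlonglongrightarrow> 0"
    by (rule kernel_sequence[OF zY]) (rule that)
  have K: "(\<lambda>n. T (X n)) \<longlonglongrightarrow> 0" if "T \<in> K" for T
    by (rule compact_weakly_null[OF that X(1) _ X(3)]) (simp_all add: X(2))
  have "(\<lambda>n. S (X n) - \<phi> \<zeta> *\<^sub>C X n) \<longlonglongrightarrow> 0" if S: "has_symbol S \<phi>" for S \<phi>
  proof -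
    note h = has_symbolD[OF S]
    have "(\<lambda>n. P (L2_mult \<phi> (X n) - \<phi> \<zeta> *\<^sub>C X n) + (S \<ominus>\<^bsub>R\<^esub> A \<phi>) (X n)) \<longlonglongrightarrow> P 0 + 0"
      by (intro tendsto_add K h(3) bounded_linear.tendsto[OF bounded_linear_orth_proj] X(4) h(2))
    moreover have "P (L2_mult \<phi> (X n) - \<phi> \<zeta> *\<^sub>C X n) + (S \<ominus>\<^bsub>R\<^esub> A \<phi>) (X n) = S (X n) - \<phi> \<zeta> *\<^sub>C X n" for n
      using X(1)[of n] h by (simp add: orth_proj_diff orth_proj_scaleC)
    ultimately show ?thesis using orth_proj_self[OF zero_H] by simp
  qed
  thus ?thesis using that X(1,2) K by blast
qed

lemma symbol_le:
  assumes zY: "\<zeta> \<in> Y" and S: "has_symbol S \<phi>" and C: "\<And>x. x \<in> H \<Longrightarrow> norm (S x) \<le> C * norm x"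
  shows "norm (\<phi> \<zeta>) \<le> C"
proof -
  obtain X where X: "\<And>n. X n \<in> H" "\<And>n::nat. norm (X n) = 1"
    "\<And>S \<phi>. has_symbol S \<phi> \<Longrightarrow> (\<lambda>n. S (X n) - \<phi> \<zeta> *\<^sub>C X n) \<longlonglongrightarrow> 0"
    by (rule has_symbol_asymptotic[OF zY]) (rule that)
  have "norm (\<phi> \<zeta>) \<le> C + norm (S (X n) - \<phi> \<zeta> *\<^sub>C X n)" for n
  proof -
    have "norm (\<phi> \<zeta> *\<^sub>C X n) \<le> norm (S (X n)) + norm (S (X n) - \<phi> \<zeta> *\<^sub>C X n)"
      using norm_triangle_ineq4[of "S (X n)" "S (X n) - \<phi> \<zeta> *\<^sub>C X n"] by simp
    thus ?thesis using C[OF X(1), of n] by (simp add: X(2))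
  qed
  moreover have "(\<lambda>n. C + norm (S (X n) - \<phi> \<zeta> *\<^sub>C X n)) \<longlonglongrightarrow> C + norm (0::circle_L2)"
    by (intro tendsto_intros X(3) S)
  ultimately show ?thesis by (intro LIMSEQ_le_const[of _ C]) auto
qed

text \<open>If S is compact, it also has the symbol 0; then S - S = 0 has symbol \<phi> - 0, and the
  norm bound of symbols gives \<phi> = 0 on \<open>Y\<close>. The converse is
  \<open>compact_if_vanishing\<close> up to the compact difference between S and
  \<open>A \<phi>\<close>.\<close>

lemma has_symbol_K_iff:
  assumes S: "has_symbol S \<phi>" shows "S \<in> K \<longleftrightarrow> (\<forall>\<zeta>\<in>Y. \<phi> \<zeta> = 0)"
proof
  note h = has_symbolD[OF S]
  show "\<forall>\<zeta>\<in>Y. \<phi> \<zeta> = 0" if "S \<in> K"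
  proof
    fix \<zeta> assume z: "\<zeta> \<in> Y"
    have "norm (\<phi> \<zeta> - 0) \<le> 0"
      by (rule symbol_le[OF z has_symbol_diff[OF S has_symbol_K[OF that]]]) (use h in simp)
    thus "\<phi> \<zeta> = 0" by simp
  qed
  show "S \<in> K" if "\<forall>\<zeta>\<in>Y. \<phi> \<zeta> = 0"
    by (rule K_diff_cancel[OF h(1) A_B[OF h(2)] h(3)]) (use that compact_if_vanishing[OF h(2)] in blast)
qed

lemma has_symbol_cong:
  assumes S: "has_symbol S \<phi>" and c: "circle_continuous \<psi>" and eq: "\<And>\<zeta>. \<zeta> \<in> Y \<Longrightarrow> \<phi> \<zeta> = \<psi> \<zeta>"
  shows "has_symbol S \<psi>"
  using has_symbol_K_iff[OF has_symbol_diff[OF S has_symbol_A[OF c]]] eq has_symbolD(1)[OF S] c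
  by (simp add: has_symbol_def)

lemma compact_Y: "compact Y"
  using closed_Y Y_subset bounded_subset[OF bounded_sphere] by (auto simp: compact_eq_bounded_closed)

text \<open>Tietze's theorem with preserved bound. This makes the norm of \<open>A \<psi>\<close> at
  most the supremum over \<open>Y\<close>, which turns the estimate of the quotient norm into an
  equality.\<close>

lemma symbol_extension:
  fixes f :: "complex \<Rightarrow> complex"
  assumes "continuous_on Y f" "0 \<le> C" "\<And>\<zeta>. \<zeta> \<in> Y \<Longrightarrow> norm (f \<zeta>) \<le> C"
  obtains \<psi> where "circle_continuous \<psi>" "\<And>\<zeta>. \<zeta> \<in> Y \<Longrightarrow> \<psi> \<zeta> = f \<zeta>" "\<And>z. z \<in> sphere 0 1 \<Longrightarrow> norm (\<psi> z) \<le> C"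
  by (rule Tietze[OF assms(1) closed_subset[OF Y_subset closed_Y] assms(2,3)]) (assumption, rule that)

lemma symbol_unbounded_extension:
  fixes f :: "complex \<Rightarrow> complex"
  assumes "continuous_on Y f"
  obtains \<psi> where "circle_continuous \<psi>" "\<And>\<zeta>. \<zeta> \<in> Y \<Longrightarrow> \<psi> \<zeta> = f \<zeta>"
  by (rule Tietze_unbounded[OF assms closed_subset[OF Y_subset closed_Y]]) (rule that)

section \<open>The closed algebra of all operators with a symbol\<close>

definition alg where "alg = {S. \<exists>\<phi>. has_symbol S \<phi>}"

lemma algI: "has_symbol S \<phi> \<Longrightarrow> S \<in> alg" by (auto simp: alg_def)

lemma algE: assumes "S \<in> alg" obtains \<phi> where "has_symbol S \<phi>" using assms by (auto simp: alg_def)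

lemma alg_eq: "alg = {A \<phi> \<oplus>\<^bsub>R\<^esub> T |\<phi> T. circle_continuous \<phi> \<and> T \<in> K}"
proof (intro equalityI subsetI)
  fix S assume "S \<in> alg"
  then obtain \<phi> where S: "has_symbol S \<phi>" by (auto simp: alg_def)
  note h = has_symbolD[OF S]
  have "S = A \<phi> \<oplus>\<^bsub>R\<^esub> (S \<ominus>\<^bsub>R\<^esub> A \<phi>)" by (rule op_ext) (use h in \<open>auto simp del: A_apply\<close>)
  thus "S \<in> {A \<phi> \<oplus>\<^bsub>R\<^esub> T |\<phi> T. circle_continuous \<phi> \<and> T \<in> K}" using h by blast
next
  fix S assume "S \<in> {A \<phi> \<oplus>\<^bsub>R\<^esub> T |\<phi> T. circle_continuous \<phi> \<and> T \<in> K}"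
  then obtain \<phi> T where "S = A \<phi> \<oplus>\<^bsub>R\<^esub> T" "circle_continuous \<phi>" "T \<in> K" by blast
  hence "has_symbol S (\<lambda>z. \<phi> z + 0)" by (simp only:) (intro has_symbol_add has_symbol_A has_symbol_K)
  thus "S \<in> alg" unfolding alg_def by blast
qed

lemma alg_B: "S \<in> alg \<Longrightarrow> S \<in> B" by (auto simp: alg_def dest: has_symbolD)

lemma K_alg: "T \<in> K \<Longrightarrow> T \<in> alg" using has_symbol_K by (auto simp: alg_def)

lemma subring_alg: "subring alg R"
proof (rule R.subringI)
  show "\<ominus>\<^bsub>R\<^esub> S \<in> alg" if "S \<in> alg" for S
    using that unfolding uminus_R[OF alg_B[OF that]] by (auto elim!: algE intro: algI has_symbol_smult)
qed (auto elim!: algE intro: algI has_symbol_one has_symbol_mult has_symbol_add dest: has_symbolD(1))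

text \<open>Symbols of approximants converge uniformly on \<open>Y\<close> by
  \<open>symbol_le\<close>, and the limit extends to a symbol g. To compare with \<open>A g\<close>
  despite arbitrary behaviour off \<open>Y\<close>, the n-th approximant is corrected by
  \<open>A \<psi>\<close>, where \<psi> extends g - \<phi> n from \<open>Y\<close> with the same
  small bound. The corrected operator G is compact and close to T - \<open>A g\<close>.\<close>

lemma norm_closed_alg: "norm_closed R alg"
proof (rule norm_closedI)
  show "alg \<subseteq> B" using alg_B by blast
  fix T assume TB: "T \<in> B" and ap: "\<And>e. e > 0 \<Longrightarrow> \<exists>F\<in>alg. \<forall>x\<in>H. norm (T x - F x) \<le> e * norm x"
  define e where "e n = 1 / real (Suc n)" for n
  have e: "e n > 0" for n by (simp add: e_def)
  have e0: "e \<longlonglongrightarrow> 0" unfolding e_def by (rule LIMSEQ_Suc[OF lim_1_over_n])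
  have "\<exists>F \<phi>. has_symbol F \<phi> \<and> (\<forall>x\<in>H. norm (T x - F x) \<le> e n * norm x)" for n
    using ap[OF e[of n]] by (auto simp: alg_def)
  then obtain F \<phi> where F: "\<And>n. has_symbol (F n) (\<phi> n)" "\<And>n x. x \<in> H \<Longrightarrow> norm (T x - F n x) \<le> e n * norm x"
    by metis
  note h = has_symbolD[OF F(1)]
  have cau: "norm (\<phi> m \<zeta> - \<phi> n \<zeta>) \<le> e m + e n" if z: "\<zeta> \<in> Y" for m n \<zeta>
  proof (rule symbol_le[OF z has_symbol_diff[OF F(1) F(1)]])
    fix x assume x: "x \<in> H"
    have "norm (F m x - F n x) \<le> norm (T x - F n x) + norm (T x - F m x)"
      using norm_triangle_ineq4[of "T x - F n x" "T x - F m x"] by simp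
    thus "norm ((F m \<ominus>\<^bsub>R\<^esub> F n) x) \<le> (e m + e n) * norm x"
      using F(2)[OF x, of m] F(2)[OF x, of n] x h(1) by (simp add: distrib_right)
  qed
  have "convergent (\<lambda>n. \<phi> n \<zeta>)" if z: "\<zeta> \<in> Y" for \<zeta>
  proof (rule Cauchy_convergent, rule CauchyI)
    fix d :: real assume d: "0 < d"
    hence "\<forall>\<^sub>F n in sequentially. e n < d/2" by (intro order_tendstoD(2)[OF e0]) auto
    then obtain N where N: "\<And>n. n \<ge> N \<Longrightarrow> e n < d/2" unfolding eventually_sequentially by blast
    have "norm (\<phi> m \<zeta> - \<phi> n \<zeta>) < d" if "m \<ge> N" "n \<ge> N" for m n
      using cau[OF z, of m n] N[OF that(1)] N[OF that(2)] by linarith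
    thus "\<exists>M. \<forall>m\<ge>M. \<forall>n\<ge>M. norm (\<phi> m \<zeta> - \<phi> n \<zeta>) < d" by blast
  qed
  hence "\<exists>f. \<forall>\<zeta>\<in>Y. (\<lambda>n. \<phi> n \<zeta>) \<longlonglongrightarrow> f \<zeta>" unfolding convergent_def by metis
  then obtain f where f: "\<And>\<zeta>. \<zeta> \<in> Y \<Longrightarrow> (\<lambda>n. \<phi> n \<zeta>) \<longlonglongrightarrow> f \<zeta>" by blast
  have fe: "norm (f \<zeta> - \<phi> n \<zeta>) \<le> e n" if z: "\<zeta> \<in> Y" for n \<zeta>
  proof (rule LIMSEQ_le)
    show "(\<lambda>m. norm (\<phi> m \<zeta> - \<phi> n \<zeta>)) \<longlonglongrightarrow> norm (f \<zeta> - \<phi> n \<zeta>)" by (intro tendsto_intros f z)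
    have "(\<lambda>m. e m + e n) \<longlonglongrightarrow> 0 + e n" by (intro tendsto_intros e0)
    thus "(\<lambda>m. e m + e n) \<longlonglongrightarrow> e n" by simp
  qed (use cau[OF z] in blast)
  have cY: "continuous_on Y (\<phi> n)" for n using continuous_on_subset[OF h(2) Y_subset] .
  have "continuous_on Y f"
  proof (rule uniform_limit_theorem[where f = \<phi> and F = sequentially])
    show "uniform_limit Y \<phi> f sequentially"
      unfolding uniform_limit_iff
    proof (intro allI impI)
      fix d :: real assume "d > 0"
      hence "\<forall>\<^sub>F n in sequentially. e n < d" by (intro order_tendstoD(2)[OF e0])
      thus "\<forall>\<^sub>F n in sequentially. \<forall>\<zeta>\<in>Y. dist (\<phi> n \<zeta>) (f \<zeta>) < d"
      proof eventually_elim
        case (elim n)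
        show ?case
        proof
          fix \<zeta> assume "\<zeta> \<in> Y"
          thus "dist (\<phi> n \<zeta>) (f \<zeta>) < d" using fe[of \<zeta> n] elim by (simp add: dist_norm norm_minus_commute)
        qed
      qed
    qed
  qed (use cY in auto)
  then obtain g where g: "circle_continuous g" "\<And>\<zeta>. \<zeta> \<in> Y \<Longrightarrow> g \<zeta> = f \<zeta>"
    by (rule symbol_unbounded_extension) (rule that)
  have "T \<ominus>\<^bsub>R\<^esub> A g \<in> K"
  proof (rule K_limit)
    fix d :: real assume d: "d > 0"
    then obtain n where n: "e n < d/2" using order_tendstoD(2)[OF e0, of "d/2"] unfolding eventually_sequentially by auto
    have c: "continuous_on Y (\<lambda>\<zeta>. g \<zeta> - \<phi> n \<zeta>)" by (intro continuous_intros cY continuous_on_subset[OF g(1) Y_subset])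
    have b: "norm (g \<zeta> - \<phi> n \<zeta>) \<le> e n" if "\<zeta> \<in> Y" for \<zeta> using fe[OF that] g(2)[OF that] by simp
    obtain \<psi> where \<psi>: "circle_continuous \<psi>" "\<And>\<zeta>. \<zeta> \<in> Y \<Longrightarrow> \<psi> \<zeta> = g \<zeta> - \<phi> n \<zeta>" "\<And>z. z \<in> sphere 0 1 \<Longrightarrow> norm (\<psi> z) \<le> e n"
      by (rule symbol_extension[OF c less_imp_le[OF e] b], assumption, rule that)
    define G where "G = (F n \<ominus>\<^bsub>R\<^esub> A g) \<oplus>\<^bsub>R\<^esub> A \<psi>"
    have G: "has_symbol G (\<lambda>z. (\<phi> n z - g z) + \<psi> z)"
      unfolding G_def by (intro has_symbol_add has_symbol_diff has_symbol_A F(1) g(1) \<psi>(1))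
    have "G \<in> K" unfolding has_symbol_K_iff[OF G] using \<psi>(2) by simp
    moreover have "norm ((T \<ominus>\<^bsub>R\<^esub> A g) x - G x) \<le> d * norm x" if x: "x \<in> H" for x
    proof -
      have "(T \<ominus>\<^bsub>R\<^esub> A g) x - G x = (T x - F n x) - A \<psi> x"
        using x g(1) h(1) TB by (simp add: G_def del: A_apply)
      moreover have "norm (A \<psi> x) \<le> e n * norm x" by (rule norm_A_le[OF \<psi>(1,3) x])
      ultimately have "norm ((T \<ominus>\<^bsub>R\<^esub> A g) x - G x) \<le> (2 * e n) * norm x"
        using norm_triangle_ineq4[of "T x - F n x" "A \<psi> x"] F(2)[OF x, of n] by (simp del: A_apply)
      also have "\<dots> \<le> d * norm x" using n by (intro mult_right_mono) auto
      finally show ?thesis .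
    qed
    ultimately show "\<exists>F\<in>K. \<forall>x\<in>H. norm ((T \<ominus>\<^bsub>R\<^esub> A g) x - F x) \<le> d * norm x" by blast
  qed (use TB g(1) in auto)
  thus "T \<in> alg" using TB g(1) unfolding alg_def has_symbol_def by blast
qed

lemma cstar_subalgebra_alg: "cstar_subalgebra alg R"
  unfolding cstar_subalgebra_def
  using subring_alg norm_closed_alg by (auto elim!: algE intro: algI has_symbol_smult has_symbol_adj)

text \<open>For a vector of \<open>H\<close> orthogonal to \<open>kernel 0\<close> the constant term
  vanishes, so the adjoint of the compressed shift acts as isometric division by z. If this remains
  possible forever, G at l equals l^n times the value of a function of the same norm, and this tends
  to 0. Hence \<open>kernel 0\<close> is cyclic for the compressed shift.\<close>

lemma shift_orbit_dense:
  assumes G: "G \<in> H" and E: "\<And>F. F \<in> E \<Longrightarrow> F \<in> H \<and> F \<cdot> kernel 0 = 0 \<and> P (coshift F) \<in> E" and "G \<in> E"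
  shows "G = 0"
proof (rule hardy_H2_eq_0[OF model_hardy[OF G]])
  fix l :: complex assume l: "norm l < 1"
  define Gn where "Gn n = (coshift ^^ n) G" for n
  have step: "P (coshift F) = coshift F" if "F \<in> E" for F
    using proj_coshift[of F] cinner_one_kernel[of F] E[OF that] by simp
  have Gn: "Gn n \<in> E" for n
  proof (induction n)
    case (Suc n)
    thus ?case using E[OF Suc] step[OF Suc] by (simp add: Gn_def)
  qed (simp add: Gn_def \<open>G \<in> E\<close>)
  have "G \<cdot> szego l = l ^ n * (Gn n \<cdot> szego l)" for n
  proof (induction n)
    case (Suc n)
    have "Gn (Suc n) \<in> hardy_H2" using E[OF Gn[of "Suc n"]] model_hardy by blast
    moreover have "shift (Gn (Suc n)) = Gn n" by (simp add: Gn_def)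
    ultimately have "Gn n \<cdot> szego l = l * (Gn (Suc n) \<cdot> szego l)" using shift_hardy_szego[OF _ l] by metis
    thus ?case using Suc.IH by simp
  qed (simp add: Gn_def)
  moreover have "norm (Gn n) = norm G" for n by (induction n) (auto simp: Gn_def)
  ultimately have le: "norm (G \<cdot> szego l) \<le> norm l ^ n * (norm G * norm (szego l))" for n
    using cinner_Cauchy_Schwarz[of "Gn n" "szego l"] by (metis mult_left_mono norm_ge_zero norm_mult norm_power zero_le_power)
  have "(\<lambda>n. norm l ^ n * (norm G * norm (szego l))) \<longlonglongrightarrow> 0 * (norm G * norm (szego l))"
    by (intro tendsto_intros LIMSEQ_realpow_zero) (use l in auto)
  hence "norm (G \<cdot> szego l) \<le> 0" using le by (intro LIMSEQ_le_const[of _ 0]) auto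
  thus "G \<cdot> szego l = 0" by simp
qed

text \<open>The defect of the adjoint is the operator \<open>rank_one (kernel 0) (kernel 0)\<close>.
  Multiplication by the compressed shift moves its range vector, adjoints exchange the two vectors,
  and composition through \<open>kernel 0\<close> then produces \<open>rank_one x y\<close> for all
  x and y.\<close>

lemma K_subset_cstar:
  assumes S: "cstar_subalgebra S R" and a: "A (\<lambda>z. z) \<in> S"
  shows "K \<subseteq> S"
proof -
  have sr: "subring S R" and sm: "\<And>c a. a \<in> S \<Longrightarrow> c \<odot>\<^bsub>R\<^esub> a \<in> S" and ad: "\<And>a. a \<in> S \<Longrightarrow> adj R a \<in> S" and nc: "norm_closed R S"
    using S by (auto simp: cstar_subalgebra_def)
  have SB: "S \<subseteq> B" using subringE(1)[OF sr] by simp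
  have k0: "kernel 0 \<in> H" by (simp add: kernel_in)
  have ci: "circle_continuous (\<lambda>z. z)" "circle_continuous (\<lambda>z. cnj z)" by (intro continuous_intros)+
  have a': "A (\<lambda>z. cnj z) \<in> S" using ad[OF a] unfolding adj_A[OF ci(1)] .
  have "rank_one (kernel 0) (kernel 0) = \<one>\<^bsub>R\<^esub> \<oplus>\<^bsub>R\<^esub> (-1) \<odot>\<^bsub>R\<^esub> (A (\<lambda>z. z) \<otimes>\<^bsub>R\<^esub> A (\<lambda>z. cnj z))"
  proof (rule op_ext)
    show "\<one>\<^bsub>R\<^esub> \<oplus>\<^bsub>R\<^esub> (-1) \<odot>\<^bsub>R\<^esub> (A (\<lambda>z. z) \<otimes>\<^bsub>R\<^esub> A (\<lambda>z. cnj z)) \<in> B"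
      by (intro add_B one_B smult_B mult_B A_B ci)
    fix y assume y: "y \<in> H"
    have "A (\<lambda>z. z) (A (\<lambda>z. cnj z) y) = P (shift (P (coshift y)))"
      using y by (simp add: shift_def coshift_def)
    also have "\<dots> = y - (y \<cdot> L2_one) *\<^sub>C kernel 0"
      unfolding proj_coshift[OF y] using orth_proj_self[OF y] by (simp add: orth_proj_diff orth_proj_scaleC proj_one)
    finally show "rank_one (kernel 0) (kernel 0) y = (\<one>\<^bsub>R\<^esub> \<oplus>\<^bsub>R\<^esub> (-1) \<odot>\<^bsub>R\<^esub> (A (\<lambda>z. z) \<otimes>\<^bsub>R\<^esub> A (\<lambda>z. cnj z))) y"
      using y cinner_one_kernel[OF y] by (simp add: scaleC_minus_one del: A_apply)
  qed (use k0 in auto)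
  hence r0: "rank_one (kernel 0) (kernel 0) \<in> S"
    using a a' sm subringE(3,6,7)[OF sr] by (simp only:)
  \<comment> \<open>D is closed because S is norm closed, contains \<open>kernel 0\<close>, and is
    mapped into itself by the compressed shift. Its orthogonal complement is therefore invariant
    under the adjoint, and \<open>shift_orbit_dense\<close> shows that it is 0.\<close>
  define D where "D = {x \<in> H. rank_one x (kernel 0) \<in> S}"
  have "D = H"
  proof (rule hilbert_subspace_complement)
    show "0 \<in> D"
    proof -
      have "rank_one 0 (kernel 0) = \<zero>\<^bsub>R\<^esub>" by (rule op_ext) auto
      thus ?thesis using subringE(2)[OF sr] by (simp add: D_def)
    qed
    show "x + y \<in> D" if "x \<in> D" "y \<in> D" for x y
    proof -
      have "rank_one (x + y) (kernel 0) = rank_one x (kernel 0) \<oplus>\<^bsub>R\<^esub> rank_one y (kernel 0)"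
        by (rule op_ext) (use that in \<open>auto simp: D_def scaleC_add_right\<close>)
      thus ?thesis using that subringE(7)[OF sr] by (simp add: D_def)
    qed
    show "c *\<^sub>C x \<in> D" if "x \<in> D" for c x
    proof -
      have "rank_one (c *\<^sub>C x) (kernel 0) = c \<odot>\<^bsub>R\<^esub> rank_one x (kernel 0)"
        by (rule op_ext) (use that in \<open>auto simp: D_def mult.commute\<close>)
      thus ?thesis using that sm by (simp add: D_def)
    qed
    show "closed D"
      unfolding closed_sequential_limits
    proof (intro allI impI)
      fix X x assume X: "(\<forall>n. X n \<in> D) \<and> X \<longlonglongrightarrow> x"
      have x: "x \<in> H" by (rule closed_sequentially[OF closed_H, of X]) (use X in \<open>auto simp: D_def\<close>)
      have "rank_one x (kernel 0) \<in> S"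
      proof (rule norm_closedD[OF nc SB])
        fix e :: real assume e: "e > 0"
        define k where "k = norm (kernel 0) + 1"
        have k: "k > 0" by (simp add: k_def add_nonneg_pos)
        obtain n where n: "norm (X n - x) < e / k"
          using LIMSEQ_D[of X x "e / k"] X e k by auto
        have "norm (rank_one x (kernel 0) y - rank_one (X n) (kernel 0) y) \<le> e * norm y" if y: "y \<in> H" for y
        proof -
          have "rank_one x (kernel 0) y - rank_one (X n) (kernel 0) y = (y \<cdot> kernel 0) *\<^sub>C (x - X n)"
            using y by (simp add: scaleC_diff_right)
          hence "norm (rank_one x (kernel 0) y - rank_one (X n) (kernel 0) y) = norm (y \<cdot> kernel 0) * norm (X n - x)"
            by (simp only: norm_scaleC norm_minus_commute)
          also have "\<dots> \<le> (norm y * k) * (e / k)"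
          proof (rule mult_mono)
            show "norm (y \<cdot> kernel 0) \<le> norm y * k"
              using order_trans[OF cinner_Cauchy_Schwarz[of y "kernel 0"] mult_left_mono[of "norm (kernel 0)" k "norm y"]] by (simp add: k_def)
          qed (use n k in auto)
          also have "\<dots> = e * norm y" using k by simp
          finally show ?thesis .
        qed
        moreover have "rank_one (X n) (kernel 0) \<in> S" using X by (simp add: D_def)
        ultimately show "\<exists>F\<in>S. \<forall>y\<in>H. norm (rank_one x (kernel 0) y - F y) \<le> e * norm y" by (intro bexI ballI)
      qed (use x in auto)
      thus "x \<in> D" using x by (simp add: D_def)
    qed
    have inv: "P (shift d) \<in> D" if "d \<in> D" for d
    proof -
      have "A (\<lambda>z. z) \<otimes>\<^bsub>R\<^esub> rank_one d (kernel 0) = rank_one (P (shift d)) (kernel 0)"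
        by (rule op_ext) (use that ci in \<open>auto simp: D_def shift_def[symmetric] shift_linear orth_proj_scaleC\<close>)
      moreover have "A (\<lambda>z. z) \<otimes>\<^bsub>R\<^esub> rank_one d (kernel 0) \<in> S"
        by (rule subringE(6)[OF sr a]) (use that in \<open>simp add: D_def\<close>)
      ultimately show ?thesis unfolding D_def mem_Collect_eq by (intro conjI orth_proj_in) (simp only:)
    qed
    have k0D: "kernel 0 \<in> D" using k0 r0 by (simp add: D_def)
    fix y assume "y \<in> H" and "\<And>d. d \<in> D \<Longrightarrow> y \<cdot> d = 0"
    thus "y = 0"
    proof (intro shift_orbit_dense[where E = "{y \<in> H. \<forall>d\<in>D. y \<cdot> d = 0}"])
      fix F assume F: "F \<in> {y \<in> H. \<forall>d\<in>D. y \<cdot> d = 0}"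
      have "P (coshift F) \<cdot> d = 0" if d: "d \<in> D" for d
      proof -
        have dH: "d \<in> H" using d by (simp add: D_def)
        have "P (coshift F) \<cdot> d = F \<cdot> P (shift d)"
          using F dH by (simp add: cinner_orth_proj cinner_orth_proj_right cinner_coshift)
        thus ?thesis using F inv[OF d] by auto
      qed
      thus "F \<in> H \<and> F \<cdot> kernel 0 = 0 \<and> P (coshift F) \<in> {y \<in> H. \<forall>d\<in>D. y \<cdot> d = 0}"
        using F k0D by auto
    qed auto
  qed (auto simp: D_def)
  hence r1: "rank_one x (kernel 0) \<in> S" if "x \<in> H" for x using that by (auto simp: D_def)
  have r2: "rank_one (kernel 0) x \<in> S" if "x \<in> H" for x
    using ad[OF r1[OF that]] adj_rank_one[OF that k0] by simp
  have r: "rank_one x y \<in> S" if xy: "x \<in> H" "y \<in> H" for x y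
  proof -
    define c where "c = kernel 0 \<cdot> kernel 0"
    have c: "c \<noteq> 0" using kernel_0_nonzero by (simp add: c_def cinner_self)
    have "rank_one x y = inverse c \<odot>\<^bsub>R\<^esub> (rank_one x (kernel 0) \<otimes>\<^bsub>R\<^esub> rank_one (kernel 0) y)"
      by (rule op_ext) (use xy k0 c in \<open>auto simp: cinner_simps c_def[symmetric] field_simps\<close>)
    thus ?thesis using sm subringE(6)[OF sr r1[OF xy(1)] r2[OF xy(2)]] by simp
  qed
  show ?thesis
  proof (rule compact_in_closed_span[OF subringE(2)[OF sr] subringE(7)[OF sr] SB r])
    fix T assume "T \<in> K" and "\<And>e. e > 0 \<Longrightarrow> \<exists>F\<in>S. \<forall>x\<in>H. norm (T x - F x) \<le> e * norm x"
    thus "T \<in> S" by (intro norm_closedD[OF nc SB]) auto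
  qed
qed

text \<open>A product of symbols corresponds to the product of operators only up to a
  semicommutator, which lies in S because all compact operators do; this is why
  \<open>K_subset_cstar\<close> comes beforehand.\<close>

lemma alg_subset_cstar:
  assumes S: "cstar_subalgebra S R" and a: "A (\<lambda>z. z) \<in> S"
  shows "alg \<subseteq> S"
proof -
  have sr: "subring S R" and sm: "\<And>c a. a \<in> S \<Longrightarrow> c \<odot>\<^bsub>R\<^esub> a \<in> S" and ad: "\<And>a. a \<in> S \<Longrightarrow> adj R a \<in> S" and nc: "norm_closed R S"
    using S by (auto simp: cstar_subalgebra_def)
  have SB: "S \<subseteq> B" using subringE(1)[OF sr] by simp
  note K = K_subset_cstar[OF S a]
  have "A \<phi> \<in> S" if c: "circle_continuous \<phi>" for \<phi>
  proof (rule norm_closedD[OF nc SB A_B[OF c]])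
    fix e :: real assume e: "e > 0"
    define Q where "Q \<psi> \<longleftrightarrow> circle_continuous \<psi> \<and> A \<psi> \<in> S" for \<psi>
    have "\<exists>\<psi>. Q \<psi> \<and> (\<forall>z\<in>sphere 0 1. norm (\<phi> z - \<psi> z) < e)"
    proof (rule circle_polynomial_approximation[OF _ _ _ _ _ c e])
      show "Q (\<lambda>z. c)" for c
      proof -
        have "A (\<lambda>z. c) = c \<odot>\<^bsub>R\<^esub> \<one>\<^bsub>R\<^esub>" by (rule op_ext) (auto simp: A_const simp del: A_apply)
        thus ?thesis using sm[OF subringE(3)[OF sr]] by (simp add: Q_def continuous_on_const)
      qed
      show "Q (\<lambda>z. z)" using a by (simp add: Q_def continuous_on_id)
      show "Q cnj" using ad[OF a] adj_A[of "\<lambda>z. z"] by (simp add: Q_def continuous_on_cnj continuous_on_id)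
      show "Q (\<lambda>z. f z + g z)" if "Q f" "Q g" for f g
        using that subringE(7)[OF sr] A_add[of f g] by (auto simp: Q_def intro: continuous_on_add)
      show "Q (\<lambda>z. f z * g z)" if "Q f" "Q g" for f g
      proof -
        have h: "circle_continuous f" "circle_continuous g" "A f \<in> S" "A g \<in> S" using that by (auto simp: Q_def)
        have cfg: "circle_continuous (\<lambda>z. f z * g z)" by (intro continuous_intros h)
        have eq: "A (\<lambda>z. f z * g z) = (A (\<lambda>z. f z * g z) \<ominus>\<^bsub>R\<^esub> A f \<otimes>\<^bsub>R\<^esub> A g) \<oplus>\<^bsub>R\<^esub> A f \<otimes>\<^bsub>R\<^esub> A g"
          by (rule op_ext) (use h cfg in \<open>auto simp del: A_apply\<close>)
        have sc: "A (\<lambda>z. f z * g z) \<ominus>\<^bsub>R\<^esub> A f \<otimes>\<^bsub>R\<^esub> A g \<in> S" using K semicommutator_K[OF h(1,2)] by blast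
        have "A (\<lambda>z. f z * g z) \<in> S" by (subst eq, rule subringE(7)[OF sr sc subringE(6)[OF sr h(3,4)]])
        thus ?thesis using cfg by (simp add: Q_def)
      qed
    qed
    then obtain \<psi> where \<psi>: "circle_continuous \<psi>" "A \<psi> \<in> S" "\<And>z. z \<in> sphere 0 1 \<Longrightarrow> norm (\<phi> z - \<psi> z) \<le> e"
      unfolding Q_def by (meson less_imp_le)
    have "norm (A \<phi> x - A \<psi> x) \<le> e * norm x" if x: "x \<in> H" for x
    proof -
      have "norm (A (\<lambda>z. \<phi> z - \<psi> z) x) \<le> e * norm x"
        by (rule norm_A_le[OF _ \<psi>(3) x]) (intro continuous_intros c \<psi>(1))
      thus ?thesis unfolding A_diff[OF c \<psi>(1)] using x \<psi>(1) by (simp del: A_apply)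
    qed
    thus "\<exists>F\<in>S. \<forall>x\<in>H. norm (A \<phi> x - F x) \<le> e * norm x" using \<psi>(2) by blast
  qed
  thus ?thesis unfolding alg_eq using K subringE(7)[OF sr] by blast
qed

end

section \<open>The structure of the generated algebra\<close>

context nonconstant_inner
begin

abbreviation \<AA> where "\<AA> \<equiv> R\<lparr>carrier := alg\<rparr>"

lemma cstar_of_compressed_shift: "cstar_of_operator H (compressed_shift u) = \<AA>"
proof -
  have c: "compressed_shift u = A (\<lambda>z. z)" by (simp add: compressed_shift_def)
  have "A (\<lambda>z. z) \<in> alg" by (rule algI[OF has_symbol_A[OF continuous_on_id]])
  hence "\<Inter>{S. cstar_subalgebra S R \<and> {A (\<lambda>z. z)} \<subseteq> S} = alg"
    using cstar_subalgebra_alg alg_subset_cstar by (intro equalityI Inter_lower Inter_greatest) auto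
  thus ?thesis by (simp only: cstar_of_operator_def cstar_generated_def c)
qed

lemma ring_alg: "ring \<AA>"
  by (rule R.subring_is_ring[OF subring_alg])

text \<open>The additive inverse is defined by a description over the carrier, so its agreement with
  the one of the full operator algebra has to be proved; addition and multiplication agree by
  definition.\<close>

lemma uminus_alg: assumes "S \<in> alg" shows "\<ominus>\<^bsub>\<AA>\<^esub> S = \<ominus>\<^bsub>R\<^esub> S"
proof -
  interpret alg: ring \<AA> by (rule ring_alg)
  show ?thesis
    using assms subringE(5)[OF subring_alg] R.l_neg[of S] alg_B by (intro alg.minus_equality) auto
qed

lemma minus_alg: "T \<in> alg \<Longrightarrow> S \<ominus>\<^bsub>\<AA>\<^esub> T = S \<ominus>\<^bsub>R\<^esub> T"
  unfolding a_minus_def by (simp add: uminus_alg)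

text \<open>Closedness relative to the subalgebra tests limits inside \<open>alg\<close>; since
  \<open>alg\<close> is itself closed, every limit of elements of S lies there.\<close>

lemma norm_closed_alg_iff:
  assumes "S \<subseteq> alg" shows "norm_closed \<AA> S \<longleftrightarrow> norm_closed R S"
proof
  assume S: "norm_closed R S"
  show "norm_closed \<AA> S"
    using S unfolding norm_closed_def by (auto simp: minus_alg alg_B)
next
  assume S: "norm_closed \<AA> S"
  show "norm_closed R S"
    unfolding norm_closed_def
  proof (intro allI ballI impI)
    fix f a assume a: "a \<in> carrier R" and f: "(\<forall>n. f n \<in> S) \<and> (\<lambda>n. nrm R (f n \<ominus>\<^bsub>R\<^esub> a)) \<longlonglongrightarrow> 0"
    have "a \<in> alg" using norm_closed_alg a f assms unfolding norm_closed_def by blast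
    thus "a \<in> S" using S f unfolding norm_closed_def by (auto simp: minus_alg)
  qed
qed

lemma ideal_K_alg: "ideal K \<AA>"
proof (rule idealI[OF ring_alg])
  show "subgroup K (add_monoid \<AA>)"
  proof (rule subgroup.intro)
    show "inv\<^bsub>add_monoid \<AA>\<^esub> x \<in> K" if "x \<in> K" for x
      using uminus_K[OF that] uminus_alg[OF K_alg[OF that]] by (simp only: a_inv_def)
  qed (auto simp: K_alg)
qed (auto simp: alg_B)

text \<open>Symbols multiply commutatively, so each commutator has symbol 0 and is compact; the
  compact operators thus form one of the ideals that are intersected.\<close>

lemma commutator_ideal_subset: "commutator_ideal \<AA> \<subseteq> K"
  unfolding commutator_ideal_def
proof (rule Inter_lower, unfold mem_Collect_eq, intro conjI ballI)
  show "norm_closed \<AA> K" using norm_closed_K norm_closed_alg_iff[of K] K_alg by blast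
  fix S T assume "S \<in> carrier \<AA>" "T \<in> carrier \<AA>"
  hence ST: "S \<in> alg" "T \<in> alg" by auto
  then obtain \<phi> \<psi> where h: "has_symbol S \<phi>" "has_symbol T \<psi>" by (auto elim!: algE)
  note c = has_symbol_diff[OF has_symbol_mult[OF h] has_symbol_mult[OF h(2,1)]]
  have "(S \<otimes>\<^bsub>R\<^esub> T) \<ominus>\<^bsub>R\<^esub> (T \<otimes>\<^bsub>R\<^esub> S) \<in> K" unfolding has_symbol_K_iff[OF c] by simp
  moreover have "T \<otimes>\<^bsub>R\<^esub> S \<in> alg" by (rule algI[OF has_symbol_mult[OF h(2,1)]])
  ultimately show "(S \<otimes>\<^bsub>\<AA>\<^esub> T) \<ominus>\<^bsub>\<AA>\<^esub> (T \<otimes>\<^bsub>\<AA>\<^esub> S) \<in> K" by (simp add: minus_alg)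
qed (rule ideal_K_alg)

text \<open>For orthogonal \<open>x, y\<close> the commutator of \<open>x \<otimes> y\<close> and \<open>y \<otimes> x\<close> is a nonzero multiple of
  \<open>x \<otimes> x\<close> on \<open>x\<close>, so multiplying it by rank-one operators produces all rank-one operators.\<close>

lemma K_subset_commutator_ideal:
  assumes dim: "\<not> one_dimensional H" shows "K \<subseteq> commutator_ideal \<AA>"
  unfolding commutator_ideal_def
proof (rule Inter_greatest, unfold mem_Collect_eq, elim conjE)
  fix I assume I: "ideal I \<AA>" "norm_closed \<AA> I"
    and com: "\<forall>S\<in>carrier \<AA>. \<forall>T\<in>carrier \<AA>. (S \<otimes>\<^bsub>\<AA>\<^esub> T) \<ominus>\<^bsub>\<AA>\<^esub> (T \<otimes>\<^bsub>\<AA>\<^esub> S) \<in> I"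
  interpret I: ideal I \<AA> by (rule I(1))
  have I_alg: "I \<subseteq> alg" using I.a_subset by simp
  have nc: "norm_closed R I" using I(2) norm_closed_alg_iff[OF I_alg] by blast
  have IB: "I \<subseteq> B" using I_alg alg_B by blast
  define x where "x = kernel 0"
  have x: "x \<in> H" "x \<noteq> 0" by (simp_all add: x_def kernel_in kernel_0_nonzero)
  have xx: "x \<cdot> x \<noteq> 0" using x by (simp add: cinner_self)
  have "H \<noteq> {c *\<^sub>C x |c. True}" using dim x(2) unfolding one_dimensional_def by blast
  moreover have "{c *\<^sub>C x |c. True} \<subseteq> H" using x by auto
  ultimately obtain v where v: "v \<in> H" "\<And>c. v \<noteq> c *\<^sub>C x" by blast
  define y where "y = v - ((v \<cdot> x) / (x \<cdot> x)) *\<^sub>C x"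
  have y: "y \<in> H" "y \<noteq> 0" using v x by (auto simp: y_def)
  have "y \<cdot> x = 0" using xx by (simp add: y_def cinner_diff_left cinner_simps)
  hence xy: "y \<cdot> x = 0" "x \<cdot> y = 0" using cinner_swap_eq_zero by auto
  have yy: "y \<cdot> y \<noteq> 0" using y by (simp add: cinner_self)
  define c where "c = rank_one x y \<otimes>\<^bsub>R\<^esub> rank_one y x \<ominus>\<^bsub>R\<^esub> rank_one y x \<otimes>\<^bsub>R\<^esub> rank_one x y"
  have r: "rank_one a b \<in> alg" if "a \<in> H" for a b by (rule K_alg[OF rank_one_K[OF that]])
  have "rank_one y x \<otimes>\<^bsub>R\<^esub> rank_one x y \<in> alg" by (rule subringE(6)[OF subring_alg r r]) (use x y in auto)
  moreover have "rank_one x y \<otimes>\<^bsub>R\<^esub> rank_one y x \<ominus>\<^bsub>\<AA>\<^esub> rank_one y x \<otimes>\<^bsub>R\<^esub> rank_one x y \<in> I"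
    using com r[OF x(1), of y] r[OF y(1), of x] by simp
  ultimately have cI: "c \<in> I" unfolding c_def by (simp only: minus_alg)
  have cx: "c x = ((x \<cdot> x) * (y \<cdot> y)) *\<^sub>C x"
    using x y by (simp add: c_def cinner_simps xy)
  have rank: "rank_one a b \<in> I" if ab: "a \<in> H" "b \<in> H" for a b
  proof -
    \<comment> \<open>Sandwiching c between rank-one operators gives a multiple of
      \<open>rank_one a b\<close>. Two factors of the scalar come from c x and the third from
      pairing x with itself.\<close>
    define s where "s = inverse ((x \<cdot> x) * (y \<cdot> y) * (x \<cdot> x))"
    have "rank_one a b = rank_one (s *\<^sub>C a) x \<otimes>\<^bsub>R\<^esub> c \<otimes>\<^bsub>R\<^esub> rank_one x b"
    proof (rule op_ext)
      show "rank_one (s *\<^sub>C a) x \<otimes>\<^bsub>R\<^esub> c \<otimes>\<^bsub>R\<^esub> rank_one x b \<in> B"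
        by (intro mult_B rank_one_B subsetD[OF IB cI] scaleC_H ab x)
      fix z assume z: "z \<in> H"
      have cB: "c \<in> B" using IB cI by blast
      have "(rank_one (s *\<^sub>C a) x \<otimes>\<^bsub>R\<^esub> c \<otimes>\<^bsub>R\<^esub> rank_one x b) z = rank_one (s *\<^sub>C a) x (c ((z \<cdot> b) *\<^sub>C x))"
        using z x(1) by simp
      also have "c ((z \<cdot> b) *\<^sub>C x) = (z \<cdot> b) *\<^sub>C (((x \<cdot> x) * (y \<cdot> y)) *\<^sub>C x)"
        unfolding opD(4)[OF cB x(1)] cx ..
      finally show "rank_one a b z = (rank_one (s *\<^sub>C a) x \<otimes>\<^bsub>R\<^esub> c \<otimes>\<^bsub>R\<^esub> rank_one x b) z"
        using z x xx yy by (simp add: s_def cinner_simps field_simps)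
    qed (use ab in auto)
    moreover have "rank_one (s *\<^sub>C a) x \<otimes>\<^bsub>R\<^esub> c \<otimes>\<^bsub>R\<^esub> rank_one x b \<in> I"
      using I.I_r_closed[OF I.I_l_closed[OF cI, of "rank_one (s *\<^sub>C a) x"], of "rank_one x b"] r ab x by simp
    ultimately show ?thesis by (simp only:)
  qed
  show "K \<subseteq> I"
  proof (rule compact_in_closed_span[OF _ _ IB rank])
    show "\<zero>\<^bsub>R\<^esub> \<in> I" using additive_subgroup.zero_closed[OF I.additive_subgroup_axioms] by simp
    show "S \<oplus>\<^bsub>R\<^esub> T \<in> I" if "S \<in> I" "T \<in> I" for S T using additive_subgroup.a_closed[OF I.additive_subgroup_axioms that] by simp
    fix T assume "T \<in> K" and "\<And>e. e > 0 \<Longrightarrow> \<exists>F\<in>I. \<forall>x\<in>H. norm (T x - F x) \<le> e * norm x"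
    thus "T \<in> I" by (intro norm_closedD[OF nc IB]) auto
  qed
qed

section \<open>Quotient norm, symbol map and exact sequence\<close>

definition sup_norm_Y :: "(complex \<Rightarrow> complex) \<Rightarrow> real" where
  "sup_norm_Y \<phi> = Sup (insert 0 ((\<lambda>\<zeta>. norm (\<phi> \<zeta>)) ` Y))"

lemma sup_norm_Y_upper:
  assumes "continuous_on Y \<phi>"
  shows "0 \<le> sup_norm_Y \<phi>" "\<zeta> \<in> Y \<Longrightarrow> norm (\<phi> \<zeta>) \<le> sup_norm_Y \<phi>"
proof -
  have "compact ((\<lambda>\<zeta>. norm (\<phi> \<zeta>)) ` Y)"
    by (intro compact_continuous_image continuous_intros assms compact_Y)
  hence "bdd_above (insert 0 ((\<lambda>\<zeta>. norm (\<phi> \<zeta>)) ` Y))"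
    by (simp add: bounded_imp_bdd_above compact_imp_bounded)
  thus "0 \<le> sup_norm_Y \<phi>" "\<zeta> \<in> Y \<Longrightarrow> norm (\<phi> \<zeta>) \<le> sup_norm_Y \<phi>"
    unfolding sup_norm_Y_def by (auto intro: cSup_upper)
qed

lemma sup_norm_Y_least: "0 \<le> C \<Longrightarrow> (\<And>\<zeta>. \<zeta> \<in> Y \<Longrightarrow> norm (\<phi> \<zeta>) \<le> C) \<Longrightarrow> sup_norm_Y \<phi> \<le> C"
  unfolding sup_norm_Y_def by (rule cSup_least) auto

definition coset where "coset S = (\<lambda>k. k \<oplus>\<^bsub>R\<^esub> S) ` K"

lemma coset_R: "K +>\<^bsub>R\<^esub> S = coset S" and coset_alg: "K +>\<^bsub>\<AA>\<^esub> S = coset S"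
  by (auto simp: a_r_coset_def' coset_def)

lemma coset_eq: assumes S: "S \<in> B" shows "coset S = {T \<in> B. T \<ominus>\<^bsub>R\<^esub> S \<in> K}"
proof (intro equalityI subsetI)
  fix T assume "T \<in> coset S"
  then obtain k where k: "k \<in> K" "T = k \<oplus>\<^bsub>R\<^esub> S" by (auto simp: coset_def)
  have "T \<ominus>\<^bsub>R\<^esub> S = k" unfolding k(2) by (rule op_ext) (use S k in auto)
  thus "T \<in> {T \<in> B. T \<ominus>\<^bsub>R\<^esub> S \<in> K}" using k S by auto
next
  fix T assume T: "T \<in> {T \<in> B. T \<ominus>\<^bsub>R\<^esub> S \<in> K}"
  have "T = (T \<ominus>\<^bsub>R\<^esub> S) \<oplus>\<^bsub>R\<^esub> S" by (rule op_ext) (use S T in auto)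
  thus "T \<in> coset S" using T unfolding coset_def by blast
qed

lemma coset_self: "S \<in> B \<Longrightarrow> S \<in> coset S"
proof -
  assume S: "S \<in> B"
  have "S \<ominus>\<^bsub>R\<^esub> S = \<zero>\<^bsub>R\<^esub>" by (rule op_ext) (use S in auto)
  thus ?thesis unfolding coset_eq[OF S] using S by (simp only: mem_Collect_eq zero_K simp_thms)
qed

lemma coset_eq_iff: assumes "S \<in> B" "T \<in> B" shows "coset S = coset T \<longleftrightarrow> S \<ominus>\<^bsub>R\<^esub> T \<in> K"
proof
  assume "coset S = coset T"
  thus "S \<ominus>\<^bsub>R\<^esub> T \<in> K" using coset_self[OF assms(1)] coset_eq[OF assms(2)] by blast
next
  assume st: "S \<ominus>\<^bsub>R\<^esub> T \<in> K"
  have 1: "F \<ominus>\<^bsub>R\<^esub> T = (F \<ominus>\<^bsub>R\<^esub> S) \<oplus>\<^bsub>R\<^esub> (S \<ominus>\<^bsub>R\<^esub> T)" "F \<ominus>\<^bsub>R\<^esub> S = (F \<ominus>\<^bsub>R\<^esub> T) \<ominus>\<^bsub>R\<^esub> (S \<ominus>\<^bsub>R\<^esub> T)" if "F \<in> B" for F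
    by (rule op_ext; use that assms in auto)+
  show "coset S = coset T"
    unfolding coset_eq[OF assms(1)] coset_eq[OF assms(2)]
  proof (intro Collect_cong conj_cong refl iffI)
    fix F assume F: "F \<in> B"
    show "F \<ominus>\<^bsub>R\<^esub> T \<in> K" if "F \<ominus>\<^bsub>R\<^esub> S \<in> K" unfolding 1(1)[OF F] by (rule add_K[OF that st])
    show "F \<ominus>\<^bsub>R\<^esub> S \<in> K" if "F \<ominus>\<^bsub>R\<^esub> T \<in> K" by (subst 1(2)[OF F]) (rule minus_K[OF that st])
  qed
qed

lemma coset_has_symbol:
  assumes S: "has_symbol S \<phi>" and T: "T \<in> coset S" shows "has_symbol T \<phi>"
proof -
  obtain k where k: "k \<in> K" "T = k \<oplus>\<^bsub>R\<^esub> S" using T by (auto simp: coset_def)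
  thus ?thesis using has_symbol_add[OF has_symbol_K[OF k(1)] S] by simp
qed

lemma coset_smult:
  assumes S: "S \<in> B" shows "K <+>\<^bsub>R\<^esub> ((\<lambda>a. c \<odot>\<^bsub>R\<^esub> a) ` coset S) = coset (c \<odot>\<^bsub>R\<^esub> S)"
proof (intro equalityI subsetI)
  fix T assume "T \<in> K <+>\<^bsub>R\<^esub> ((\<lambda>a. c \<odot>\<^bsub>R\<^esub> a) ` coset S)"
  then obtain k l where kl: "k \<in> K" "l \<in> K" "T = k \<oplus>\<^bsub>R\<^esub> c \<odot>\<^bsub>R\<^esub> (l \<oplus>\<^bsub>R\<^esub> S)" by (auto simp: set_add_def' coset_def)
  have "T = (k \<oplus>\<^bsub>R\<^esub> c \<odot>\<^bsub>R\<^esub> l) \<oplus>\<^bsub>R\<^esub> c \<odot>\<^bsub>R\<^esub> S"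
    unfolding kl(3) by (rule op_ext) (use S kl in \<open>auto simp: scaleC_add_right add_ac\<close>)
  thus "T \<in> coset (c \<odot>\<^bsub>R\<^esub> S)" using kl by (auto simp: coset_def)
next
  fix T assume "T \<in> coset (c \<odot>\<^bsub>R\<^esub> S)"
  then obtain k where "k \<in> K" "T = k \<oplus>\<^bsub>R\<^esub> c \<odot>\<^bsub>R\<^esub> S" by (auto simp: coset_def)
  thus "T \<in> K <+>\<^bsub>R\<^esub> ((\<lambda>a. c \<odot>\<^bsub>R\<^esub> a) ` coset S)" using coset_self[OF S] by (auto simp: set_add_def')
qed

lemma coset_adj:
  assumes S: "S \<in> B" shows "adj R ` coset S = coset (adj R S)"
proof (intro equalityI subsetI)
  fix T assume "T \<in> adj R ` coset S"
  then obtain k where k: "k \<in> K" "T = adj R (k \<oplus>\<^bsub>R\<^esub> S)" by (auto simp: coset_def)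
  hence "T = adj R k \<oplus>\<^bsub>R\<^esub> adj R S" using S by (simp add: adj_add)
  thus "T \<in> coset (adj R S)" using adj_K[OF k(1)] by (auto simp: coset_def)
next
  fix T assume "T \<in> coset (adj R S)"
  then obtain k where k: "k \<in> K" "T = k \<oplus>\<^bsub>R\<^esub> adj R S" by (auto simp: coset_def)
  hence "T = adj R (adj R k \<oplus>\<^bsub>R\<^esub> S)" using S by (simp add: adj_add adj_adj)
  thus "T \<in> adj R ` coset S" using adj_K[OF k(1)] by (auto simp: coset_def)
qed

text \<open>All members of the coset have the symbol \<phi>, so \<open>symbol_le\<close> bounds
  their norms below by the supremum over \<open>Y\<close>. The value is attained by
  \<open>A \<psi>\<close>, where \<psi> extends \<phi> from \<open>Y\<close> without increasing its
  bound.\<close>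

lemma coset_norm:
  assumes S: "has_symbol S \<phi>" shows "Inf (nrm R ` coset S) = sup_norm_Y \<phi>"
proof (rule antisym)
  note h = has_symbolD[OF S]
  have cY: "continuous_on Y \<phi>" by (rule continuous_on_subset[OF h(2) Y_subset])
  note sn = sup_norm_Y_upper[OF cY]
  show "sup_norm_Y \<phi> \<le> Inf (nrm R ` coset S)"
  proof (rule cInf_greatest)
    show "nrm R ` coset S \<noteq> {}" using coset_self[OF h(1)] by blast
    fix r assume "r \<in> nrm R ` coset S"
    then obtain T where T: "T \<in> coset S" "r = nrm R T" by blast
    have hT: "has_symbol T \<phi>" by (rule coset_has_symbol[OF S T(1)])
    show "sup_norm_Y \<phi> \<le> r"
      unfolding T(2)
      by (intro sup_norm_Y_least nrm_nonneg has_symbolD(1)[OF hT] symbol_le[OF _ hT] norm_op_le)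
  qed
  obtain \<psi> where \<psi>: "circle_continuous \<psi>" "\<And>\<zeta>. \<zeta> \<in> Y \<Longrightarrow> \<psi> \<zeta> = \<phi> \<zeta>" "\<And>z. z \<in> sphere 0 1 \<Longrightarrow> norm (\<psi> z) \<le> sup_norm_Y \<phi>"
    by (rule symbol_extension[OF cY sn], assumption, rule that)
  have hA: "has_symbol (A \<psi>) \<phi>" by (rule has_symbol_cong[OF has_symbol_A[OF \<psi>(1)] h(2) \<psi>(2)])
  have "A \<psi> \<ominus>\<^bsub>R\<^esub> S \<in> K" unfolding has_symbol_K_iff[OF has_symbol_diff[OF hA S]] by simp
  hence "A \<psi> \<in> coset S" unfolding coset_eq[OF h(1)] using \<psi>(1) by simp
  moreover have "bdd_below (nrm R ` coset S)"
    using nrm_nonneg coset_eq[OF h(1)] by (intro bdd_belowI[of _ 0]) auto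
  ultimately have "Inf (nrm R ` coset S) \<le> nrm R (A \<psi>)" by (intro cInf_lower imageI)
  also have "\<dots> \<le> sup_norm_Y \<phi>" by (rule nrm_le[OF norm_A_le[OF \<psi>(1,3)] sn(1)])
  finally show "Inf (nrm R ` coset S) \<le> sup_norm_Y \<phi>" .
qed

text \<open>The chosen symbol is arbitrary off \<open>Y\<close>; after restriction to
  \<open>Y\<close> the choice no longer matters, by \<open>sym_eq\<close>.\<close>

definition sym where "sym S = restrict (SOME \<phi>. has_symbol S \<phi>) Y"

lemma sym_eq: assumes S: "has_symbol S \<phi>" shows "sym S = restrict \<phi> Y"
proof -
  define \<psi> where "\<psi> = (SOME \<phi>. has_symbol S \<phi>)"
  have \<psi>: "has_symbol S \<psi>" unfolding \<psi>_def by (rule someI[of "has_symbol S", OF S])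
  have "S \<ominus>\<^bsub>R\<^esub> S = \<zero>\<^bsub>R\<^esub>" by (rule op_ext) (use has_symbolD(1)[OF S] in auto)
  hence "S \<ominus>\<^bsub>R\<^esub> S \<in> K" by (simp only: zero_K)
  hence "\<forall>\<zeta>\<in>Y. \<psi> \<zeta> - \<phi> \<zeta> = 0" unfolding has_symbol_K_iff[OF has_symbol_diff[OF \<psi> S]] .
  thus ?thesis unfolding sym_def \<psi>_def[symmetric] by (auto simp: restrict_def fun_eq_iff)
qed

abbreviation \<CC> where "\<CC> \<equiv> continuous_functions Y"

lemma sym_hom: "sym \<in> star_hom \<AA> \<CC>"
  unfolding star_hom_def mem_Collect_eq
proof (intro conjI ballI allI)
  show "sym \<in> carrier \<AA> \<rightarrow> carrier \<CC>"
  proof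
    fix S assume "S \<in> carrier \<AA>"
    then obtain \<phi> where S: "has_symbol S \<phi>" by (auto elim!: algE)
    show "sym S \<in> carrier \<CC>"
      unfolding sym_eq[OF S] using continuous_on_subset[OF has_symbolD(2)[OF S] Y_subset]
      by (simp add: continuous_functions_def cong: continuous_on_cong)
  qed
  fix S T assume "S \<in> carrier \<AA>" "T \<in> carrier \<AA>"
  then obtain \<phi> \<psi> where S: "has_symbol S \<phi>" and T: "has_symbol T \<psi>" by (auto elim!: algE)
  show "sym (S \<oplus>\<^bsub>\<AA>\<^esub> T) = sym S \<oplus>\<^bsub>\<CC>\<^esub> sym T" "sym (S \<otimes>\<^bsub>\<AA>\<^esub> T) = sym S \<otimes>\<^bsub>\<CC>\<^esub> sym T"
    using sym_eq[OF has_symbol_add[OF S T]] sym_eq[OF has_symbol_mult[OF S T]]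
    by (auto simp: sym_eq[OF S] sym_eq[OF T] continuous_functions_def restrict_def)
next
  fix c S assume "S \<in> carrier \<AA>"
  then obtain \<phi> where S: "has_symbol S \<phi>" by (auto elim!: algE)
  show "sym (c \<odot>\<^bsub>\<AA>\<^esub> S) = c \<odot>\<^bsub>\<CC>\<^esub> sym S"
    using sym_eq[OF has_symbol_smult[OF S, of c]] by (auto simp: sym_eq[OF S] continuous_functions_def restrict_def)
next
  fix S assume "S \<in> carrier \<AA>"
  then obtain \<phi> where S: "has_symbol S \<phi>" by (auto elim!: algE)
  show "sym (adj \<AA> S) = adj \<CC> (sym S)"
    using sym_eq[OF has_symbol_adj[OF S]] by (auto simp: sym_eq[OF S] continuous_functions_def restrict_def)
qed

lemma sym_surj: "sym ` alg = carrier \<CC>"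
proof
  show "sym ` alg \<subseteq> carrier \<CC>" using sym_hom by (auto simp: star_hom_def)
  show "carrier \<CC> \<subseteq> sym ` alg"
  proof
    fix f assume "f \<in> carrier \<CC>"
    hence f: "f \<in> extensional Y" "continuous_on Y f" by (auto simp: continuous_functions_def)
    obtain \<psi> where \<psi>: "circle_continuous \<psi>" "\<And>\<zeta>. \<zeta> \<in> Y \<Longrightarrow> \<psi> \<zeta> = f \<zeta>"
      by (rule symbol_unbounded_extension[OF f(2)]) (rule that)
    have "sym (A \<psi>) = restrict \<psi> Y" by (rule sym_eq[OF has_symbol_A[OF \<psi>(1)]])
    also have "\<dots> = f" using \<psi>(2) f(1) by (auto simp: restrict_def extensional_def fun_eq_iff)
    finally show "f \<in> sym ` alg" using algI[OF has_symbol_A[OF \<psi>(1)]] by blast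
  qed
qed

lemma sym_eq_iff:
  assumes S: "has_symbol S \<phi>" and T: "has_symbol T \<psi>" shows "sym S = sym T \<longleftrightarrow> S \<ominus>\<^bsub>R\<^esub> T \<in> K"
  unfolding has_symbol_K_iff[OF has_symbol_diff[OF S T]] sym_eq[OF S] sym_eq[OF T] by (auto simp: restrict_def fun_eq_iff)

lemma sym_kernel: "a_kernel \<AA> \<CC> sym = K"
proof (intro equalityI subsetI)
  have z: "sym S = \<zero>\<^bsub>\<CC>\<^esub> \<longleftrightarrow> S \<in> K" if S: "has_symbol S \<phi>" for S \<phi>
    unfolding has_symbol_K_iff[OF S] sym_eq[OF S] by (auto simp: continuous_functions_def restrict_def fun_eq_iff)
  show "S \<in> K" if "S \<in> a_kernel \<AA> \<CC> sym" for S using that z by (auto simp: a_kernel_def' elim!: algE)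
  show "S \<in> a_kernel \<AA> \<CC> sym" if "S \<in> K" for S
    using that z[OF has_symbol_K[OF that]] K_alg by (auto simp: a_kernel_def')
qed

lemma exact_sequence: "short_exact_sequence (compact_algebra H) id \<AA> sym \<CC>"
  unfolding short_exact_sequence_def sym_kernel
proof (intro conjI sym_hom)
  show "id \<in> star_hom (compact_algebra H) \<AA>"
    using K_alg by (auto simp: star_hom_def compact_algebra_def)
  show "sym ` carrier \<AA> = carrier \<CC>" using sym_surj by simp
qed (auto simp: compact_algebra_def)

lemma quotient_isomorphic: "isometrically_star_isomorphic (star_quotient \<AA> K) \<CC>"
proof -
  interpret K: ideal K \<AA> by (rule ideal_K_alg)
  let ?Q = "star_quotient \<AA> K"
  have carr: "carrier ?Q = coset ` alg"
    by (auto simp: star_quotient_def FactRing_def A_RCOSETS_def' coset_alg)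
  have add: "coset S \<oplus>\<^bsub>?Q\<^esub> coset T = coset (S \<oplus>\<^bsub>R\<^esub> T)" if "S \<in> alg" "T \<in> alg" for S T
    using K.a_rcos_sum[of S T] that by (simp add: star_quotient_def FactRing_def coset_alg)
  have mult: "coset S \<otimes>\<^bsub>?Q\<^esub> coset T = coset (S \<otimes>\<^bsub>R\<^esub> T)" if "S \<in> alg" "T \<in> alg" for S T
    using K.rcoset_mult_add[of S T] that by (simp add: star_quotient_def FactRing_def coset_alg)
  have smult: "c \<odot>\<^bsub>?Q\<^esub> coset S = coset (c \<odot>\<^bsub>R\<^esub> S)" if "S \<in> alg" for c S
    using coset_smult[OF alg_B[OF that], of c] by (simp add: star_quotient_def set_add_def')
  have adj: "adj ?Q (coset S) = coset (adj R S)" if "S \<in> alg" for S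
    using coset_adj[OF alg_B[OF that]] by (simp add: star_quotient_def)
  \<comment> \<open>Members of a coset share their symbols, so evaluating \<open>sym\<close> at an
    arbitrary representative is well defined.\<close>
  define h where "h X = sym (SOME S. S \<in> X)" for X
  have h: "h (coset S) = sym S" if S: "S \<in> alg" for S
  proof -
    obtain \<phi> where \<phi>: "has_symbol S \<phi>" using S by (rule algE)
    have "(SOME T. T \<in> coset S) \<in> coset S" using coset_self[OF alg_B[OF S]] by (rule someI[of "\<lambda>T. T \<in> coset S"])
    thus ?thesis unfolding h_def using sym_eq[OF coset_has_symbol[OF \<phi>]] sym_eq[OF \<phi>] by simp
  qed
  have closed: "S \<oplus>\<^bsub>R\<^esub> T \<in> alg" "S \<otimes>\<^bsub>R\<^esub> T \<in> alg" if "S \<in> alg" "T \<in> alg" for S T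
    using that subringE(6,7)[OF subring_alg] by auto
  have closed2: "c \<odot>\<^bsub>R\<^esub> S \<in> alg" "adj R S \<in> alg" if "S \<in> alg" for c S
    using that cstar_subalgebra_alg by (auto simp: cstar_subalgebra_def)
  note sh = sym_hom[unfolded star_hom_def mem_Collect_eq]
  have "h \<in> star_hom ?Q \<CC>"
    unfolding star_hom_def carr
    using sh by (auto simp: h add mult smult adj closed closed2)
  moreover have "bij_betw h (carrier ?Q) (carrier \<CC>)"
    unfolding bij_betw_def carr
  proof
    show "inj_on h (coset ` alg)"
    proof (rule inj_onI, elim imageE)
      fix X X' S T assume X: "h X = h X'" "X = coset S" "S \<in> alg" "X' = coset T" "T \<in> alg"
      hence "sym S = sym T" by (simp add: h)
      moreover obtain \<phi> \<psi> where "has_symbol S \<phi>" "has_symbol T \<psi>" using X by (auto elim!: algE)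
      ultimately show "X = X'" using sym_eq_iff coset_eq_iff alg_B X by metis
    qed
    have "h ` coset ` alg = sym ` alg" by (auto simp: h image_image)
    thus "h ` coset ` alg = carrier \<CC>" by (simp add: sym_surj)
  qed
  moreover have "nrm \<CC> (h X) = nrm ?Q X" if X: "X \<in> carrier ?Q" for X
  proof -
    obtain S where S: "S \<in> alg" "X = coset S" using X unfolding carr by blast
    obtain \<phi> where \<phi>: "has_symbol S \<phi>" using S(1) by (rule algE)
    have "nrm \<CC> (h X) = sup_norm_Y \<phi>"
      by (simp add: S(2) h[OF S(1)] sym_eq[OF \<phi>] continuous_functions_def sup_norm_Y_def cong: image_cong)
    also have "\<dots> = nrm ?Q X" using coset_norm[OF \<phi>] by (simp add: S(2) star_quotient_def)
    finally show ?thesis .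
  qed
  ultimately show ?thesis unfolding isometrically_star_isomorphic_def by blast
qed

lemma essential_norm_eq: "has_symbol S \<phi> \<Longrightarrow> essential_norm H S = sup_norm_Y \<phi>"
  using coset_norm by (simp add: essential_norm_def calkin_algebra_def calkin_coset_def star_quotient_def coset_R)

section \<open>The Calkin algebra and essential spectra\<close>

abbreviation \<QQ> where "\<QQ> \<equiv> calkin_algebra H"

lemma carrier_calkin: "carrier \<QQ> = coset ` B"
  by (auto simp: calkin_algebra_def star_quotient_def FactRing_def A_RCOSETS_def' coset_R)

lemma one_calkin: "\<one>\<^bsub>\<QQ>\<^esub> = coset \<one>\<^bsub>R\<^esub>"
  by (simp add: calkin_algebra_def star_quotient_def FactRing_def coset_R)

lemma mult_calkin: "S \<in> B \<Longrightarrow> T \<in> B \<Longrightarrow> coset S \<otimes>\<^bsub>\<QQ>\<^esub> coset T = coset (S \<otimes>\<^bsub>R\<^esub> T)"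
  using ideal.rcoset_mult_add[OF ideal_K, of S T] by (simp add: calkin_algebra_def star_quotient_def FactRing_def coset_R)

lemma add_calkin: "S \<in> B \<Longrightarrow> T \<in> B \<Longrightarrow> coset S \<oplus>\<^bsub>\<QQ>\<^esub> coset T = coset (S \<oplus>\<^bsub>R\<^esub> T)"
  using ideal.a_rcos_sum[OF ideal_K, of S T] by (simp add: calkin_algebra_def star_quotient_def FactRing_def coset_R)

text \<open>The Calkin algebra has the carrier and the addition of the quotient ring, hence the same
  additive inverses; the ring laws are used there.\<close>

lemma minus_calkin:
  assumes "S \<in> B" "T \<in> B" shows "coset S \<ominus>\<^bsub>\<QQ>\<^esub> coset T = coset (S \<ominus>\<^bsub>R\<^esub> T)"
proof -
  interpret Q: ring "R Quot K" by (rule ideal.quotient_is_ring[OF ideal_K])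
  have eq: "\<ominus>\<^bsub>\<QQ>\<^esub> X = \<ominus>\<^bsub>R Quot K\<^esub> X" for X
    by (simp add: a_inv_def m_inv_def calkin_algebra_def star_quotient_def)
  have nT: "\<ominus>\<^bsub>R\<^esub> T \<in> B" using assms by (simp add: uminus_R)
  have "\<ominus>\<^bsub>R Quot K\<^esub> coset T = coset (\<ominus>\<^bsub>R\<^esub> T)"
  proof (rule Q.minus_equality)
    have "coset (\<ominus>\<^bsub>R\<^esub> T) \<oplus>\<^bsub>R Quot K\<^esub> coset T = K +>\<^bsub>R\<^esub> (\<ominus>\<^bsub>R\<^esub> T \<oplus>\<^bsub>R\<^esub> T)"
      unfolding coset_R[symmetric] FactRing_def using ideal.a_rcos_sum[OF ideal_K, of "\<ominus>\<^bsub>R\<^esub> T" T] assms nT by simp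
    also have "\<dots> = \<zero>\<^bsub>R Quot K\<^esub>"
      using R.l_neg[of T] R.a_rcos_zero[OF ideal_K zero_K] assms by (simp add: FactRing_def)
    finally show "coset (\<ominus>\<^bsub>R\<^esub> T) \<oplus>\<^bsub>R Quot K\<^esub> coset T = \<zero>\<^bsub>R Quot K\<^esub>" .
    show "coset T \<in> carrier (R Quot K)" "coset (\<ominus>\<^bsub>R\<^esub> T) \<in> carrier (R Quot K)"
      using assms nT by (auto simp: FactRing_def A_RCOSETS_def' coset_R)
  qed
  thus ?thesis
    using add_calkin[OF assms(1), of "\<ominus>\<^bsub>R\<^esub> T"] nT assms by (simp add: a_minus_def eq)
qed

text \<open>If \<phi> has no zero on \<open>Y\<close>, an extension of its reciprocal is the symbol
  of an inverse modulo compact operators. At a zero \<zeta>, a left inverse T modulo compact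
  operators would satisfy T (S (X n)) - X n \<rightarrow> 0 along asymptotic eigenvectors with S (X
  n) \<rightarrow> 0, against |X n| = 1. T is an arbitrary bounded operator, so invertibility in the
  whole Calkin algebra is decided.\<close>

lemma coset_Units_iff:
  assumes S: "has_symbol S \<phi>" shows "coset S \<in> Units \<QQ> \<longleftrightarrow> (\<forall>\<zeta>\<in>Y. \<phi> \<zeta> \<noteq> 0)"
proof
  note h = has_symbolD[OF S]
  assume nz: "\<forall>\<zeta>\<in>Y. \<phi> \<zeta> \<noteq> 0"
  have "continuous_on Y (\<lambda>\<zeta>. inverse (\<phi> \<zeta>))"
    by (intro continuous_intros continuous_on_subset[OF h(2) Y_subset]) (use nz in auto)
  then obtain \<psi> where \<psi>: "circle_continuous \<psi>" "\<And>\<zeta>. \<zeta> \<in> Y \<Longrightarrow> \<psi> \<zeta> = inverse (\<phi> \<zeta>)"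
    by (rule symbol_unbounded_extension) (rule that)
  note hA = has_symbol_A[OF \<psi>(1)]
  have "A \<psi> \<otimes>\<^bsub>R\<^esub> S \<ominus>\<^bsub>R\<^esub> \<one>\<^bsub>R\<^esub> \<in> K" "S \<otimes>\<^bsub>R\<^esub> A \<psi> \<ominus>\<^bsub>R\<^esub> \<one>\<^bsub>R\<^esub> \<in> K"
    unfolding has_symbol_K_iff[OF has_symbol_diff[OF has_symbol_mult[OF hA S] has_symbol_one]]
      has_symbol_K_iff[OF has_symbol_diff[OF has_symbol_mult[OF S hA] has_symbol_one]] using \<psi>(2) nz by auto
  hence "coset (A \<psi>) \<otimes>\<^bsub>\<QQ>\<^esub> coset S = \<one>\<^bsub>\<QQ>\<^esub>" "coset S \<otimes>\<^bsub>\<QQ>\<^esub> coset (A \<psi>) = \<one>\<^bsub>\<QQ>\<^esub>"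
    using h(1) \<psi>(1) by (simp_all add: mult_calkin one_calkin coset_eq_iff)
  thus "coset S \<in> Units \<QQ>" unfolding Units_def carrier_calkin using h(1) \<psi>(1) by blast
next
  note h = has_symbolD[OF S]
  assume "coset S \<in> Units \<QQ>"
  then obtain T where T: "T \<in> B" "coset T \<otimes>\<^bsub>\<QQ>\<^esub> coset S = \<one>\<^bsub>\<QQ>\<^esub>" unfolding Units_def carrier_calkin by blast
  hence K: "T \<otimes>\<^bsub>R\<^esub> S \<ominus>\<^bsub>R\<^esub> \<one>\<^bsub>R\<^esub> \<in> K" using h(1) by (simp add: mult_calkin one_calkin coset_eq_iff)
  show "\<forall>\<zeta>\<in>Y. \<phi> \<zeta> \<noteq> 0"
  proof (intro ballI notI)
    fix \<zeta> assume \<zeta>: "\<zeta> \<in> Y" "\<phi> \<zeta> = 0"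
    obtain X where X: "\<And>n. X n \<in> H" "\<And>n::nat. norm (X n) = 1" "\<And>T. T \<in> K \<Longrightarrow> (\<lambda>n. T (X n)) \<longlonglongrightarrow> 0"
      "\<And>S \<phi>. has_symbol S \<phi> \<Longrightarrow> (\<lambda>n. S (X n) - \<phi> \<zeta> *\<^sub>C X n) \<longlonglongrightarrow> 0"
      by (rule has_symbol_asymptotic[OF \<zeta>(1)]) (rule that)
    have SX: "(\<lambda>n. S (X n)) \<longlonglongrightarrow> 0" using X(4)[OF S] \<zeta>(2) by simp
    have "(\<lambda>n. T (S (X n)) - (T \<otimes>\<^bsub>R\<^esub> S \<ominus>\<^bsub>R\<^esub> \<one>\<^bsub>R\<^esub>) (X n)) \<longlonglongrightarrow> T 0 - 0"
      by (intro tendsto_diff op_tendsto[OF T(1) opD(1)[OF h(1) X(1)] zero_H SX] X(3) K)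
    moreover have "T (S (X n)) - (T \<otimes>\<^bsub>R\<^esub> S \<ominus>\<^bsub>R\<^esub> \<one>\<^bsub>R\<^esub>) (X n) = X n" for n using X(1)[of n] by simp
    ultimately have "X \<longlonglongrightarrow> 0" by (simp add: op_zero[OF T(1)])
    hence "(\<lambda>n. norm (X n)) \<longlonglongrightarrow> norm (0::circle_L2)" by (rule tendsto_norm)
    thus False by (simp add: X(2) LIMSEQ_const_iff)
  qed
qed

lemma essential_spectrum_eq:
  assumes S: "has_symbol S \<phi>" shows "essential_spectrum H S = \<phi> ` Y"
proof -
  have SB: "S \<in> B" by (rule has_symbolD[OF S])
  have "(c \<odot>\<^bsub>\<QQ>\<^esub> \<one>\<^bsub>\<QQ>\<^esub>) \<ominus>\<^bsub>\<QQ>\<^esub> calkin_coset H S = coset ((c \<odot>\<^bsub>R\<^esub> \<one>\<^bsub>R\<^esub>) \<ominus>\<^bsub>R\<^esub> S)" for c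
  proof -
    have "c \<odot>\<^bsub>\<QQ>\<^esub> \<one>\<^bsub>\<QQ>\<^esub> = coset (c \<odot>\<^bsub>R\<^esub> \<one>\<^bsub>R\<^esub>)"
      unfolding one_calkin using coset_smult[OF one_B, of c] by (simp add: calkin_algebra_def star_quotient_def)
    thus ?thesis using SB by (simp add: calkin_coset_def coset_R minus_calkin)
  qed
  hence "essential_spectrum H S = {c. \<not> (\<forall>\<zeta>\<in>Y. c * 1 - \<phi> \<zeta> \<noteq> 0)}"
    unfolding essential_spectrum_def algebra_spectrum_def
    using coset_Units_iff[OF has_symbol_diff[OF has_symbol_smult[OF has_symbol_one] S]] by simp
  thus ?thesis by auto
qed

lemma alg_normal_plus_compact:
  assumes "T \<in> alg" shows "\<exists>N. \<exists>k\<in>K. normal_operator H N \<and> T = N \<oplus>\<^bsub>R\<^esub> k"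
proof -
  obtain \<phi> where \<phi>: "has_symbol T \<phi>" using assms by (rule algE)
  note h = has_symbolD[OF \<phi>]
  obtain N where N: "normal_operator H N" "N \<in> B" "A \<phi> \<ominus>\<^bsub>R\<^esub> N \<in> K"
    by (rule normal_plus_compact[OF h(2)]) (rule that)
  have "T = N \<oplus>\<^bsub>R\<^esub> ((A \<phi> \<ominus>\<^bsub>R\<^esub> N) \<oplus>\<^bsub>R\<^esub> (T \<ominus>\<^bsub>R\<^esub> A \<phi>))"
    by (rule op_ext) (use h N in \<open>auto simp del: A_apply\<close>)
  thus ?thesis using N add_K[OF N(3) h(3)] by blast
qed

end

theorem theorem1:
  fixes u :: "complex \<Rightarrow> complex"
    and H :: "circle_L2 set" and Y :: "complex set"
    and \<A> :: "(circle_L2 \<Rightarrow> circle_L2) star_algebra"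
    and \<K> :: "(circle_L2 \<Rightarrow> circle_L2) set"
  defines "H \<equiv> model_space u"
    and "Y \<equiv> inner_spectrum u \<inter> sphere 0 1"
    and "\<A> \<equiv> cstar_of_operator H (compressed_shift u)"
    and "\<K> \<equiv> compact_operators H"
  assumes "inner_function u" and "\<not> u constant_on ball 0 1"
  shows "(\<not> one_dimensional H \<longrightarrow> commutator_ideal \<A> = \<K>) \<and>
    isometrically_star_isomorphic (star_quotient \<A> \<K>) (continuous_functions Y) \<and>
    (\<forall>\<phi>. continuous_on (sphere 0 1) \<phi> \<longrightarrow>
       (truncated_toeplitz u \<phi> \<in> \<K> \<longleftrightarrow> (\<forall>\<zeta>\<in>Y. \<phi> \<zeta> = 0))) \<and>
    carrier \<A> = {truncated_toeplitz u \<phi> \<oplus>\<^bsub>operator_algebra H\<^esub> K |\<phi> K.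
       continuous_on (sphere 0 1) \<phi> \<and> K \<in> \<K>} \<and>
    (\<forall>\<phi>. continuous_on (sphere 0 1) \<phi> \<longrightarrow>
       essential_spectrum H (truncated_toeplitz u \<phi>) =
       \<phi> ` essential_spectrum H (compressed_shift u)) \<and>
    (\<forall>\<phi>. continuous_on (sphere 0 1) \<phi> \<longrightarrow>
       essential_norm H (truncated_toeplitz u \<phi>) =
       Sup (insert 0 ((\<lambda>\<zeta>. norm (\<phi> \<zeta>)) ` Y))) \<and>
    (\<forall>T\<in>carrier \<A>. \<exists>N. \<exists>K\<in>\<K>.
       normal_operator H N \<and> T = N \<oplus>\<^bsub>operator_algebra H\<^esub> K) \<and>
    (\<exists>\<pi>. (\<forall>\<phi>. \<forall>K\<in>\<K>. continuous_on (sphere 0 1) \<phi> \<longrightarrow>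
            \<pi> (truncated_toeplitz u \<phi> \<oplus>\<^bsub>operator_algebra H\<^esub> K) = restrict \<phi> Y) \<and>
         short_exact_sequence (compact_algebra H) id \<A> \<pi> (continuous_functions Y))"
proof -
  interpret u: nonconstant_inner u by unfold_locales (use assms in auto)
  have Y: "Y = u.Y" by (simp only: Y_def u.Y_def)
  have alg: "\<A> = operator_algebra H\<lparr>carrier := u.alg\<rparr>"
    unfolding \<A>_def H_def by (rule u.cstar_of_compressed_shift)
  have carr: "carrier (operator_algebra H\<lparr>carrier := u.alg\<rparr>) = u.alg" by simp
  \<comment> \<open>The symbol z is the identity on \<open>Y\<close>, so the essential spectrum of
    the compressed shift is \<open>Y\<close> itself and spectral mapping amounts to computing the
    essential spectrum as the image of \<open>Y\<close> under \<phi>.\<close>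
  have spec: "essential_spectrum H (compressed_shift u) = u.Y"
    using u.essential_spectrum_eq[OF u.has_symbol_A[OF continuous_on_id]] by (simp add: compressed_shift_def H_def)
  show ?thesis
    unfolding alg carr spec Y
    unfolding \<K>_def H_def
  proof (intro conjI impI allI ballI)
    show "commutator_ideal (operator_algebra (model_space u)\<lparr>carrier := u.alg\<rparr>) = compact_operators (model_space u)"
      if "\<not> one_dimensional (model_space u)"
      using u.commutator_ideal_subset u.K_subset_commutator_ideal[OF that] by blast
    show "\<exists>\<pi>. (\<forall>\<phi>. \<forall>K\<in>compact_operators (model_space u). continuous_on (sphere 0 1) \<phi> \<longrightarrow>
          \<pi> (truncated_toeplitz u \<phi> \<oplus>\<^bsub>operator_algebra (model_space u)\<^esub> K) = restrict \<phi> u.Y) \<and>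
        short_exact_sequence (compact_algebra (model_space u)) id
          (operator_algebra (model_space u)\<lparr>carrier := u.alg\<rparr>) \<pi> (continuous_functions u.Y)"
    proof (intro exI[of _ u.sym] conjI u.exact_sequence allI ballI impI)
      fix \<phi> :: "complex \<Rightarrow> complex" and K
      assume "K \<in> compact_operators (model_space u)" "continuous_on (sphere 0 1) \<phi>"
      hence "u.has_symbol (truncated_toeplitz u \<phi> \<oplus>\<^bsub>operator_algebra (model_space u)\<^esub> K) (\<lambda>z. \<phi> z + 0)"
        by (intro u.has_symbol_add u.has_symbol_A u.has_symbol_K)
      thus "u.sym (truncated_toeplitz u \<phi> \<oplus>\<^bsub>operator_algebra (model_space u)\<^esub> K) = restrict \<phi> u.Y"
        using u.sym_eq by simp
    qed
  next
    fix \<phi> :: "complex \<Rightarrow> complex" assume \<phi>: "continuous_on (sphere 0 1) \<phi>"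
    note A = u.has_symbol_A[OF \<phi>]
    show "truncated_toeplitz u \<phi> \<in> compact_operators (model_space u) \<longleftrightarrow> (\<forall>\<zeta>\<in>u.Y. \<phi> \<zeta> = 0)"
      by (rule u.has_symbol_K_iff[OF A])
    show "essential_spectrum (model_space u) (truncated_toeplitz u \<phi>) = \<phi> ` u.Y"
      by (rule u.essential_spectrum_eq[OF A])
    show "essential_norm (model_space u) (truncated_toeplitz u \<phi>) = Sup (insert 0 ((\<lambda>\<zeta>. norm (\<phi> \<zeta>)) ` u.Y))"
      using u.essential_norm_eq[OF A] by (simp only: u.sup_norm_Y_def)
  next
    fix T assume "T \<in> u.alg"
    thus "\<exists>N. \<exists>K\<in>compact_operators (model_space u). normal_operator (model_space u) N \<and>
        T = N \<oplus>\<^bsub>operator_algebra (model_space u)\<^esub> K"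
      by (rule u.alg_normal_plus_compact)
  qed (rule u.quotient_isomorphic u.alg_eq)+
qed

end
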